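(* Let $k,d\ge 1$ be integers. There exist constants $C_1, C_\eta>0$ depending only on $k$ and $d$ such that the following holds. Suppose $\mathcal{L} u = \sum_{0 \le |\sigma|, |\gamma| \le k} (-1)^{|\sigma|} D^{\sigma} (a_{\sigma \gamma}(x) D^{\gamma} u)$ is self-adjoint on $D\subset\mathbb{R}^d$, with $a_{\sigma\gamma}\in L^\infty(D)$ for all $0\le|\sigma|,|\gamma|\le k$, and that for every $x \in D$: (i) (nonnegativity) $\sum_{0 \le |\sigma|, |\gamma| \le k} a_{\sigma \gamma}(x) \zeta_{\sigma} \zeta_{\gamma} \ge 0$ for all $\zeta=(\zeta_\sigma)_{|\sigma|\le k} \in \mathbb{R}^{\binom{k+d}{k}}$; (ii) (boundedness) there are $\theta_{0,\max}\ge 0$ and $\theta'_{k,\max}>0$ (independent of $x$) with $\sum_{0 \le |\sigma|, |\gamma| \le k} a_{\sigma \gamma}(x) \zeta_{\sigma} \zeta_{\gamma} \le \theta'_{k,\max} \sum_{|\sigma| = k} \zeta_{\sigma}^2 + \theta_{0,\max} \sum_{|\sigma| < k} \zeta_{\sigma}^2$ for all $\zeta \in \mathbb{R}^{\binom{k+d}{k}}$; (iii) (strong ellipticity) there is $\theta_{k,\min}>0$ (independent of $x$) with $\sum_{|\sigma| = |\gamma| = k} a_{\sigma \gamma}(x) \zeta_{\sigma} \zeta_{\gamma} \ge \theta_{k,\min} \sum_{|\sigma| = k} \zeta_{\sigma}^2$ for all $\zeta=(\zeta_\sigma)_{|\sigma|=k} \in \mathbb{R}^{\binom{k+d-1}{k}}$.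 Put $\theta_{k,\max}:=\max(\theta_{0,\max},\theta'_{k,\max})$. Then there exists $h_0>0$ such that for any partition with mesh size $h\le h_0$, any $1\le i\le m$, $1\le q\le Q$, and $r>0$, $$\|\psi_{i,q}\|_{H(D \cap (B(x_i,r))^c)}^2 \le \exp\left(1 - \frac{r}{l h} \right) \|\psi_{i,q}\|_{H(D)}^2$$ whenever $\sqrt{l^2-1} \ge 2 (e-1) C_{\eta} C_p (C_1 + C(k,d,\delta)) \sqrt{\theta_{k,\max}/\theta_{k,\min}}$. Moreover $h_0$ can be taken as $$h_0 = \sup \left\{h > 0 : \frac{h^2-h^{2k}}{1-h^2} \le \frac{1}{C_p^2},\ \frac{h^2(1-h^{2k})}{1-h^2} \le \min\left(\frac{\theta_{k,\max}}{2 \theta_{0,\max} C_f^2}, \frac{\theta_{k,\min}^2}{16 \theta_{0,\max}\theta_{k,\max} C_p^2}\right)\right\}.$$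
   Context: Notation: $|u|_{p,2,S}^2=\sum_{|\sigma|=p}\int_S|D^\sigma u|^2$. $B(x,r)$ is the ball of center $x$ and radius $r$. Quotients $\frac{h^2-h^{2k}}{1-h^2}$ and $\frac{h^2(1-h^{2k})}{1-h^2}$ are read as $\sum_{j=1}^{k-1}h^{2j}$ and $\sum_{j=1}^{k}h^{2j}$; a quotient with denominator $\theta_{0,\max}=0$ is $+\infty$. Setting: $D\subset\mathbb{R}^d$ is a bounded domain. The bilinear form of $\mathcal{L}$ is $B(u,v)=\sum_{0\le|\sigma|,|\gamma|\le k}\int_D a_{\sigma\gamma}D^\sigma u\,D^\gamma v$ on $H_0^k(D)$. Self-adjoint means $B$ is symmetric on $H_0^k(D)$. Standing assumption: there are $0<a_{\min}\le a_{\max}$ with $a_{\min}|u|_{k,2,D}^2\le B(u,u)\le a_{\max}|u|_{k,2,D}^2$ for all $u\in H_0^k(D)$. $H=H_0^k(D)$ with $\|u\|_H^2=B(u,u)$. For $S\subset D$ the local energy norm is $\|\psi\|_{H(S)}^2=\sum_{0\le|\sigma|,|\gamma|\le k}\int_S a_{\sigma\gamma}D^\sigma\psi\,D^\gamma\psi$. Partition: $D$ is divided into elements $\tau_1,\dots,\tau_m$ (triangles or quadrilaterals in 2D, tetrahedra or hexahedra in 3D), $h_i$ is the diameter of $\tau_i$, $h=\max_i h_i$ is the mesh size, and the partition is regular: the maximum diameter $\rho_i$ of a ball inscribed in $\tau_i$ satisfies $\rho_i/h_i\ge\delta$ for all $i$, with a fixed $\delta>0$. The point $x_i\in\tau_i$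 satisfies $B(x_i,\delta h_i/2)\subset\tau_i$. Basis functions: $\mathcal{P}_{k-1}(\tau_i)$ is the space of $d$-variate polynomials of degree at most $k-1$ on $\tau_i$, $Q=\binom{k+d-1}{d}$ is its dimension, and $\{\phi_{i,q}\}_{q=1}^Q$ is a basis of it (extended by zero to $D$) with $\int_{\tau_i}\phi_{i,q}\phi_{i,q'}=|\tau_i|\delta_{q,q'}$. $\psi_{i,q}$ is the unique minimizer of $\|\psi\|_H^2$ over $\psi\in H_0^k(D)$ subject to $\int_D\psi\,\phi_{j,q'}=\delta_{iq,jq'}$ for all $1\le j\le m$, $1\le q'\le Q$. Constants: $C_p$ is a constant (uniform over the elements) such that $|u-\Pi_iu|_{p,2,\tau_i}\le C_ph^{k-p}_{i}|u|_{k,2,\tau_i}$, hence also $\le C_p h^{k-p}|u|_{k,2,\tau_i}$, for all $u\in H^k(D)$, all $i$ and all integers $0\le p\le k$, where $\Pi_i$ is the $L^2(\tau_i)$-orthogonal projection onto $\mathcal{P}_{k-1}(\tau_i)$. $C_f=C_f(d,k)$ is a constant such that $|u|_{p,2,\Omega}\le C_ft^{k-p}|u|_{k,2,\Omega}$ for all bounded open $\Omega\subset\mathbb{R}^d$ of diameter at most $t$, all $u\in H_0^k(\Omega)$ and all integers $0\le p\le k$ (Friedrichs' inequality). $C(k,d,\delta)$ is a constant depending only on $k,d,\delta$ such that, for every $t>0$ and every bounded open $\Omega\subset\mathbb{R}^d$ of diameter at most $t$ containing a ball of radius $\delta t/2$, every $u\in H_0^k(\Omega)$ for which $(-1)^k\sum_{|\sigma|=k}D^{2\sigma}u$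 (weakly) equals a polynomial $p$ of degree at most $k-1$ satisfies $\|p\|_{L^2(\Omega)}\le C(k,d,\delta)t^{-k}|u|_{k,2,\Omega}$. *)

theory Defs
  imports "HOL-Analysis.Analysis"
begin

type_synonym 'n midx = "'n \<Rightarrow> nat"

definition mlen :: "'n::finite midx \<Rightarrow> nat" where
  "mlen \<sigma> = (\<Sum>i\<in>UNIV. \<sigma> i)"

text \<open>The index sets of all sums below are finite, so no sum is silently zero.\<close>

lemma finite_mlen_le: "finite {\<sigma>::'n::finite midx. mlen \<sigma> \<le> p}"
proof (rule finite_subset)
  show "{\<sigma>::'n midx. mlen \<sigma> \<le> p} \<subseteq> PiE UNIV (\<lambda>_. {..p})"
  proof
    fix \<sigma> :: "'n midx"
    assume "\<sigma> \<in> {\<sigma>. mlen \<sigma> \<le> p}"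
    then have le: "(\<Sum>i\<in>UNIV. \<sigma> i) \<le> p" by (simp add: mlen_def)
    have "\<sigma> i \<le> p" for i
    proof -
      have "\<sigma> i \<le> (\<Sum>i\<in>UNIV. \<sigma> i)" by (rule member_le_sum) auto
      then show ?thesis using le by simp
    qed
    then show "\<sigma> \<in> PiE UNIV (\<lambda>_. {..p})" by (auto simp: PiE_def)
  qed
  show "finite (PiE (UNIV::'n set) (\<lambda>_. {..p}))" by (rule finite_PiE) auto
qed

lemma finite_mlen_eq: "finite {\<sigma>::'n::finite midx. mlen \<sigma> = p}"
  by (rule finite_subset[OF _ finite_mlen_le[of p]]) auto

lemma finite_mlen_less: "finite {\<sigma>::'n::finite midx. mlen \<sigma> < p}"
  by (rule finite_subset[OF _ finite_mlen_le[of p]]) auto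


subsection \<open>Test functions and weak derivatives\<close>

definition pd :: "'n::finite \<Rightarrow> (real^'n \<Rightarrow> real) \<Rightarrow> real^'n \<Rightarrow> real" where
  "pd i f x = frechet_derivative f (at x) (axis i 1)"

fun Ck :: "nat \<Rightarrow> (real^'n::finite \<Rightarrow> real) \<Rightarrow> bool" where
  "Ck 0 f \<longleftrightarrow> continuous_on UNIV f"
| "Ck (Suc p) f \<longleftrightarrow> (\<forall>x. f differentiable (at x)) \<and> (\<forall>i. Ck p (pd i f))"

definition test_functions :: "(real^'n::finite) set \<Rightarrow> (real^'n \<Rightarrow> real) set" where
  "test_functions \<Omega> = {f. (\<forall>p. Ck p f) \<and> compact (closure {x. f x \<noteq> 0})
                           \<and> closure {x. f x \<noteq> 0} \<subseteq> \<Omega>}"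

text \<open>
  Classical derivative of order \<open>\<sigma>\<close>. The index type carries no order, so the
  sequence of partial derivatives is an arbitrary list in which each \<open>i\<close> occurs \<open>\<sigma> i\<close>
  times; \<open>mderiv\<close> is only applied to smooth functions, for which the order is irrelevant.
\<close>
definition mderiv :: "'n::finite midx \<Rightarrow> (real^'n \<Rightarrow> real) \<Rightarrow> real^'n \<Rightarrow> real" where
  "mderiv \<sigma> f = foldr pd (SOME xs. \<forall>i. count_list xs i = \<sigma> i) f"

definition loc_integrable :: "(real^'n::finite) set \<Rightarrow> (real^'n \<Rightarrow> real) \<Rightarrow> bool" where
  "loc_integrable \<Omega> u \<longleftrightarrow> (\<forall>K. compact K \<and> K \<subseteq> \<Omega> \<longrightarrow> set_integrable lebesgue K u)"

definition has_weak_deriv ::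
  "(real^'n::finite) set \<Rightarrow> 'n midx \<Rightarrow> (real^'n \<Rightarrow> real) \<Rightarrow> (real^'n \<Rightarrow> real) \<Rightarrow> bool" where
  "has_weak_deriv \<Omega> \<sigma> u v \<longleftrightarrow> loc_integrable \<Omega> u \<and> loc_integrable \<Omega> v \<and>
     (\<forall>f\<in>test_functions \<Omega>.
        (LINT x:\<Omega>|lebesgue. u x * mderiv \<sigma> f x)
          = (-1) ^ mlen \<sigma> * (LINT x:\<Omega>|lebesgue. v x * f x))"

text \<open>A representative of the weak derivative on the open set \<open>\<Omega>\<close>, unique up to null sets.\<close>
definition wderiv :: "(real^'n::finite) set \<Rightarrow> 'n midx \<Rightarrow> (real^'n \<Rightarrow> real) \<Rightarrow> real^'n \<Rightarrow> real" where
  "wderiv \<Omega> \<sigma> u = (SOME v. has_weak_deriv \<Omega> \<sigma> u v)"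


subsection \<open>Sobolev spaces\<close>

text \<open>
  Elements are represented by functions on the whole space; their values outside \<open>\<Omega>\<close>
  are irrelevant.
\<close>

definition L2 :: "(real^'n::finite) set \<Rightarrow> (real^'n \<Rightarrow> real) set" where
  "L2 \<Omega> = {u. u \<in> borel_measurable (lebesgue_on \<Omega>) \<and> set_integrable lebesgue \<Omega> (\<lambda>x. (u x)\<^sup>2)}"

definition L2norm :: "(real^'n::finite) set \<Rightarrow> (real^'n \<Rightarrow> real) \<Rightarrow> real" where
  "L2norm \<Omega> u = sqrt (LINT x:\<Omega>|lebesgue. (u x)\<^sup>2)"

definition Linf :: "(real^'n::finite) set \<Rightarrow> (real^'n \<Rightarrow> real) set" where
  "Linf \<Omega> = {u. u \<in> borel_measurable (lebesgue_on \<Omega>) \<and>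
                  (\<exists>M. AE x in lebesgue_on \<Omega>. \<bar>u x\<bar> \<le> M)}"

definition Hk :: "nat \<Rightarrow> (real^'n::finite) set \<Rightarrow> (real^'n \<Rightarrow> real) set" where
  "Hk k \<Omega> = {u\<in>L2 \<Omega>. \<forall>\<sigma>. mlen \<sigma> \<le> k \<longrightarrow> (\<exists>v\<in>L2 \<Omega>. has_weak_deriv \<Omega> \<sigma> u v)}"

definition H0k :: "nat \<Rightarrow> (real^'n::finite) set \<Rightarrow> (real^'n \<Rightarrow> real) set" where
  "H0k k \<Omega> = {u\<in>Hk k \<Omega>. \<exists>f::nat \<Rightarrow> real^'n \<Rightarrow> real. (\<forall>n. f n \<in> test_functions \<Omega>) \<and>
     (\<lambda>n. \<Sum>\<sigma> | mlen \<sigma> \<le> k.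
        LINT x:\<Omega>|lebesgue. (wderiv \<Omega> \<sigma> u x - mderiv \<sigma> (f n) x)\<^sup>2) \<longlonglongrightarrow> 0}"

text \<open>The seminorm \<open>|u|\<close> of order \<open>p\<close> in \<open>L\<^sup>2\<close> over the open set \<open>\<Omega>\<close>.\<close>
definition seminormk :: "nat \<Rightarrow> (real^'n::finite) set \<Rightarrow> (real^'n \<Rightarrow> real) \<Rightarrow> real" where
  "seminormk p \<Omega> u = sqrt (\<Sum>\<sigma> | mlen \<sigma> = p. LINT x:\<Omega>|lebesgue. (wderiv \<Omega> \<sigma> u x)\<^sup>2)"


subsection \<open>The operator\<close>

text \<open>
  \<open>bform k a D S\<close> integrates over \<open>S \<subseteq> D\<close> but differentiates weakly on \<open>D\<close>, so
  that \<open>S\<close> need not be open. \<open>bform k a D D\<close> is the bilinear form of the operator, and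
  \<open>bform k a D S u u\<close> is the square of the local energy norm on \<open>S\<close>.
\<close>
definition bform :: "nat \<Rightarrow> ('n midx \<Rightarrow> 'n midx \<Rightarrow> real^'n \<Rightarrow> real) \<Rightarrow> (real^'n::finite) set
    \<Rightarrow> (real^'n) set \<Rightarrow> (real^'n \<Rightarrow> real) \<Rightarrow> (real^'n \<Rightarrow> real) \<Rightarrow> real" where
  "bform k a D S u v = (\<Sum>\<sigma> | mlen \<sigma> \<le> k. \<Sum>\<gamma> | mlen \<gamma> \<le> k.
     LINT x:S|lebesgue. a \<sigma> \<gamma> x * wderiv D \<sigma> u x * wderiv D \<gamma> v x)"

definition energy :: "nat \<Rightarrow> ('n midx \<Rightarrow> 'n midx \<Rightarrow> real^'n \<Rightarrow> real) \<Rightarrow> (real^'n::finite) set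
    \<Rightarrow> (real^'n) set \<Rightarrow> (real^'n \<Rightarrow> real) \<Rightarrow> real" where
  "energy k a D S u = bform k a D S u u"

definition self_adjoint :: "nat \<Rightarrow> ('n midx \<Rightarrow> 'n midx \<Rightarrow> real^'n \<Rightarrow> real) \<Rightarrow> (real^'n::finite) set
    \<Rightarrow> bool" where
  "self_adjoint k a D \<longleftrightarrow> (\<forall>u\<in>H0k k D. \<forall>v\<in>H0k k D. bform k a D D u v = bform k a D D v u)"

definition energy_equivalent :: "nat \<Rightarrow> ('n midx \<Rightarrow> 'n midx \<Rightarrow> real^'n \<Rightarrow> real)
    \<Rightarrow> (real^'n::finite) set \<Rightarrow> bool" where
  "energy_equivalent k a D \<longleftrightarrow> (\<exists>amin amax. 0 < amin \<and> amin \<le> amax \<and>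
     (\<forall>u\<in>H0k k D. amin * (seminormk k D u)\<^sup>2 \<le> bform k a D D u u \<and>
                   bform k a D D u u \<le> amax * (seminormk k D u)\<^sup>2))"

definition quad_form :: "('n::finite midx) set \<Rightarrow> ('n midx \<Rightarrow> 'n midx \<Rightarrow> real^'n \<Rightarrow> real)
    \<Rightarrow> real^'n \<Rightarrow> ('n midx \<Rightarrow> real) \<Rightarrow> real" where
  "quad_form I a x \<zeta> = (\<Sum>\<sigma>\<in>I. \<Sum>\<gamma>\<in>I. a \<sigma> \<gamma> x * \<zeta> \<sigma> * \<zeta> \<gamma>)"

definition nonneg_coeffs :: "nat \<Rightarrow> ('n midx \<Rightarrow> 'n midx \<Rightarrow> real^'n \<Rightarrow> real) \<Rightarrow> (real^'n::finite) set
    \<Rightarrow> bool" where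
  "nonneg_coeffs k a D \<longleftrightarrow> (\<forall>x\<in>D. \<forall>\<zeta>. 0 \<le> quad_form {\<sigma>. mlen \<sigma> \<le> k} a x \<zeta>)"

definition bounded_coeffs :: "nat \<Rightarrow> ('n midx \<Rightarrow> 'n midx \<Rightarrow> real^'n \<Rightarrow> real) \<Rightarrow> (real^'n::finite) set
    \<Rightarrow> real \<Rightarrow> real \<Rightarrow> bool" where
  "bounded_coeffs k a D \<theta>0 \<theta>k \<longleftrightarrow> (\<forall>x\<in>D. \<forall>\<zeta>. quad_form {\<sigma>. mlen \<sigma> \<le> k} a x \<zeta>
     \<le> \<theta>k * (\<Sum>\<sigma> | mlen \<sigma> = k. (\<zeta> \<sigma>)\<^sup>2) + \<theta>0 * (\<Sum>\<sigma> | mlen \<sigma> < k. (\<zeta> \<sigma>)\<^sup>2))"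

definition strongly_elliptic :: "nat \<Rightarrow> ('n midx \<Rightarrow> 'n midx \<Rightarrow> real^'n \<Rightarrow> real)
    \<Rightarrow> (real^'n::finite) set \<Rightarrow> real \<Rightarrow> bool" where
  "strongly_elliptic k a D \<theta>min \<longleftrightarrow> (\<forall>x\<in>D. \<forall>\<zeta>.
     \<theta>min * (\<Sum>\<sigma> | mlen \<sigma> = k. (\<zeta> \<sigma>)\<^sup>2) \<le> quad_form {\<sigma>. mlen \<sigma> = k} a x \<zeta>)"


subsection \<open>Partitions\<close>

text \<open>
  Elements are taken open. For every dimension, an element is the interior of a (not
  necessarily convex) polyhedral cell; this covers intervals, triangles, quadrilaterals,
  tetrahedra and hexahedra.
\<close>
definition mesh_element :: "(real^'n::finite) set \<Rightarrow> bool" where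
  "mesh_element T \<longleftrightarrow> T \<noteq> {} \<and> connected T \<and>
     (\<exists>F. finite F \<and> (\<forall>P\<in>F. polytope P) \<and> T = interior (\<Union>F))"

definition mesh_partition :: "(real^'n::finite) set \<Rightarrow> nat \<Rightarrow> (nat \<Rightarrow> (real^'n) set) \<Rightarrow> bool" where
  "mesh_partition D m \<tau> \<longleftrightarrow>
     (\<forall>i\<in>{1..m}. mesh_element (\<tau> i) \<and> \<tau> i \<subseteq> D) \<and>
     disjoint_family_on \<tau> {1..m} \<and> negligible (D - (\<Union>i\<in>{1..m}. \<tau> i))"

definition mesh_size :: "nat \<Rightarrow> (nat \<Rightarrow> (real^'n::finite) set) \<Rightarrow> real" where
  "mesh_size m \<tau> = Max ((\<lambda>i. diameter (\<tau> i)) ` {1..m})"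

definition inscribed_diameter :: "(real^'n::finite) set \<Rightarrow> real" where
  "inscribed_diameter T = Sup {2 * r | r. 0 < r \<and> (\<exists>x. ball x r \<subseteq> T)}"

definition regular_partition :: "real \<Rightarrow> nat \<Rightarrow> (nat \<Rightarrow> (real^'n::finite) set) \<Rightarrow> bool" where
  "regular_partition \<delta> m \<tau> \<longleftrightarrow>
     (\<forall>i\<in>{1..m}. inscribed_diameter (\<tau> i) / diameter (\<tau> i) \<ge> \<delta>)"

definition centers :: "real \<Rightarrow> nat \<Rightarrow> (nat \<Rightarrow> (real^'n::finite) set) \<Rightarrow> (nat \<Rightarrow> real^'n) \<Rightarrow> bool" where
  "centers \<delta> m \<tau> c \<longleftrightarrow>
     (\<forall>i\<in>{1..m}. c i \<in> \<tau> i \<and> ball (c i) (\<delta> * diameter (\<tau> i) / 2) \<subseteq> \<tau> i)"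


subsection \<open>Basis functions\<close>

definition polys :: "nat \<Rightarrow> (real^'n::finite \<Rightarrow> real) set" where
  "polys s = {p. \<exists>c. \<forall>x. p x = (\<Sum>\<sigma> | mlen \<sigma> \<le> s. c \<sigma> * (\<Prod>i\<in>UNIV. (x $ i) ^ \<sigma> i))}"

text \<open>Polynomials on \<open>T\<close>, extended by zero.\<close>
definition polys_on :: "nat \<Rightarrow> (real^'n::finite) set \<Rightarrow> (real^'n \<Rightarrow> real) set" where
  "polys_on s T = (\<lambda>p x. if x \<in> T then p x else 0) ` polys s"

definition num_basis :: "'n::finite itself \<Rightarrow> nat \<Rightarrow> nat" where
  "num_basis _ k = (k + CARD('n) - 1) choose CARD('n)"

definition poly_basis :: "nat \<Rightarrow> (real^'n::finite) set \<Rightarrow> (nat \<Rightarrow> real^'n \<Rightarrow> real) \<Rightarrow> bool" where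
  "poly_basis k T f \<longleftrightarrow> (let Q = num_basis TYPE('n) k in
     (\<forall>q\<in>{1..Q}. f q \<in> polys_on (k - 1) T) \<and>
     (\<forall>p\<in>polys_on (k - 1) T. \<exists>c. \<forall>x. p x = (\<Sum>q=1..Q. c q * f q x)) \<and>
     (\<forall>c. (\<forall>x. (\<Sum>q=1..Q. c q * f q x) = 0) \<longrightarrow> (\<forall>q\<in>{1..Q}. c q = 0)))"

definition scaled_orthonormal :: "nat \<Rightarrow> (real^'n::finite) set \<Rightarrow> (nat \<Rightarrow> real^'n \<Rightarrow> real) \<Rightarrow> bool" where
  "scaled_orthonormal Q T f \<longleftrightarrow> (\<forall>q\<in>{1..Q}. \<forall>q'\<in>{1..Q}.
     (LINT x:T|lebesgue. f q x * f q' x) = (if q = q' then measure lebesgue T else 0))"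

definition local_basis :: "nat \<Rightarrow> nat \<Rightarrow> (nat \<Rightarrow> (real^'n::finite) set)
    \<Rightarrow> (nat \<Rightarrow> nat \<Rightarrow> real^'n \<Rightarrow> real) \<Rightarrow> bool" where
  "local_basis k m \<tau> \<phi> \<longleftrightarrow> (\<forall>i\<in>{1..m}. poly_basis k (\<tau> i) (\<phi> i) \<and>
     scaled_orthonormal (num_basis TYPE('n) k) (\<tau> i) (\<phi> i))"

definition admissible :: "nat \<Rightarrow> (real^'n::finite) set \<Rightarrow> nat \<Rightarrow> (nat \<Rightarrow> nat \<Rightarrow> real^'n \<Rightarrow> real)
    \<Rightarrow> nat \<Rightarrow> nat \<Rightarrow> (real^'n \<Rightarrow> real) set" where
  "admissible k D m \<phi> i q = {u\<in>H0k k D. \<forall>j\<in>{1..m}. \<forall>q'\<in>{1..num_basis TYPE('n) k}.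
     (LINT x:D|lebesgue. u x * \<phi> j q' x) = (if i = j \<and> q = q' then 1 else 0)}"

text \<open>Coercivity makes the minimizer unique up to null sets.\<close>
definition energy_minimizer :: "nat \<Rightarrow> ('n midx \<Rightarrow> 'n midx \<Rightarrow> real^'n \<Rightarrow> real)
    \<Rightarrow> (real^'n::finite) set \<Rightarrow> (real^'n \<Rightarrow> real) set \<Rightarrow> (real^'n \<Rightarrow> real) \<Rightarrow> bool" where
  "energy_minimizer k a D A u \<longleftrightarrow> u \<in> A \<and> (\<forall>v\<in>A. energy k a D D u \<le> energy k a D D v)"


subsection \<open>The constants\<close>

definition L2_projection :: "nat \<Rightarrow> (real^'n::finite) set \<Rightarrow> (real^'n \<Rightarrow> real) \<Rightarrow> (real^'n \<Rightarrow> real)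
    \<Rightarrow> bool" where
  "L2_projection s T u p \<longleftrightarrow> p \<in> polys s \<and>
     (\<forall>q\<in>polys s. (LINT x:T|lebesgue. (u x - p x) * q x) = 0)"

definition projection_const :: "nat \<Rightarrow> (real^'n::finite) set \<Rightarrow> nat \<Rightarrow> (nat \<Rightarrow> (real^'n) set)
    \<Rightarrow> real \<Rightarrow> bool" where
  "projection_const k D m \<tau> Cp \<longleftrightarrow>
     (\<forall>u\<in>Hk k D. \<forall>i\<in>{1..m}. \<forall>w. L2_projection (k - 1) (\<tau> i) u w \<longrightarrow>
        (\<forall>p\<le>k. seminormk p (\<tau> i) (\<lambda>x. u x - w x)
                 \<le> Cp * diameter (\<tau> i) ^ (k - p) * seminormk k (\<tau> i) u))"

definition friedrichs_const :: "'n::finite itself \<Rightarrow> nat \<Rightarrow> real \<Rightarrow> bool" where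
  "friedrichs_const _ k Cf \<longleftrightarrow>
     (\<forall>(\<Omega>::(real^'n) set) t. open \<Omega> \<and> bounded \<Omega> \<and> diameter \<Omega> \<le> t \<longrightarrow>
        (\<forall>u\<in>H0k k \<Omega>. \<forall>p\<le>k. seminormk p \<Omega> u \<le> Cf * t ^ (k - p) * seminormk k \<Omega> u))"

text \<open>
  \<open>(-1)\<^sup>k\<close> times the sum of \<open>D\<^bsup>2\<sigma>\<^esup> u\<close> over \<open>|\<sigma>| = k\<close> equals \<open>p\<close> as a
  distribution on \<open>\<Omega>\<close>; moving the even number \<open>2k\<close> of derivatives to the test function
  produces no sign.
\<close>
definition weak_polyharmonic :: "nat \<Rightarrow> (real^'n::finite) set \<Rightarrow> (real^'n \<Rightarrow> real)
    \<Rightarrow> (real^'n \<Rightarrow> real) \<Rightarrow> bool" where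
  "weak_polyharmonic k \<Omega> u p \<longleftrightarrow> (\<forall>f\<in>test_functions \<Omega>.
     (-1) ^ k * (\<Sum>\<sigma> | mlen \<sigma> = k. LINT x:\<Omega>|lebesgue. u x * mderiv (\<lambda>i. 2 * \<sigma> i) f x)
       = (LINT x:\<Omega>|lebesgue. p x * f x))"

definition inverse_const :: "'n::finite itself \<Rightarrow> nat \<Rightarrow> real \<Rightarrow> real \<Rightarrow> bool" where
  "inverse_const _ k \<delta> C \<longleftrightarrow>
     (\<forall>t>0. \<forall>\<Omega>::(real^'n) set. open \<Omega> \<and> bounded \<Omega> \<and> diameter \<Omega> \<le> t \<and>
        (\<exists>y. ball y (\<delta> * t / 2) \<subseteq> \<Omega>) \<longrightarrow>
        (\<forall>u\<in>H0k k \<Omega>. \<forall>p\<in>polys (k - 1). weak_polyharmonic k \<Omega> u p \<longrightarrow>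
           L2norm \<Omega> p \<le> C / t ^ k * seminormk k \<Omega> u))"

text \<open>
  Extended real numbers: for \<open>\<theta>0 = 0\<close> both quotients are \<open>\<infinity>\<close>, as division of a positive
  extended real by zero yields \<open>\<infinity>\<close>, and the supremum itself may be \<open>\<infinity>\<close> (when \<open>k = 1\<close>).
  The sums are the expanded forms of \<open>(h\<^sup>2 - h\<^bsup>2k\<^esup>) / (1 - h\<^sup>2)\<close> and
  \<open>h\<^sup>2 (1 - h\<^bsup>2k\<^esup>) / (1 - h\<^sup>2)\<close>, which also make sense at \<open>h = 1\<close>.
\<close>
definition mesh_threshold :: "nat \<Rightarrow> real \<Rightarrow> real \<Rightarrow> real \<Rightarrow> real \<Rightarrow> real \<Rightarrow> ereal" where
  "mesh_threshold k Cp Cf \<theta>0 \<theta>max \<theta>min = Sup {ereal h | h. h > 0 \<and>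
     (\<Sum>j\<in>{1..<k}. h ^ (2 * j)) \<le> 1 / Cp\<^sup>2 \<and>
     ereal (\<Sum>j\<in>{1..k}. h ^ (2 * j))
       \<le> min (ereal \<theta>max / ereal (2 * \<theta>0 * Cf\<^sup>2))
             (ereal (\<theta>min\<^sup>2) / ereal (16 * \<theta>0 * \<theta>max * Cp\<^sup>2))}"

end

theory Submission
  imports Defs
begin

text \<open>
  A minimiser \<open>u = \<psi> i q\<close> is orthogonal to everything with zero moments, so the operator maps it to a
  polynomial \<open>g j\<close> on each element. Testing with \<open>\<eta> u\<close> for a cutoff \<open>\<eta>\<close> that is 0 near the centre and 1 far
  away leaves only the elements in the transition layer. There the commutator terms are small, because \<open>u\<close>
  has zero moments and the projection estimate compensates every derivative of \<open>\<eta>\<close>, and the source term is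
  small, because \<open>g j\<close> is bounded by an inverse estimate and only the oscillation of \<open>\<eta>\<close> on an element enters.
  Hence the energy outside a layer is at most a fraction \<open>1 / e\<close> of the energy inside it.

  Only the symmetric part of the coefficients is used: it has the same quadratic form, and the minimisers
  depend on the quadratic form alone. Layers are cubes instead of balls, which makes the cutoff a product of
  functions of one variable and costs a factor depending only on the dimension.
\<close>

section \<open>Smooth functions\<close>

text \<open>The passage from one layer to the next is hole filling. If E' and E are the energies
  outside the larger and the smaller cube, testing with \<eta> u gives E' <= \<kappa> (E - E');
  moving \<kappa> E' to the left yields the ratio \<kappa>/(1 + \<kappa>), which is at most 1/e once
  \<kappa> (e - 1) <= 1. As \<kappa> is proportional to h/L, the layers must have width of order l h
  with l large. The 1 in the exponent pays for rounding r/(l h) to an integer.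

  Each of the three conditions on h absorbs lower-order terms: those of the commutator, where order
  0 does not occur and the sum therefore stops at k - 1; those of the energy of a test function on
  an element; those in the coercivity of the top seminorm.

  The obstacle is the bound on \<open>g j\<close>, since the inverse constant speaks of polyharmonic
  solutions and not of u. The Dirichlet problem with right side \<open>g j\<close> is therefore
  solved on the element, and its solution is compared with u through the functional given by
  \<open>g j\<close>.

  Weak derivatives are arbitrary representatives, so each rule of calculus is proved for test
  functions and carried to \<open>H0k\<close> by L2 limits.\<close>

definition smooth :: "(real^'n::finite \<Rightarrow> real) \<Rightarrow> bool" where
  "smooth f \<longleftrightarrow> (\<forall>p. Ck p f)"

lemma smooth_pd: "smooth f \<Longrightarrow> smooth (pd i f)"
  unfolding smooth_def by (metis Ck.simps(2))

lemma smooth_differentiable: "smooth f \<Longrightarrow> f differentiable (at x)"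
  unfolding smooth_def by (metis Ck.simps(2))

lemma smooth_continuous: "smooth f \<Longrightarrow> continuous_on UNIV f"
  unfolding smooth_def by (metis Ck.simps(1))

lemma Ck_SucD: "Ck (Suc p) f \<Longrightarrow> Ck p f"
proof (induction p arbitrary: f)
  case 0
  then show ?case
    by (auto intro!: differentiable_imp_continuous_on simp: differentiable_on_def
        intro: differentiable_at_withinI)
next
  case (Suc p)
  then show ?case by (metis Ck.simps(2))
qed

lemma pd_eq: "(f has_derivative f') (at x) \<Longrightarrow> pd i f x = f' (axis i 1)"
  unfolding pd_def using frechet_derivative_at by metis

lemma pd_add:
  assumes "f differentiable (at x)" "g differentiable (at x)"
  shows "pd i (\<lambda>x. f x + g x) x = pd i f x + pd i g x"
proof -
  have "((\<lambda>x. f x + g x) has_derivative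
      (\<lambda>h. frechet_derivative f (at x) h + frechet_derivative g (at x) h)) (at x)"
    using assms by (intro has_derivative_add) (auto simp: frechet_derivative_works[symmetric])
  from pd_eq[OF this] show ?thesis by (simp add: pd_def)
qed

lemma pd_mult:
  assumes "f differentiable (at x)" "g differentiable (at x)"
  shows "pd i (\<lambda>x. f x * g x) x = f x * pd i g x + pd i f x * g x"
proof -
  have "((\<lambda>x. f x * g x) has_derivative
      (\<lambda>h. f x * frechet_derivative g (at x) h + frechet_derivative f (at x) h * g x)) (at x)"
    using assms by (intro has_derivative_mult) (auto simp: frechet_derivative_works[symmetric])
  from pd_eq[OF this] show ?thesis by (simp add: pd_def)
qed

lemma pd_const: "pd i (\<lambda>x. c) x = 0"
  using pd_eq[of "\<lambda>x. c" "\<lambda>_. 0" x i] by simp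

lemma Ck_const: "Ck p (\<lambda>x. c)"
  by (induction p arbitrary: c) (auto simp: pd_const[abs_def])

lemma Ck_add: "Ck p f \<Longrightarrow> Ck p g \<Longrightarrow> Ck p (\<lambda>x. f x + g x)"
proof (induction p arbitrary: f g)
  case 0
  then show ?case by (auto intro: continuous_intros)
next
  case (Suc p)
  have "pd i (\<lambda>x. f x + g x) = (\<lambda>x. pd i f x + pd i g x)" for i
    using Suc.prems by (auto simp: pd_add)
  then show ?case using Suc by (auto intro: differentiable_add)
qed

lemma Ck_mult: "Ck p f \<Longrightarrow> Ck p g \<Longrightarrow> Ck p (\<lambda>x. f x * g x)"
proof (induction p arbitrary: f g)
  case 0
  then show ?case by (auto intro: continuous_intros)
next
  case (Suc p)
  have *: "pd i (\<lambda>x. f x * g x) = (\<lambda>x. f x * pd i g x + pd i f x * g x)" for i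
    using Suc.prems by (auto simp: pd_mult)
  have "Ck p (pd i f)" "Ck p (pd i g)" "Ck p f" "Ck p g" for i
    using Suc.prems Ck_SucD[of p] by auto
  then show ?case using Suc.prems unfolding Ck.simps *
    by (auto intro!: Ck_add Suc.IH differentiable_mult)
qed

lemma smooth_const: "smooth (\<lambda>x. c)"
  unfolding smooth_def by (simp add: Ck_const)

lemma smooth_add: "smooth f \<Longrightarrow> smooth g \<Longrightarrow> smooth (\<lambda>x. f x + g x)"
  unfolding smooth_def by (simp add: Ck_add)

lemma smooth_mult: "smooth f \<Longrightarrow> smooth g \<Longrightarrow> smooth (\<lambda>x. f x * g x)"
  unfolding smooth_def by (simp add: Ck_mult)

lemma smooth_cmult: "smooth f \<Longrightarrow> smooth (\<lambda>x. c * f x)"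
  by (intro smooth_mult smooth_const)

lemma smooth_foldr: "smooth f \<Longrightarrow> smooth (foldr pd xs f)"
  by (induction xs) (auto intro: smooth_pd)

section \<open>Symmetry of second partial derivatives\<close>

lemma has_derivative_line:
  assumes "f differentiable (at (x + t *\<^sub>R axis i 1))"
  shows "((\<lambda>t. f (x + t *\<^sub>R axis i 1)) has_real_derivative pd i f (x + t *\<^sub>R axis i 1)) (at t)"
proof -
  let ?y = "x + t *\<^sub>R axis i 1"
  have f: "(f has_derivative frechet_derivative f (at ?y)) (at ?y)"
    using assms by (simp add: frechet_derivative_works[symmetric])
  have "((\<lambda>t. x + t *\<^sub>R axis i 1) has_derivative (\<lambda>t. t *\<^sub>R axis i 1)) (at t)"
    by (auto intro!: derivative_eq_intros)
  from diff_chain_at[OF this f]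
  have "((\<lambda>t. f (x + t *\<^sub>R axis i 1)) has_derivative (\<lambda>t. frechet_derivative f (at ?y) (t *\<^sub>R axis i 1))) (at t)"
    by (simp add: o_def)
  moreover have "frechet_derivative f (at ?y) (s *\<^sub>R axis i 1) = pd i f ?y * s" for s
    using linear_scale[OF has_derivative_linear[OF f]] by (simp add: pd_def)
  ultimately show ?thesis
    by (simp add: has_field_derivative_def)
qed

text \<open>The mean value theorem, applied in direction i to the difference along two parallel
  lines and then in direction j. The left side is symmetric in i and j, the right side is not yet
  known to be, and comparing the two orders is what the lemma is for.\<close>

lemma second_difference:
  assumes f: "smooth f" and h: "h > 0"
  shows "\<exists>u v. 0 \<le> u \<and> u \<le> h \<and> 0 \<le> v \<and> v \<le> h \<and>
    f (x + h *\<^sub>R axis i 1 + h *\<^sub>R axis j 1) - f (x + h *\<^sub>R axis i 1) - f (x + h *\<^sub>R axis j 1) + f x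
      = h\<^sup>2 * pd j (pd i f) (x + u *\<^sub>R axis i 1 + v *\<^sub>R axis j 1)"
proof -
  have d: "((\<lambda>t. f (x + h *\<^sub>R axis j 1 + t *\<^sub>R axis i 1) - f (x + t *\<^sub>R axis i 1)) has_real_derivative
     pd i f (x + h *\<^sub>R axis j 1 + t *\<^sub>R axis i 1) - pd i f (x + t *\<^sub>R axis i 1)) (at t)" for t
    by (intro DERIV_diff has_derivative_line smooth_differentiable f)
  from MVT2[OF h d] obtain u where u: "0 < u" "u < h" and
    eq: "f (x + h *\<^sub>R axis j 1 + h *\<^sub>R axis i 1) - f (x + h *\<^sub>R axis i 1) - (f (x + h *\<^sub>R axis j 1) - f x)
       = h * (pd i f (x + h *\<^sub>R axis j 1 + u *\<^sub>R axis i 1) - pd i f (x + u *\<^sub>R axis i 1))"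
    by auto
  have d2: "((\<lambda>t. pd i f (x + u *\<^sub>R axis i 1 + t *\<^sub>R axis j 1)) has_real_derivative
     pd j (pd i f) (x + u *\<^sub>R axis i 1 + t *\<^sub>R axis j 1)) (at t)" for t
    by (intro has_derivative_line smooth_differentiable smooth_pd f)
  from MVT2[OF h d2] obtain v where v: "0 < v" "v < h" and
    eq2: "pd i f (x + u *\<^sub>R axis i 1 + h *\<^sub>R axis j 1) - pd i f (x + u *\<^sub>R axis i 1)
       = h * pd j (pd i f) (x + u *\<^sub>R axis i 1 + v *\<^sub>R axis j 1)"
    by auto
  have "pd i f (x + h *\<^sub>R axis j 1 + u *\<^sub>R axis i 1) = pd i f (x + u *\<^sub>R axis i 1 + h *\<^sub>R axis j 1)"
    "f (x + h *\<^sub>R axis j 1 + h *\<^sub>R axis i 1) = f (x + h *\<^sub>R axis i 1 + h *\<^sub>R axis j 1)"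
    by (simp_all add: algebra_simps)
  with eq eq2 have "f (x + h *\<^sub>R axis i 1 + h *\<^sub>R axis j 1) - f (x + h *\<^sub>R axis i 1) - f (x + h *\<^sub>R axis j 1) + f x
      = h\<^sup>2 * pd j (pd i f) (x + u *\<^sub>R axis i 1 + v *\<^sub>R axis j 1)"
    by (simp add: power2_eq_square)
  with u v show ?thesis by (intro exI[of _ u] exI[of _ v]) auto
qed

text \<open>Both orders of differentiation are values, at points close to x, of the same second
  difference; continuity at x finishes the argument.\<close>

lemma pd_commute:
  assumes f: "smooth f"
  shows "pd i (pd j f) = pd j (pd i f)"
proof
  fix x
  show "pd i (pd j f) x = pd j (pd i f) x"
  proof (rule ccontr)
    assume ne: "pd i (pd j f) x \<noteq> pd j (pd i f) x"
    define e where "e = \<bar>pd i (pd j f) x - pd j (pd i f) x\<bar> / 2"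
    have e: "e > 0" using ne by (simp add: e_def)
    have c: "continuous (at x) (pd i (pd j f))" "continuous (at x) (pd j (pd i f))"
      using f by (auto intro!: continuous_on_interior[of UNIV] smooth_continuous smooth_pd)
    obtain d1 where d1: "d1 > 0" "\<And>y. dist y x < d1 \<Longrightarrow> \<bar>pd i (pd j f) y - pd i (pd j f) x\<bar> < e"
      using c(1) e unfolding continuous_at_eps_delta dist_real_def by metis
    obtain d2 where d2: "d2 > 0" "\<And>y. dist y x < d2 \<Longrightarrow> \<bar>pd j (pd i f) y - pd j (pd i f) x\<bar> < e"
      using c(2) e unfolding continuous_at_eps_delta dist_real_def by metis
    \<comment> \<open>The evaluation points differ from x by two steps of length at most h, hence by
      at most 2/3 of the smaller radius.\<close>
    define h where "h = min d1 d2 / 3"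
    have h: "h > 0" using d1 d2 by (simp add: h_def)
    have near: "dist (x + u *\<^sub>R axis i' 1 + v *\<^sub>R axis j' 1) x < min d1 d2"
      if "0 \<le> u" "u \<le> h" "0 \<le> v" "v \<le> h" for u v and i' j' :: 'a
    proof -
      have "norm (u *\<^sub>R axis i' (1::real) + v *\<^sub>R axis j' 1) \<le> u + v"
        using norm_triangle_ineq[of "u *\<^sub>R axis i' (1::real)" "v *\<^sub>R axis j' 1"] that by simp
      also have "\<dots> < min d1 d2" using that h by (simp add: h_def)
      finally show ?thesis by (simp add: dist_norm algebra_simps)
    qed
    obtain u v where uv: "0 \<le> u" "u \<le> h" "0 \<le> v" "v \<le> h" and
      1: "f (x + h *\<^sub>R axis i 1 + h *\<^sub>R axis j 1) - f (x + h *\<^sub>R axis i 1) - f (x + h *\<^sub>R axis j 1) + f x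
      = h\<^sup>2 * pd j (pd i f) (x + u *\<^sub>R axis i 1 + v *\<^sub>R axis j 1)"
      using second_difference[OF f h] by blast
    obtain u' v' where uv': "0 \<le> u'" "u' \<le> h" "0 \<le> v'" "v' \<le> h" and
      2: "f (x + h *\<^sub>R axis j 1 + h *\<^sub>R axis i 1) - f (x + h *\<^sub>R axis j 1) - f (x + h *\<^sub>R axis i 1) + f x
      = h\<^sup>2 * pd i (pd j f) (x + u' *\<^sub>R axis j 1 + v' *\<^sub>R axis i 1)"
      using second_difference[OF f h] by blast
    have "h\<^sup>2 * pd j (pd i f) (x + u *\<^sub>R axis i 1 + v *\<^sub>R axis j 1)
       = h\<^sup>2 * pd i (pd j f) (x + u' *\<^sub>R axis j 1 + v' *\<^sub>R axis i 1)"
      using 1 2 by (simp add: algebra_simps)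
    then have eq: "pd j (pd i f) (x + u *\<^sub>R axis i 1 + v *\<^sub>R axis j 1)
       = pd i (pd j f) (x + u' *\<^sub>R axis j 1 + v' *\<^sub>R axis i 1)" using h by simp
    have "\<bar>pd j (pd i f) (x + u *\<^sub>R axis i 1 + v *\<^sub>R axis j 1) - pd j (pd i f) x\<bar> < e"
      using near[OF uv] by (intro d2) auto
    moreover have "\<bar>pd i (pd j f) (x + u' *\<^sub>R axis j 1 + v' *\<^sub>R axis i 1) - pd i (pd j f) x\<bar> < e"
      using near[OF uv'] by (intro d1) auto
    ultimately have "\<bar>pd i (pd j f) x - pd j (pd i f) x\<bar> < 2 * e" using eq by linarith
    then show False by (simp add: e_def)
  qed
qed

section \<open>Multi-index derivatives as iterated partial derivatives\<close>

lemma foldr_pd_move: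
  "smooth f \<Longrightarrow> foldr pd (us @ x # vs) f = pd x (foldr pd (us @ vs) f)"
proof (induction us)
  case (Cons u us)
  then show ?case using pd_commute[of "foldr pd (us @ vs) f" u x] smooth_foldr[of f "us @ vs"] by simp
qed simp

text \<open>Permutation invariance, proved by moving the matching entry of the second list to its
  front. It removes the arbitrary choice of a list inside \<open>mderiv\<close>.\<close>

lemma foldr_pd_cong:
  assumes "smooth f" "count_list xs = count_list ys"
  shows "foldr pd xs f = foldr pd ys f"
  using assms(2)
proof (induction xs arbitrary: ys)
  case (Nil ys)
  then have "\<forall>i. count_list ys i = 0" by (metis count_list.simps(1))
  then have "ys = []" by (cases ys) (auto split: if_splits)
  then show ?case by simp
next
  case (Cons x xs ys)
  then have "x \<in> set ys"
    by (metis count_list_0_iff list.set_intros(1))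
  then obtain us vs where ys: "ys = us @ x # vs" by (meson split_list)
  have "count_list xs = count_list (us @ vs)"
    using Cons.prems unfolding ys fun_eq_iff by (auto split: if_splits)
  then have "foldr pd xs f = foldr pd (us @ vs) f" by (rule Cons.IH)
  then show ?case using foldr_pd_move[OF assms(1)] by (simp add: ys)
qed

lemma mlen_count_list: "mlen (count_list xs) = length xs"
  unfolding mlen_def by (simp add: sum_count_set)

lemma ex_count_list: "\<exists>xs. count_list xs = (\<sigma> :: 'n::finite midx)"
proof (induction "mlen \<sigma>" arbitrary: \<sigma>)
  case 0
  then have "\<sigma> = count_list []" by (auto simp: mlen_def)
  then show ?case by metis
next
  case (Suc n)
  then obtain i where i: "\<sigma> i > 0" unfolding mlen_def
    by (metis Suc.hyps(2) bot_nat_0.not_eq_extremum mlen_def nat.distinct(1) sum.neutral)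
  let ?\<tau> = "\<sigma>(i := \<sigma> i - 1)"
  have "mlen \<sigma> = \<sigma> i + (\<Sum>j\<in>UNIV-{i}. \<sigma> j)" "mlen ?\<tau> = ?\<tau> i + (\<Sum>j\<in>UNIV-{i}. ?\<tau> j)"
    unfolding mlen_def by (rule sum.remove; simp)+
  moreover have "(\<Sum>j\<in>UNIV-{i}. ?\<tau> j) = (\<Sum>j\<in>UNIV-{i}. \<sigma> j)" by (intro sum.cong) auto
  ultimately have "n = mlen ?\<tau>" using Suc.hyps(2) i by simp
  then obtain xs where "count_list xs = ?\<tau>" using Suc.hyps(1) by blast
  then have "count_list (i # xs) = \<sigma>" using i by (auto simp: fun_eq_iff)
  then show ?case by blast
qed

text \<open>The list chosen inside \<open>mderiv\<close>. Lists turn multi-index calculus into list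
  recursion, with a Leibniz rule free of binomial coefficients.\<close>

definition mlist :: "'n::finite midx \<Rightarrow> 'n list" where
  "mlist \<sigma> = (SOME xs. \<forall>i. count_list xs i = \<sigma> i)"

lemma count_list_mlist: "count_list (mlist \<sigma>) = \<sigma>"
proof -
  have "\<exists>xs. \<forall>i. count_list xs i = \<sigma> i" using ex_count_list[of \<sigma>] by metis
  from someI_ex[OF this] show ?thesis unfolding mlist_def by auto
qed

lemma length_mlist: "length (mlist \<sigma>) = mlen \<sigma>"
  using mlen_count_list[of "mlist \<sigma>"] by (simp add: count_list_mlist)

lemma mderiv_mlist: "mderiv \<sigma> f = foldr pd (mlist \<sigma>) f"
  by (simp add: mderiv_def mlist_def)

lemma mderiv_count_list: "smooth f \<Longrightarrow> mderiv (count_list xs) f = foldr pd xs f"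
  unfolding mderiv_mlist by (rule foldr_pd_cong) (auto simp: count_list_mlist)

lemma mlen_eq_0_iff: "mlen \<sigma> = 0 \<longleftrightarrow> \<sigma> = (\<lambda>_. 0)"
  by (auto simp: mlen_def)

lemma mderiv_0: "mderiv (\<lambda>_. 0) f = f"
proof -
  have "mlist (\<lambda>_::'a. 0) = []" using length_mlist[of "\<lambda>_::'a. 0"] mlen_eq_0_iff[of "\<lambda>_::'a. 0"] by simp
  then show ?thesis by (simp add: mderiv_mlist)
qed

lemma smooth_mderiv: "smooth f \<Longrightarrow> smooth (mderiv \<sigma> f)"
  unfolding mderiv_mlist by (rule smooth_foldr)

text \<open>Needed because \<open>weak_polyharmonic\<close> puts the derivative of order 2\<sigma>
  on the test function, while the weak formulation of the Dirichlet problem carries \<sigma> on each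
  factor.\<close>

lemma mderiv_double:
  assumes "smooth f"
  shows "mderiv (\<lambda>i. 2 * \<sigma> i) f = mderiv \<sigma> (mderiv \<sigma> f)"
proof -
  have "(\<lambda>i. 2 * \<sigma> i) = count_list (mlist \<sigma> @ mlist \<sigma>)"
    by (simp add: fun_eq_iff count_list_mlist)
  then show ?thesis using mderiv_count_list[OF assms, of "mlist \<sigma> @ mlist \<sigma>"]
    by (simp add: mderiv_mlist)
qed

section \<open>Linearity and the Leibniz rule for iterated partial derivatives\<close>

lemma foldr_pd_add:
  "smooth f \<Longrightarrow> smooth g \<Longrightarrow>
    foldr pd xs (\<lambda>x. f x + g x) = (\<lambda>x. foldr pd xs f x + foldr pd xs g x)"
proof (induction xs)
  case (Cons i xs)
  then show ?case by (auto simp: pd_add smooth_differentiable smooth_foldr)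
qed simp

lemma foldr_pd_cmult:
  "smooth f \<Longrightarrow> foldr pd xs (\<lambda>x. c * f x) = (\<lambda>x. c * foldr pd xs f x)"
proof (induction xs)
  case (Cons i xs)
  then show ?case by (auto simp: pd_mult pd_const smooth_differentiable smooth_foldr)
qed simp

lemma mderiv_add:
  "smooth f \<Longrightarrow> smooth g \<Longrightarrow> mderiv \<sigma> (\<lambda>x. f x + g x) = (\<lambda>x. mderiv \<sigma> f x + mderiv \<sigma> g x)"
  unfolding mderiv_mlist by (rule foldr_pd_add)

lemma mderiv_cmult: "smooth f \<Longrightarrow> mderiv \<sigma> (\<lambda>x. c * f x) = (\<lambda>x. c * mderiv \<sigma> f x)"
  unfolding mderiv_mlist by (rule foldr_pd_cmult)

text \<open>All ways to distribute the derivatives in a list over the two factors of a product; the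
  first entry is the split that leaves the first factor undifferentiated.\<close>

fun splits :: "'a list \<Rightarrow> ('a list \<times> 'a list) list" where
  "splits [] = [([], [])]"
| "splits (x # xs) = map (\<lambda>(ys, zs). (ys, x # zs)) (splits xs) @ map (\<lambda>(ys, zs). (x # ys, zs)) (splits xs)"

lemma length_splits: "length (splits xs) = 2 ^ length xs"
  by (induction xs) auto

lemma splits_length: "(ys, zs) \<in> set (splits xs) \<Longrightarrow> length ys + length zs = length xs"
  by (induction xs arbitrary: ys zs) auto

lemma splits_Cons: "splits xs = ([], xs) # tl (splits xs)"
proof (induction xs)
  case (Cons x xs)
  have "map (\<lambda>(ys, zs). (ys, x # zs)) (splits xs) = ([], x # xs) # map (\<lambda>(ys, zs). (ys, x # zs)) (tl (splits xs))"
    by (subst Cons.IH) simp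
  then show ?case by simp
qed simp

lemma tl_splits_nonempty: "(ys, zs) \<in> set (tl (splits xs)) \<Longrightarrow> ys \<noteq> []"
proof (induction xs arbitrary: ys zs)
  case (Cons x xs)
  have "map (\<lambda>(ys, zs). (ys, x # zs)) (splits xs) = ([], x # xs) # map (\<lambda>(ys, zs). (ys, x # zs)) (tl (splits xs))"
    by (subst splits_Cons) simp
  then show ?case using Cons by auto
qed simp

text \<open>Repeated terms stand in place of binomial coefficients, so a list of length n has
  exactly 2^n terms. This count is the source of the factors 2^p and 2^k in the constants.\<close>

lemma foldr_pd_mult:
  assumes "smooth f" "smooth g"
  shows "foldr pd xs (\<lambda>x. f x * g x) =
    (\<lambda>x. \<Sum>(ys, zs)\<leftarrow>splits xs. foldr pd ys f x * foldr pd zs g x)"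
proof (induction xs)
  case (Cons i xs)
  have sm: "smooth (\<lambda>x. \<Sum>(ys, zs)\<leftarrow>ps. foldr pd ys f x * foldr pd zs g x)" for ps
    by (induction ps) (auto intro!: smooth_const smooth_add smooth_mult smooth_foldr assms)
  have "pd i (\<lambda>x. \<Sum>(ys, zs)\<leftarrow>ps. foldr pd ys f x * foldr pd zs g x) x
      = (\<Sum>(ys, zs)\<leftarrow>map (\<lambda>(ys, zs). (ys, i # zs)) ps @ map (\<lambda>(ys, zs). (i # ys, zs)) ps.
           foldr pd ys f x * foldr pd zs g x)" for ps x
  proof (induction ps)
    case (Cons p ps)
    obtain ys zs where p: "p = (ys, zs)" by fastforce
    have "pd i (\<lambda>x. foldr pd ys f x * foldr pd zs g x + (\<Sum>(ys, zs)\<leftarrow>ps. foldr pd ys f x * foldr pd zs g x)) x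
       = foldr pd ys f x * pd i (foldr pd zs g) x + pd i (foldr pd ys f) x * foldr pd zs g x
         + pd i (\<lambda>x. \<Sum>(ys, zs)\<leftarrow>ps. foldr pd ys f x * foldr pd zs g x) x"
      by (subst pd_add)
        (auto intro!: smooth_differentiable sm smooth_mult smooth_foldr assms pd_mult)
    then show ?case using Cons by (simp add: p)
  qed (simp add: pd_const)
  then show ?case using Cons by auto
qed simp

section \<open>Test functions\<close>

lemma test_smooth: "f \<in> test_functions \<Omega> \<Longrightarrow> smooth f"
  by (simp add: test_functions_def smooth_def)

lemma test_mono: "\<Omega> \<subseteq> \<Omega>' \<Longrightarrow> f \<in> test_functions \<Omega> \<Longrightarrow> f \<in> test_functions \<Omega>'"
  by (auto simp: test_functions_def)

lemma test_functionsI: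
  assumes "smooth f" "compact K" "K \<subseteq> \<Omega>" "\<And>x. x \<notin> K \<Longrightarrow> f x = 0"
  shows "f \<in> test_functions \<Omega>"
proof -
  have "closure {x. f x \<noteq> 0} \<subseteq> K" using assms by (intro closure_minimal) (auto intro: compact_imp_closed)
  moreover from this have "compact (closure {x. f x \<noteq> 0})"
    using compact_Int_closed[OF assms(2) closed_closure] by (metis Int_absorb1)
  ultimately show ?thesis using assms unfolding test_functions_def smooth_def by auto
qed

lemma test_functionsE:
  assumes "f \<in> test_functions \<Omega>"
  obtains K where "compact K" "K \<subseteq> \<Omega>" "\<And>x. x \<notin> K \<Longrightarrow> f x = 0"
proof
  show "compact (closure {x. f x \<noteq> 0})" "closure {x. f x \<noteq> 0} \<subseteq> \<Omega>"
    using assms by (auto simp: test_functions_def)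
  show "f x = 0" if "x \<notin> closure {x. f x \<noteq> 0}" for x
    using that closure_subset[of "{x. f x \<noteq> 0}"] by blast
qed

lemma test_mult:
  assumes "smooth g" "f \<in> test_functions \<Omega>"
  shows "(\<lambda>x. g x * f x) \<in> test_functions \<Omega>"
proof -
  obtain K where "compact K" "K \<subseteq> \<Omega>" "\<And>x. x \<notin> K \<Longrightarrow> f x = 0"
    using test_functionsE[OF assms(2)] by blast
  then show ?thesis
    using assms by (intro test_functionsI[of _ K] smooth_mult) (auto intro: test_smooth)
qed

lemma test_cmult: "f \<in> test_functions \<Omega> \<Longrightarrow> (\<lambda>x. c * f x) \<in> test_functions \<Omega>"
  by (intro test_mult smooth_const)

lemma test_add:
  assumes "f \<in> test_functions \<Omega>" "g \<in> test_functions \<Omega>"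
  shows "(\<lambda>x. f x + g x) \<in> test_functions \<Omega>"
proof -
  obtain K where K: "compact K" "K \<subseteq> \<Omega>" "\<And>x. x \<notin> K \<Longrightarrow> f x = 0"
    using test_functionsE[OF assms(1)] by blast
  obtain L where L: "compact L" "L \<subseteq> \<Omega>" "\<And>x. x \<notin> L \<Longrightarrow> g x = 0"
    using test_functionsE[OF assms(2)] by blast
  show ?thesis
    using assms K L by (intro test_functionsI[of _ "K \<union> L"] smooth_add) (auto dest: test_smooth)
qed

lemma test_pd:
  assumes "f \<in> test_functions \<Omega>"
  shows "pd i f \<in> test_functions \<Omega>"
proof -
  obtain K where K: "compact K" "K \<subseteq> \<Omega>" "\<And>x. x \<notin> K \<Longrightarrow> f x = 0"
    using test_functionsE[OF assms] by blast
  show ?thesis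
  proof (rule test_functionsI[OF _ K(1,2)])
    fix x assume x: "x \<notin> K"
    have "((\<lambda>_. 0) has_derivative (\<lambda>_. 0)) (at x)" by simp
    then have "(f has_derivative (\<lambda>_. 0)) (at x)"
      by (rule has_derivative_transform_within_open[of _ _ _ "UNIV" "- K"])
        (use x K in \<open>auto simp: compact_imp_closed\<close>)
    then show "pd i f x = 0" by (simp add: pd_eq)
  qed (use assms in \<open>auto intro: smooth_pd test_smooth\<close>)
qed

lemma test_foldr: "f \<in> test_functions \<Omega> \<Longrightarrow> foldr pd xs f \<in> test_functions \<Omega>"
  by (induction xs) (auto intro: test_pd)

lemma test_mderiv: "f \<in> test_functions \<Omega> \<Longrightarrow> mderiv \<sigma> f \<in> test_functions \<Omega>"
  unfolding mderiv_mlist by (rule test_foldr)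

lemma test_bounded:
  assumes "f \<in> test_functions \<Omega>"
  obtains B where "B > 0" "\<And>x. \<bar>f x\<bar> \<le> B"
proof -
  obtain K where K: "compact K" "K \<subseteq> \<Omega>" "\<And>x. x \<notin> K \<Longrightarrow> f x = 0"
    using test_functionsE[OF assms] by blast
  have "compact (f ` K)"
    using K(1) smooth_continuous[OF test_smooth[OF assms]]
    by (intro compact_continuous_image) (auto intro: continuous_on_subset)
  then obtain B where B: "B > 0" "\<forall>x\<in>f ` K. norm x \<le> B"
    using bounded_pos compact_imp_bounded by metis
  have "\<bar>f x\<bar> \<le> B" for x using B K(3)[of x] by (cases "x \<in> K") auto
  with B that show thesis by blast
qed

section \<open>Integrability of test functions and integration by parts\<close>

lemma smooth_measurable: "smooth f \<Longrightarrow> f \<in> borel_measurable borel"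
  by (intro borel_measurable_continuous_onI smooth_continuous)

lemma test_integrable_lborel:
  assumes "f \<in> test_functions \<Omega>"
  shows "integrable lborel f"
proof -
  obtain K where K: "compact K" "K \<subseteq> \<Omega>" "\<And>x. x \<notin> K \<Longrightarrow> f x = 0"
    using test_functionsE[OF assms] by blast
  have "set_integrable lborel K f"
    unfolding set_integrable_def
    using K(1) smooth_continuous[OF test_smooth[OF assms]]
    by (intro borel_integrable_compact) (auto intro: continuous_on_subset)
  moreover have "(\<lambda>x. indicat_real K x *\<^sub>R f x) = f" using K(3) by (fastforce simp: indicator_def)
  ultimately show ?thesis unfolding set_integrable_def by metis
qed

lemma test_integrable: "f \<in> test_functions \<Omega> \<Longrightarrow> integrable lebesgue f"
  using test_integrable_lborel[of f \<Omega>] integrable_completion[of f lborel] smooth_measurable[OF test_smooth[of f \<Omega>]]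
  by simp

text \<open>Translation invariance of Lebesgue measure makes every difference quotient integrate to
  zero, and dominated convergence passes this on to the derivative.\<close>

lemma integral_pd_test:
  assumes f: "f \<in> test_functions \<Omega>"
  shows "(LINT x|lborel. pd i f x) = 0"
proof -
  obtain K where K: "compact K" "K \<subseteq> \<Omega>" "\<And>x. x \<notin> K \<Longrightarrow> f x = 0"
    using test_functionsE[OF f] by blast
  obtain R where R: "K \<subseteq> cball 0 R"
    using bounded_subset_ballD[OF compact_imp_bounded[OF K(1)], of 0] ball_subset_cball by blast
  obtain B where B: "B > 0" "\<And>x. \<bar>pd i f x\<bar> \<le> B"
    using test_bounded[OF test_pd[OF f]] by blast
  define s where "s n x = real (Suc n) * (f (x + (1 / real (Suc n)) *\<^sub>R axis i 1) - f x)" for n x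
  have fi: "integrable lborel f" by (rule test_integrable_lborel[OF f])
  have sh: "integrable lborel (\<lambda>x. f (x + c))" "(LINT x|lborel. f (x + c)) = (LINT x|lborel. f x)" for c
  proof -
    have "distr lborel borel ((+) c) = (lborel :: (real^'a) measure)" by (rule lborel_distr_plus)
    moreover have m: "f \<in> borel_measurable borel" by (rule smooth_measurable[OF test_smooth[OF f]])
    ultimately show "integrable lborel (\<lambda>x. f (x + c))" "(LINT x|lborel. f (x + c)) = (LINT x|lborel. f x)"
      using integrable_distr_eq[of "(+) c" lborel borel f] integral_distr[of "(+) c" lborel borel f] fi
      by (auto simp: add.commute)
  qed
  have s0: "(LINT x|lborel. s n x) = 0" for n
    unfolding s_def using sh fi by simp
  \<comment> \<open>The majorant: by the mean value theorem the quotients are bounded by B, and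
    since their steps are at most 1 they vanish outside the ball of radius R + 1.\<close>
  have "(\<lambda>n. LINT x|lborel. s n x) \<longlonglongrightarrow> (LINT x|lborel. pd i f x)"
  proof (rule integral_dominated_convergence[where w = "\<lambda>x. B * indicator (cball 0 (R + 1)) x"])
    show "integrable lborel (\<lambda>x. B * indicat_real (cball 0 (R + 1)) x)"
      by (intro integrable_mult_right integrable_real_indicator) (auto intro: emeasure_bounded_finite[unfolded infinity_ennreal_def])
    show "AE x in lborel. (\<lambda>n. s n x) \<longlonglongrightarrow> pd i f x"
    proof (rule AE_I2)
      fix x
      have "((\<lambda>t. f (x + t *\<^sub>R axis i 1)) has_real_derivative pd i f (x + 0 *\<^sub>R axis i 1)) (at 0)"
        by (intro has_derivative_line smooth_differentiable test_smooth[OF f])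
      then have "((\<lambda>h. (f (x + h *\<^sub>R axis i 1) - f x) / h) \<longlongrightarrow> pd i f x) (at 0)"
        unfolding DERIV_def by simp
      moreover have "filterlim (\<lambda>n. 1 / real (Suc n)) (at 0) sequentially"
        unfolding filterlim_at using LIMSEQ_inverse_real_of_nat by (auto simp: inverse_eq_divide)
      ultimately have "(\<lambda>n. (f (x + (1 / real (Suc n)) *\<^sub>R axis i 1) - f x) / (1 / real (Suc n))) \<longlonglongrightarrow> pd i f x"
        by (rule filterlim_compose)
      then show "(\<lambda>n. s n x) \<longlonglongrightarrow> pd i f x" unfolding s_def by (simp add: mult.commute)
    qed
    show "AE x in lborel. norm (s n x) \<le> B * indicator (cball 0 (R + 1)) x" for n
    proof (rule AE_I2)
      fix x
      let ?h = "1 / real (Suc n)"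
      have h: "?h > 0" "?h \<le> 1" by auto
      have "((\<lambda>t. f (x + t *\<^sub>R axis i 1)) has_real_derivative pd i f (x + t *\<^sub>R axis i 1)) (at t)" for t
        by (intro has_derivative_line smooth_differentiable test_smooth[OF f])
      from MVT2[OF h(1) this] obtain z where
        "f (x + ?h *\<^sub>R axis i 1) - f x = ?h * pd i f (x + z *\<^sub>R axis i 1)" by auto
      then have "s n x = pd i f (x + z *\<^sub>R axis i 1)" unfolding s_def by (simp add: field_simps)
      then have b: "norm (s n x) \<le> B" using B by simp
      show "norm (s n x) \<le> B * indicator (cball 0 (R + 1)) x"
      proof (cases "x \<in> cball 0 (R + 1)")
        case False
        have "norm x \<le> norm (x + ?h *\<^sub>R axis i 1) + norm (?h *\<^sub>R axis i 1 :: real^'a)"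
          using norm_triangle_ineq4[of "x + ?h *\<^sub>R axis i 1" "?h *\<^sub>R axis i 1"] by simp
        moreover have "norm (?h *\<^sub>R axis i 1 :: real^'a) \<le> 1" using h by simp
        ultimately have "norm x \<le> norm (x + ?h *\<^sub>R axis i 1) + 1" by linarith
      then have "norm x > R" "norm (x + ?h *\<^sub>R axis i 1) > R" using False by auto
      then have "x \<notin> K" "x + ?h *\<^sub>R axis i 1 \<notin> K" using R by fastforce+
        then have "s n x = 0" unfolding s_def using K(3) by simp
        then show ?thesis using B by simp
      qed (use b in simp)
    qed
  next
    have [measurable]: "f \<in> borel_measurable borel" by (rule smooth_measurable[OF test_smooth[OF f]])
    show "s n \<in> borel_measurable lborel" for n unfolding s_def by measurable
    show "pd i f \<in> borel_measurable lborel"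
      using smooth_measurable[OF test_smooth[OF test_pd[OF f]]] by simp
  qed
  then show ?thesis unfolding s0 using LIMSEQ_unique tendsto_const by metis
qed

lemma integral_by_parts_pd:
  assumes f: "f \<in> test_functions \<Omega>" and g: "smooth g"
  shows "(LINT x|lborel. g x * pd i f x) = - (LINT x|lborel. pd i g x * f x)"
proof -
  have "0 = (LINT x|lborel. pd i (\<lambda>x. g x * f x) x)"
    using integral_pd_test[OF test_mult[OF g f]] by simp
  also have "\<dots> = (LINT x|lborel. g x * pd i f x + pd i g x * f x)"
    using f g by (simp add: pd_mult smooth_differentiable test_smooth)
  also have "\<dots> = (LINT x|lborel. g x * pd i f x) + (LINT x|lborel. pd i g x * f x)"
    using f g by (intro Bochner_Integration.integral_add test_integrable_lborel[of _ \<Omega>] test_mult smooth_pd test_pd)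
  finally show ?thesis by simp
qed

text \<open>The derivatives are peeled off from the outside and reach g in the opposite order, hence
  \<open>rev\<close>.\<close>

lemma integral_by_parts_foldr:
  assumes f: "f \<in> test_functions \<Omega>" and g: "smooth g"
  shows "(LINT x|lborel. g x * foldr pd xs f x) = (-1) ^ length xs * (LINT x|lborel. foldr pd (rev xs) g x * f x)"
  using g
proof (induction xs arbitrary: g)
  case (Cons i xs)
  have "(LINT x|lborel. g x * pd i (foldr pd xs f) x) = - (LINT x|lborel. pd i g x * foldr pd xs f x)"
    by (rule integral_by_parts_pd[OF test_foldr[OF f] Cons.prems])
  also have "\<dots> = - ((-1) ^ length xs * (LINT x|lborel. foldr pd (rev xs) (pd i g) x * f x))"
    using Cons.IH[OF smooth_pd[OF Cons.prems]] by simp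
  finally show ?case by simp
qed simp

lemma lebesgue_eq_lborel_integral:
  fixes f :: "'a::euclidean_space \<Rightarrow> real"
  assumes "f \<in> borel_measurable borel"
  shows "(LINT x|lebesgue. f x) = (LINT x|lborel. f x)"
  using assms by (intro integral_completion) auto

lemma set_integral_test:
  assumes f: "f \<in> test_functions \<Omega>"
  shows "(LINT x:\<Omega>|lebesgue. g x * f x) = (LINT x|lebesgue. g x * f x)"
proof -
  obtain K where K: "compact K" "K \<subseteq> \<Omega>" "\<And>x. x \<notin> K \<Longrightarrow> f x = 0"
    using test_functionsE[OF f] by blast
  have "(\<lambda>x. indicat_real \<Omega> x *\<^sub>R (g x * f x)) = (\<lambda>x. g x * f x)"
    using K(2,3) by (fastforce simp: indicator_def)
  then show ?thesis unfolding set_lebesgue_integral_def by metis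
qed

lemma integral_by_parts:
  assumes f: "f \<in> test_functions \<Omega>" and g: "smooth g"
  shows "(LINT x:\<Omega>|lebesgue. g x * mderiv \<sigma> f x) = (-1) ^ mlen \<sigma> * (LINT x:\<Omega>|lebesgue. mderiv \<sigma> g x * f x)"
proof -
  \<comment> \<open>The reversed list has the same multiplicities, so for a smooth g it gives the
    same derivative.\<close>
  have c: "mderiv \<sigma> g = foldr pd (rev (mlist \<sigma>)) g"
    unfolding mderiv_mlist by (rule foldr_pd_cong[OF g]) (auto simp: fun_eq_iff)
  have "(LINT x:\<Omega>|lebesgue. g x * mderiv \<sigma> f x) = (LINT x|lborel. g x * mderiv \<sigma> f x)"
    unfolding set_integral_test[OF test_mderiv[OF f]]
    by (intro lebesgue_eq_lborel_integral smooth_measurable smooth_mult g smooth_mderiv test_smooth[OF f])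
  also have "\<dots> = (-1) ^ mlen \<sigma> * (LINT x|lborel. mderiv \<sigma> g x * f x)"
    unfolding c unfolding mderiv_mlist
    using integral_by_parts_foldr[OF f g, of "mlist \<sigma>"] by (simp add: length_mlist)
  also have "(LINT x|lborel. mderiv \<sigma> g x * f x) = (LINT x:\<Omega>|lebesgue. mderiv \<sigma> g x * f x)"
    unfolding set_integral_test[OF f]
    by (intro lebesgue_eq_lborel_integral[symmetric] smooth_measurable smooth_mult g smooth_mderiv test_smooth[OF f])
  finally show ?thesis .
qed

section \<open>Cutoff functions\<close>

text \<open>Boundedness is built into every order so that the class is closed under products and,
  away from zero, under reciprocals, and so that an affine substitution changes the bounds by exact
  powers of its slope.\<close>

fun sm :: "nat \<Rightarrow> (real \<Rightarrow> real) \<Rightarrow> bool" where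
  "sm 0 f \<longleftrightarrow> continuous_on UNIV f \<and> bounded (range f)"
| "sm (Suc p) f \<longleftrightarrow> bounded (range f) \<and> (\<exists>f'. (\<forall>x. (f has_real_derivative f' x) (at x)) \<and> sm p f')"

lemma bounded_range_real: "bounded (range f) \<longleftrightarrow> (\<exists>B. \<forall>x. \<bar>f x\<bar> \<le> (B::real))"
  unfolding bounded_iff by auto

lemma sm_bounded: "sm p f \<Longrightarrow> bounded (range f)"
  by (cases p) auto

lemma sm_SucD: "sm (Suc p) f \<Longrightarrow> sm p f"
proof (induction p arbitrary: f)
  case 0
  then show ?case using DERIV_isCont continuous_at_imp_continuous_on by (metis sm.simps)
next
  case (Suc p)
  then show ?case by (metis sm.simps(2))
qed

lemma bounded_range_add: "bounded (range f) \<Longrightarrow> bounded (range g) \<Longrightarrow> bounded (range (\<lambda>x. f x + g x :: real))"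
  by (rule bounded_plus_comp)

lemma bounded_range_mult:
  assumes "bounded (range f)" "bounded (range g)" shows "bounded (range (\<lambda>x. f x * g x :: real))"
proof -
  obtain B C where "\<And>x. \<bar>f x\<bar> \<le> B" "\<And>x. \<bar>g x\<bar> \<le> C"
    using assms unfolding bounded_range_real by metis
  then have "\<bar>f x * g x\<bar> \<le> B * C" for x
    unfolding abs_mult by (meson abs_ge_zero mult_mono order_trans)
  then show ?thesis unfolding bounded_range_real by blast
qed

lemma sm_const: "sm p (\<lambda>x. c)"
proof (induction p arbitrary: c)
  case (Suc p)
  have "\<forall>x. ((\<lambda>x. c) has_real_derivative (\<lambda>x. 0) x) (at x)" by auto
  then show ?case using Suc[of 0] unfolding sm.simps by (metis bounded_range_real order_refl)
qed (auto simp: bounded_range_real)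

lemma sm_add: "sm p f \<Longrightarrow> sm p g \<Longrightarrow> sm p (\<lambda>x. f x + g x)"
proof (induction p arbitrary: f g)
  case 0
  then show ?case by (auto intro: continuous_intros bounded_range_add)
next
  case (Suc p)
  from Suc.prems obtain f' g' where f: "\<And>x. (f has_real_derivative f' x) (at x)" "sm p f'"
    and g: "\<And>x. (g has_real_derivative g' x) (at x)" "sm p g'" by auto
  have "\<forall>x. ((\<lambda>x. f x + g x) has_real_derivative (f' x + g' x)) (at x)"
    by (auto intro: DERIV_add f g)
  moreover have "sm p (\<lambda>x. f' x + g' x)" by (intro Suc.IH f g)
  ultimately show ?case using Suc.prems bounded_range_add by auto
qed

lemma sm_mult: "sm p f \<Longrightarrow> sm p g \<Longrightarrow> sm p (\<lambda>x. f x * g x)"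
proof (induction p arbitrary: f g)
  case 0
  then show ?case by (auto intro: continuous_intros bounded_range_mult)
next
  case (Suc p)
  from Suc.prems obtain f' g' where f: "\<And>x. (f has_real_derivative f' x) (at x)" "sm p f'"
    and g: "\<And>x. (g has_real_derivative g' x) (at x)" "sm p g'" by auto
  have "\<forall>x. ((\<lambda>x. f x * g x) has_real_derivative (f' x * g x + g' x * f x)) (at x)"
    by (auto intro: DERIV_mult f g)
  moreover have "sm p (\<lambda>x. f' x * g x + g' x * f x)"
    by (intro Suc.IH f g sm_add sm_SucD[OF Suc.prems(1)] sm_SucD[OF Suc.prems(2)])
  ultimately show ?case using Suc.prems bounded_range_mult by auto
qed

text \<open>The derivative of 1/g is -g' (1/g)^2, whose factors belong to the class one order lower;
  the lower bound c keeps 1/g bounded.\<close>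

lemma sm_inverse:
  assumes "\<And>x. g x \<ge> c" "c > 0"
  shows "sm p g \<Longrightarrow> sm p (\<lambda>x. inverse (g x))"
proof (induction p)
  have ge: "g x \<noteq> 0" "g x > 0" for x using assms(1)[of x] assms(2) by auto
  have b: "bounded (range (\<lambda>x. inverse (g x)))" unfolding bounded_range_real
  proof (intro exI allI)
    fix x show "\<bar>inverse (g x)\<bar> \<le> inverse c" using assms(1)[of x] assms(2) ge(2)[of x] by (simp add: le_imp_inverse_le)
  qed
  {
    case 0
    then show ?case using b ge by (auto intro: continuous_on_inverse)
  next
    case (Suc p)
    then obtain g' where g: "\<And>x. (g has_real_derivative g' x) (at x)" "sm p g'" by auto
    have "\<forall>x. ((\<lambda>x. inverse (g x)) has_real_derivative ((-1) * (g' x * (inverse (g x) * inverse (g x))))) (at x)"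
      using ge by (auto intro!: derivative_eq_intros g simp: power2_eq_square field_simps)
    moreover have "sm p (\<lambda>x. (-1) * (g' x * (inverse (g x) * inverse (g x))))"
      by (intro sm_mult sm_const g Suc.IH sm_SucD[OF Suc.prems])
    ultimately show ?case using b by auto
  }
qed

lemma sm_reflect: "sm p g \<Longrightarrow> sm p (\<lambda>x. g (1 - x))"
proof (induction p arbitrary: g)
  case 0
  then have "continuous_on UNIV (\<lambda>x. g (1 - x))"
    by (auto intro!: continuous_on_compose2[of UNIV g] continuous_intros)
  then show ?case using 0 by (auto simp: bounded_range_real)
next
  case (Suc p)
  then obtain g' where g: "\<And>x. (g has_real_derivative g' x) (at x)" "sm p g'" by auto
  have "\<forall>x. ((\<lambda>x. g (1 - x)) has_real_derivative ((-1) * g' (1 - x))) (at x)"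
  proof
    fix x
    show "((\<lambda>x. g (1 - x)) has_real_derivative ((-1) * g' (1 - x))) (at x)"
    proof -
      have "((\<lambda>x. 1 - x) has_real_derivative -1) (at x)" by (auto intro!: derivative_eq_intros)
      from DERIV_chain2[OF g(1) this] show ?thesis by simp
    qed
  qed
  moreover have "sm p (\<lambda>x. (-1) * g' (1 - x))"
    by (intro sm_mult sm_const Suc.IH g)
  ultimately show ?case using Suc.prems by (auto simp: bounded_range_real)
qed

text \<open>The power of 1/t makes the family closed under differentiation up to linear
  combinations, so one induction on the order treats all n at once. For n = 0 it is the classical
  function that is flat at 0.\<close>

definition flat :: "nat \<Rightarrow> real \<Rightarrow> real" where
  "flat n t = (if t \<le> 0 then 0 else (1 / t) ^ n * exp (- 1 / t))"

text \<open>From (1 + y/n)^n <= exp y with y = 1/t one gets y^n <= n^n exp y. For n = 0 the bound is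
  1 by the convention 0^0 = 1.\<close>

lemma flat_bounds: "0 \<le> flat n t" "flat n t \<le> real n ^ n"
proof -
  show "0 \<le> flat n t" by (simp add: flat_def)
  show "flat n t \<le> real n ^ n"
  proof (cases "t > 0 \<and> n > 0")
    case True
    let ?y = "1 / t"
    have "(?y / n) ^ n \<le> (1 + ?y / n) ^ n" using True by (intro power_mono) auto
    also have "\<dots> \<le> exp ?y" using True by (intro exp_ge_one_plus_x_over_n_power_n) (auto intro: order_trans[of _ 0])
    finally have "(?y / n) ^ n * real n ^ n \<le> exp ?y * real n ^ n" by (rule mult_right_mono) simp
    moreover have "(?y / n) ^ n * real n ^ n = ?y ^ n" using True by (simp add: power_mult_distrib[symmetric])
    ultimately have "?y ^ n \<le> real n ^ n * exp ?y" by (simp add: mult.commute)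
    then have "?y ^ n * exp (- ?y) \<le> real n ^ n * exp ?y * exp (- ?y)" by (intro mult_right_mono) auto
    also have "\<dots> = real n ^ n" by (simp add: exp_minus)
    finally show ?thesis using True by (simp add: flat_def)
  next
    case False
    then show ?thesis by (auto simp: flat_def)
  qed
qed

lemma flat_deriv: "(flat n has_real_derivative (flat (n + 2) t - real n * flat (n + 1) t)) (at t)"
proof -
  consider "t < 0" | "t = 0" | "t > 0" by linarith
  then show ?thesis
  proof cases
    case 1
    have "((\<lambda>_. 0) has_real_derivative 0) (at t)" by simp
    then have "(flat n has_real_derivative 0) (at t)"
      by (rule has_field_derivative_transform_within_open[of _ _ _ "{..<0}"]) (use 1 in \<open>auto simp: flat_def\<close>)
    then show ?thesis using 1 by (simp add: flat_def)
  next
    case 3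
    have a: "((\<lambda>t. 1 / t) has_real_derivative (- 1 / t\<^sup>2)) (at t)"
      using 3 by (auto intro!: derivative_eq_intros simp: power2_eq_square)
    have b: "((\<lambda>t. (1 / t) ^ n) has_real_derivative real n * (1 / t) ^ (n - 1) * (- 1 / t\<^sup>2)) (at t)"
      using DERIV_power[OF a, of n] by (simp add: mult_ac)
    have c: "((\<lambda>t. exp (- 1 / t)) has_real_derivative exp (- 1 / t) * (1 / t\<^sup>2)) (at t)"
      using 3 by (auto intro!: derivative_eq_intros simp: power2_eq_square)
    have "((\<lambda>t. (1 / t) ^ n * exp (- 1 / t)) has_real_derivative
        (1 / t) ^ n * (exp (- 1 / t) * (1 / t\<^sup>2)) + (real n * (1 / t) ^ (n - 1) * (- 1 / t\<^sup>2)) * exp (- 1 / t)) (at t)"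
      using DERIV_mult[OF b c] by (simp add: mult_ac add_ac)
    moreover have "(1 / t) ^ n * (exp (- 1 / t) * (1 / t\<^sup>2)) + (real n * (1 / t) ^ (n - 1) * (- 1 / t\<^sup>2)) * exp (- 1 / t)
       = flat (n + 2) t - real n * flat (n + 1) t"
      using 3 by (cases n) (auto simp: flat_def power2_eq_square field_simps)
    ultimately have "((\<lambda>t. (1 / t) ^ n * exp (- 1 / t)) has_real_derivative
        flat (n + 2) t - real n * flat (n + 1) t) (at t)" by metis
    then show ?thesis
      by (rule has_field_derivative_transform_within_open[of _ _ _ "{0<..}"]) (use 3 in \<open>auto simp: flat_def\<close>)
  next
    case 2
    \<comment> \<open>For h > 0 the quotient equals h times \<open>flat (n + 2) h\<close>, so the
      uniform bound for n + 2 makes it O(h). This gives the derivative 0 at the origin.\<close>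
    have b: "\<bar>(flat n h - flat n 0) / h\<bar> \<le> real (n + 2) ^ (n + 2) * \<bar>h\<bar>" for h
    proof (cases "h > 0")
      case False
      then have "(flat n h - flat n 0) / h = 0" by (simp add: flat_def)
      then show ?thesis by (simp only: abs_zero) (intro mult_nonneg_nonneg; simp)
    next
      case True
      then have "\<bar>(flat n h - flat n 0) / h\<bar> = flat (n + 2) h * h"
        by (simp add: flat_def field_simps power2_eq_square)
      then show ?thesis using True flat_bounds(2)[of "n + 2" h] by (simp add: mult_right_mono)
    qed
    have "((\<lambda>h. real (n + 2) ^ (n + 2) * \<bar>h\<bar>) \<longlongrightarrow> real (n + 2) ^ (n + 2) * \<bar>0\<bar>) (at 0)"
      by (intro tendsto_intros)
    then have "((\<lambda>h. real (n + 2) ^ (n + 2) * \<bar>h\<bar>) \<longlongrightarrow> 0) (at 0)" by simp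
    then have "((\<lambda>h. (flat n h - flat n 0) / h) \<longlongrightarrow> 0) (at 0)"
      by (rule Lim_null_comparison[rotated]) (use b in \<open>auto intro: always_eventually\<close>)
    then show ?thesis using 2 by (simp add: DERIV_def flat_def)
  qed
qed

lemma sm_flat: "sm p (flat n)"
proof (induction p arbitrary: n)
  have b: "bounded (range (flat n))" for n
    unfolding bounded_range_real by (metis abs_of_nonneg flat_bounds)
  {
    case 0
    have "continuous_on UNIV (flat n)"
      using DERIV_isCont[OF flat_deriv] continuous_at_imp_continuous_on by blast
    then show ?case using b by simp
  next
    case (Suc p)
    have "sm p (\<lambda>t. flat (n + 2) t + (- real n) * flat (n + 1) t)"
      by (intro sm_add sm_mult sm_const Suc.IH)
    moreover have "\<forall>t. (flat n has_real_derivative (flat (n + 2) t + (- real n) * flat (n + 1) t)) (at t)"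
      using flat_deriv by simp
    ultimately show ?case using b[of n] unfolding sm.simps
      by (intro conjI exI[of _ "\<lambda>t. flat (n + 2) t + (- real n) * flat (n + 1) t"]) auto
  }
qed

definition smooth_step :: "real \<Rightarrow> real" where
  "smooth_step t = flat 0 t * inverse (flat 0 t + flat 0 (1 - t))"

text \<open>One of t and 1 - t is at least 1/2, and from there on the flat function is at least
  exp(-2). The bound is what makes the quotient \<open>smooth_step\<close> smooth.\<close>

lemma step_denom: "flat 0 t + flat 0 (1 - t) \<ge> exp (- 2)"
proof -
  have *: "flat 0 s \<ge> exp (- 2)" if "s \<ge> 1/2" for s
    using that by (auto simp: flat_def field_simps)
  show ?thesis
    using *[of t] *[of "1 - t"] flat_bounds(1)[of 0 t] flat_bounds(1)[of 0 "1 - t"] by (cases "t \<ge> 1/2") auto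
qed

lemma sm_step: "sm p smooth_step"
  unfolding smooth_step_def[abs_def]
  by (intro sm_mult sm_inverse[of "exp (- 2)"] sm_add sm_flat sm_reflect step_denom) auto

lemma step_bounds: "0 \<le> smooth_step t" "smooth_step t \<le> 1"
proof -
  have "flat 0 t + flat 0 (1 - t) > 0" using step_denom[of t] by (meson exp_gt_zero less_le_trans)
  then show "0 \<le> smooth_step t" "smooth_step t \<le> 1"
    using flat_bounds(1)[of 0 t] flat_bounds(1)[of 0 "1 - t"]
    by (auto simp: smooth_step_def field_simps)
qed

lemma step_0: "t \<le> 0 \<Longrightarrow> smooth_step t = 0"
  by (simp add: smooth_step_def flat_def)

lemma step_1: "t \<ge> 1 \<Longrightarrow> smooth_step t = 1"
  by (simp add: smooth_step_def flat_def)

section \<open>Functions of one coordinate, the scaling of their derivatives, and products\<close>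

lemma pd_affine:
  assumes "\<And>t. (g has_real_derivative g' t) (at t)"
  shows "(\<lambda>x::real^'n::finite. g (\<alpha> * x $ i + \<beta>)) differentiable (at x)"
    and "pd j (\<lambda>x::real^'n::finite. g (\<alpha> * x $ i + \<beta>)) x = (if i = j then \<alpha> else 0) * g' (\<alpha> * x $ i + \<beta>)"
proof -
  have 1: "((\<lambda>x::real^'n. \<alpha> * x $ i + \<beta>) has_derivative (\<lambda>v. \<alpha> * v $ i)) (at x)"
    by (auto intro!: derivative_eq_intros bounded_linear_imp_has_derivative)
  have 2: "(g has_derivative (\<lambda>v. g' (\<alpha> * x $ i + \<beta>) * v)) (at (\<alpha> * x $ i + \<beta>))"
    using assms by (simp add: has_field_derivative_def)
  have 3: "((\<lambda>x::real^'n. g (\<alpha> * x $ i + \<beta>)) has_derivative (\<lambda>v. g' (\<alpha> * x $ i + \<beta>) * (\<alpha> * v $ i))) (at x)"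
    using diff_chain_at[OF 1 2] by (simp add: o_def)
  show "(\<lambda>x::real^'n. g (\<alpha> * x $ i + \<beta>)) differentiable (at x)"
    using 3 by (auto simp: differentiable_def)
  show "pd j (\<lambda>x::real^'n. g (\<alpha> * x $ i + \<beta>)) x = (if i = j then \<alpha> else 0) * g' (\<alpha> * x $ i + \<beta>)"
    using pd_eq[OF 3] by (simp add: axis_def)
qed

lemma Ck_affine: "sm p g \<Longrightarrow> Ck p (\<lambda>x::real^'n::finite. g (\<alpha> * x $ i + \<beta>))"
proof (induction p arbitrary: g)
  case 0
  then show ?case by (auto intro!: continuous_on_compose2[of UNIV g] continuous_intros)
next
  case (Suc p)
  then obtain g' where g: "\<And>x. (g has_real_derivative g' x) (at x)" "sm p g'" by auto
  have "pd j (\<lambda>x::real^'n. g (\<alpha> * x $ i + \<beta>)) = (\<lambda>x. (if i = j then \<alpha> else 0) * g' (\<alpha> * x $ i + \<beta>))" for j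
    using pd_affine(2)[of g g'] g(1) by blast
  moreover have "Ck p (\<lambda>x::real^'n. c * g' (\<alpha> * x $ i + \<beta>))" for c
    by (intro Ck_mult Ck_const Suc.IH g)
  moreover have "(\<lambda>x::real^'n. g (\<alpha> * x $ i + \<beta>)) differentiable (at x)" for x
    by (rule pd_affine(1)[OF g(1)])
  ultimately show ?case by simp
qed

text \<open>Each derivative in direction i brings a factor \<alpha>, each other one gives 0. The
  constant does not depend on \<alpha>, \<beta> or i, so it serves transition zones of every width
  1/\<alpha>.\<close>

lemma foldr_pd_affine_bound:
  assumes "\<forall>p. sm p g"
  shows "\<exists>C\<ge>0. \<forall>xs \<alpha> \<beta> i (x::real^'n::finite). length xs = p \<longrightarrow>
      \<bar>foldr pd xs (\<lambda>x. g (\<alpha> * x $ i + \<beta>)) x\<bar> \<le> C * \<bar>\<alpha>\<bar> ^ p"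
  using assms
proof (induction p arbitrary: g)
  case 0
  then have "bounded (range g)" using sm_bounded by blast
  then obtain B where "\<And>x. \<bar>g x\<bar> \<le> B" unfolding bounded_range_real by blast
  then have "\<bar>g x\<bar> \<le> \<bar>B\<bar>" for x by (meson abs_ge_self order_trans)
  then show ?case by (intro exI[of _ "\<bar>B\<bar>"]) auto
next
  case (Suc p)
  then obtain g' where g: "\<And>x. (g has_real_derivative g' x) (at x)" by (metis sm.simps(2))
  have g': "\<forall>p. sm p g'"
  proof
    fix p
    obtain g2 where "\<And>x. (g has_real_derivative g2 x) (at x)" "sm p g2"
      using Suc.prems by (metis sm.simps(2))
    moreover from this have "g2 = g'" using g DERIV_unique by blast
    ultimately show "sm p g'" by simp
  qed
  from Suc.IH[OF g'] obtain C where C: "C \<ge> 0" and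
    bd: "\<And>xs \<alpha> \<beta> i (x::real^'n). length xs = p \<Longrightarrow> \<bar>foldr pd xs (\<lambda>x. g' (\<alpha> * x $ i + \<beta>)) x\<bar> \<le> C * \<bar>\<alpha>\<bar> ^ p"
    by blast
  show ?case
  proof (intro exI[of _ C] conjI C allI impI)
    fix xs :: "'n list" and \<alpha> \<beta> i and x :: "real^'n" assume "length xs = Suc p"
    \<comment> \<open>\<open>foldr\<close> applies the last entry of the list first, so that is the
      derivative to be evaluated.\<close>
    then obtain ys j where xs: "xs = ys @ [j]" and l: "length ys = p"
      by (metis length_append_singleton nat.inject rev_exhaust length_0_conv nat.distinct(1))
    have sm': "smooth (\<lambda>x::real^'n. g' (\<alpha> * x $ i + \<beta>))" using g' by (simp add: smooth_def Ck_affine)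
    have "foldr pd xs (\<lambda>x. g (\<alpha> * x $ i + \<beta>)) = foldr pd ys (pd j (\<lambda>x. g (\<alpha> * x $ i + \<beta>)))"
      by (simp add: xs)
    also have "pd j (\<lambda>x::real^'n. g (\<alpha> * x $ i + \<beta>)) = (\<lambda>x. (if i = j then \<alpha> else 0) * g' (\<alpha> * x $ i + \<beta>))"
      using pd_affine(2)[of g g'] g by blast
    finally have "foldr pd xs (\<lambda>x. g (\<alpha> * x $ i + \<beta>)) x =
       (if i = j then \<alpha> else 0) * foldr pd ys (\<lambda>x. g' (\<alpha> * x $ i + \<beta>)) x"
      by (simp add: foldr_pd_cmult[OF sm'])
    then have "\<bar>foldr pd xs (\<lambda>x. g (\<alpha> * x $ i + \<beta>)) x\<bar> \<le> \<bar>\<alpha>\<bar> * \<bar>foldr pd ys (\<lambda>x. g' (\<alpha> * x $ i + \<beta>)) x\<bar>"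
      by (auto simp: abs_mult)
    also have "\<dots> \<le> \<bar>\<alpha>\<bar> * (C * \<bar>\<alpha>\<bar> ^ p)" by (intro mult_left_mono bd l) auto
    finally show "\<bar>foldr pd xs (\<lambda>x. g (\<alpha> * x $ i + \<beta>)) x\<bar> \<le> C * \<bar>\<alpha>\<bar> ^ Suc p" by (simp add: mult_ac)
  qed
qed

text \<open>The parameter \<alpha> is an inverse length: a derivative of order q costs \<alpha>^q,
  with the same constant for all orders up to p.\<close>

definition deriv_bound :: "nat \<Rightarrow> real \<Rightarrow> real \<Rightarrow> (real^'n::finite \<Rightarrow> real) \<Rightarrow> bool" where
  "deriv_bound p C \<alpha> f \<longleftrightarrow> smooth f \<and>
     (\<forall>xs x. length xs \<le> p \<longrightarrow> \<bar>foldr pd xs f x\<bar> \<le> C * \<alpha> ^ length xs)"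

lemma abs_sum_list_le:
  assumes "\<And>p. p \<in> set ps \<Longrightarrow> \<bar>F p\<bar> \<le> (K::real)"
  shows "\<bar>\<Sum>p\<leftarrow>ps. F p\<bar> \<le> real (length ps) * K"
  using assms
proof (induction ps)
  case (Cons q ps)
  have "\<bar>F q + (\<Sum>p\<leftarrow>ps. F p)\<bar> \<le> \<bar>F q\<bar> + \<bar>\<Sum>p\<leftarrow>ps. F p\<bar>" by (rule abs_triangle_ineq)
  also have "\<dots> \<le> K + real (length ps) * K" using Cons by (intro add_mono) auto
  finally show ?case by (simp add: algebra_simps)
qed simp

text \<open>Each of the at most 2^p Leibniz terms carries the same total power of \<alpha>.\<close>

lemma deriv_bound_mult:
  fixes f g :: "real^'n::finite \<Rightarrow> real"
  assumes f: "deriv_bound p C \<alpha> f" and g: "deriv_bound p C' \<alpha> g" and nn: "C \<ge> 0" "C' \<ge> 0" "\<alpha> \<ge> 0"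
  shows "deriv_bound p (2 ^ p * C * C') \<alpha> (\<lambda>x. f x * g x)"
  unfolding deriv_bound_def
proof (intro conjI allI impI)
  have sf: "smooth f" "smooth g" using f g by (auto simp: deriv_bound_def)
  then show "smooth (\<lambda>x. f x * g x)" by (rule smooth_mult)
  fix xs :: "'n list" and x assume l: "length xs \<le> p"
  have "\<bar>foldr pd xs (\<lambda>x. f x * g x) x\<bar> = \<bar>\<Sum>(ys, zs)\<leftarrow>splits xs. foldr pd ys f x * foldr pd zs g x\<bar>"
    by (simp add: foldr_pd_mult[OF sf])
  also have "\<dots> \<le> real (length (splits xs)) * (C * C' * \<alpha> ^ length xs)"
  proof (rule abs_sum_list_le)
    fix q assume "q \<in> set (splits xs)"
    then obtain ys zs where q: "q = (ys, zs)" "(ys, zs) \<in> set (splits xs)" by (metis surj_pair)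
    have len: "length ys + length zs = length xs" by (rule splits_length[OF q(2)])
    have "\<bar>foldr pd ys f x * foldr pd zs g x\<bar> \<le> (C * \<alpha> ^ length ys) * (C' * \<alpha> ^ length zs)"
      unfolding abs_mult using f g l len nn unfolding deriv_bound_def by (intro mult_mono) auto
    also have "\<dots> = C * C' * \<alpha> ^ length xs" by (simp add: len[symmetric] power_add)
    finally show "\<bar>case q of (ys, zs) \<Rightarrow> foldr pd ys f x * foldr pd zs g x\<bar> \<le> C * C' * \<alpha> ^ length xs"
      by (simp add: q)
  qed
  also have "\<dots> = 2 ^ length xs * (C * C' * \<alpha> ^ length xs)" by (simp add: length_splits)
  also have "\<dots> \<le> 2 ^ p * (C * C' * \<alpha> ^ length xs)"
    using l nn by (intro mult_right_mono power_increasing) auto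
  finally show "\<bar>foldr pd xs (\<lambda>x. f x * g x) x\<bar> \<le> 2 ^ p * C * C' * \<alpha> ^ length xs" by (simp add: mult_ac)
qed

lemma foldr_pd_const: "xs \<noteq> [] \<Longrightarrow> foldr pd xs (\<lambda>x. c) = (\<lambda>x. 0)"
proof (induction xs)
  case (Cons i xs)
  then show ?case by (cases "xs = []") (auto simp: pd_const)
qed simp

lemma deriv_bound_prod:
  fixes f :: "'i \<Rightarrow> real^'n::finite \<Rightarrow> real"
  assumes "finite A" "\<And>i. i \<in> A \<Longrightarrow> deriv_bound p C \<alpha> (f i)" "C \<ge> 0" "\<alpha> \<ge> 0"
  shows "deriv_bound p ((2 ^ p * C) ^ card A) \<alpha> (\<lambda>x. \<Prod>i\<in>A. f i x)"
  using assms(1,2)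
proof (induction A rule: finite_induct)
  case empty
  have "\<bar>foldr pd xs (\<lambda>x::real^'n. 1) x\<bar> \<le> \<alpha> ^ length xs" for xs :: "'n list" and x
    using foldr_pd_const[of xs 1] assms by (cases xs) auto
  then show ?case by (simp add: deriv_bound_def smooth_const)
next
  case (insert i A)
  have "deriv_bound p (2 ^ p * C * (2 ^ p * C) ^ card A) \<alpha> (\<lambda>x. f i x * (\<Prod>i\<in>A. f i x))"
    using insert assms by (intro deriv_bound_mult) auto
  then show ?case using insert by (simp add: mult_ac)
qed

text \<open>A smooth version of the indicator of a box, with transition zones of width 1/\<alpha>
  inside the box. A fixed \<alpha> gives the cutoff for a layer; \<alpha> tending to infinity
  recovers the indicator, which is how integrals over boxes are reached from test functions.\<close>

definition bump :: "real \<Rightarrow> real^'n::finite \<Rightarrow> real^'n \<Rightarrow> real^'n \<Rightarrow> real" where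
  "bump \<alpha> a b x = (\<Prod>i\<in>UNIV. smooth_step (\<alpha> * (x $ i - a $ i)) * smooth_step (\<alpha> * (b $ i - x $ i)))"

lemma deriv_bound_bump:
  "\<exists>C\<ge>1. \<forall>\<alpha>>0. \<forall>a b::real^'n::finite. deriv_bound p C \<alpha> (bump \<alpha> a b)"
proof -
  have "\<forall>q. \<exists>C\<ge>0. \<forall>xs \<alpha> \<beta> i (x::real^'n::finite). length xs = q \<longrightarrow>
      \<bar>foldr pd xs (\<lambda>x. smooth_step (\<alpha> * x $ i + \<beta>)) x\<bar> \<le> C * \<bar>\<alpha>\<bar> ^ q"
    using foldr_pd_affine_bound[of smooth_step] sm_step by blast
  then obtain C where C0: "\<And>q. C q \<ge> 0" and C: "\<And>q (xs::'n list) \<alpha> \<beta> i (x::real^'n). length xs = q \<Longrightarrow>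
      \<bar>foldr pd xs (\<lambda>x. smooth_step (\<alpha> * x $ i + \<beta>)) x\<bar> \<le> C q * \<bar>\<alpha>\<bar> ^ q" by metis
  \<comment> \<open>A single constant for all orders up to p; the added 1 gives K >= 1.\<close>
  define K where "K = 1 + (\<Sum>q\<le>p. C q)"
  have K1: "K \<ge> 1" using C0 by (simp add: K_def sum_nonneg)
  have CK: "C q \<le> K" if "q \<le> p" for q
    using member_le_sum[of q "{..p}" C] C0 that by (auto simp: K_def)
  \<comment> \<open>Stated with the absolute value of \<alpha> because the factors that cut off at
    the upper faces have slope -\<alpha>.\<close>
  have st: "deriv_bound p K \<bar>\<alpha>\<bar> (\<lambda>x::real^'n. smooth_step (\<alpha> * x $ i + \<beta>))" for \<alpha> \<beta> i
    unfolding deriv_bound_def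
  proof (intro conjI allI impI)
    show "smooth (\<lambda>x::real^'n. smooth_step (\<alpha> * x $ i + \<beta>))" using sm_step by (simp add: smooth_def Ck_affine)
    fix xs :: "'n list" and x :: "real^'n" assume "length xs \<le> p"
    then show "\<bar>foldr pd xs (\<lambda>x::real^'n. smooth_step (\<alpha> * x $ i + \<beta>)) x\<bar> \<le> K * \<bar>\<alpha>\<bar> ^ length xs"
      using CK[of "length xs"] C[OF refl, of xs \<alpha> i \<beta> x]
      by (meson abs_ge_zero mult_right_mono order_trans zero_le_power)
  qed
  show ?thesis
  proof (intro exI[of _ "(2 ^ p * (2 ^ p * K * K)) ^ CARD('n)"] conjI allI impI)
    have "1 \<le> 2 ^ p * (2 ^ p * (K * K))"
      using K1 mult_mono[of 1 "2^p" 1 "2 ^ p * (K * K)"] mult_mono[of 1 "2^p" 1 "K*K"] mult_mono[of 1 K 1 K] by auto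
    then show "1 \<le> (2 ^ p * (2 ^ p * K * K)) ^ CARD('n)" by (auto intro: one_le_power simp: mult_ac)
    fix \<alpha> :: real and a b :: "real^'n" assume \<alpha>: "\<alpha> > 0"
    have "deriv_bound p (2 ^ p * K * K) \<alpha> (\<lambda>x. smooth_step (\<alpha> * x $ i + - (\<alpha> * a $ i)) * smooth_step ((-\<alpha>) * x $ i + \<alpha> * b $ i))" for i
      using st[of \<alpha> i "- (\<alpha> * a $ i)"] st[of "-\<alpha>" i "\<alpha> * b $ i"] \<alpha> K1 by (intro deriv_bound_mult) auto
    moreover have "(\<lambda>x. smooth_step (\<alpha> * x $ i + - (\<alpha> * a $ i)) * smooth_step ((-\<alpha>) * x $ i + \<alpha> * b $ i))
       = (\<lambda>x. smooth_step (\<alpha> * (x $ i - a $ i)) * smooth_step (\<alpha> * (b $ i - x $ i)))" for i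
      by (simp add: algebra_simps)
    ultimately show "deriv_bound p ((2 ^ p * (2 ^ p * K * K)) ^ CARD('n)) \<alpha> (bump \<alpha> a b)"
      unfolding bump_def[abs_def] using K1 \<alpha> by (intro deriv_bound_prod) auto
  qed
qed

lemma bump_bounds: "0 \<le> bump \<alpha> a b x" "bump \<alpha> a b x \<le> 1"
  unfolding bump_def using step_bounds
  by (auto intro!: prod_nonneg prod_le_1 mult_nonneg_nonneg mult_le_one)

lemma bump_0:
  assumes "\<alpha> > 0" "x \<notin> box a b" shows "bump \<alpha> a b x = 0"
proof -
  obtain i where "x $ i \<le> a $ i \<or> x $ i \<ge> b $ i" using assms(2) unfolding mem_box_cart by (meson not_less)
  then have "smooth_step (\<alpha> * (x $ i - a $ i)) * smooth_step (\<alpha> * (b $ i - x $ i)) = 0"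
    using assms(1) by (auto simp: step_0 mult_nonneg_nonpos)
  then show ?thesis unfolding bump_def by (auto intro!: prod_zero)
qed

lemma bump_1:
  assumes "\<alpha> > 0" "\<And>i. a $ i + 1 / \<alpha> \<le> x $ i" "\<And>i. x $ i + 1 / \<alpha> \<le> b $ i" shows "bump \<alpha> a b x = 1"
proof -
  have "\<alpha> * (x $ i - a $ i) \<ge> 1" "\<alpha> * (b $ i - x $ i) \<ge> 1" for i
    using assms(2)[of i] assms(3)[of i] assms(1) by (auto simp: field_simps)
  then show ?thesis unfolding bump_def by (simp add: step_1)
qed

lemma smooth_bump: "\<alpha> > 0 \<Longrightarrow> smooth (bump \<alpha> a b)"
  using deriv_bound_bump unfolding deriv_bound_def by metis

lemma bump_test: "\<alpha> > 0 \<Longrightarrow> cbox a b \<subseteq> \<Omega> \<Longrightarrow> bump \<alpha> a b \<in> test_functions \<Omega>"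
  by (intro test_functionsI[of _ "cbox a b"] smooth_bump bump_0) (use box_subset_cbox[of a b] in auto)

lemma bump_tendsto: "(\<lambda>n. bump (real (Suc n)) a b x) \<longlonglongrightarrow> indicator (box a b) x"
proof (cases "x \<in> box a b")
  case True
  define e where "e = Min (range (\<lambda>i. min (x $ i - a $ i) (b $ i - x $ i)))"
  have "e > 0" unfolding e_def using True by (subst Min_gr_iff) (auto simp: mem_box_cart)
  then obtain N where N: "inverse (real (Suc N)) < e" using reals_Archimedean by blast
  have ei: "e \<le> min (x $ i - a $ i) (b $ i - x $ i)" for i unfolding e_def by (rule Min_le) auto
  have "bump (real (Suc n)) a b x = 1" if "n \<ge> N" for n
  proof (rule bump_1)
    have "1 / real (Suc n) \<le> inverse (real (Suc N))" using that by (simp add: inverse_eq_divide frac_le)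
    then have "1 / real (Suc n) \<le> e" using N by simp
    then show "a $ i + 1 / real (Suc n) \<le> x $ i" "x $ i + 1 / real (Suc n) \<le> b $ i" for i
      using ei[of i] by auto
  qed simp
  then show ?thesis using True unfolding indicator_def
    by (intro tendsto_eventually) (metis (mono_tags, lifting) eventually_sequentiallyI of_bool_eq(2))
next
  case False
  then show ?thesis by (simp add: bump_0)
qed

section \<open>The Lipschitz bound and the cutoff for one layer\<close>

lemma frechet_derivative_pd:
  assumes "f differentiable (at x)"
  shows "(f has_derivative (\<lambda>v. \<Sum>i\<in>UNIV. v $ i * pd i f x)) (at x)"
proof -
  let ?D = "frechet_derivative f (at x)"
  have D: "(f has_derivative ?D) (at x)" using assms by (simp add: frechet_derivative_works[symmetric])
  have l: "linear ?D" by (rule has_derivative_linear[OF D])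
  have "?D v = (\<Sum>i\<in>UNIV. v $ i * pd i f x)" for v
  proof -
    have "?D v = ?D (\<Sum>i\<in>UNIV. v $ i *\<^sub>R axis i 1)" by (metis basis_expansion scalar_mult_eq_scaleR)
    also have "\<dots> = (\<Sum>i\<in>UNIV. v $ i * pd i f x)"
      by (simp add: linear_sum[OF l] linear_scale[OF l] pd_def)
    finally show ?thesis .
  qed
  then have "?D = (\<lambda>v. \<Sum>i\<in>UNIV. v $ i * pd i f x)" by blast
  with D show ?thesis by metis
qed

lemma deriv_bound_lipschitz:
  fixes f :: "real^'n::finite \<Rightarrow> real"
  assumes "deriv_bound p C \<alpha> f" "p \<ge> 1"
  shows "\<bar>f x - f y\<bar> \<le> real CARD('n) * (C * \<alpha>) * norm (x - y)"
proof -
  have d: "(f has_derivative (\<lambda>v. \<Sum>i\<in>UNIV. v $ i * pd i f z)) (at z within UNIV)" for z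
    using assms(1) by (auto intro!: frechet_derivative_pd smooth_differentiable simp: deriv_bound_def)
  have b: "\<bar>pd i f z\<bar> \<le> C * \<alpha>" for i z
  proof -
    have "\<bar>foldr pd [i] f z\<bar> \<le> C * \<alpha> ^ length [i]" using assms unfolding deriv_bound_def
      by (metis (full_types) One_nat_def length_Cons list.size(3))
    then show ?thesis by simp
  qed
  have on: "onorm (\<lambda>v::real^'n. \<Sum>i\<in>UNIV. v $ i * pd i f z) \<le> real CARD('n) * (C * \<alpha>)" for z
  proof (rule onorm_le)
    fix v :: "real^'n"
    have "norm (\<Sum>i\<in>UNIV. v $ i * pd i f z) \<le> (\<Sum>i\<in>(UNIV::'n set). norm v * (C * \<alpha>))"
      by (rule order_trans[OF norm_sum], rule sum_mono)
        (auto simp: abs_mult intro!: mult_mono b component_le_norm_cart)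
    then show "norm (\<Sum>i\<in>UNIV. v $ i * pd i f z) \<le> real CARD('n) * (C * \<alpha>) * norm v" by (simp add: mult_ac)
  qed
  have "norm (f x - f y) \<le> real CARD('n) * (C * \<alpha>) * norm (x - y)"
    by (rule differentiable_bound[OF convex_UNIV d on]) auto
  then show ?thesis by simp
qed

text \<open>The cutoff is 1 minus a bump. The factor given by the dimension comes from bounding the
  differential by the sum of the partial derivatives, and is put into C so that one constant serves
  derivatives and Lipschitz bound.\<close>

lemma cutoff_exists:
  assumes "p \<ge> 1"
  shows "\<exists>C\<ge>1. \<forall>(c::real^'n::finite) R L. R \<ge> 0 \<and> L > 0 \<longrightarrow> (\<exists>\<eta>. smooth \<eta> \<and>
    (\<forall>x. 0 \<le> \<eta> x \<and> \<eta> x \<le> 1) \<and>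
    (\<forall>x. (\<forall>i. \<bar>x $ i - c $ i\<bar> \<le> R) \<longrightarrow> \<eta> x = 0) \<and>
    (\<forall>x. (\<exists>i. \<bar>x $ i - c $ i\<bar> \<ge> R + L) \<longrightarrow> \<eta> x = 1) \<and>
    (\<forall>xs x. xs \<noteq> [] \<and> length xs \<le> p \<longrightarrow> \<bar>foldr pd xs \<eta> x\<bar> \<le> C / L ^ length xs) \<and>
    (\<forall>x y. \<bar>\<eta> x - \<eta> y\<bar> \<le> C / L * norm (x - y)))"
proof -
  obtain C where C1: "C \<ge> 1" and C: "\<And>\<alpha> a b. \<alpha> > 0 \<Longrightarrow> deriv_bound p C \<alpha> (bump \<alpha> a (b::real^'n))"
    using deriv_bound_bump[where ?'n = 'n and p = p] by blast
  have n1: "real CARD('n) \<ge> 1" using zero_less_card_finite[where 'a='n] by linarith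
  then have CC: "C \<le> real CARD('n) * C" using C1 by simp
  show ?thesis
  proof (intro exI[of _ "real CARD('n) * C"] conjI allI impI)
    show "1 \<le> real CARD('n) * C" using CC C1 by linarith
    fix c :: "real^'n" and R L :: real assume RL: "R \<ge> 0 \<and> L > 0"
    \<comment> \<open>Half-width R + L and transition width L: the bump is 1 on the cube of
      half-width R and 0 off the open cube of half-width R + L.\<close>
    let ?v = "(\<chi> i. R + L) :: real^'n"
    let ?b = "bump (1 / L) (c - ?v) (c + ?v)"
    have db: "deriv_bound p C (1 / L) ?b" using RL by (intro C) auto
    have sb: "smooth ?b" using db by (simp add: deriv_bound_def)
    show "\<exists>\<eta>. smooth \<eta> \<and> (\<forall>x. 0 \<le> \<eta> x \<and> \<eta> x \<le> 1) \<and>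
      (\<forall>x. (\<forall>i. \<bar>x $ i - c $ i\<bar> \<le> R) \<longrightarrow> \<eta> x = 0) \<and>
      (\<forall>x. (\<exists>i. \<bar>x $ i - c $ i\<bar> \<ge> R + L) \<longrightarrow> \<eta> x = 1) \<and>
      (\<forall>xs x. xs \<noteq> [] \<and> length xs \<le> p \<longrightarrow> \<bar>foldr pd xs \<eta> x\<bar> \<le> real CARD('n) * C / L ^ length xs) \<and>
      (\<forall>x y. \<bar>\<eta> x - \<eta> y\<bar> \<le> real CARD('n) * C / L * norm (x - y))"
    proof (intro exI[of _ "\<lambda>x. 1 + (-1) * ?b x"] conjI allI impI)
      show "smooth (\<lambda>x. 1 + (-1) * ?b x)" by (intro smooth_add smooth_const smooth_mult sb)
      fix x :: "real^'n"
      show "0 \<le> 1 + (-1) * ?b x" "1 + (-1) * ?b x \<le> 1" using bump_bounds by auto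
      show "1 + (-1) * ?b x = 0" if "\<forall>i. \<bar>x $ i - c $ i\<bar> \<le> R"
      proof -
        have "?b x = 1" using RL that by (intro bump_1) (auto simp: abs_le_iff algebra_simps)
        then show ?thesis by simp
      qed
      show "1 + (-1) * ?b x = 1" if "\<exists>i. \<bar>x $ i - c $ i\<bar> \<ge> R + L"
      proof -
        from that obtain i where "\<bar>x $ i - c $ i\<bar> \<ge> R + L" by blast
        then have "\<not> ((c - ?v) $ i < x $ i \<and> x $ i < (c + ?v) $ i)" by auto
        then have "x \<notin> box (c - ?v) (c + ?v)" unfolding mem_box_cart by blast
        then have "?b x = 0" using RL by (intro bump_0) auto
        then show ?thesis by simp
      qed
      show "\<bar>(1 + (-1) * ?b x) - (1 + (-1) * ?b y)\<bar> \<le> real CARD('n) * C / L * norm (x - y)" for y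
        using deriv_bound_lipschitz[OF db assms, of y x] by (simp add: norm_minus_commute)
      fix xs :: "'n list" assume xs: "xs \<noteq> [] \<and> length xs \<le> p"
      have "foldr pd xs (\<lambda>x. 1 + (-1) * ?b x) x = - foldr pd xs ?b x"
        using xs by (subst foldr_pd_add[OF smooth_const smooth_cmult[OF sb]])
          (simp add: foldr_pd_const foldr_pd_cmult[OF sb, of _ "-1", simplified])
      moreover have "\<bar>foldr pd xs ?b x\<bar> \<le> C * (1 / L) ^ length xs" using db xs by (simp add: deriv_bound_def)
      ultimately have "\<bar>foldr pd xs (\<lambda>x. 1 + (-1) * ?b x) x\<bar> \<le> C / L ^ length xs" by (simp add: power_divide)
      also have "\<dots> \<le> real CARD('n) * C / L ^ length xs" using CC RL by (intro divide_right_mono) auto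
      finally show "\<bar>foldr pd xs (\<lambda>x. 1 + (-1) * ?b x) x\<bar> \<le> real CARD('n) * C / L ^ length xs" .
    qed
  qed
qed

section \<open>Square-integrable functions\<close>

text \<open>With \<open>lebesgue_on S\<close> in place of the measure this is \<open>L2 S\<close>.
  Carrying the domain in the measure instead of in a set integral lets the general integration rules
  apply directly.\<close>

definition sqint :: "'a measure \<Rightarrow> ('a \<Rightarrow> real) set" where
  "sqint M = {u \<in> borel_measurable M. integrable M (\<lambda>x. (u x)\<^sup>2)}"

lemma sqint_measurable: "u \<in> sqint M \<Longrightarrow> u \<in> borel_measurable M"
  and sqint_square: "u \<in> sqint M \<Longrightarrow> integrable M (\<lambda>x. (u x)\<^sup>2)"
  by (auto simp: sqint_def)

lemma sqint_mult_integrable: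
  assumes u: "u \<in> sqint M" and v: "v \<in> sqint M"
  shows "integrable M (\<lambda>x. u x * v x)"
proof (rule Bochner_Integration.integrable_bound)
  show "integrable M (\<lambda>x. (u x)\<^sup>2 + (v x)\<^sup>2)"
    using u v by (intro Bochner_Integration.integrable_add sqint_square)
  show "(\<lambda>x. u x * v x) \<in> borel_measurable M"
    using u v by (intro borel_measurable_times sqint_measurable)
  have "\<bar>u x * v x\<bar> \<le> (u x)\<^sup>2 + (v x)\<^sup>2" for x
  proof -
    have "2 * (\<bar>u x\<bar> * \<bar>v x\<bar>) \<le> \<bar>u x\<bar>\<^sup>2 + \<bar>v x\<bar>\<^sup>2"
      using sum_squares_bound[of "\<bar>u x\<bar>" "\<bar>v x\<bar>"] by (simp add: mult.assoc)
    moreover have "0 \<le> \<bar>u x\<bar> * \<bar>v x\<bar>" by simp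
    ultimately have "\<bar>u x\<bar> * \<bar>v x\<bar> \<le> \<bar>u x\<bar>\<^sup>2 + \<bar>v x\<bar>\<^sup>2" by linarith
    then show ?thesis unfolding abs_mult by simp
  qed
  then show "AE x in M. norm (u x * v x) \<le> norm ((u x)\<^sup>2 + (v x)\<^sup>2)" by simp
qed

lemma sqint_add:
  assumes u: "u \<in> sqint M" and v: "v \<in> sqint M"
  shows "(\<lambda>x. u x + v x) \<in> sqint M"
proof -
  have "integrable M (\<lambda>x. (u x)\<^sup>2 + 2 * (u x * v x) + (v x)\<^sup>2)"
    by (intro Bochner_Integration.integrable_add integrable_mult_right sqint_square sqint_mult_integrable u v)
  moreover have "(u x)\<^sup>2 + 2 * (u x * v x) + (v x)\<^sup>2 = (u x + v x)\<^sup>2" for x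
    by (simp add: power2_sum algebra_simps)
  moreover have "(\<lambda>x. u x + v x) \<in> borel_measurable M"
    using u v by (intro borel_measurable_add sqint_measurable)
  ultimately show ?thesis by (simp add: sqint_def)
qed

lemma sqint_bounded_mult:
  assumes u: "u \<in> sqint M" and g: "g \<in> borel_measurable M" and B: "AE x in M. \<bar>g x\<bar> \<le> B"
  shows "(\<lambda>x. g x * u x) \<in> sqint M"
proof -
  have "integrable M (\<lambda>x. (g x * u x)\<^sup>2)"
  proof (rule Bochner_Integration.integrable_bound)
    show "integrable M (\<lambda>x. B\<^sup>2 * (u x)\<^sup>2)" by (intro integrable_mult_right sqint_square u)
    show "(\<lambda>x. (g x * u x)\<^sup>2) \<in> borel_measurable M" using g sqint_measurable[OF u] by simp
    show "AE x in M. norm ((g x * u x)\<^sup>2) \<le> norm (B\<^sup>2 * (u x)\<^sup>2)"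
      using B
    proof eventually_elim
      case (elim x)
      have "(g x)\<^sup>2 \<le> B\<^sup>2" using elim by (metis abs_ge_zero power2_abs power_mono)
      then show ?case by (simp add: power_mult_distrib mult_right_mono)
    qed
  qed
  then show ?thesis using g sqint_measurable[OF u] by (simp add: sqint_def)
qed

lemma sqint_cmult: "u \<in> sqint M \<Longrightarrow> (\<lambda>x. c * u x) \<in> sqint M"
  by (rule sqint_bounded_mult[of _ _ _ "\<bar>c\<bar>"]) auto

lemma sqint_diff:
  assumes u: "u \<in> sqint M" and v: "v \<in> sqint M"
  shows "(\<lambda>x. u x - v x) \<in> sqint M"
  using sqint_add[OF u sqint_cmult[OF v, of "-1"]] by simp

lemma sqint_0: "(\<lambda>x. 0) \<in> sqint M"
  by (simp add: sqint_def)

lemma sqint_sum_list: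
  "(\<And>p. p \<in> set ps \<Longrightarrow> u p \<in> sqint M) \<Longrightarrow> (\<lambda>x. \<Sum>p\<leftarrow>ps. u p x) \<in> sqint M"
  by (induction ps) (auto intro: sqint_0 sqint_add)

lemma sqint_cauchy_schwarz:
  assumes u: "u \<in> sqint M" and v: "v \<in> sqint M"
  shows "\<bar>LINT x|M. u x * v x\<bar> \<le> sqrt (LINT x|M. (u x)\<^sup>2) * sqrt (LINT x|M. (v x)\<^sup>2)"
proof -
  let ?a = "LINT x|M. (u x)\<^sup>2" and ?b = "LINT x|M. u x * v x" and ?c = "LINT x|M. (v x)\<^sup>2"
  have q: "0 \<le> ?a * t\<^sup>2 + 2 * ?b * t + ?c" for t
  proof -
    have "0 \<le> (LINT x|M. (t * u x + v x)\<^sup>2)" by simp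
    also have "\<dots> = (LINT x|M. t\<^sup>2 * (u x)\<^sup>2 + 2 * t * (u x * v x) + (v x)\<^sup>2)"
      by (intro Bochner_Integration.integral_cong) (auto simp: power2_sum power_mult_distrib algebra_simps)
    also have "\<dots> = t\<^sup>2 * ?a + 2 * t * ?b + ?c"
      using sqint_square[OF u] sqint_square[OF v] sqint_mult_integrable[OF u v] by simp
    finally show ?thesis by (simp add: algebra_simps)
  qed
  have a0: "?a \<ge> 0" and c0: "?c \<ge> 0" by simp_all
  have "?b\<^sup>2 \<le> ?a * ?c"
  proof (cases "?a = 0")
    case True
    have "?b = 0"
    proof (rule ccontr)
      assume "?b \<noteq> 0"
      \<comment> \<open>With the quadratic term gone, this value of t turns the remaining linear
        polynomial into -1.\<close>
      with q[of "- (?c + 1) / (2 * ?b)"] show False unfolding True by (simp add: field_simps)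
    qed
    then show ?thesis using True by simp
  next
    case False
    then have "?a > 0" using a0 by linarith
    have "0 \<le> ?a * (- ?b / ?a)\<^sup>2 + 2 * ?b * (- ?b / ?a) + ?c" by (rule q)
    also have "\<dots> = ?c - ?b\<^sup>2 / ?a" using False by (simp add: power2_eq_square field_simps)
    finally show ?thesis using \<open>?a > 0\<close> by (simp add: field_simps)
  qed
  then have "sqrt (?b\<^sup>2) \<le> sqrt (?a * ?c)" by (rule real_sqrt_le_mono)
  then show ?thesis by (simp add: real_sqrt_mult)
qed

section \<open>Convergence in L2 and completeness\<close>

definition L2_limit :: "'a measure \<Rightarrow> (nat \<Rightarrow> 'a \<Rightarrow> real) \<Rightarrow> ('a \<Rightarrow> real) \<Rightarrow> bool" where
  "L2_limit M f u \<longleftrightarrow> u \<in> sqint M \<and> (\<forall>n. f n \<in> sqint M) \<and> (\<lambda>n. LINT x|M. (u x - f n x)\<^sup>2) \<longlonglongrightarrow> 0"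

lemma square_add_le: "(a + b)\<^sup>2 \<le> 2 * a\<^sup>2 + 2 * (b::real)\<^sup>2"
  using sum_squares_bound[of a b] by (simp add: power2_sum)

lemma L2_limit_add:
  assumes f: "L2_limit M f u" and g: "L2_limit M g v"
  shows "L2_limit M (\<lambda>n x. f n x + g n x) (\<lambda>x. u x + v x)"
  unfolding L2_limit_def
proof (intro conjI allI)
  note s = f[unfolded L2_limit_def] g[unfolded L2_limit_def]
  show "(\<lambda>x. u x + v x) \<in> sqint M" "(\<lambda>x. f n x + g n x) \<in> sqint M" for n
    using s by (auto intro: sqint_add)
  have lim: "(\<lambda>n. 2 * (LINT x|M. (u x - f n x)\<^sup>2) + 2 * (LINT x|M. (v x - g n x)\<^sup>2)) \<longlonglongrightarrow> 2 * 0 + 2 * 0"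
    using s by (intro tendsto_intros) auto
  have le: "(LINT x|M. (u x + v x - (f n x + g n x))\<^sup>2)
      \<le> 2 * (LINT x|M. (u x - f n x)\<^sup>2) + 2 * (LINT x|M. (v x - g n x)\<^sup>2)" for n
  proof -
    have i: "integrable M (\<lambda>x. (u x - f n x)\<^sup>2)" "integrable M (\<lambda>x. (v x - g n x)\<^sup>2)"
      "integrable M (\<lambda>x. (u x + v x - (f n x + g n x))\<^sup>2)"
      using s by (auto intro!: sqint_square sqint_diff sqint_add)
    have "(LINT x|M. (u x + v x - (f n x + g n x))\<^sup>2) \<le> (LINT x|M. 2 * (u x - f n x)\<^sup>2 + 2 * (v x - g n x)\<^sup>2)"
    proof (rule integral_mono)
      show "(u x + v x - (f n x + g n x))\<^sup>2 \<le> 2 * (u x - f n x)\<^sup>2 + 2 * (v x - g n x)\<^sup>2" for x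
        using square_add_le[of "u x - f n x" "v x - g n x"] by (simp add: algebra_simps)
    qed (use i in auto)
    also have "\<dots> = 2 * (LINT x|M. (u x - f n x)\<^sup>2) + 2 * (LINT x|M. (v x - g n x)\<^sup>2)" using i by simp
    finally show ?thesis .
  qed
  show "(\<lambda>n. LINT x|M. (u x + v x - (f n x + g n x))\<^sup>2) \<longlonglongrightarrow> 0"
    by (rule tendsto_sandwich[OF _ _ tendsto_const lim[simplified]]) (auto simp: le)
qed

lemma L2_limit_bounded_mult:
  assumes f: "L2_limit M f u" and g: "g \<in> borel_measurable M" "\<And>x. x \<in> space M \<Longrightarrow> \<bar>g x\<bar> \<le> B"
  shows "L2_limit M (\<lambda>n x. g x * f n x) (\<lambda>x. g x * u x)"
  unfolding L2_limit_def
proof (intro conjI allI)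
  note s = f[unfolded L2_limit_def]
  show m: "(\<lambda>x. g x * u x) \<in> sqint M" "(\<lambda>x. g x * f n x) \<in> sqint M" for n
    using s g by (auto intro: sqint_bounded_mult)
  have lim: "(\<lambda>n. B\<^sup>2 * (LINT x|M. (u x - f n x)\<^sup>2)) \<longlonglongrightarrow> B\<^sup>2 * 0"
    using s by (intro tendsto_intros) auto
  have le: "(LINT x|M. (g x * u x - g x * f n x)\<^sup>2) \<le> B\<^sup>2 * (LINT x|M. (u x - f n x)\<^sup>2)" for n
  proof -
    have i: "integrable M (\<lambda>x. (u x - f n x)\<^sup>2)" using s by (auto intro!: sqint_square sqint_diff)
    have i2: "integrable M (\<lambda>x. (g x * u x - g x * f n x)\<^sup>2)" by (intro sqint_square sqint_diff m)
    have "(LINT x|M. (g x * u x - g x * f n x)\<^sup>2) \<le> (LINT x|M. B\<^sup>2 * (u x - f n x)\<^sup>2)"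
    proof (rule integral_mono)
      fix x assume "x \<in> space M"
      then have "(g x)\<^sup>2 \<le> B\<^sup>2" using g(2)[of x] by (metis abs_ge_zero power2_abs power_mono)
      then have "(g x)\<^sup>2 * (u x - f n x)\<^sup>2 \<le> B\<^sup>2 * (u x - f n x)\<^sup>2" by (rule mult_right_mono) simp
      then show "(g x * u x - g x * f n x)\<^sup>2 \<le> B\<^sup>2 * (u x - f n x)\<^sup>2"
        by (simp add: power_mult_distrib[symmetric] algebra_simps)
    qed (use i i2 in auto)
    then show ?thesis using i by simp
  qed
  show "(\<lambda>n. LINT x|M. (g x * u x - g x * f n x)\<^sup>2) \<longlonglongrightarrow> 0"
    by (rule tendsto_sandwich[OF _ _ tendsto_const lim[simplified]]) (auto simp: le)
qed

lemma L2_limit_cmult: "L2_limit M f u \<Longrightarrow> L2_limit M (\<lambda>n x. c * f n x) (\<lambda>x. c * u x)"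
  by (rule L2_limit_bounded_mult[of _ _ _ _ "\<bar>c\<bar>"]) auto

lemma L2_limit_const: "u \<in> sqint M \<Longrightarrow> L2_limit M (\<lambda>n. u) u"
  by (simp add: L2_limit_def)

lemma L2_limit_sum_list:
  "(\<And>p. p \<in> set ps \<Longrightarrow> L2_limit M (\<lambda>n. f n p) (u p)) \<Longrightarrow>
    L2_limit M (\<lambda>n x. \<Sum>p\<leftarrow>ps. f n p x) (\<lambda>x. \<Sum>p\<leftarrow>ps. u p x)"
  by (induction ps) (auto intro!: L2_limit_add L2_limit_const sqint_0)

lemma L2_limit_inner_left:
  assumes f: "L2_limit M f u" and v: "v \<in> sqint M"
  shows "(\<lambda>n. LINT x|M. f n x * v x) \<longlonglongrightarrow> (LINT x|M. u x * v x)"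
proof -
  note s = f[unfolded L2_limit_def]
  have "(\<lambda>n. sqrt (LINT x|M. (u x - f n x)\<^sup>2) * sqrt (LINT x|M. (v x)\<^sup>2)) \<longlonglongrightarrow> sqrt 0 * sqrt (LINT x|M. (v x)\<^sup>2)"
    using s by (intro tendsto_intros) auto
  then have lim: "(\<lambda>n. sqrt (LINT x|M. (u x - f n x)\<^sup>2) * sqrt (LINT x|M. (v x)\<^sup>2)) \<longlonglongrightarrow> 0" by simp
  have "\<bar>(LINT x|M. f n x * v x) - (LINT x|M. u x * v x)\<bar>
      \<le> sqrt (LINT x|M. (u x - f n x)\<^sup>2) * sqrt (LINT x|M. (v x)\<^sup>2)" for n
  proof -
    have "(LINT x|M. u x * v x) - (LINT x|M. f n x * v x) = (LINT x|M. (u x - f n x) * v x)"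
      using s v by (simp add: left_diff_distrib sqint_mult_integrable)
    moreover have "(\<lambda>x. u x - f n x) \<in> sqint M" using s by (intro sqint_diff) auto
    ultimately show ?thesis using sqint_cauchy_schwarz[of "\<lambda>x. u x - f n x" M v] v
      by (simp add: abs_minus_commute)
  qed
  then have "(\<lambda>n. (LINT x|M. f n x * v x) - (LINT x|M. u x * v x)) \<longlonglongrightarrow> 0"
    by (intro Lim_null_comparison[OF _ lim]) auto
  then show ?thesis by (rule LIM_zero_cancel)
qed

text \<open>Expanding the square of u - \<open>f n\<close> expresses the square norm of
  \<open>f n\<close> through inner products with the fixed function u and a term that tends to
  0.\<close>

lemma L2_limit_norm:
  assumes f: "L2_limit M f u"
  shows "(\<lambda>n. LINT x|M. (f n x)\<^sup>2) \<longlonglongrightarrow> (LINT x|M. (u x)\<^sup>2)"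
proof -
  note s = f[unfolded L2_limit_def]
  have "(\<lambda>n. 2 * (LINT x|M. f n x * u x) - (LINT x|M. u x * u x) + (LINT x|M. (u x - f n x)\<^sup>2))
      \<longlonglongrightarrow> 2 * (LINT x|M. u x * u x) - (LINT x|M. u x * u x) + 0"
    using s by (intro tendsto_intros L2_limit_inner_left f) auto
  moreover have "2 * (LINT x|M. f n x * u x) - (LINT x|M. u x * u x) + (LINT x|M. (u x - f n x)\<^sup>2)
      = (LINT x|M. (f n x)\<^sup>2)" for n
  proof -
    have i: "integrable M (\<lambda>x. f n x * u x)" "integrable M (\<lambda>x. u x * u x)" "integrable M (\<lambda>x. (u x - f n x)\<^sup>2)"
      using s by (auto intro!: sqint_mult_integrable sqint_square sqint_diff)
    have "2 * (LINT x|M. f n x * u x) - (LINT x|M. u x * u x) + (LINT x|M. (u x - f n x)\<^sup>2)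
       = (LINT x|M. 2 * (f n x * u x) - u x * u x + (u x - f n x)\<^sup>2)"
      using i by simp
    also have "\<dots> = (LINT x|M. (f n x)\<^sup>2)"
      by (intro Bochner_Integration.integral_cong) (auto simp: power2_eq_square algebra_simps)
    finally show ?thesis .
  qed
  ultimately show ?thesis by (simp add: power2_eq_square)
qed

text \<open>Finiteness of the measure turns the L2 Cauchy property into an L1 one, which yields a
  subsequence converging almost everywhere; Fatou's lemma then bounds the L2 distance to its
  limit.\<close>

lemma (in finite_measure) L2_complete:
  assumes f: "\<And>n. f n \<in> sqint M"
    and cauchy: "\<And>e. e > 0 \<Longrightarrow> \<exists>N. \<forall>m\<ge>N. \<forall>n\<ge>N. (LINT x|M. (f m x - f n x)\<^sup>2) < e"
  shows "\<exists>u. L2_limit M f u"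
proof -
  have one: "(\<lambda>_. 1) \<in> sqint M" by (simp add: sqint_def)
  have fi: "integrable M (f n)" for n using sqint_mult_integrable[OF f one] by simp
  have fm[measurable]: "f n \<in> borel_measurable M" for n by (rule sqint_measurable[OF f])
  have absint: "(\<lambda>x. \<bar>f m x - f n x\<bar>) \<in> sqint M" for m n
    using sqint_diff[OF f f] by (simp add: sqint_def)
  have L1: "\<exists>N. \<forall>i\<ge>N. \<forall>j\<ge>N. LINT x|M. norm (f i x - f j x) < e" if e: "e > 0" for e
  proof -
    let ?m = "sqrt (measure M (space M)) + 1"
    have m: "?m > 0" by (simp add: add_nonneg_pos)
    have "(e / ?m)\<^sup>2 > 0" using e m by simp
    then obtain N where N: "\<And>m n. m \<ge> N \<Longrightarrow> n \<ge> N \<Longrightarrow> (LINT x|M. (f m x - f n x)\<^sup>2) < (e / ?m)\<^sup>2"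
      using cauchy by blast
    show ?thesis
    proof (intro exI[of _ N] allI impI)
      fix i j assume ij: "i \<ge> N" "j \<ge> N"
      have "(LINT x|M. norm (f i x - f j x)) \<le> sqrt (LINT x|M. (f i x - f j x)\<^sup>2) * sqrt (LINT x|M. 1\<^sup>2)"
        using sqint_cauchy_schwarz[OF absint[of i j] one] by simp
      also have "\<dots> \<le> sqrt (LINT x|M. (f i x - f j x)\<^sup>2) * ?m" by (intro mult_left_mono) auto
      also have "\<dots> < sqrt ((e / ?m)\<^sup>2) * ?m"
        using m by (intro mult_strict_right_mono real_sqrt_less_mono N ij) auto
      also have "\<dots> = e" using e m by simp
      finally show "LINT x|M. norm (f i x - f j x) < e" .
    qed
  qed
  obtain r where r: "strict_mono r" "AE x in M. Cauchy (\<lambda>i. f (r i) x)"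
    using cauchy_L1_AE_cauchy_subseq[OF fi L1] by blast
  define u where "u x = lim (\<lambda>i. f (r i) x)" for x
  have um[measurable]: "u \<in> borel_measurable M" unfolding u_def by measurable
  have ae: "AE x in M. (\<lambda>i. f (r i) x) \<longlonglongrightarrow> u x"
    using r(2) by eventually_elim (auto simp: u_def Cauchy_convergent_iff convergent_LIMSEQ_iff)
  \<comment> \<open>Fatou along the subsequence: a bound on the distance from \<open>f n\<close> to
    all late terms is inherited by the limit u.\<close>
  have fatou: "(\<integral>\<^sup>+x. ennreal ((u x - f n x)\<^sup>2) \<partial>M) \<le> ennreal e"
    if N: "\<And>m. m \<ge> N \<Longrightarrow> (LINT x|M. (f m x - f n x)\<^sup>2) \<le> e" for n N e
  proof -
    have "(\<integral>\<^sup>+x. ennreal ((u x - f n x)\<^sup>2) \<partial>M) = (\<integral>\<^sup>+x. liminf (\<lambda>i. ennreal ((f (r i) x - f n x)\<^sup>2)) \<partial>M)"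
    proof (rule nn_integral_cong_AE)
      show "AE x in M. ennreal ((u x - f n x)\<^sup>2) = liminf (\<lambda>i. ennreal ((f (r i) x - f n x)\<^sup>2))"
        using ae
      proof eventually_elim
        case (elim x)
        then have "(\<lambda>i. ennreal ((f (r i) x - f n x)\<^sup>2)) \<longlonglongrightarrow> ennreal ((u x - f n x)\<^sup>2)"
          by (intro tendsto_intros)
        then show ?case using lim_imp_Liminf[OF sequentially_bot] by metis
      qed
    qed
    also have "\<dots> \<le> liminf (\<lambda>i. \<integral>\<^sup>+x. ennreal ((f (r i) x - f n x)\<^sup>2) \<partial>M)"
      by (rule nn_integral_liminf) measurable
    also have "\<dots> = liminf (\<lambda>i. ennreal (LINT x|M. (f (r i) x - f n x)\<^sup>2))"
      by (subst nn_integral_eq_integral) (auto intro!: sqint_square[OF sqint_diff[OF f f]])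
    also have "\<dots> \<le> liminf (\<lambda>i. ennreal e)"
    proof (rule Liminf_mono)
      show "\<forall>\<^sub>F i in sequentially. ennreal (LINT x|M. (f (r i) x - f n x)\<^sup>2) \<le> ennreal e"
        using eventually_ge_at_top[of N]
      proof eventually_elim
        case (elim i)
        then have "r i \<ge> N" using seq_suble[OF r(1), of i] by linarith
        then show ?case by (intro ennreal_leI N)
      qed
    qed
    also have "\<dots> = ennreal e" by (simp add: Liminf_const)
    finally show ?thesis .
  qed
  have sq: "(\<lambda>x. u x - f n x) \<in> sqint M" if "\<And>m. m \<ge> N \<Longrightarrow> (LINT x|M. (f m x - f n x)\<^sup>2) \<le> e" for n N e
  proof -
    have "(\<integral>\<^sup>+x. ennreal (norm ((u x - f n x)\<^sup>2)) \<partial>M) < \<infinity>"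
      using le_less_trans[OF fatou[OF that] ennreal_less_top] by simp
    then have "integrable M (\<lambda>x. (u x - f n x)\<^sup>2)"
      by (intro integrableI_bounded) auto
    then show ?thesis by (simp add: sqint_def)
  qed
  obtain N1 where N1: "\<And>m n. m \<ge> N1 \<Longrightarrow> n \<ge> N1 \<Longrightarrow> (LINT x|M. (f m x - f n x)\<^sup>2) < 1"
    using cauchy[of 1] by auto
  have "(\<lambda>x. u x - f N1 x) \<in> sqint M" by (rule sq[of N1 _ 1]) (auto intro: less_imp_le N1)
  from sqint_add[OF this f[of N1]] have us: "u \<in> sqint M" by simp
  have "(\<lambda>n. LINT x|M. (u x - f n x)\<^sup>2) \<longlonglongrightarrow> 0"
  proof (rule LIMSEQ_I)
    fix e :: real assume e: "e > 0"
    then obtain N where N: "\<And>m n. m \<ge> N \<Longrightarrow> n \<ge> N \<Longrightarrow> (LINT x|M. (f m x - f n x)\<^sup>2) < e / 2"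
      using cauchy[of "e / 2"] by auto
    show "\<exists>no. \<forall>n\<ge>no. norm ((LINT x|M. (u x - f n x)\<^sup>2) - 0) < e"
    proof (intro exI[of _ N] allI impI)
      fix n assume n: "n \<ge> N"
      have "(\<integral>\<^sup>+x. ennreal ((u x - f n x)\<^sup>2) \<partial>M) \<le> ennreal (e / 2)"
        by (rule fatou[of N], rule less_imp_le, rule N[OF _ n])
      also have "(\<integral>\<^sup>+x. ennreal ((u x - f n x)\<^sup>2) \<partial>M) = ennreal (LINT x|M. (u x - f n x)\<^sup>2)"
        by (rule nn_integral_eq_integral) (auto intro!: sqint_square sqint_diff us f)
      finally have "(LINT x|M. (u x - f n x)\<^sup>2) \<le> e / 2" using e by simp
      then show "norm ((LINT x|M. (u x - f n x)\<^sup>2) - 0) < e" using e by simp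
    qed
  qed
  then show ?thesis using us f unfolding L2_limit_def by blast
qed

subsection \<open>Restriction to sets\<close>

lemma set_integral_lebesgue_on:
  fixes f :: "'a::euclidean_space \<Rightarrow> real"
  shows "S \<in> sets lebesgue \<Longrightarrow> (LINT x:S|lebesgue. f x) = (LINT x|lebesgue_on S. f x)"
  unfolding set_lebesgue_integral_def by (subst integral_restrict_space) auto

lemma set_integrable_lebesgue_on:
  fixes f :: "'a::euclidean_space \<Rightarrow> real"
  shows "S \<in> sets lebesgue \<Longrightarrow> set_integrable lebesgue S f \<longleftrightarrow> integrable (lebesgue_on S) f"
  unfolding set_integrable_def by (subst integrable_restrict_space) auto

lemma AE_lebesgue_on:
  "S \<in> sets lebesgue \<Longrightarrow> (AE x in lebesgue_on S. P x) \<longleftrightarrow> (AE x in lebesgue. x \<in> S \<longrightarrow> P x)"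
  by (subst AE_restrict_space_iff) auto

lemma open_sets_lebesgue: "open S \<Longrightarrow> S \<in> sets lebesgue"
  by (simp add: borel_open)

lemma L2_sqint: "S \<in> sets lebesgue \<Longrightarrow> L2 S = sqint (lebesgue_on S)"
  unfolding L2_def sqint_def by (auto simp: set_integrable_lebesgue_on)

lemma integrable_on_subset:
  fixes f :: "'a::euclidean_space \<Rightarrow> real"
  assumes "integrable (lebesgue_on T) f" "S \<subseteq> T" "S \<in> sets lebesgue" "T \<in> sets lebesgue"
  shows "integrable (lebesgue_on S) f"
  using set_integrable_subset[of lebesgue T f S] assms by (simp add: set_integrable_lebesgue_on)

lemma measurable_on_subset:
  fixes f :: "'a::euclidean_space \<Rightarrow> real"
  assumes "f \<in> borel_measurable (lebesgue_on T)" "S \<subseteq> T"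
  shows "f \<in> borel_measurable (lebesgue_on S)"
  using assms measurable_restrict_mono by blast

lemma sqint_subset:
  fixes u :: "'a::euclidean_space \<Rightarrow> real"
  assumes "u \<in> sqint (lebesgue_on T)" "S \<subseteq> T" "S \<in> sets lebesgue" "T \<in> sets lebesgue"
  shows "u \<in> sqint (lebesgue_on S)"
  using assms integrable_on_subset measurable_on_subset unfolding sqint_def by blast

text \<open>Holds because Lebesgue measure is complete. It is applied to \<open>wderiv\<close>,
  whose chosen representative is known only up to null sets.\<close>

lemma measurable_AE_lebesgue_on:
  fixes u v :: "'a::euclidean_space \<Rightarrow> real"
  assumes u: "u \<in> borel_measurable (lebesgue_on S)" and S: "S \<in> sets lebesgue"
    and ae: "AE x in lebesgue_on S. u x = v x"
  shows "v \<in> borel_measurable (lebesgue_on S)"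
proof -
  let ?u = "\<lambda>x. indicator S x *\<^sub>R u x" and ?v = "\<lambda>x. indicator S x *\<^sub>R v x"
  have um: "?u \<in> borel_measurable lebesgue"
    using u S by (subst (asm) borel_measurable_restrict_space_iff) auto
  have ae': "AE x in lebesgue. ?u x = ?v x"
    using ae S by (subst (asm) AE_lebesgue_on) (auto elim!: eventually_mono simp: indicator_def)
  have "?v \<in> borel_measurable lebesgue"
  proof (rule measurableI)
    fix A :: "real set" assume A: "A \<in> sets borel"
    show "?v -` A \<inter> space lebesgue \<in> sets lebesgue"
    proof (rule completion.in_sets_AE[where A = "?u -` A \<inter> space lebesgue"])
      show "AE x in lebesgue. (x \<in> ?u -` A \<inter> space lebesgue) = (x \<in> ?v -` A \<inter> space lebesgue)"
        using ae' by eventually_elim auto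
      show "?u -` A \<inter> space lebesgue \<in> sets lebesgue" by (rule measurable_sets[OF um A])
    qed simp
  qed simp
  then show ?thesis using S by (subst borel_measurable_restrict_space_iff) auto
qed

lemma sqint_AE:
  fixes u v :: "'a::euclidean_space \<Rightarrow> real"
  assumes u: "u \<in> sqint (lebesgue_on S)" and S: "S \<in> sets lebesgue"
    and ae: "AE x in lebesgue_on S. u x = v x"
  shows "v \<in> sqint (lebesgue_on S)"
proof -
  have v: "v \<in> borel_measurable (lebesgue_on S)"
    by (rule measurable_AE_lebesgue_on[OF sqint_measurable[OF u] S ae])
  have "integrable (lebesgue_on S) (\<lambda>x. (v x)\<^sup>2)"
  proof (rule integrable_cong_AE_imp[OF sqint_square[OF u]])
    show "AE x in lebesgue_on S. (u x)\<^sup>2 = (v x)\<^sup>2" using ae by eventually_elim simp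
  qed (use v in measurable)
  then show ?thesis using v by (simp add: sqint_def)
qed

section \<open>Weak derivatives\<close>

lemma loc_integrable_test:
  assumes v: "loc_integrable \<Omega> v" and f: "f \<in> test_functions \<Omega>" and \<Omega>: "\<Omega> \<in> sets lebesgue"
  shows "integrable (lebesgue_on \<Omega>) (\<lambda>x. v x * f x)"
proof -
  obtain K where K: "compact K" "K \<subseteq> \<Omega>" "\<And>x. x \<notin> K \<Longrightarrow> f x = 0"
    using test_functionsE[OF f] by blast
  obtain B where B: "B > 0" "\<And>x. \<bar>f x\<bar> \<le> B" using test_bounded[OF f] by blast
  have vK: "integrable lebesgue (\<lambda>x. indicator K x *\<^sub>R v x)"
    using v K unfolding loc_integrable_def set_integrable_def by blast
  have fm: "f \<in> borel_measurable lebesgue"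
    using smooth_measurable[OF test_smooth[OF f]] by (simp add: measurable_completion)
  have "integrable lebesgue (\<lambda>x. (indicator K x *\<^sub>R v x) * f x)"
  proof (rule Bochner_Integration.integrable_bound)
    show "integrable lebesgue (\<lambda>x. B * (indicator K x *\<^sub>R v x))" by (intro integrable_mult_right vK)
    show "(\<lambda>x. (indicator K x *\<^sub>R v x) * f x) \<in> borel_measurable lebesgue"
      using borel_measurable_integrable[OF vK] fm by (rule borel_measurable_times)
    show "AE x in lebesgue. norm ((indicator K x *\<^sub>R v x) * f x) \<le> norm (B * (indicator K x *\<^sub>R v x))"
      using B by (intro AE_I2) (auto simp: abs_mult mult.commute intro!: mult_right_mono)
  qed
  moreover have "(\<lambda>x. (indicat_real K x *\<^sub>R v x) * f x) = (\<lambda>x. indicat_real \<Omega> x *\<^sub>R (v x * f x))"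
    using K(2,3) by (fastforce simp: indicator_def)
  ultimately have "set_integrable lebesgue \<Omega> (\<lambda>x. v x * f x)" unfolding set_integrable_def by metis
  then show ?thesis using \<Omega> by (simp add: set_integrable_lebesgue_on)
qed

lemma sqint_const_bounded: "S \<in> lmeasurable \<Longrightarrow> (\<lambda>x. c) \<in> sqint (lebesgue_on S)"
  unfolding sqint_def using finite_measure_lebesgue_on[of S] by (simp add: finite_measure.integrable_const)

lemma sqint_loc_integrable:
  assumes v: "v \<in> sqint (lebesgue_on \<Omega>)" and \<Omega>: "\<Omega> \<in> sets lebesgue"
  shows "loc_integrable \<Omega> v"
  unfolding loc_integrable_def
proof (intro allI impI, elim conjE)
  fix K :: "(real^'a) set" assume K: "compact K" "K \<subseteq> \<Omega>"
  have Ks: "K \<in> lmeasurable" "K \<in> sets lebesgue" using K(1) by (auto intro: lmeasurable_compact fmeasurableD)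
  have "integrable (lebesgue_on K) (\<lambda>x. v x * 1)"
    by (rule sqint_mult_integrable[OF sqint_subset[OF v K(2) Ks(2) \<Omega>] sqint_const_bounded[OF Ks(1)]])
  then show "set_integrable lebesgue K v" using Ks by (simp add: set_integrable_lebesgue_on)
qed

text \<open>A Dynkin argument: open boxes generate the Borel sets and are stable under intersection,
  and the vanishing total integral takes care of complements. Then w has the same integral as the
  zero function over every Borel set.\<close>

lemma integral_zero_on_boxes_AE:
  fixes w :: "'a::euclidean_space \<Rightarrow> real"
  assumes w: "integrable lebesgue w" and z: "\<And>a b. (LINT x:box a b|lebesgue. w x) = 0"
    and U: "(LINT x|lebesgue. w x) = 0"
  shows "AE x in lebesgue. w x = 0"
proof -
  \<comment> \<open>Boxes generate only the Borel sets, so the argument runs with a Borel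
    representative of w.\<close>
  obtain w' where w'm: "w' \<in> borel_measurable lborel" and ae: "AE x in lborel. w x = w' x"
    using completion_ex_borel_measurable_real[OF borel_measurable_integrable[OF w]] by blast
  have ae': "AE x in lebesgue. w x = w' x" by (rule AE_completion[OF ae])
  have "integrable lebesgue w'"
    by (rule integrable_cong_AE_imp[OF w]) (use w'm ae' in \<open>auto intro: measurable_completion\<close>)
  then have w'i: "integrable lborel w'" using w'm by (subst (asm) integrable_completion) auto
  have conv: "(LINT x:A|lborel. w' x) = (LINT x:A|lebesgue. w x)" if A: "A \<in> sets borel" for A
  proof -
    have "(LINT x:A|lborel. w' x) = (LINT x:A|lebesgue. w' x)"
      unfolding set_lebesgue_integral_def using A w'm by (intro integral_completion[symmetric]) auto
    also have "\<dots> = (LINT x:A|lebesgue. w x)"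
      by (rule set_lebesgue_integral_cong_AE)
        (use A w'm ae' borel_measurable_integrable[OF w] in \<open>auto intro: measurable_completion elim!: eventually_mono\<close>)
    finally show ?thesis .
  qed
  have UN: "(LINT x:UNIV|lborel. w' x) = 0"
    using conv[of UNIV] U by (simp add: set_lebesgue_integral_def)
  have wi: "set_integrable lborel B w'" if "B \<in> sets borel" for B
    unfolding set_integrable_def by (rule integrable_mult_indicator) (use that w'i in auto)
  let ?E = "range (\<lambda>(a, b). box a b::'a set)"
  have "(LINT x:A|lborel. w' x) = 0" if A: "A \<in> sets borel" for A
  proof -
    have "Int_stable ?E" by (auto simp: Int_stable_def box_Int_box)
    moreover have "?E \<subseteq> Pow UNIV" by simp
    moreover have "A \<in> sigma_sets UNIV ?E" using A by (subst (asm) borel_eq_box) (simp add: sets_measure_of)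
    ultimately show ?thesis
    proof (induction rule: sigma_sets_induct_disjoint)
      case (basic A)
      then show ?case using conv z by auto
    next
      case empty
      then show ?case by (simp add: set_lebesgue_integral_def)
    next
      case (compl A)
      have Ab: "A \<in> sets borel" using compl(1) by (subst borel_eq_box) (simp add: sets_measure_of)
      have "(LINT x:A \<union> (UNIV - A)|lborel. w' x) = (LINT x:A|lborel. w' x) + (LINT x:UNIV - A|lborel. w' x)"
        using Ab by (intro set_integral_Un wi) auto
      then show ?case using UN compl(2) by simp
    next
      case (union F)
      have Fb: "F i \<in> sets borel" for i
        using union(2) by (subst borel_eq_box) (auto simp: sets_measure_of)
      have "(LINT x:(\<Union>i. F i)|lborel. w' x) = (\<Sum>i. (LINT x:F i|lborel. w' x))"
        using union(1) Fb by (intro lebesgue_integral_countable_add wi) (auto simp: disjoint_family_on_def)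
      then show ?case using union(3) by simp
    qed
  qed
  then have "AE x in lborel. w' x = 0"
    using density_unique_real[OF w'i, of "\<lambda>_. 0"] by (simp add: set_lebesgue_integral_def)
  then have "AE x in lebesgue. w' x = 0" by (rule AE_completion)
  with ae' show ?thesis by eventually_elim simp
qed

text \<open>The fundamental lemma of the calculus of variations. Bumps converge to indicators of
  boxes, so v has integral zero over every open box whose closure lies in \<Omega>, and countably
  many closed boxes cover \<Omega>.\<close>

lemma weak_zero_AE:
  fixes \<Omega> :: "(real^'n::finite) set"
  assumes \<Omega>: "open \<Omega>" and v: "loc_integrable \<Omega> v"
    and z: "\<And>f. f \<in> test_functions \<Omega> \<Longrightarrow> (LINT x:\<Omega>|lebesgue. v x * f x) = 0"
  shows "AE x in lebesgue_on \<Omega>. v x = 0"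
proof -
  have \<Omega>s: "\<Omega> \<in> sets lebesgue" using \<Omega> by (rule open_sets_lebesgue)
  have vb: "integrable lebesgue (\<lambda>x. indicat_real (cbox a b) x * v x)" if "cbox a b \<subseteq> \<Omega>" for a b
    using v that unfolding loc_integrable_def set_integrable_def by auto
  have box0: "(LINT x|lebesgue. indicat_real (box a b) x * v x) = 0" if ab: "cbox a b \<subseteq> \<Omega>" for a b
  proof -
    let ?g = "\<lambda>n x. (indicat_real (cbox a b) x * v x) * bump (real (Suc n)) a b x"
    have m: "bump (real (Suc n)) a b \<in> borel_measurable lebesgue" for n
      using smooth_measurable[OF smooth_bump[of "real (Suc n)" a b]] by (simp add: measurable_completion)
    have "(\<lambda>n. LINT x|lebesgue. ?g n x) \<longlonglongrightarrow> (LINT x|lebesgue. (indicat_real (cbox a b) x * v x) * indicator (box a b) x)"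
    proof (rule integral_dominated_convergence[where w = "\<lambda>x. \<bar>indicat_real (cbox a b) x * v x\<bar>"])
      show "integrable lebesgue (\<lambda>x. \<bar>indicat_real (cbox a b) x * v x\<bar>)" using vb[OF ab] by (rule integrable_abs)
      show "AE x in lebesgue. (\<lambda>n. ?g n x) \<longlonglongrightarrow> (indicat_real (cbox a b) x * v x) * indicator (box a b) x"
        by (intro AE_I2 tendsto_mult tendsto_const bump_tendsto)
      show "AE x in lebesgue. norm (?g n x) \<le> \<bar>indicat_real (cbox a b) x * v x\<bar>" for n
      proof (rule AE_I2)
        fix x
        have "\<bar>indicat_real (cbox a b) x * v x\<bar> * bump (real (Suc n)) a b x \<le> \<bar>indicat_real (cbox a b) x * v x\<bar> * 1"
          by (intro mult_left_mono bump_bounds) auto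
        then show "norm (?g n x) \<le> \<bar>indicat_real (cbox a b) x * v x\<bar>" using bump_bounds(1)[of _ a b x]
          by (simp add: abs_mult)
      qed
      show "(\<lambda>x. (indicat_real (cbox a b) x * v x) * indicator (box a b) x) \<in> borel_measurable lebesgue"
        by (intro borel_measurable_times borel_measurable_integrable[OF vb[OF ab]] borel_measurable_indicator) simp
      show "?g n \<in> borel_measurable lebesgue" for n
        by (intro borel_measurable_times borel_measurable_integrable[OF vb[OF ab]] m)
    qed
    moreover have "(LINT x|lebesgue. ?g n x) = 0" for n
    proof -
      have "?g n = (\<lambda>x. indicat_real \<Omega> x *\<^sub>R (v x * bump (real (Suc n)) a b x))"
      proof
        fix x show "?g n x = indicat_real \<Omega> x *\<^sub>R (v x * bump (real (Suc n)) a b x)"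
        proof (cases "x \<in> box a b")
          case True
          then have "x \<in> cbox a b" "x \<in> \<Omega>" using ab box_subset_cbox by blast+
          then show ?thesis by simp
        next
          case False then show ?thesis by (simp add: bump_0)
        qed
      qed
      then show ?thesis using z[OF bump_test[OF _ ab, of "real (Suc n)"]]
        unfolding set_lebesgue_integral_def by simp
    qed
    moreover have "(\<lambda>x. (indicat_real (cbox a b) x * v x) * indicator (box a b) x) = (\<lambda>x. indicat_real (box a b) x * v x)"
      using box_subset_cbox[of a b] by (auto simp: indicator_def fun_eq_iff)
    ultimately show ?thesis by (simp add: LIMSEQ_const_iff)
  qed
  have cb: "AE x in lebesgue. x \<in> X \<longrightarrow> v x = 0" if X: "X = cbox a b" "X \<subseteq> \<Omega>" for X a b
  proof -
    have ab: "cbox a b \<subseteq> \<Omega>" using X by simp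
    have "AE x in lebesgue. indicat_real (box a b) x * v x = 0"
    proof (rule integral_zero_on_boxes_AE)
      have "integrable lebesgue (\<lambda>x. indicat_real (box a b) x *\<^sub>R (indicat_real (cbox a b) x * v x))"
        by (intro integrable_mult_indicator vb[OF ab]) simp
      moreover have "(\<lambda>x. indicat_real (box a b) x *\<^sub>R (indicat_real (cbox a b) x * v x)) = (\<lambda>x. indicat_real (box a b) x * v x)"
        using box_subset_cbox[of a b] by (auto simp: indicator_def fun_eq_iff)
      ultimately show "integrable lebesgue (\<lambda>x. indicat_real (box a b) x * v x)" by metis
      show "(LINT x|lebesgue. indicat_real (box a b) x * v x) = 0" by (rule box0[OF ab])
      \<comment> \<open>The box that is tested need not lie in \<Omega>, but its intersection with
        \<open>box a b\<close> is a box whose closure does.\<close>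
      fix c d :: "real^'n"
      obtain e f where ef: "box a b \<inter> box c d = box e f" "cbox a b \<inter> cbox c d = cbox e f"
        using box_Int_box[of a b c d] Int_interval[of a b c d] by blast
      have "cbox e f \<subseteq> \<Omega>" using ef ab by blast
      from box0[OF this] have "(LINT x|lebesgue. indicat_real (box e f) x * v x) = 0" .
      moreover have "(\<lambda>x. indicat_real (box c d) x *\<^sub>R (indicat_real (box a b) x * v x)) = (\<lambda>x. indicat_real (box e f) x * v x)"
        unfolding ef(1)[symmetric] by (auto simp: indicator_def)
      ultimately show "(LINT x:box c d|lebesgue. indicat_real (box a b) x * v x) = 0"
        unfolding set_lebesgue_integral_def by metis
    qed
    \<comment> \<open>The integrals vanish over open boxes while the cover consists of closed ones;
      the faces are null sets.\<close>
    moreover have "AE x in lebesgue. x \<notin> cbox a b - box a b"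
      using negligible_frontier_interval[of a b] by (intro AE_not_in) (simp add: negligible_iff_null_sets)
    ultimately show ?thesis unfolding X(1) by eventually_elim (auto simp: indicator_def split: if_splits)
  qed
  obtain \<D> where \<D>: "countable \<D>" "\<D> \<subseteq> Pow \<Omega>" "\<And>X. X \<in> \<D> \<Longrightarrow> \<exists>a b. X = cbox a b" "\<Union>\<D> = \<Omega>"
    using open_countable_Union_open_cbox[OF \<Omega>] by blast
  have "AE x in lebesgue. \<forall>X\<in>\<D>. x \<in> X \<longrightarrow> v x = 0"
  proof (rule AE_ball_countable'[OF _ \<D>(1)])
    fix X assume "X \<in> \<D>"
    then obtain a b where "X = cbox a b" "X \<subseteq> \<Omega>" using \<D> by blast
    then show "AE x in lebesgue. x \<in> X \<longrightarrow> v x = 0" by (rule cb)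
  qed
  then have "AE x in lebesgue. x \<in> \<Omega> \<longrightarrow> v x = 0" by eventually_elim (use \<D>(4) in blast)
  then show ?thesis using \<Omega>s by (simp add: AE_lebesgue_on)
qed

lemma has_weak_deriv_unique:
  fixes \<Omega> :: "(real^'n::finite) set"
  assumes \<Omega>: "open \<Omega>" and v: "has_weak_deriv \<Omega> \<sigma> u v" and w: "has_weak_deriv \<Omega> \<sigma> u w"
  shows "AE x in lebesgue_on \<Omega>. v x = w x"
proof -
  have \<Omega>s: "\<Omega> \<in> sets lebesgue" using \<Omega> by (rule open_sets_lebesgue)
  have l: "loc_integrable \<Omega> v" "loc_integrable \<Omega> w" using v w by (auto simp: has_weak_deriv_def)
  have "AE x in lebesgue_on \<Omega>. v x - w x = 0"
  proof (rule weak_zero_AE[OF \<Omega>])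
    show "loc_integrable \<Omega> (\<lambda>x. v x - w x)" unfolding loc_integrable_def
    proof (intro allI impI set_integral_diff(1))
      fix K assume "compact K \<and> K \<subseteq> \<Omega>"
      then show "set_integrable lebesgue K v" "set_integrable lebesgue K w" using l by (simp_all add: loc_integrable_def)
    qed
    fix f assume f: "f \<in> test_functions \<Omega>"
    have "(LINT x:\<Omega>|lebesgue. v x * f x) = (LINT x:\<Omega>|lebesgue. w x * f x)"
    proof -
      have "(-1) ^ mlen \<sigma> * (LINT x:\<Omega>|lebesgue. v x * f x) = (-1) ^ mlen \<sigma> * (LINT x:\<Omega>|lebesgue. w x * f x)"
        using v w f unfolding has_weak_deriv_def by simp
      then show ?thesis by simp
    qed
    then show "(LINT x:\<Omega>|lebesgue. (v x - w x) * f x) = 0"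
      using loc_integrable_test[OF l(1) f \<Omega>s] loc_integrable_test[OF l(2) f \<Omega>s]
      by (simp add: set_integral_lebesgue_on[OF \<Omega>s] left_diff_distrib)
  qed
  then show ?thesis by eventually_elim simp
qed

lemma wderiv_weak_deriv:
  "has_weak_deriv \<Omega> \<sigma> u v \<Longrightarrow> has_weak_deriv \<Omega> \<sigma> u (wderiv \<Omega> \<sigma> u)"
  unfolding wderiv_def by (rule someI[of "has_weak_deriv \<Omega> \<sigma> u"])

lemma wderiv_AE:
  "open \<Omega> \<Longrightarrow> has_weak_deriv \<Omega> \<sigma> u v \<Longrightarrow> AE x in lebesgue_on \<Omega>. wderiv \<Omega> \<sigma> u x = v x"
  using has_weak_deriv_unique wderiv_weak_deriv by blast

lemma has_weak_deriv_restrict: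
  fixes \<Omega> :: "(real^'n::finite) set"
  assumes "has_weak_deriv \<Omega> \<sigma> u v" "\<Omega>' \<subseteq> \<Omega>"
  shows "has_weak_deriv \<Omega>' \<sigma> u v"
  unfolding has_weak_deriv_def
proof (intro conjI ballI)
  show "loc_integrable \<Omega>' u" "loc_integrable \<Omega>' v"
    using assms unfolding has_weak_deriv_def loc_integrable_def by blast+
  fix f assume f: "f \<in> test_functions \<Omega>'"
  then have f': "f \<in> test_functions \<Omega>" by (rule test_mono[OF assms(2)])
  show "(LINT x:\<Omega>'|lebesgue. u x * mderiv \<sigma> f x) = (-1) ^ mlen \<sigma> * (LINT x:\<Omega>'|lebesgue. v x * f x)"
  proof -
    have "(LINT x:\<Omega>|lebesgue. u x * mderiv \<sigma> f x) = (-1) ^ mlen \<sigma> * (LINT x:\<Omega>|lebesgue. v x * f x)"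
      using assms(1) f' unfolding has_weak_deriv_def by blast
    then show ?thesis
      unfolding set_integral_test[OF f] set_integral_test[OF f'] set_integral_test[OF test_mderiv[OF f]]
        set_integral_test[OF test_mderiv[OF f']] .
  qed
qed

lemma test_sqint:
  assumes "f \<in> test_functions \<Omega>" "S \<in> sets lebesgue"
  shows "f \<in> sqint (lebesgue_on S)"
proof -
  have "f \<in> borel_measurable lebesgue"
    using smooth_measurable[OF test_smooth[OF assms(1)]] by (simp add: measurable_completion)
  moreover have "integrable lebesgue (\<lambda>x. (f x)\<^sup>2)"
    using test_integrable[OF test_mult[OF test_smooth[OF assms(1)] assms(1)]] by (simp add: power2_eq_square)
  ultimately have "f \<in> sqint (lebesgue_on UNIV)" by (simp add: sqint_def lebesgue_on_UNIV_eq)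
  then show ?thesis by (rule sqint_subset) (use assms in auto)
qed

section \<open>Approximation by test functions\<close>

text \<open>A presentation of an element of \<open>H0k\<close> by approximants and by the L2 limits
  \<open>v \<sigma>\<close> of their derivatives. That these limits are weak derivatives of one
  function is a consequence and not part of the definition.\<close>

definition sob_seq :: "nat \<Rightarrow> (real^'n::finite) set \<Rightarrow> (nat \<Rightarrow> real^'n \<Rightarrow> real) \<Rightarrow> ('n midx \<Rightarrow> real^'n \<Rightarrow> real) \<Rightarrow> bool" where
  "sob_seq k \<Omega> f v \<longleftrightarrow> (\<forall>n. f n \<in> test_functions \<Omega>) \<and>
     (\<forall>\<sigma>. mlen \<sigma> \<le> k \<longrightarrow> L2_limit (lebesgue_on \<Omega>) (\<lambda>n. mderiv \<sigma> (f n)) (v \<sigma>))"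

lemma mlen_0: "mlen (\<lambda>_. 0) = 0"
  by (simp add: mlen_eq_0_iff)

text \<open>Integration by parts holds for every smooth approximant, and both of its sides are
  continuous in L2.\<close>

lemma sob_seq_weak_deriv:
  fixes \<Omega> :: "(real^'n::finite) set"
  assumes \<Omega>: "open \<Omega>" and s: "sob_seq k \<Omega> f v" and u: "u \<in> L2 \<Omega>"
    and ae: "AE x in lebesgue_on \<Omega>. u x = v (\<lambda>_. 0) x" and \<sigma>: "mlen \<sigma> \<le> k"
  shows "has_weak_deriv \<Omega> \<sigma> u (v \<sigma>)"
proof -
  have \<Omega>s: "\<Omega> \<in> sets lebesgue" using \<Omega> by (rule open_sets_lebesgue)
  have us: "u \<in> sqint (lebesgue_on \<Omega>)" using u L2_sqint[OF \<Omega>s] by simp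
  have lim: "L2_limit (lebesgue_on \<Omega>) (\<lambda>n. mderiv \<sigma> (f n)) (v \<sigma>)" using s \<sigma> by (simp add: sob_seq_def)
  have "L2_limit (lebesgue_on \<Omega>) (\<lambda>n. mderiv (\<lambda>_. 0) (f n)) (v (\<lambda>_. 0))"
    using s[unfolded sob_seq_def, THEN conjunct2, rule_format, of "\<lambda>_. 0"] by (simp add: mlen_0)
  then have lim0: "L2_limit (lebesgue_on \<Omega>) f (v (\<lambda>_. 0))" by (simp add: mderiv_0)
  have vs: "v \<sigma> \<in> sqint (lebesgue_on \<Omega>)" "v (\<lambda>_. 0) \<in> sqint (lebesgue_on \<Omega>)"
    using lim lim0 by (auto simp: L2_limit_def)
  show ?thesis unfolding has_weak_deriv_def
  proof (intro conjI ballI sqint_loc_integrable us vs \<Omega>s)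
    fix g assume g: "g \<in> test_functions \<Omega>"
    have 1: "(\<lambda>n. LINT x|lebesgue_on \<Omega>. f n x * mderiv \<sigma> g x) \<longlonglongrightarrow> (LINT x|lebesgue_on \<Omega>. v (\<lambda>_. 0) x * mderiv \<sigma> g x)"
      by (rule L2_limit_inner_left[OF lim0 test_sqint[OF test_mderiv[OF g] \<Omega>s]])
    have 2: "(\<lambda>n. (-1) ^ mlen \<sigma> * (LINT x|lebesgue_on \<Omega>. mderiv \<sigma> (f n) x * g x))
        \<longlonglongrightarrow> (-1) ^ mlen \<sigma> * (LINT x|lebesgue_on \<Omega>. v \<sigma> x * g x)"
      by (intro tendsto_mult tendsto_const L2_limit_inner_left[OF lim test_sqint[OF g \<Omega>s]])
    have eq: "(LINT x|lebesgue_on \<Omega>. f n x * mderiv \<sigma> g x) = (-1) ^ mlen \<sigma> * (LINT x|lebesgue_on \<Omega>. mderiv \<sigma> (f n) x * g x)" for n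
      using integral_by_parts[OF g, of "f n" \<sigma>] s test_smooth by (auto simp: sob_seq_def set_integral_lebesgue_on[OF \<Omega>s])
    have "(LINT x|lebesgue_on \<Omega>. v (\<lambda>_. 0) x * mderiv \<sigma> g x) = (-1) ^ mlen \<sigma> * (LINT x|lebesgue_on \<Omega>. v \<sigma> x * g x)"
      using LIMSEQ_unique[OF 1[unfolded eq] 2] .
    moreover have "(LINT x|lebesgue_on \<Omega>. u x * mderiv \<sigma> g x) = (LINT x|lebesgue_on \<Omega>. v (\<lambda>_. 0) x * mderiv \<sigma> g x)"
    proof (rule integral_cong_AE)
      show "AE x in lebesgue_on \<Omega>. u x * mderiv \<sigma> g x = v (\<lambda>_. 0) x * mderiv \<sigma> g x"
        using ae by eventually_elim simp
      have gm: "mderiv \<sigma> g \<in> borel_measurable (lebesgue_on \<Omega>)"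
        by (rule sqint_measurable[OF test_sqint[OF test_mderiv[OF g] \<Omega>s]])
      show "(\<lambda>x. u x * mderiv \<sigma> g x) \<in> borel_measurable (lebesgue_on \<Omega>)"
        "(\<lambda>x. v (\<lambda>_. 0) x * mderiv \<sigma> g x) \<in> borel_measurable (lebesgue_on \<Omega>)"
        by (rule borel_measurable_times[OF sqint_measurable[OF us] gm],
            rule borel_measurable_times[OF sqint_measurable[OF vs(2)] gm])
    qed
    ultimately show "(LINT x:\<Omega>|lebesgue. u x * mderiv \<sigma> g x) = (-1) ^ mlen \<sigma> * (LINT x:\<Omega>|lebesgue. v \<sigma> x * g x)"
      by (simp add: set_integral_lebesgue_on[OF \<Omega>s])
  qed
qed

text \<open>The general way into \<open>H0k\<close>: approximants and limits of their derivatives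
  yield membership and, at the same time, the weak derivatives almost everywhere.\<close>

lemma sob_seq_H0k:
  fixes \<Omega> :: "(real^'n::finite) set"
  assumes \<Omega>: "open \<Omega>" and s: "sob_seq k \<Omega> f v" and u: "u \<in> L2 \<Omega>"
    and ae: "AE x in lebesgue_on \<Omega>. u x = v (\<lambda>_. 0) x"
  shows "u \<in> H0k k \<Omega>" and "mlen \<sigma> \<le> k \<Longrightarrow> AE x in lebesgue_on \<Omega>. wderiv \<Omega> \<sigma> u x = v \<sigma> x"
proof -
  have \<Omega>s: "\<Omega> \<in> sets lebesgue" using \<Omega> by (rule open_sets_lebesgue)
  have wd: "has_weak_deriv \<Omega> \<sigma> u (v \<sigma>)" if "mlen \<sigma> \<le> k" for \<sigma>
    by (rule sob_seq_weak_deriv[OF assms that])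
  have vL: "v \<sigma> \<in> L2 \<Omega>" if "mlen \<sigma> \<le> k" for \<sigma>
    using s that by (auto simp: sob_seq_def L2_limit_def L2_sqint[OF \<Omega>s])
  have w: "AE x in lebesgue_on \<Omega>. wderiv \<Omega> \<sigma> u x = v \<sigma> x" if "mlen \<sigma> \<le> k" for \<sigma>
    by (rule wderiv_AE[OF \<Omega> wd[OF that]])
  then show "mlen \<sigma> \<le> k \<Longrightarrow> AE x in lebesgue_on \<Omega>. wderiv \<Omega> \<sigma> u x = v \<sigma> x" .
  have "u \<in> Hk k \<Omega>" using u wd vL by (auto simp: Hk_def)
  moreover have "(\<lambda>n. \<Sum>\<sigma> | mlen \<sigma> \<le> k. LINT x:\<Omega>|lebesgue. (wderiv \<Omega> \<sigma> u x - mderiv \<sigma> (f n) x)\<^sup>2) \<longlonglongrightarrow> (\<Sum>\<sigma>::'n midx | mlen \<sigma> \<le> k. 0)"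
  proof (rule tendsto_sum)
    fix \<sigma> :: "'n midx" assume "\<sigma> \<in> {\<sigma>. mlen \<sigma> \<le> k}"
    then have \<sigma>: "mlen \<sigma> \<le> k" by simp
    have lim: "L2_limit (lebesgue_on \<Omega>) (\<lambda>n. mderiv \<sigma> (f n)) (v \<sigma>)" using s \<sigma> by (simp add: sob_seq_def)
    have "(LINT x:\<Omega>|lebesgue. (wderiv \<Omega> \<sigma> u x - mderiv \<sigma> (f n) x)\<^sup>2) = (LINT x|lebesgue_on \<Omega>. (v \<sigma> x - mderiv \<sigma> (f n) x)\<^sup>2)" for n
      unfolding set_integral_lebesgue_on[OF \<Omega>s]
    proof (rule integral_cong_AE)
      have vm: "v \<sigma> \<in> borel_measurable (lebesgue_on \<Omega>)" "mderiv \<sigma> (f n) \<in> borel_measurable (lebesgue_on \<Omega>)"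
        using lim by (auto simp: L2_limit_def intro: sqint_measurable)
      have "AE x in lebesgue_on \<Omega>. v \<sigma> x = wderiv \<Omega> \<sigma> u x" using w[OF \<sigma>] by eventually_elim simp
      from measurable_AE_lebesgue_on[OF vm(1) \<Omega>s this]
      have wm: "wderiv \<Omega> \<sigma> u \<in> borel_measurable (lebesgue_on \<Omega>)" .
      show "(\<lambda>x. (wderiv \<Omega> \<sigma> u x - mderiv \<sigma> (f n) x)\<^sup>2) \<in> borel_measurable (lebesgue_on \<Omega>)"
        "(\<lambda>x. (v \<sigma> x - mderiv \<sigma> (f n) x)\<^sup>2) \<in> borel_measurable (lebesgue_on \<Omega>)"
        using vm wm by (auto intro!: borel_measurable_power borel_measurable_diff)
      show "AE x in lebesgue_on \<Omega>. (wderiv \<Omega> \<sigma> u x - mderiv \<sigma> (f n) x)\<^sup>2 = (v \<sigma> x - mderiv \<sigma> (f n) x)\<^sup>2"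
        using w[OF \<sigma>] by eventually_elim simp
    qed
    then show "(\<lambda>n. LINT x:\<Omega>|lebesgue. (wderiv \<Omega> \<sigma> u x - mderiv \<sigma> (f n) x)\<^sup>2) \<longlonglongrightarrow> 0"
      using lim by (simp add: L2_limit_def)
  qed
  ultimately show "u \<in> H0k k \<Omega>" using s by (auto simp: H0k_def sob_seq_def intro!: exI[of _ f])
qed

lemma H0k_sob_seq:
  fixes \<Omega> :: "(real^'n::finite) set"
  assumes \<Omega>: "open \<Omega>" and u: "u \<in> H0k k \<Omega>"
  shows "u \<in> sqint (lebesgue_on \<Omega>)"
    and "mlen \<sigma> \<le> k \<Longrightarrow> wderiv \<Omega> \<sigma> u \<in> sqint (lebesgue_on \<Omega>)"
    and "mlen \<sigma> \<le> k \<Longrightarrow> has_weak_deriv \<Omega> \<sigma> u (wderiv \<Omega> \<sigma> u)"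
    and "AE x in lebesgue_on \<Omega>. u x = wderiv \<Omega> (\<lambda>_. 0) u x"
    and "\<exists>f. sob_seq k \<Omega> f (\<lambda>\<sigma>. wderiv \<Omega> \<sigma> u)"
proof -
  have \<Omega>s: "\<Omega> \<in> sets lebesgue" using \<Omega> by (rule open_sets_lebesgue)
  have uH: "u \<in> Hk k \<Omega>" using u by (simp add: H0k_def)
  show us: "u \<in> sqint (lebesgue_on \<Omega>)" using uH by (simp add: Hk_def L2_sqint[OF \<Omega>s])
  have wd: "wderiv \<Omega> \<sigma> u \<in> sqint (lebesgue_on \<Omega>)" "has_weak_deriv \<Omega> \<sigma> u (wderiv \<Omega> \<sigma> u)"
    if "mlen \<sigma> \<le> k" for \<sigma>
  proof -
    have "\<exists>v\<in>L2 \<Omega>. has_weak_deriv \<Omega> \<sigma> u v" using uH that by (simp add: Hk_def)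
    then obtain v where v: "v \<in> L2 \<Omega>" "has_weak_deriv \<Omega> \<sigma> u v" by blast
    then show "has_weak_deriv \<Omega> \<sigma> u (wderiv \<Omega> \<sigma> u)" by (intro wderiv_weak_deriv)
    have "AE x in lebesgue_on \<Omega>. v x = wderiv \<Omega> \<sigma> u x"
      using wderiv_AE[OF \<Omega> v(2)] by eventually_elim simp
    from sqint_AE[OF _ \<Omega>s this] show "wderiv \<Omega> \<sigma> u \<in> sqint (lebesgue_on \<Omega>)"
      using v(1) L2_sqint[OF \<Omega>s] by simp
  qed
  show "mlen \<sigma> \<le> k \<Longrightarrow> wderiv \<Omega> \<sigma> u \<in> sqint (lebesgue_on \<Omega>)"
    "mlen \<sigma> \<le> k \<Longrightarrow> has_weak_deriv \<Omega> \<sigma> u (wderiv \<Omega> \<sigma> u)" using wd by blast+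
  \<comment> \<open>Even the derivative of order 0 is a chosen representative, so it agrees with u
    only almost everywhere.\<close>
  have "has_weak_deriv \<Omega> (\<lambda>_. 0) u u"
    unfolding has_weak_deriv_def using sqint_loc_integrable[OF us \<Omega>s] by (simp add: mderiv_0 mlen_0)
  then show "AE x in lebesgue_on \<Omega>. u x = wderiv \<Omega> (\<lambda>_. 0) u x"
    by (rule has_weak_deriv_unique[OF \<Omega>]) (rule wd(2), simp add: mlen_0)
  obtain f where f: "\<And>n. f n \<in> test_functions \<Omega>" and
    lim: "(\<lambda>n. \<Sum>\<sigma> | mlen \<sigma> \<le> k. LINT x:\<Omega>|lebesgue. (wderiv \<Omega> \<sigma> u x - mderiv \<sigma> (f n) x)\<^sup>2) \<longlonglongrightarrow> 0"
    using u unfolding H0k_def by blast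
  have "sob_seq k \<Omega> f (\<lambda>\<sigma>. wderiv \<Omega> \<sigma> u)" unfolding sob_seq_def L2_limit_def
  proof (intro conjI allI impI f wd(1) test_sqint[OF test_mderiv[OF f] \<Omega>s])
    fix \<sigma> :: "'n midx" assume \<sigma>: "mlen \<sigma> \<le> k"
    have nn: "0 \<le> (LINT x:\<Omega>|lebesgue. (wderiv \<Omega> \<sigma> u x - mderiv \<sigma> (f n) x)\<^sup>2)" for \<sigma> n
      unfolding set_integral_lebesgue_on[OF \<Omega>s] by simp
    have "(LINT x|lebesgue_on \<Omega>. (wderiv \<Omega> \<sigma> u x - mderiv \<sigma> (f n) x)\<^sup>2)
        \<le> (\<Sum>\<sigma> | mlen \<sigma> \<le> k. LINT x:\<Omega>|lebesgue. (wderiv \<Omega> \<sigma> u x - mderiv \<sigma> (f n) x)\<^sup>2)" for n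
      unfolding set_integral_lebesgue_on[OF \<Omega>s, symmetric]
      by (rule member_le_sum) (use \<sigma> nn finite_mlen_le in auto)
    then show "(\<lambda>n. LINT x|lebesgue_on \<Omega>. (wderiv \<Omega> \<sigma> u x - mderiv \<sigma> (f n) x)\<^sup>2) \<longlonglongrightarrow> 0"
      by (intro tendsto_sandwich[OF _ _ tendsto_const lim]) auto
  qed
  then show "\<exists>f. sob_seq k \<Omega> f (\<lambda>\<sigma>. wderiv \<Omega> \<sigma> u)" by blast
qed

section \<open>Test functions, linear combinations and smooth multiples in
  \<open>H0k\<close>\<close>

lemma test_sob_seq:
  assumes "f \<in> test_functions \<Omega>" "open \<Omega>"
  shows "sob_seq k \<Omega> (\<lambda>n. f) (\<lambda>\<sigma>. mderiv \<sigma> f)"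
  using assms by (auto simp: sob_seq_def intro!: L2_limit_const test_sqint test_mderiv open_sets_lebesgue)

lemma test_H0k:
  fixes \<Omega> :: "(real^'n::finite) set"
  assumes f: "f \<in> test_functions \<Omega>" and \<Omega>: "open \<Omega>"
  shows "f \<in> H0k k \<Omega>" and "mlen \<sigma> \<le> k \<Longrightarrow> AE x in lebesgue_on \<Omega>. wderiv \<Omega> \<sigma> f x = mderiv \<sigma> f x"
proof -
  have "f \<in> L2 \<Omega>" using test_sqint[OF f open_sets_lebesgue[OF \<Omega>]] L2_sqint[OF open_sets_lebesgue[OF \<Omega>]] by simp
  from sob_seq_H0k[OF \<Omega> test_sob_seq[OF f \<Omega>] this]
  show "f \<in> H0k k \<Omega>" "mlen \<sigma> \<le> k \<Longrightarrow> AE x in lebesgue_on \<Omega>. wderiv \<Omega> \<sigma> f x = mderiv \<sigma> f x"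
    by (auto simp: mderiv_0)
qed

lemma H0k_add_cmult:
  fixes \<Omega> :: "(real^'n::finite) set"
  assumes \<Omega>: "open \<Omega>" and u: "u \<in> H0k k \<Omega>" and v: "v \<in> H0k k \<Omega>"
  shows "(\<lambda>x. u x + t * v x) \<in> H0k k \<Omega>"
    and "mlen \<sigma> \<le> k \<Longrightarrow>
      AE x in lebesgue_on \<Omega>. wderiv \<Omega> \<sigma> (\<lambda>x. u x + t * v x) x = wderiv \<Omega> \<sigma> u x + t * wderiv \<Omega> \<sigma> v x"
proof -
  obtain f where f: "sob_seq k \<Omega> f (\<lambda>\<sigma>. wderiv \<Omega> \<sigma> u)" using H0k_sob_seq(5)[OF \<Omega> u] by blast
  obtain g where g: "sob_seq k \<Omega> g (\<lambda>\<sigma>. wderiv \<Omega> \<sigma> v)" using H0k_sob_seq(5)[OF \<Omega> v] by blast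
  have sm: "smooth (f n)" "smooth (g n)" for n using f g by (auto simp: sob_seq_def dest: test_smooth)
  have s: "sob_seq k \<Omega> (\<lambda>n x. f n x + t * g n x) (\<lambda>\<sigma> x. wderiv \<Omega> \<sigma> u x + t * wderiv \<Omega> \<sigma> v x)"
    using f g unfolding sob_seq_def
    by (auto simp: mderiv_add mderiv_cmult smooth_cmult sm intro!: test_add test_cmult L2_limit_add L2_limit_cmult)
  have L: "(\<lambda>x. u x + t * v x) \<in> L2 \<Omega>" using H0k_sob_seq(1)[OF \<Omega>] u v
    by (auto simp: L2_sqint[OF open_sets_lebesgue[OF \<Omega>]] intro!: sqint_add sqint_cmult)
  have ae: "AE x in lebesgue_on \<Omega>. u x + t * v x = wderiv \<Omega> (\<lambda>_. 0) u x + t * wderiv \<Omega> (\<lambda>_. 0) v x"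
    using H0k_sob_seq(4)[OF \<Omega> u] H0k_sob_seq(4)[OF \<Omega> v] by eventually_elim simp
  show "(\<lambda>x. u x + t * v x) \<in> H0k k \<Omega>" by (rule sob_seq_H0k(1)[OF \<Omega> s L ae])
  show "mlen \<sigma> \<le> k \<Longrightarrow>
      AE x in lebesgue_on \<Omega>. wderiv \<Omega> \<sigma> (\<lambda>x. u x + t * v x) x = wderiv \<Omega> \<sigma> u x + t * wderiv \<Omega> \<sigma> v x"
    by (rule sob_seq_H0k(2)[OF \<Omega> s L ae])
qed

text \<open>The Leibniz rule for the approximants survives the L2 limit because the derivatives of
  \<eta> up to order k are bounded. The bound may depend on the list, so \<eta> itself and its
  proper derivatives can have different ones.\<close>

lemma H0k_mult_smooth:
  fixes \<Omega> :: "(real^'n::finite) set"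
  assumes \<Omega>: "open \<Omega>" and u: "u \<in> H0k k \<Omega>" and \<eta>: "smooth \<eta>"
    and B: "\<And>xs x. length xs \<le> k \<Longrightarrow> \<bar>foldr pd xs \<eta> x\<bar> \<le> B xs"
  shows "(\<lambda>x. \<eta> x * u x) \<in> H0k k \<Omega>"
    and "mlen \<sigma> \<le> k \<Longrightarrow> AE x in lebesgue_on \<Omega>. wderiv \<Omega> \<sigma> (\<lambda>x. \<eta> x * u x) x =
      (\<Sum>(ys, zs)\<leftarrow>splits (mlist \<sigma>). foldr pd ys \<eta> x * wderiv \<Omega> (count_list zs) u x)"
proof -
  have \<Omega>s: "\<Omega> \<in> sets lebesgue" using \<Omega> by (rule open_sets_lebesgue)
  obtain f where f: "sob_seq k \<Omega> f (\<lambda>\<sigma>. wderiv \<Omega> \<sigma> u)" using H0k_sob_seq(5)[OF \<Omega> u] by blast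
  have sm: "smooth (f n)" for n using f by (auto simp: sob_seq_def dest: test_smooth)
  have meas: "foldr pd xs \<eta> \<in> borel_measurable (lebesgue_on \<Omega>)" for xs
    using smooth_measurable[OF smooth_foldr[OF \<eta>]]
    by (intro measurable_restrict_space1) (simp add: measurable_completion)
  let ?v = "\<lambda>\<sigma> x. \<Sum>(ys, zs)\<leftarrow>splits (mlist \<sigma>). foldr pd ys \<eta> x * wderiv \<Omega> (count_list zs) u x"
  have s: "sob_seq k \<Omega> (\<lambda>n x. \<eta> x * f n x) ?v" unfolding sob_seq_def
  proof (intro conjI allI impI)
    show "(\<lambda>x. \<eta> x * f n x) \<in> test_functions \<Omega>" for n using f by (auto simp: sob_seq_def intro: test_mult[OF \<eta>])
    fix \<sigma> :: "'n midx" assume \<sigma>: "mlen \<sigma> \<le> k"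
    have "mderiv \<sigma> (\<lambda>x. \<eta> x * f n x) = (\<lambda>x. \<Sum>p\<leftarrow>splits (mlist \<sigma>). foldr pd (fst p) \<eta> x * mderiv (count_list (snd p)) (f n) x)" for n
      unfolding mderiv_mlist[of \<sigma>] foldr_pd_mult[OF \<eta> sm] by (simp add: mderiv_count_list[OF sm] case_prod_unfold)
    moreover have "L2_limit (lebesgue_on \<Omega>)
       (\<lambda>n x. \<Sum>p\<leftarrow>splits (mlist \<sigma>). foldr pd (fst p) \<eta> x * mderiv (count_list (snd p)) (f n) x)
       (\<lambda>x. \<Sum>p\<leftarrow>splits (mlist \<sigma>). foldr pd (fst p) \<eta> x * wderiv \<Omega> (count_list (snd p)) u x)"
    proof (rule L2_limit_sum_list)
      fix p assume "p \<in> set (splits (mlist \<sigma>))"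
      then have len: "length (fst p) + length (snd p) = mlen \<sigma>"
        using splits_length[of "fst p" "snd p"] by (simp add: length_mlist)
      show "L2_limit (lebesgue_on \<Omega>) (\<lambda>n x. foldr pd (fst p) \<eta> x * mderiv (count_list (snd p)) (f n) x)
         (\<lambda>x. foldr pd (fst p) \<eta> x * wderiv \<Omega> (count_list (snd p)) u x)"
      proof (rule L2_limit_bounded_mult[OF _ meas])
        show "L2_limit (lebesgue_on \<Omega>) (\<lambda>n. mderiv (count_list (snd p)) (f n)) (wderiv \<Omega> (count_list (snd p)) u)"
          using f len \<sigma> by (auto simp: sob_seq_def mlen_count_list)
        show "\<bar>foldr pd (fst p) \<eta> x\<bar> \<le> B (fst p)" for x by (rule B) (use len \<sigma> in simp)
      qed
    qed
    ultimately show "L2_limit (lebesgue_on \<Omega>) (\<lambda>n. mderiv \<sigma> (\<lambda>x. \<eta> x * f n x)) (?v \<sigma>)"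
      by (simp add: case_prod_unfold)
  qed
  have L: "(\<lambda>x. \<eta> x * u x) \<in> L2 \<Omega>"
    unfolding L2_sqint[OF \<Omega>s] using H0k_sob_seq(1)[OF \<Omega> u] meas[of "[]"] B[of "[]"]
    by (intro sqint_bounded_mult[of _ _ _ "B []"]) auto
  have "mlist (\<lambda>_::'n. 0) = []" using length_mlist[of "\<lambda>_::'n. 0"] by (simp add: mlen_0)
  moreover have "count_list [] = (\<lambda>_::'n. 0)" by (simp add: fun_eq_iff)
  ultimately have v0: "?v (\<lambda>_. 0) x = \<eta> x * wderiv \<Omega> (\<lambda>_. 0) u x" for x by simp
  have ae: "AE x in lebesgue_on \<Omega>. \<eta> x * u x = ?v (\<lambda>_. 0) x"
    unfolding v0 using H0k_sob_seq(4)[OF \<Omega> u] by eventually_elim simp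
  show "(\<lambda>x. \<eta> x * u x) \<in> H0k k \<Omega>" by (rule sob_seq_H0k(1)[OF \<Omega> s L ae])
  show "mlen \<sigma> \<le> k \<Longrightarrow> AE x in lebesgue_on \<Omega>. wderiv \<Omega> \<sigma> (\<lambda>x. \<eta> x * u x) x = ?v \<sigma> x"
    by (rule sob_seq_H0k(2)[OF \<Omega> s L ae])
qed

lemma wderiv_restrict:
  fixes \<Omega> :: "(real^'n::finite) set"
  assumes "open \<Omega>" "open \<Omega>'" "\<Omega>' \<subseteq> \<Omega>" "u \<in> H0k k \<Omega>" "mlen \<sigma> \<le> k"
  shows "AE x in lebesgue_on \<Omega>'. wderiv \<Omega>' \<sigma> u x = wderiv \<Omega> \<sigma> u x"
  by (rule wderiv_AE[OF assms(2) has_weak_deriv_restrict[OF H0k_sob_seq(3)[OF assms(1,4,5)] assms(3)]])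

section \<open>Quadratic forms\<close>

lemma nonneg_quadratic_imp_zero:
  assumes "\<And>s::real. 0 \<le> 2 * s * A + s\<^sup>2 * C"
  shows "A = 0"
proof (rule ccontr)
  assume A: "A \<noteq> 0"
  \<comment> \<open>A positive number above C, so that s = -A/c makes sense and makes the enlarged
    quadratic negative whatever the sign of C.\<close>
  obtain c where c: "c > 0" "C \<le> c" by (rule that[of "\<bar>C\<bar> + 1"]) auto
  have "0 \<le> 2 * (- A / c) * A + (- A / c)\<^sup>2 * C" by (rule assms)
  also have "\<dots> \<le> 2 * (- A / c) * A + (- A / c)\<^sup>2 * c"
    using c by (intro add_left_mono mult_left_mono) auto
  also have "\<dots> = - (A\<^sup>2 / c)" using c(1) by (simp add: power2_eq_square field_simps)
  finally have "A\<^sup>2 / c \<le> 0" by simp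
  moreover have "A\<^sup>2 / c > 0" using A c(1) by simp
  ultimately show False by simp
qed

text \<open>The polar form of \<open>quad_form\<close>. It is what the first variation of the energy
  produces when \<open>a \<sigma> \<gamma>\<close> and \<open>a \<gamma> \<sigma>\<close>
  differ.\<close>

definition sym_form :: "('n::finite midx) set \<Rightarrow> ('n midx \<Rightarrow> 'n midx \<Rightarrow> real^'n \<Rightarrow> real)
    \<Rightarrow> real^'n \<Rightarrow> ('n midx \<Rightarrow> real) \<Rightarrow> ('n midx \<Rightarrow> real) \<Rightarrow> real" where
  "sym_form I a x \<zeta> \<xi> = (\<Sum>\<sigma>\<in>I. \<Sum>\<gamma>\<in>I. (a \<sigma> \<gamma> x + a \<gamma> \<sigma> x) / 2 * \<zeta> \<sigma> * \<xi> \<gamma>)"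

lemma sym_form_alt:
  "sym_form I a x \<zeta> \<xi> = ((\<Sum>\<sigma>\<in>I. \<Sum>\<gamma>\<in>I. a \<sigma> \<gamma> x * \<zeta> \<sigma> * \<xi> \<gamma>) + (\<Sum>\<sigma>\<in>I. \<Sum>\<gamma>\<in>I. a \<sigma> \<gamma> x * \<xi> \<sigma> * \<zeta> \<gamma>)) / 2"
proof -
  have "sym_form I a x \<zeta> \<xi> = (\<Sum>\<sigma>\<in>I. \<Sum>\<gamma>\<in>I. a \<sigma> \<gamma> x * \<zeta> \<sigma> * \<xi> \<gamma>) / 2 + (\<Sum>\<sigma>\<in>I. \<Sum>\<gamma>\<in>I. a \<gamma> \<sigma> x * \<zeta> \<sigma> * \<xi> \<gamma>) / 2"
    unfolding sym_form_def sum_divide_distrib sum.distrib[symmetric]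
    by (intro sum.cong refl) (simp add: field_simps)
  also have "(\<Sum>\<sigma>\<in>I. \<Sum>\<gamma>\<in>I. a \<gamma> \<sigma> x * \<zeta> \<sigma> * \<xi> \<gamma>) = (\<Sum>\<sigma>\<in>I. \<Sum>\<gamma>\<in>I. a \<sigma> \<gamma> x * \<xi> \<sigma> * \<zeta> \<gamma>)"
    by (subst sum.swap) (simp add: mult_ac)
  finally show ?thesis by (simp add: add_divide_distrib)
qed

lemma quad_form_add:
  "quad_form I a x (\<lambda>\<sigma>. \<zeta> \<sigma> + t * \<xi> \<sigma>) = quad_form I a x \<zeta> + 2 * t * sym_form I a x \<zeta> \<xi> + t\<^sup>2 * quad_form I a x \<xi>"
proof -
  have "quad_form I a x (\<lambda>\<sigma>. \<zeta> \<sigma> + t * \<xi> \<sigma>) = (\<Sum>\<sigma>\<in>I. \<Sum>\<gamma>\<in>I. a \<sigma> \<gamma> x * \<zeta> \<sigma> * \<zeta> \<gamma>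
      + (t * (a \<sigma> \<gamma> x * \<zeta> \<sigma> * \<xi> \<gamma>) + (t * (a \<sigma> \<gamma> x * \<xi> \<sigma> * \<zeta> \<gamma>) + t\<^sup>2 * (a \<sigma> \<gamma> x * \<xi> \<sigma> * \<xi> \<gamma>))))"
    unfolding quad_form_def by (intro sum.cong refl) (simp add: power2_eq_square algebra_simps)
  also have "\<dots> = quad_form I a x \<zeta> + 2 * t * sym_form I a x \<zeta> \<xi> + t\<^sup>2 * quad_form I a x \<xi>"
  proof -
    have *: "A + (t * B + (t * C + s * D)) = A + 2 * t * ((B + C) / 2) + s * D" for A B C D s :: real
      by (simp add: field_simps)
    show ?thesis unfolding sym_form_alt quad_form_def sum.distrib sum_distrib_left[symmetric] by (rule *)
  qed
  finally show ?thesis .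
qed

lemma sym_form_self: "sym_form I a x \<zeta> \<zeta> = quad_form I a x \<zeta>"
  unfolding sym_form_alt quad_form_def by simp

lemma sym_form_add_right:
  "sym_form I a x \<zeta> (\<lambda>\<sigma>. \<xi> \<sigma> + c * \<xi>' \<sigma>) = sym_form I a x \<zeta> \<xi> + c * sym_form I a x \<zeta> \<xi>'"
  unfolding sym_form_def sum_distrib_left sum.distrib[symmetric]
  by (intro sum.cong refl) (simp add: field_simps)

text \<open>Young's inequality for a semidefinite form, from its values at \<zeta> + \<xi>/t and
  \<zeta> - \<xi>/t. This additive version can be integrated directly, with t chosen so that the two
  integrals balance.\<close>

lemma sym_form_bound:
  assumes nn: "\<And>\<zeta>. 0 \<le> quad_form I a x \<zeta>" and t: "t > 0"
  shows "2 * \<bar>sym_form I a x \<zeta> \<xi>\<bar> \<le> t * quad_form I a x \<zeta> + quad_form I a x \<xi> / t"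
proof -
  have *: "0 \<le> quad_form I a x \<zeta> + 2 * s * sym_form I a x \<zeta> \<xi> + s\<^sup>2 * quad_form I a x \<xi>" for s
    using nn quad_form_add by metis
  have e: "t * (A + 2 * (1 / t) * S + (1 / t)\<^sup>2 * X) = t * A + 2 * S + X / t"
    "t * (A + 2 * (- 1 / t) * S + (- 1 / t)\<^sup>2 * X) = t * A - 2 * S + X / t" for A S X
    using t by (simp_all add: power2_eq_square field_simps)
  have "0 \<le> t * quad_form I a x \<zeta> + 2 * sym_form I a x \<zeta> \<xi> + quad_form I a x \<xi> / t"
    unfolding e(1)[symmetric] using *[of "1 / t"] t by (intro mult_nonneg_nonneg; simp)
  moreover have "0 \<le> t * quad_form I a x \<zeta> - 2 * sym_form I a x \<zeta> \<xi> + quad_form I a x \<xi> / t"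
    unfolding e(2)[symmetric] using *[of "- 1 / t"] t by (intro mult_nonneg_nonneg; simp)
  ultimately show ?thesis by linarith
qed

lemma quad_form_cong: "(\<And>\<sigma>. \<sigma> \<in> I \<Longrightarrow> \<zeta> \<sigma> = \<zeta>' \<sigma>) \<Longrightarrow> quad_form I a x \<zeta> = quad_form I a x \<zeta>'"
  unfolding quad_form_def by (intro sum.cong refl) auto

lemma sym_form_cong:
  "(\<And>\<sigma>. \<sigma> \<in> I \<Longrightarrow> \<zeta> \<sigma> = \<zeta>' \<sigma>) \<Longrightarrow> (\<And>\<sigma>. \<sigma> \<in> I \<Longrightarrow> \<xi> \<sigma> = \<xi>' \<sigma>) \<Longrightarrow> sym_form I a x \<zeta> \<xi> = sym_form I a x \<zeta>' \<xi>'"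
  unfolding sym_form_def by (intro sum.cong refl) auto

lemma quad_form_top:
  fixes x :: "real^'n::finite"
  assumes "\<And>\<sigma>. mlen \<sigma> < k \<Longrightarrow> \<zeta> \<sigma> = 0"
  shows "quad_form {\<sigma>. mlen \<sigma> \<le> k} a x \<zeta> = quad_form {\<sigma>. mlen \<sigma> = k} a x \<zeta>"
  unfolding quad_form_def
proof (rule sum.mono_neutral_cong_right)
  fix \<sigma> :: "'n midx" assume "\<sigma> \<in> {\<sigma>. mlen \<sigma> = k}"
  show "(\<Sum>\<gamma> | mlen \<gamma> \<le> k. a \<sigma> \<gamma> x * \<zeta> \<sigma> * \<zeta> \<gamma>) = (\<Sum>\<gamma> | mlen \<gamma> = k. a \<sigma> \<gamma> x * \<zeta> \<sigma> * \<zeta> \<gamma>)"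
    by (intro sum.mono_neutral_cong_right) (auto simp: assms finite_mlen_le)
qed (auto simp: assms finite_mlen_le)

lemma sum_mlen_less:
  "(\<Sum>\<sigma>::'n::finite midx | mlen \<sigma> < k. F \<sigma>) = (\<Sum>p<k. \<Sum>\<sigma> | mlen \<sigma> = p. F \<sigma>)"
proof -
  have "{\<sigma>::'n midx. mlen \<sigma> < k} = (\<Union>p<k. {\<sigma>. mlen \<sigma> = p})" by auto
  then show ?thesis by (simp only:) (rule sum.UNION_disjoint, auto simp: finite_mlen_eq)
qed

text \<open>The top-order part of \<zeta> is \<zeta> minus its lower-order part, so by
  semidefiniteness its form is at most twice the sum of the other two forms. Ellipticity bounds the
  first from below; boundedness, with no top-order entries left, bounds the last by
  \<theta>0.\<close>

lemma coercivity_pointwise: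
  fixes x :: "real^'n::finite"
  assumes x: "x \<in> D" and nn: "nonneg_coeffs k a D" and b: "bounded_coeffs k a D \<theta>0 \<theta>'"
    and e: "strongly_elliptic k a D \<theta>min"
  shows "\<theta>min * (\<Sum>\<sigma> | mlen \<sigma> = k. (\<zeta> \<sigma>)\<^sup>2)
    \<le> 2 * quad_form {\<sigma>. mlen \<sigma> \<le> k} a x \<zeta> + 2 * \<theta>0 * (\<Sum>\<sigma> | mlen \<sigma> < k. (\<zeta> \<sigma>)\<^sup>2)"
proof -
  let ?I = "{\<sigma>::'n midx. mlen \<sigma> \<le> k}"
  define \<zeta>k where "\<zeta>k \<sigma> = (if mlen \<sigma> = k then \<zeta> \<sigma> else 0)" for \<sigma>
  define \<zeta>l where "\<zeta>l \<sigma> = (if mlen \<sigma> < k then \<zeta> \<sigma> else 0)" for \<sigma>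
  have nn': "0 \<le> quad_form ?I a x z" for z using nn x by (auto simp: nonneg_coeffs_def)
  have "quad_form ?I a x \<zeta>k = quad_form {\<sigma>. mlen \<sigma> = k} a x \<zeta>k"
    by (rule quad_form_top) (simp add: \<zeta>k_def)
  also have "\<dots> = quad_form {\<sigma>. mlen \<sigma> = k} a x \<zeta>"
    by (rule quad_form_cong) (simp add: \<zeta>k_def)
  finally have "quad_form ?I a x \<zeta>k = quad_form {\<sigma>. mlen \<sigma> = k} a x \<zeta>" .
  moreover have "quad_form ?I a x \<zeta>k = quad_form ?I a x (\<lambda>\<sigma>. \<zeta> \<sigma> + (-1) * \<zeta>l \<sigma>)"
    by (rule quad_form_cong) (auto simp: \<zeta>k_def \<zeta>l_def)
  moreover have "\<dots> \<le> 2 * quad_form ?I a x \<zeta> + 2 * quad_form ?I a x \<zeta>l"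
    unfolding quad_form_add using sym_form_bound[of ?I a x 1 \<zeta> \<zeta>l, OF nn'] by (simp add: abs_le_iff)
  moreover have "quad_form ?I a x \<zeta>l \<le> \<theta>' * (\<Sum>\<sigma> | mlen \<sigma> = k. (\<zeta>l \<sigma>)\<^sup>2) + \<theta>0 * (\<Sum>\<sigma> | mlen \<sigma> < k. (\<zeta>l \<sigma>)\<^sup>2)"
    using b x by (auto simp: bounded_coeffs_def)
  moreover have "(\<Sum>\<sigma> | mlen \<sigma> = k. (\<zeta>l \<sigma>)\<^sup>2) = 0" "(\<Sum>\<sigma> | mlen \<sigma> < k. (\<zeta>l \<sigma>)\<^sup>2) = (\<Sum>\<sigma> | mlen \<sigma> < k. (\<zeta> \<sigma>)\<^sup>2)"
    by (auto simp: \<zeta>l_def)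
  moreover have "\<theta>min * (\<Sum>\<sigma> | mlen \<sigma> = k. (\<zeta> \<sigma>)\<^sup>2) \<le> quad_form {\<sigma>. mlen \<sigma> = k} a x \<zeta>"
    using e x by (auto simp: strongly_elliptic_def)
  ultimately show ?thesis by simp
qed

lemma coeff_integrable:
  fixes D :: "(real^'n::finite) set"
  assumes a: "a \<in> Linf D" and D: "D \<in> sets lebesgue" and T: "T \<in> sets lebesgue" "T \<subseteq> D"
    and z: "z \<in> sqint (lebesgue_on T)" and w: "w \<in> sqint (lebesgue_on T)"
  shows "integrable (lebesgue_on T) (\<lambda>x. a x * z x * w x)"
proof -
  obtain M where M: "AE x in lebesgue_on D. \<bar>a x\<bar> \<le> M" using a by (auto simp: Linf_def)
  have "a \<in> borel_measurable (lebesgue_on T)" using a T measurable_on_subset by (auto simp: Linf_def)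
  moreover have "AE x in lebesgue_on T. \<bar>a x\<bar> \<le> M"
    using M T D by (auto simp: AE_lebesgue_on elim!: eventually_mono)
  ultimately have "(\<lambda>x. a x * z x) \<in> sqint (lebesgue_on T)" by (rule sqint_bounded_mult[OF z])
  then show ?thesis by (rule sqint_mult_integrable[OF _ w])
qed

section \<open>The polyharmonic Dirichlet problem\<close>

definition grad_form :: "nat \<Rightarrow> (real^'n::finite) set \<Rightarrow> (real^'n \<Rightarrow> real) \<Rightarrow> (real^'n \<Rightarrow> real) \<Rightarrow> real" where
  "grad_form k \<Omega> f g = (\<Sum>\<sigma> | mlen \<sigma> = k. LINT x|lebesgue_on \<Omega>. mderiv \<sigma> f x * mderiv \<sigma> g x)"

lemma grad_form_add:
  fixes \<Omega> :: "(real^'n::finite) set"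
  assumes t: "f \<in> test_functions \<Omega>" "g \<in> test_functions \<Omega>" and \<Omega>: "\<Omega> \<in> sets lebesgue"
  shows "grad_form k \<Omega> (\<lambda>x. f x + s * g x) (\<lambda>x. f x + s * g x)
    = grad_form k \<Omega> f f + 2 * s * grad_form k \<Omega> f g + s\<^sup>2 * grad_form k \<Omega> g g"
proof -
  have sm: "smooth f" "smooth g" using t test_smooth by blast+
  have "(LINT x|lebesgue_on \<Omega>. mderiv \<sigma> (\<lambda>x. f x + s * g x) x * mderiv \<sigma> (\<lambda>x. f x + s * g x) x)
     = (LINT x|lebesgue_on \<Omega>. mderiv \<sigma> f x * mderiv \<sigma> f x)
       + 2 * s * (LINT x|lebesgue_on \<Omega>. mderiv \<sigma> f x * mderiv \<sigma> g x)
       + s\<^sup>2 * (LINT x|lebesgue_on \<Omega>. mderiv \<sigma> g x * mderiv \<sigma> g x)" for \<sigma>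
  proof -
    have i: "integrable (lebesgue_on \<Omega>) (\<lambda>x. mderiv \<sigma> p x * mderiv \<sigma> q x)"
      if "p \<in> test_functions \<Omega>" "q \<in> test_functions \<Omega>" for p q
      using that by (intro sqint_mult_integrable test_sqint[OF test_mderiv] \<Omega>)
    have "(LINT x|lebesgue_on \<Omega>. mderiv \<sigma> (\<lambda>x. f x + s * g x) x * mderiv \<sigma> (\<lambda>x. f x + s * g x) x)
      = (LINT x|lebesgue_on \<Omega>. mderiv \<sigma> f x * mderiv \<sigma> f x + 2 * s * (mderiv \<sigma> f x * mderiv \<sigma> g x)
          + s\<^sup>2 * (mderiv \<sigma> g x * mderiv \<sigma> g x))"
      by (intro Bochner_Integration.integral_cong refl)
        (simp add: mderiv_add mderiv_cmult sm smooth_cmult power2_eq_square algebra_simps)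
    then show ?thesis using i[OF t(1) t(1)] i[OF t] i[OF t(2) t(2)] by simp
  qed
  then show ?thesis unfolding grad_form_def by (simp add: sum.distrib sum_distrib_left)
qed

lemma seminormk_test:
  fixes \<Omega> :: "(real^'n::finite) set"
  assumes f: "f \<in> test_functions \<Omega>" and \<Omega>: "open \<Omega>" and p: "p \<le> k"
  shows "(seminormk p \<Omega> f)\<^sup>2 = grad_form p \<Omega> f f"
proof -
  have \<Omega>s: "\<Omega> \<in> sets lebesgue" using \<Omega> by (rule open_sets_lebesgue)
  have "(LINT x:\<Omega>|lebesgue. (wderiv \<Omega> \<sigma> f x)\<^sup>2) = (LINT x|lebesgue_on \<Omega>. mderiv \<sigma> f x * mderiv \<sigma> f x)"
    if "mlen \<sigma> = p" for \<sigma>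
    unfolding set_integral_lebesgue_on[OF \<Omega>s]
  proof (rule integral_cong_AE)
    show "AE x in lebesgue_on \<Omega>. (wderiv \<Omega> \<sigma> f x)\<^sup>2 = mderiv \<sigma> f x * mderiv \<sigma> f x"
      using test_H0k(2)[OF f \<Omega>, of \<sigma> k] that p by (auto simp: power2_eq_square)
    have "wderiv \<Omega> \<sigma> f \<in> sqint (lebesgue_on \<Omega>)" using H0k_sob_seq(2)[OF \<Omega> test_H0k(1)[OF f \<Omega>, of k]] that p by simp
    then show "(\<lambda>x. (wderiv \<Omega> \<sigma> f x)\<^sup>2) \<in> borel_measurable (lebesgue_on \<Omega>)"
      by (intro borel_measurable_power sqint_measurable)
    have "mderiv \<sigma> f \<in> borel_measurable (lebesgue_on \<Omega>)"
      by (rule sqint_measurable[OF test_sqint[OF test_mderiv[OF f] \<Omega>s]])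
    then show "(\<lambda>x. mderiv \<sigma> f x * mderiv \<sigma> f x) \<in> borel_measurable (lebesgue_on \<Omega>)" by simp
  qed
  then have "(\<Sum>\<sigma> | mlen \<sigma> = p. LINT x:\<Omega>|lebesgue. (wderiv \<Omega> \<sigma> f x)\<^sup>2) = grad_form p \<Omega> f f"
    unfolding grad_form_def by (intro sum.cong) auto
  moreover have "grad_form p \<Omega> f f \<ge> 0" unfolding grad_form_def by (auto intro!: sum_nonneg)
  ultimately show ?thesis unfolding seminormk_def by simp
qed

lemma friedrichs_test:
  fixes \<Omega> :: "(real^'n::finite) set"
  assumes fr: "friedrichs_const TYPE('n) k Cf" and Cf: "Cf > 0" and \<Omega>: "open \<Omega>" "bounded \<Omega>"
    and f: "f \<in> test_functions \<Omega>" and p: "p \<le> k" and t: "diameter \<Omega> \<le> t" "t \<ge> 0"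
  shows "grad_form p \<Omega> f f \<le> (Cf * t ^ (k - p))\<^sup>2 * grad_form k \<Omega> f f"
proof -
  have "seminormk p \<Omega> f \<le> Cf * t ^ (k - p) * seminormk k \<Omega> f"
    using fr \<Omega> t test_H0k(1)[OF f \<Omega>(1)] p unfolding friedrichs_const_def by blast
  then have "(seminormk p \<Omega> f)\<^sup>2 \<le> (Cf * t ^ (k - p) * seminormk k \<Omega> f)\<^sup>2"
    by (intro power_mono) (auto simp: seminormk_def set_integral_lebesgue_on[OF open_sets_lebesgue[OF \<Omega>(1)]] intro!: sum_nonneg)
  then show ?thesis
    unfolding power_mult_distrib seminormk_test[OF f \<Omega>(1) p] seminormk_test[OF f \<Omega>(1) order_refl] .
qed

lemma grad_form_single:
  assumes "mlen \<sigma> = p"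
  shows "(LINT x|lebesgue_on \<Omega>. (mderiv \<sigma> f x)\<^sup>2) \<le> grad_form p \<Omega> f f"
proof -
  have "(LINT x|lebesgue_on \<Omega>. mderiv \<sigma> f x * mderiv \<sigma> f x) \<le> grad_form p \<Omega> f f"
    unfolding grad_form_def by (rule member_le_sum) (use assms in \<open>auto simp: finite_mlen_eq\<close>)
  then show ?thesis by (simp add: power2_eq_square)
qed

text \<open>Only the Dirichlet problem for the polyharmonic operator is needed. It is solved by minimising
  over test functions: minimising sequences are Cauchy by the parallelogram law.\<close>

lemma polyharmonic_solution:
  fixes \<Omega> :: "(real^'n::finite) set"
  assumes fr: "friedrichs_const TYPE('n) k Cf" and Cf: "Cf > 0" and \<Omega>: "open \<Omega>" "bounded \<Omega>"
    and g: "g \<in> sqint (lebesgue_on \<Omega>)"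
  obtains f v where "sob_seq k \<Omega> f v"
    "\<And>\<phi>. \<phi> \<in> test_functions \<Omega> \<Longrightarrow>
       (\<Sum>\<sigma> | mlen \<sigma> = k. LINT x|lebesgue_on \<Omega>. v \<sigma> x * mderiv \<sigma> \<phi> x) = (LINT x|lebesgue_on \<Omega>. g x * \<phi> x)"
proof -
  let ?M = "lebesgue_on \<Omega>"
  have \<Omega>s: "\<Omega> \<in> sets lebesgue" using \<Omega>(1) by (rule open_sets_lebesgue)
  have fin: "finite_measure ?M" using \<Omega> by (intro finite_measure_lebesgue_on bounded_set_imp_lmeasurable) (auto simp: \<Omega>s)
  define t where "t = diameter \<Omega>"
  have t: "t \<ge> 0" "diameter \<Omega> \<le> t" using \<Omega>(2) by (auto simp: t_def diameter_ge_0)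
  define l where "l \<phi> = (LINT x|?M. g x * \<phi> x)" for \<phi>
  define J where "J \<phi> = grad_form k \<Omega> \<phi> \<phi> - 2 * l \<phi>" for \<phi>
  let ?T = "test_functions \<Omega>"
  have ladd: "l (\<lambda>x. \<phi> x + s * h x) = l \<phi> + s * l h" if "\<phi> \<in> ?T" "h \<in> ?T" for \<phi> h s
    using sqint_mult_integrable[OF g test_sqint[OF that(1) \<Omega>s]] sqint_mult_integrable[OF g test_sqint[OF that(2) \<Omega>s]]
    by (simp add: l_def distrib_left mult.left_commute)
  have Jadd: "J (\<lambda>x. \<phi> x + s * h x) = J \<phi> + 2 * s * (grad_form k \<Omega> \<phi> h - l h) + s\<^sup>2 * grad_form k \<Omega> h h"
    if "\<phi> \<in> ?T" "h \<in> ?T" for \<phi> h s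
    unfolding J_def grad_form_add[OF that \<Omega>s] ladd[OF that] by (simp add: algebra_simps)
  define G where "G = sqrt (LINT x|?M. (g x)\<^sup>2)"
  \<comment> \<open>Friedrichs with p = 0 bounds the L2 norm by the top seminorm, so completing the
    square absorbs the linear term.\<close>
  have Jlow: "J \<phi> \<ge> - ((G * (Cf * t ^ k))\<^sup>2)" if \<phi>: "\<phi> \<in> ?T" for \<phi>
  proof -
    let ?n = "sqrt (grad_form k \<Omega> \<phi> \<phi>)"
    have n0: "grad_form k \<Omega> \<phi> \<phi> \<ge> 0" unfolding grad_form_def by (auto intro!: sum_nonneg)
    have "(LINT x|?M. (\<phi> x)\<^sup>2) \<le> (Cf * t ^ k)\<^sup>2 * grad_form k \<Omega> \<phi> \<phi>"
      using grad_form_single[of "\<lambda>_. 0" 0 \<Omega> \<phi>] friedrichs_test[OF fr Cf \<Omega> \<phi> _ t(2,1), of 0]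
      by (simp add: mderiv_0 mlen_0)
    then have "sqrt (LINT x|?M. (\<phi> x)\<^sup>2) \<le> sqrt ((Cf * t ^ k)\<^sup>2 * grad_form k \<Omega> \<phi> \<phi>)" by (rule real_sqrt_le_mono)
    also have "\<dots> = Cf * t ^ k * ?n" using Cf t by (simp add: real_sqrt_mult)
    finally have "G * sqrt (LINT x|?M. (\<phi> x)\<^sup>2) \<le> G * (Cf * t ^ k * ?n)" by (rule mult_left_mono) (simp add: G_def)
    moreover have "\<bar>l \<phi>\<bar> \<le> G * sqrt (LINT x|?M. (\<phi> x)\<^sup>2)"
      unfolding l_def G_def by (rule sqint_cauchy_schwarz[OF g test_sqint[OF \<phi> \<Omega>s]])
    ultimately have "l \<phi> \<le> G * (Cf * t ^ k) * ?n" by (simp add: mult_ac)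
    moreover have "2 * (G * (Cf * t ^ k)) * ?n \<le> (G * (Cf * t ^ k))\<^sup>2 + ?n\<^sup>2" by (rule sum_squares_bound)
    moreover have "?n\<^sup>2 = grad_form k \<Omega> \<phi> \<phi>" using n0 by simp
    ultimately show ?thesis unfolding J_def by linarith
  qed
  define m where "m = Inf (J ` ?T)"
  have T0: "(\<lambda>_. 0) \<in> ?T" by (rule test_functionsI[of _ "{}"]) (auto simp: smooth_const)
  have bdd: "bdd_below (J ` ?T)" using Jlow by (auto intro!: bdd_belowI)
  have mle: "m \<le> J \<phi>" if "\<phi> \<in> ?T" for \<phi> unfolding m_def using that bdd by (intro cInf_lower) auto
  have "\<exists>\<phi>\<in>?T. J \<phi> < m + 1 / real (Suc n)" for n
  proof -
    have "Inf (J ` ?T) < m + 1 / real (Suc n)" by (simp add: m_def)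
    then show ?thesis using T0 bdd by (subst (asm) cInf_less_iff) auto
  qed
  then obtain f where f: "\<And>n. f n \<in> ?T" "\<And>n. J (f n) < m + 1 / real (Suc n)" by metis
  have cau: "grad_form k \<Omega> (\<lambda>x. f i x + (-1) * f j x) (\<lambda>x. f i x + (-1) * f j x) \<le> 2 / real (Suc i) + 2 / real (Suc j)" for i j
  proof -
    \<comment> \<open>The midpoint of \<open>f i\<close> and \<open>f j\<close>, written as a step
      from \<open>f i\<close> along their difference so that the expansion of J applies. Compared
      with the value at \<open>f j\<close> this is the parallelogram law.\<close>
    have mid: "J (\<lambda>x. f i x + (-1/2) * (f i x + (-1) * f j x)) \<ge> m"
      by (intro mle test_add test_cmult f)
    let ?d = "\<lambda>x. f i x + (-1) * f j x"
    have d: "?d \<in> ?T" by (intro test_add test_cmult f)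
    have "J (f j) = J (\<lambda>x. f i x + (-1) * ?d x)" by simp
    then have "J (f j) = J (f i) + 2 * (-1) * (grad_form k \<Omega> (f i) ?d - l ?d) + (-1)\<^sup>2 * grad_form k \<Omega> ?d ?d"
      using Jadd[OF f(1) d, of i "-1"] by metis
    with mid f(2)[of i] f(2)[of j] show ?thesis
      unfolding Jadd[OF f(1) d] by (simp add: power2_eq_square)
  qed
  have "\<exists>v. L2_limit ?M (\<lambda>n. mderiv \<sigma> (f n)) v" if \<sigma>: "mlen \<sigma> \<le> k" for \<sigma>
  proof (rule finite_measure.L2_complete[OF fin])
    show "mderiv \<sigma> (f n) \<in> sqint ?M" for n by (rule test_sqint[OF test_mderiv[OF f(1)] \<Omega>s])
    fix e :: real assume e: "e > 0"
    \<comment> \<open>The added 1 keeps K positive when the Friedrichs factor is 0, as it may be for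
      t = 0.\<close>
    obtain K where K: "K > 0" "(Cf * t ^ (k - mlen \<sigma>))\<^sup>2 \<le> K"
      by (rule that[of "(Cf * t ^ (k - mlen \<sigma>))\<^sup>2 + 1"]) (auto intro: add_nonneg_pos)
    obtain N where N: "inverse (real (Suc N)) < e / (4 * K)" using reals_Archimedean[of "e / (4 * K)"] e K by auto
    show "\<exists>N. \<forall>i\<ge>N. \<forall>j\<ge>N. (LINT x|?M. (mderiv \<sigma> (f i) x - mderiv \<sigma> (f j) x)\<^sup>2) < e"
    proof (intro exI[of _ N] allI impI)
      fix i j assume ij: "i \<ge> N" "j \<ge> N"
      let ?d = "\<lambda>x. f i x + (-1) * f j x"
      have d: "?d \<in> ?T" by (intro test_add test_cmult f)
      have le: "1 / real (Suc i) \<le> inverse (real (Suc N))" "1 / real (Suc j) \<le> inverse (real (Suc N))"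
        using ij by (auto simp: inverse_eq_divide frac_le)
      have "mderiv \<sigma> ?d = (\<lambda>x. mderiv \<sigma> (f i) x + (-1) * mderiv \<sigma> (f j) x)"
      proof -
        have sm: "smooth (f n)" for n by (rule test_smooth[OF f(1)])
        show ?thesis by (simp only: mderiv_add[OF sm smooth_cmult[OF sm]] mderiv_cmult[OF sm])
      qed
      then have "(LINT x|?M. (mderiv \<sigma> (f i) x - mderiv \<sigma> (f j) x)\<^sup>2) = (LINT x|?M. (mderiv \<sigma> ?d x)\<^sup>2)" by simp
      also have "\<dots> \<le> grad_form (mlen \<sigma>) \<Omega> ?d ?d" by (rule grad_form_single) simp
      also have "\<dots> \<le> (Cf * t ^ (k - mlen \<sigma>))\<^sup>2 * grad_form k \<Omega> ?d ?d"
        by (rule friedrichs_test[OF fr Cf \<Omega> d \<sigma> t(2,1)])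
      also have "\<dots> \<le> K * grad_form k \<Omega> ?d ?d"
        using K by (intro mult_right_mono) (auto simp: grad_form_def intro!: sum_nonneg)
      also have "\<dots> \<le> K * (2 / real (Suc i) + 2 / real (Suc j))" using K by (intro mult_left_mono cau) auto
      also have "\<dots> \<le> K * (4 * inverse (real (Suc N)))" using K le by (intro mult_left_mono) auto
      also have "\<dots> < K * (4 * (e / (4 * K)))" using K N by (intro mult_strict_left_mono) auto
      also have "\<dots> = e" using K by simp
      finally show "(LINT x|?M. (mderiv \<sigma> (f i) x - mderiv \<sigma> (f j) x)\<^sup>2) < e" .
    qed
  qed
  then obtain v where v: "\<And>\<sigma>. mlen \<sigma> \<le> k \<Longrightarrow> L2_limit ?M (\<lambda>n. mderiv \<sigma> (f n)) (v \<sigma>)" by metis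
  show ?thesis
  proof (rule that)
    show "sob_seq k \<Omega> f v" using f v by (simp add: sob_seq_def)
    fix \<phi> assume \<phi>: "\<phi> \<in> ?T"
    have lim: "(\<lambda>n. grad_form k \<Omega> (f n) \<phi>) \<longlonglongrightarrow> (\<Sum>\<sigma> | mlen \<sigma> = k. LINT x|?M. v \<sigma> x * mderiv \<sigma> \<phi> x)"
      unfolding grad_form_def
      by (intro tendsto_sum L2_limit_inner_left v test_sqint[OF test_mderiv[OF \<phi>] \<Omega>s]) auto
    let ?A = "(\<Sum>\<sigma> | mlen \<sigma> = k. LINT x|?M. v \<sigma> x * mderiv \<sigma> \<phi> x) - l \<phi>"
    \<comment> \<open>The value of J at \<open>f n\<close> + s \<phi> is at least the infimum m, and
      that at \<open>f n\<close> exceeds m by less than 1/(n + 1). Letting n grow leaves a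
      nonnegative quadratic in s without constant term.\<close>
    have "0 \<le> 2 * s * ?A + s\<^sup>2 * grad_form k \<Omega> \<phi> \<phi>" for s
    proof -
      have l1: "(\<lambda>n. 2 * s * (grad_form k \<Omega> (f n) \<phi> - l \<phi>) + s\<^sup>2 * grad_form k \<Omega> \<phi> \<phi> + 1 / real (Suc n))
         \<longlonglongrightarrow> 2 * s * ?A + s\<^sup>2 * grad_form k \<Omega> \<phi> \<phi> + 0"
        by (intro tendsto_intros lim) (use LIMSEQ_inverse_real_of_nat in \<open>simp add: inverse_eq_divide\<close>)
      have "0 \<le> 2 * s * (grad_form k \<Omega> (f n) \<phi> - l \<phi>) + s\<^sup>2 * grad_form k \<Omega> \<phi> \<phi> + 1 / real (Suc n)" for n
      proof -
        have "m \<le> J (\<lambda>x. f n x + s * \<phi> x)" by (intro mle test_add test_cmult f \<phi>)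
        then show ?thesis using f(2)[of n] unfolding Jadd[OF f(1) \<phi>] by linarith
      qed
      then show ?thesis using LIMSEQ_le_const[OF l1] by auto
    qed
    then have "?A = 0" by (rule nonneg_quadratic_imp_zero)
    then show "(\<Sum>\<sigma> | mlen \<sigma> = k. LINT x|?M. v \<sigma> x * mderiv \<sigma> \<phi> x) = (LINT x|?M. g x * \<phi> x)"
      by (simp add: l_def)
  qed
qed

section \<open>Polynomials and the inverse estimate on one element\<close>

lemma polys_continuous: "p \<in> polys s \<Longrightarrow> continuous_on UNIV p"
proof -
  assume "p \<in> polys s"
  then obtain c where "\<And>x. p x = (\<Sum>\<sigma> | mlen \<sigma> \<le> s. c \<sigma> * (\<Prod>i\<in>UNIV. (x $ i) ^ \<sigma> i))"
    unfolding polys_def by blast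
  then have "p = (\<lambda>x. \<Sum>\<sigma> | mlen \<sigma> \<le> s. c \<sigma> * (\<Prod>i\<in>UNIV. (x $ i) ^ \<sigma> i))" by blast
  then show ?thesis by (auto intro!: continuous_intros)
qed

lemma continuous_sqint_bounded:
  fixes p :: "real^'n::finite \<Rightarrow> real"
  assumes p: "continuous_on UNIV p" and T: "bounded T" "T \<in> sets lebesgue"
  shows "p \<in> sqint (lebesgue_on T)"
proof -
  have "compact (closure T)" using T(1) by simp
  then have "compact (p ` closure T)" using p by (intro compact_continuous_image) (auto intro: continuous_on_subset)
  then obtain B where B: "\<forall>x\<in>p ` closure T. norm x \<le> B" using compact_imp_bounded bounded_iff by metis
  have lm: "T \<in> lmeasurable" using T by (rule bounded_set_imp_lmeasurable)
  have pm: "p \<in> borel_measurable (lebesgue_on T)"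
    using borel_measurable_continuous_onI[OF p] by (intro measurable_restrict_space1) (simp add: measurable_completion)
  have "(\<lambda>x. p x * 1) \<in> sqint (lebesgue_on T)"
    using B closure_subset[of T]
    by (intro sqint_bounded_mult[OF sqint_const_bounded[OF lm] pm, of B]) (auto intro!: AE_I2)
  then show ?thesis by simp
qed

text \<open>The hypothesis on \<open>E\<close> says that the functional given by \<open>p\<close> is dominated on \<open>\<Omega>\<close>; in the
  application \<open>E\<close> is a local energy.\<close>

lemma inverse_estimate:
  fixes \<Omega> :: "(real^'n::finite) set"
  assumes fr: "friedrichs_const TYPE('n) k Cf" and Cf: "Cf > 0"
    and inv: "inverse_const TYPE('n) k \<delta> C" and \<Omega>: "open \<Omega>" "bounded \<Omega>"
    and t: "t > 0" "diameter \<Omega> \<le> t" "ball y (\<delta> * t / 2) \<subseteq> \<Omega>" and C: "C > 0"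
    and p: "p \<in> polys (k - 1)" and \<theta>: "\<theta> > 0"
    and dom: "\<And>f. f \<in> test_functions \<Omega> \<Longrightarrow>
        2 * (LINT x|lebesgue_on \<Omega>. p x * f x) \<le> \<theta> * E + grad_form k \<Omega> f f"
  shows "(LINT x|lebesgue_on \<Omega>. (p x)\<^sup>2) \<le> (C / t ^ k)\<^sup>2 * (\<theta> * E)"
proof -
  let ?M = "lebesgue_on \<Omega>"
  have \<Omega>s: "\<Omega> \<in> sets lebesgue" using \<Omega>(1) by (rule open_sets_lebesgue)
  have ps: "p \<in> sqint ?M" by (rule continuous_sqint_bounded[OF polys_continuous[OF p] \<Omega>(2) \<Omega>s])
  obtain f v where fv: "sob_seq k \<Omega> f v" and
    eq: "\<And>\<phi>. \<phi> \<in> test_functions \<Omega> \<Longrightarrow>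
       (\<Sum>\<sigma> | mlen \<sigma> = k. LINT x|?M. v \<sigma> x * mderiv \<sigma> \<phi> x) = (LINT x|?M. p x * \<phi> x)"
    using polyharmonic_solution[OF fr Cf \<Omega> ps] by blast
  have ft: "f n \<in> test_functions \<Omega>" for n using fv by (simp add: sob_seq_def)
  have lim: "L2_limit ?M (\<lambda>n. mderiv \<sigma> (f n)) (v \<sigma>)" if "mlen \<sigma> \<le> k" for \<sigma> using fv that by (simp add: sob_seq_def)
  define w where "w = v (\<lambda>_. 0)"
  have lim0: "L2_limit ?M f w" using lim[of "\<lambda>_. 0"] by (simp add: w_def mderiv_0 mlen_0)
  have vs: "v \<sigma> \<in> sqint ?M" if "mlen \<sigma> \<le> k" for \<sigma> using lim[OF that] by (simp add: L2_limit_def)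
  have wL: "w \<in> L2 \<Omega>" using lim0 by (simp add: L2_sqint[OF \<Omega>s] L2_limit_def)
  have wae: "AE x in ?M. w x = v (\<lambda>_. 0) x" by (simp add: w_def)
  note wH = sob_seq_H0k[OF \<Omega>(1) fv wL wae]
  define N where "N = (\<Sum>\<sigma> | mlen \<sigma> = k. LINT x|?M. (v \<sigma> x)\<^sup>2)"
  have N0: "N \<ge> 0" unfolding N_def by (auto intro!: sum_nonneg)
  \<comment> \<open>The equation is tested with the approximants of its own solution w.\<close>
  have "N = (LINT x|?M. p x * w x)"
  proof (rule LIMSEQ_unique)
    show "(\<lambda>n. LINT x|?M. p x * f n x) \<longlonglongrightarrow> (LINT x|?M. p x * w x)"
      using L2_limit_inner_left[OF lim0 ps] by (simp add: mult.commute)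
    have "(\<lambda>n. \<Sum>\<sigma> | mlen \<sigma> = k. LINT x|?M. mderiv \<sigma> (f n) x * v \<sigma> x) \<longlonglongrightarrow> (\<Sum>\<sigma> | mlen \<sigma> = k. LINT x|?M. v \<sigma> x * v \<sigma> x)"
      by (intro tendsto_sum L2_limit_inner_left lim vs) auto
    then show "(\<lambda>n. LINT x|?M. p x * f n x) \<longlonglongrightarrow> N"
      unfolding N_def eq[OF ft, symmetric] by (simp add: mult.commute power2_eq_square)
  qed
  moreover have "2 * (LINT x|?M. p x * w x) \<le> \<theta> * E + N"
  proof (rule LIMSEQ_le)
    show "(\<lambda>n. 2 * (LINT x|?M. p x * f n x)) \<longlonglongrightarrow> 2 * (LINT x|?M. p x * w x)"
      using tendsto_mult[OF tendsto_const L2_limit_inner_left[OF lim0 ps], of 2] by (simp add: mult.commute)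
    have "(\<lambda>n. \<Sum>\<sigma> | mlen \<sigma> = k. LINT x|?M. (mderiv \<sigma> (f n) x)\<^sup>2) \<longlonglongrightarrow> N"
      unfolding N_def by (intro tendsto_sum L2_limit_norm lim) auto
    then have "(\<lambda>n. grad_form k \<Omega> (f n) (f n)) \<longlonglongrightarrow> N" unfolding grad_form_def by (simp add: power2_eq_square)
    then show "(\<lambda>n. \<theta> * E + grad_form k \<Omega> (f n) (f n)) \<longlonglongrightarrow> \<theta> * E + N" by (intro tendsto_intros)
    show "\<exists>N. \<forall>n\<ge>N. 2 * (LINT x|?M. p x * f n x) \<le> \<theta> * E + grad_form k \<Omega> (f n) (f n)" using dom[OF ft] by blast
  qed
  \<comment> \<open>In the limit the domination reads 2N <= \<theta> E + N, so N is absorbed on the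
    left.\<close>
  ultimately have NE: "N \<le> \<theta> * E" by simp
  have "weak_polyharmonic k \<Omega> w p" unfolding weak_polyharmonic_def
  proof
    fix \<phi> assume \<phi>: "\<phi> \<in> test_functions \<Omega>"
    \<comment> \<open>Moving half of the derivatives back onto w produces a second sign (-1)^k,
      which cancels the one in \<open>weak_polyharmonic\<close>.\<close>
    have "(-1) ^ k * (LINT x:\<Omega>|lebesgue. w x * mderiv (\<lambda>i. 2 * \<sigma> i) \<phi> x) = (LINT x|?M. v \<sigma> x * mderiv \<sigma> \<phi> x)"
      if \<sigma>: "mlen \<sigma> = k" for \<sigma>
    proof -
      have "has_weak_deriv \<Omega> \<sigma> w (v \<sigma>)" by (rule sob_seq_weak_deriv[OF \<Omega>(1) fv wL wae]) (simp add: \<sigma>)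
      then have "(LINT x:\<Omega>|lebesgue. w x * mderiv \<sigma> (mderiv \<sigma> \<phi>) x) = (-1) ^ mlen \<sigma> * (LINT x:\<Omega>|lebesgue. v \<sigma> x * mderiv \<sigma> \<phi> x)"
        using test_mderiv[OF \<phi>] unfolding has_weak_deriv_def by blast
      then show ?thesis using \<sigma>
        by (simp add: mderiv_double[OF test_smooth[OF \<phi>]] set_integral_lebesgue_on[OF \<Omega>s] power_mult_distrib[symmetric] mult.assoc[symmetric])
    qed
    then show "(-1) ^ k * (\<Sum>\<sigma> | mlen \<sigma> = k. LINT x:\<Omega>|lebesgue. w x * mderiv (\<lambda>i. 2 * \<sigma> i) \<phi> x)
       = (LINT x:\<Omega>|lebesgue. p x * \<phi> x)"
      unfolding sum_distrib_left using eq[OF \<phi>] by (simp add: set_integral_lebesgue_on[OF \<Omega>s])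
  qed
  then have "L2norm \<Omega> p \<le> C / t ^ k * seminormk k \<Omega> w"
    using inv t \<Omega> wH(1) p unfolding inverse_const_def by blast
  then have "(L2norm \<Omega> p)\<^sup>2 \<le> (C / t ^ k * seminormk k \<Omega> w)\<^sup>2"
    by (intro power_mono) (auto simp: L2norm_def set_integral_lebesgue_on[OF \<Omega>s])
  moreover have "(L2norm \<Omega> p)\<^sup>2 = (LINT x|?M. (p x)\<^sup>2)" by (simp add: L2norm_def set_integral_lebesgue_on[OF \<Omega>s])
  moreover have "(seminormk k \<Omega> w)\<^sup>2 = N"
  proof -
    have "(LINT x:\<Omega>|lebesgue. (wderiv \<Omega> \<sigma> w x)\<^sup>2) = (LINT x|?M. (v \<sigma> x)\<^sup>2)" if "mlen \<sigma> = k" for \<sigma>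
      unfolding set_integral_lebesgue_on[OF \<Omega>s]
    proof (rule integral_cong_AE)
      show "AE x in ?M. (wderiv \<Omega> \<sigma> w x)\<^sup>2 = (v \<sigma> x)\<^sup>2" using wH(2)[of \<sigma>] that by auto
      show "(\<lambda>x. (wderiv \<Omega> \<sigma> w x)\<^sup>2) \<in> borel_measurable ?M" "(\<lambda>x. (v \<sigma> x)\<^sup>2) \<in> borel_measurable ?M"
        using H0k_sob_seq(2)[OF \<Omega>(1) wH(1), of \<sigma>] vs[of \<sigma>] that
        by (simp_all add: borel_measurable_power sqint_measurable)
    qed
    then show ?thesis unfolding seminormk_def using N0 by (simp add: N_def)
  qed
  ultimately have "(LINT x|?M. (p x)\<^sup>2) \<le> (C / t ^ k)\<^sup>2 * N"
    unfolding power_mult_distrib[of "C / t ^ k"] by simp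
  also have "\<dots> \<le> (C / t ^ k)\<^sup>2 * (\<theta> * E)" by (intro mult_left_mono NE) auto
  finally show ?thesis .
qed

section \<open>Local energy estimates\<close>

lemma integral_on_zero_outside:
  fixes F :: "'a::euclidean_space \<Rightarrow> real"
  assumes "S \<in> sets lebesgue" "T \<in> sets lebesgue" "S \<subseteq> T" "\<And>x. x \<in> T - S \<Longrightarrow> F x = 0"
  shows "(LINT x|lebesgue_on T. F x) = (LINT x|lebesgue_on S. F x)"
proof -
  have "(\<lambda>x. indicat_real T x *\<^sub>R F x) = (\<lambda>x. indicat_real S x *\<^sub>R F x)"
    using assms(3,4) by (auto simp: indicator_def fun_eq_iff)
  then have "(LINT x:T|lebesgue. F x) = (LINT x:S|lebesgue. F x)"
    unfolding set_lebesgue_integral_def by metis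
  then show ?thesis using assms by (simp add: set_integral_lebesgue_on)
qed

lemma sum_power_reindex: "(\<Sum>p<k. (h ^ (k - p))\<^sup>2) = (\<Sum>j\<in>{1..k}. (h::real) ^ (2 * j))"
  by (rule sum.reindex_bij_witness[of _ "\<lambda>j. k - j" "\<lambda>p. k - p"]) (auto simp: power_mult[symmetric] mult.commute)

lemma square_sum_list_le:
  "(\<Sum>p\<leftarrow>ps. F p)\<^sup>2 \<le> real (length ps) * (\<Sum>p\<leftarrow>ps. (F p)\<^sup>2 :: real)"
proof (induction ps)
  case (Cons q ps)
  let ?n = "real (length ps)" and ?S = "\<Sum>p\<leftarrow>ps. F p" and ?T = "\<Sum>p\<leftarrow>ps. (F p)\<^sup>2"
  have T0: "?T \<ge> 0" by (induction ps) auto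
  show ?case
  proof (cases "ps = []")
    case False
    then have n: "?n > 0" by simp
    have "2 * F q * ?S \<le> ?n * (F q)\<^sup>2 + ?S\<^sup>2 / ?n"
    proof -
      have "0 \<le> (?n * F q - ?S)\<^sup>2 / ?n" using n by simp
      also have "\<dots> = ?n * (F q)\<^sup>2 + ?S\<^sup>2 / ?n - 2 * F q * ?S" using n by (simp add: power2_eq_square field_simps)
      finally show ?thesis by simp
    qed
    moreover have "?S\<^sup>2 / ?n \<le> ?T" using Cons.IH n by (simp add: pos_divide_le_eq mult.commute)
    ultimately have "(F q + ?S)\<^sup>2 \<le> (F q)\<^sup>2 + (?n * (F q)\<^sup>2 + ?T) + ?n * ?T"
      using Cons.IH by (simp add: power2_sum)
    then show ?thesis by (simp add: algebra_simps)
  qed simp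
qed simp

lemma polys_on_sqint:
  fixes \<phi> :: "real^'n::finite \<Rightarrow> real"
  assumes \<phi>: "\<phi> \<in> polys_on s T" and T: "T \<in> sets lebesgue" and D: "bounded D" "D \<in> sets lebesgue"
  shows "\<phi> \<in> sqint (lebesgue_on D)"
proof -
  obtain p where p: "p \<in> polys s" "\<phi> = (\<lambda>x. if x \<in> T then p x else 0)"
    using \<phi> unfolding polys_on_def by blast
  have ps: "p \<in> sqint (lebesgue_on D)" by (rule continuous_sqint_bounded[OF polys_continuous[OF p(1)] D])
  have "indicat_real T \<in> borel_measurable (lebesgue_on D)"
    using T by (intro measurable_restrict_space1 borel_measurable_indicator)
  then have "(\<lambda>x. indicat_real T x * p x) \<in> sqint (lebesgue_on D)"
    by (rule sqint_bounded_mult[OF ps, of _ 1]) (auto intro!: AE_I2 simp: indicator_def)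
  moreover have "\<phi> = (\<lambda>x. indicat_real T x * p x)" unfolding p(2) by (auto simp: indicator_def)
  ultimately show ?thesis by simp
qed

locale elliptic =
  fixes k :: nat and D :: "(real^'n::finite) set"
    and a :: "'n midx \<Rightarrow> 'n midx \<Rightarrow> real^'n \<Rightarrow> real" and \<theta>0 \<theta>' \<theta>min :: real
  assumes k: "k \<ge> 1" and D: "open D" "bounded D"
    and a: "\<And>\<sigma> \<gamma>. mlen \<sigma> \<le> k \<Longrightarrow> mlen \<gamma> \<le> k \<Longrightarrow> a \<sigma> \<gamma> \<in> Linf D"
    and nn: "nonneg_coeffs k a D" and bd: "bounded_coeffs k a D \<theta>0 \<theta>'"
    and el: "strongly_elliptic k a D \<theta>min"
    and \<theta>: "\<theta>0 \<ge> 0" "\<theta>' > 0" "\<theta>min > 0"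
begin

abbreviation "I \<equiv> {\<sigma>::'n midx. mlen \<sigma> \<le> k}"
abbreviation "\<theta>max \<equiv> max \<theta>0 \<theta>'"

definition jet :: "(real^'n \<Rightarrow> real) \<Rightarrow> real^'n \<Rightarrow> 'n midx \<Rightarrow> real" where
  "jet u x \<sigma> = wderiv D \<sigma> u x"

text \<open>\<open>energy\<close> with the double sum moved under the integral, so that inequalities
  between quadratic forms at a point can be integrated.\<close>

definition en :: "(real^'n) set \<Rightarrow> (real^'n \<Rightarrow> real) \<Rightarrow> real" where
  "en T u = (LINT x|lebesgue_on T. quad_form I a x (jet u x))"

text \<open>By \<open>en_add\<close> this is half the first variation of the energy on
  \<open>D\<close>.\<close>

definition Bf :: "(real^'n \<Rightarrow> real) \<Rightarrow> (real^'n \<Rightarrow> real) \<Rightarrow> real" where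
  "Bf u v = (LINT x|lebesgue_on D. sym_form I a x (jet u x) (jet v x))"

lemma \<theta>max_pos: "\<theta>max > 0" using \<theta> by simp

lemma Ds: "D \<in> sets lebesgue"
  using D by (simp add: open_sets_lebesgue)

lemma quad_nonneg: "x \<in> D \<Longrightarrow> 0 \<le> quad_form I a x \<zeta>"
  using nn by (simp add: nonneg_coeffs_def)

lemma bilinear_integrable:
  assumes "T \<in> sets lebesgue" "T \<subseteq> D"
    and "\<And>\<sigma>. mlen \<sigma> \<le> k \<Longrightarrow> z \<sigma> \<in> sqint (lebesgue_on T)" "\<And>\<sigma>. mlen \<sigma> \<le> k \<Longrightarrow> w \<sigma> \<in> sqint (lebesgue_on T)"
  shows "integrable (lebesgue_on T) (\<lambda>x. \<Sum>\<sigma>\<in>I. \<Sum>\<gamma>\<in>I. a \<sigma> \<gamma> x * z \<sigma> x * w \<gamma> x)"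
  using assms by (intro Bochner_Integration.integrable_sum coeff_integrable[OF a Ds]) auto

lemma quad_integrable:
  assumes "T \<in> sets lebesgue" "T \<subseteq> D" "\<And>\<sigma>. mlen \<sigma> \<le> k \<Longrightarrow> z \<sigma> \<in> sqint (lebesgue_on T)"
  shows "integrable (lebesgue_on T) (\<lambda>x. quad_form I a x (\<lambda>\<sigma>. z \<sigma> x))"
  unfolding quad_form_def using assms by (intro bilinear_integrable)

lemma sym_integrable:
  assumes "T \<in> sets lebesgue" "T \<subseteq> D"
    and "\<And>\<sigma>. mlen \<sigma> \<le> k \<Longrightarrow> z \<sigma> \<in> sqint (lebesgue_on T)" "\<And>\<sigma>. mlen \<sigma> \<le> k \<Longrightarrow> w \<sigma> \<in> sqint (lebesgue_on T)"
  shows "integrable (lebesgue_on T) (\<lambda>x. sym_form I a x (\<lambda>\<sigma>. z \<sigma> x) (\<lambda>\<sigma>. w \<sigma> x))"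
  unfolding sym_form_alt using assms
  by (intro integrable_divide Bochner_Integration.integrable_add bilinear_integrable)

lemma jet_sqint:
  assumes "u \<in> H0k k D" "T \<in> sets lebesgue" "T \<subseteq> D" "mlen \<sigma> \<le> k"
  shows "(\<lambda>x. jet u x \<sigma>) \<in> sqint (lebesgue_on T)"
  unfolding jet_def using sqint_subset[OF H0k_sob_seq(2)[OF D(1) assms(1,4)] assms(3,2) Ds] by simp

lemma jet_quad_integrable:
  assumes "u \<in> H0k k D" "T \<in> sets lebesgue" "T \<subseteq> D"
  shows "integrable (lebesgue_on T) (\<lambda>x. quad_form I a x (jet u x))"
  using quad_integrable[OF assms(2,3), of "\<lambda>\<sigma> x. jet u x \<sigma>"] jet_sqint[OF assms] by simp

lemma jet_sym_integrable:
  assumes "u \<in> H0k k D" "v \<in> H0k k D" "T \<in> sets lebesgue" "T \<subseteq> D"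
  shows "integrable (lebesgue_on T) (\<lambda>x. sym_form I a x (jet u x) (jet v x))"
  using sym_integrable[OF assms(3,4), of "\<lambda>\<sigma> x. jet u x \<sigma>" "\<lambda>\<sigma> x. jet v x \<sigma>"]
    jet_sqint[OF assms(1,3,4)] jet_sqint[OF assms(2,3,4)] by simp

lemma energy_en:
  assumes "u \<in> H0k k D" "T \<in> sets lebesgue" "T \<subseteq> D"
  shows "energy k a D T u = en T u"
proof -
  have "energy k a D T u = (\<Sum>\<sigma>\<in>I. \<Sum>\<gamma>\<in>I. LINT x|lebesgue_on T. a \<sigma> \<gamma> x * jet u x \<sigma> * jet u x \<gamma>)"
    unfolding energy_def bform_def jet_def by (simp add: set_integral_lebesgue_on[OF assms(2)])
  also have "\<dots> = (LINT x|lebesgue_on T. (\<Sum>\<sigma>\<in>I. \<Sum>\<gamma>\<in>I. a \<sigma> \<gamma> x * jet u x \<sigma> * jet u x \<gamma>))"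
  proof -
    have i: "integrable (lebesgue_on T) (\<lambda>x. a \<sigma> \<gamma> x * jet u x \<sigma> * jet u x \<gamma>)" if "\<sigma> \<in> I" "\<gamma> \<in> I" for \<sigma> \<gamma>
      using that assms by (intro coeff_integrable[OF a Ds] jet_sqint) auto
    then show ?thesis
      by (subst Bochner_Integration.integral_sum) (auto intro!: sum.cong Bochner_Integration.integral_sum[symmetric] Bochner_Integration.integrable_sum)
  qed
  finally show ?thesis by (simp add: en_def quad_form_def)
qed

lemma en_nonneg: "T \<subseteq> D \<Longrightarrow> 0 \<le> en T u"
  unfolding en_def using quad_nonneg by (auto intro!: integral_nonneg_AE AE_I2)

lemma en_add:
  assumes u: "u \<in> H0k k D" and v: "v \<in> H0k k D"
  shows "en D (\<lambda>x. u x + t * v x) = en D u + 2 * t * Bf u v + t\<^sup>2 * en D v"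
proof -
  have iu: "integrable (lebesgue_on D) (\<lambda>x. quad_form I a x (jet u x))"
    "integrable (lebesgue_on D) (\<lambda>x. quad_form I a x (jet v x))"
    "integrable (lebesgue_on D) (\<lambda>x. sym_form I a x (jet u x) (jet v x))"
    using u v Ds by (auto intro: jet_quad_integrable jet_sym_integrable)
  have fin: "finite I" by (rule finite_mlen_le)
  have "AE x in lebesgue_on D. \<forall>\<sigma>\<in>I. jet (\<lambda>x. u x + t * v x) x \<sigma> = jet u x \<sigma> + t * jet v x \<sigma>"
    unfolding jet_def using H0k_add_cmult(2)[OF D(1) u v] fin by (intro AE_finite_allI) auto
  then have ae: "AE x in lebesgue_on D. quad_form I a x (jet (\<lambda>x. u x + t * v x) x) =
      quad_form I a x (jet u x) + 2 * t * sym_form I a x (jet u x) (jet v x) + t\<^sup>2 * quad_form I a x (jet v x)"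
    by eventually_elim (subst quad_form_add[symmetric], rule quad_form_cong, simp)
  have "en D (\<lambda>x. u x + t * v x) = (LINT x|lebesgue_on D. quad_form I a x (jet u x)
      + 2 * t * sym_form I a x (jet u x) (jet v x) + t\<^sup>2 * quad_form I a x (jet v x))"
    unfolding en_def
    using iu jet_quad_integrable[OF H0k_add_cmult(1)[OF D(1) u v] Ds order_refl]
    by (intro integral_cong_AE[OF _ _ ae]) (auto intro!: borel_measurable_integrable)
  also have "\<dots> = en D u + 2 * t * Bf u v + t\<^sup>2 * en D v"
    using iu by (simp add: en_def Bf_def)
  finally show ?thesis .
qed

lemma Bf_add:
  assumes u: "u \<in> H0k k D" and v: "v \<in> H0k k D" and w: "w \<in> H0k k D"
  shows "Bf u (\<lambda>x. v x + c * w x) = Bf u v + c * Bf u w"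
proof -
  have i: "integrable (lebesgue_on D) (\<lambda>x. sym_form I a x (jet u x) (jet v x))"
    "integrable (lebesgue_on D) (\<lambda>x. sym_form I a x (jet u x) (jet w x))"
    using u v w Ds by (auto intro: jet_sym_integrable)
  have fin: "finite I" by (rule finite_mlen_le)
  have "AE x in lebesgue_on D. \<forall>\<sigma>\<in>I. jet (\<lambda>x. v x + c * w x) x \<sigma> = jet v x \<sigma> + c * jet w x \<sigma>"
    unfolding jet_def using H0k_add_cmult(2)[OF D(1) v w] fin by (intro AE_finite_allI) auto
  then have ae: "AE x in lebesgue_on D. sym_form I a x (jet u x) (jet (\<lambda>x. v x + c * w x) x) =
      sym_form I a x (jet u x) (jet v x) + c * sym_form I a x (jet u x) (jet w x)"
    by eventually_elim (subst sym_form_add_right[symmetric], rule sym_form_cong, simp_all)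
  have "Bf u (\<lambda>x. v x + c * w x) = (LINT x|lebesgue_on D. sym_form I a x (jet u x) (jet v x)
      + c * sym_form I a x (jet u x) (jet w x))"
    unfolding Bf_def
    using i jet_sym_integrable[OF u H0k_add_cmult(1)[OF D(1) v w] Ds order_refl]
    by (intro integral_cong_AE[OF _ _ ae]) (auto intro!: borel_measurable_integrable)
  also have "\<dots> = Bf u v + c * Bf u w" using i by (simp add: Bf_def)
  finally show ?thesis .
qed

lemma Bf_lincomb:
  assumes u: "u \<in> H0k k D" and v: "v \<in> H0k k D" and "finite A" "\<And>p. p \<in> A \<Longrightarrow> w p \<in> H0k k D"
  shows "(\<lambda>x. v x + (\<Sum>p\<in>A. c p * w p x)) \<in> H0k k D"
    and "Bf u (\<lambda>x. v x + (\<Sum>p\<in>A. c p * w p x)) = Bf u v + (\<Sum>p\<in>A. c p * Bf u (w p))"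
proof -
  have "(\<lambda>x. v x + (\<Sum>p\<in>A. c p * w p x)) \<in> H0k k D \<and>
     Bf u (\<lambda>x. v x + (\<Sum>p\<in>A. c p * w p x)) = Bf u v + (\<Sum>p\<in>A. c p * Bf u (w p))"
    using assms(3,4)
  proof (induction A rule: finite_induct)
    case empty
    then show ?case using v by simp
  next
    case (insert q A)
    have eq: "(\<lambda>x. v x + (\<Sum>p\<in>insert q A. c p * w p x)) = (\<lambda>x. (v x + (\<Sum>p\<in>A. c p * w p x)) + c q * w q x)"
      using insert by (simp add: fun_eq_iff)
    have IH: "(\<lambda>x. v x + (\<Sum>p\<in>A. c p * w p x)) \<in> H0k k D"
      "Bf u (\<lambda>x. v x + (\<Sum>p\<in>A. c p * w p x)) = Bf u v + (\<Sum>p\<in>A. c p * Bf u (w p))" using insert by auto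
    have wq: "w q \<in> H0k k D" using insert by simp
    show ?case unfolding eq using H0k_add_cmult(1)[OF D(1) IH(1) wq, of "c q"] Bf_add[OF u IH(1) wq, of "c q"] IH(2) insert(1,2)
      by simp
  qed
  then show "(\<lambda>x. v x + (\<Sum>p\<in>A. c p * w p x)) \<in> H0k k D"
    "Bf u (\<lambda>x. v x + (\<Sum>p\<in>A. c p * w p x)) = Bf u v + (\<Sum>p\<in>A. c p * Bf u (w p))" by auto
qed

text \<open>Ellipticity and boundedness are compared on a vector with a single entry at a
  multi-index of order k. The result makes the ratio under the square root at least 1 and lets
  \<theta>max be cancelled when lower-order terms are absorbed.\<close>

lemma \<theta>min_le: "D \<noteq> {} \<Longrightarrow> \<theta>min \<le> \<theta>max"
proof -
  assume "D \<noteq> {}"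
  then obtain x where x: "x \<in> D" by blast
  \<comment> \<open>All k derivatives in one fixed direction; any direction would do.\<close>
  define s0 :: "'n midx" where "s0 = count_list (replicate k undefined)"
  have s0: "mlen s0 = k" by (simp add: s0_def mlen_count_list)
  define \<zeta> :: "'n midx \<Rightarrow> real" where "\<zeta> \<sigma> = (if \<sigma> = s0 then 1 else 0)" for \<sigma>
  have 1: "(\<Sum>\<sigma> | mlen \<sigma> = k. (\<zeta> \<sigma>)\<^sup>2) = 1"
  proof -
    have "(\<Sum>\<sigma> | mlen \<sigma> = k. (\<zeta> \<sigma>)\<^sup>2) = (\<Sum>\<sigma>\<in>{s0}. (\<zeta> \<sigma>)\<^sup>2)"
      by (rule sum.mono_neutral_right) (auto simp: \<zeta>_def s0 finite_mlen_eq)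
    then show ?thesis by (simp add: \<zeta>_def)
  qed
  have 0: "(\<Sum>\<sigma> | mlen \<sigma> < k. (\<zeta> \<sigma>)\<^sup>2) = 0" by (rule sum.neutral) (auto simp: \<zeta>_def s0)
  have "\<theta>min * 1 \<le> quad_form {\<sigma>. mlen \<sigma> = k} a x \<zeta>"
    using el x 1 unfolding strongly_elliptic_def by metis
  also have "\<dots> = quad_form I a x \<zeta>" by (rule quad_form_top[symmetric]) (auto simp: \<zeta>_def s0)
  also have "\<dots> \<le> \<theta>' * 1 + \<theta>0 * 0" using bd x 1 0 unfolding bounded_coeffs_def by metis
  finally show "\<theta>min \<le> \<theta>max" by simp
qed

text \<open>On an open set this is the square of \<open>seminormk\<close>, but with the derivatives
  taken on \<open>D\<close>, so that integrals over different elements refer to the same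
  representative.\<close>

definition seminorm2 :: "nat \<Rightarrow> (real^'n) set \<Rightarrow> (real^'n \<Rightarrow> real) \<Rightarrow> real" where
  "seminorm2 p T u = (\<Sum>\<sigma> | mlen \<sigma> = p. LINT x|lebesgue_on T. (jet u x \<sigma>)\<^sup>2)"

lemma seminorm2_nonneg: "0 \<le> seminorm2 p T u"
  unfolding seminorm2_def by (auto intro!: sum_nonneg)

lemma seminormk_restrict:
  assumes u: "u \<in> H0k k D" and T: "open T" "T \<subseteq> D" and p: "p \<le> k"
  shows "(seminormk p T u)\<^sup>2 = seminorm2 p T u"
proof -
  have Ts: "T \<in> sets lebesgue" using T by (simp add: open_sets_lebesgue)
  have "(LINT x:T|lebesgue. (wderiv T \<sigma> u x)\<^sup>2) = (LINT x|lebesgue_on T. (jet u x \<sigma>)\<^sup>2)" if "mlen \<sigma> = p" for \<sigma>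
    unfolding set_integral_lebesgue_on[OF Ts]
  proof (rule integral_cong_AE)
    have ae: "AE x in lebesgue_on T. wderiv T \<sigma> u x = jet u x \<sigma>"
      unfolding jet_def using wderiv_restrict[OF D(1) T u] that p by simp
    then show "AE x in lebesgue_on T. (wderiv T \<sigma> u x)\<^sup>2 = (jet u x \<sigma>)\<^sup>2" by eventually_elim simp
    have m: "(\<lambda>x. jet u x \<sigma>) \<in> borel_measurable (lebesgue_on T)"
      using jet_sqint[OF u Ts T(2)] that p by (simp add: sqint_measurable)
    then show "(\<lambda>x. (jet u x \<sigma>)\<^sup>2) \<in> borel_measurable (lebesgue_on T)" by simp
    have "wderiv T \<sigma> u \<in> borel_measurable (lebesgue_on T)"
      by (rule measurable_AE_lebesgue_on[OF m Ts]) (use ae in \<open>auto elim!: eventually_mono\<close>)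
    then show "(\<lambda>x. (wderiv T \<sigma> u x)\<^sup>2) \<in> borel_measurable (lebesgue_on T)" by simp
  qed
  then have "(\<Sum>\<sigma> | mlen \<sigma> = p. LINT x:T|lebesgue. (wderiv T \<sigma> u x)\<^sup>2) = seminorm2 p T u"
    unfolding seminorm2_def by (intro sum.cong) auto
  then show ?thesis unfolding seminormk_def using seminorm2_nonneg by simp
qed

lemma quad_integral_upper:
  assumes T: "T \<in> sets lebesgue" "T \<subseteq> D" and z: "\<And>\<sigma>. mlen \<sigma> \<le> k \<Longrightarrow> z \<sigma> \<in> sqint (lebesgue_on T)"
  shows "(LINT x|lebesgue_on T. quad_form I a x (\<lambda>\<sigma>. z \<sigma> x))
    \<le> \<theta>' * (\<Sum>\<sigma> | mlen \<sigma> = k. LINT x|lebesgue_on T. (z \<sigma> x)\<^sup>2)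
      + \<theta>0 * (\<Sum>p<k. \<Sum>\<sigma> | mlen \<sigma> = p. LINT x|lebesgue_on T. (z \<sigma> x)\<^sup>2)"
proof -
  have i: "integrable (lebesgue_on T) (\<lambda>x. (z \<sigma> x)\<^sup>2)" if "mlen \<sigma> \<le> k" for \<sigma>
    by (rule sqint_square[OF z[OF that]])
  have s1: "integrable (lebesgue_on T) (\<lambda>x. \<Sum>\<sigma> | mlen \<sigma> = k. (z \<sigma> x)\<^sup>2)"
    "integrable (lebesgue_on T) (\<lambda>x. \<Sum>\<sigma> | mlen \<sigma> < k. (z \<sigma> x)\<^sup>2)"
    by (auto intro!: Bochner_Integration.integrable_sum i)
  have "(LINT x|lebesgue_on T. quad_form I a x (\<lambda>\<sigma>. z \<sigma> x))
    \<le> (LINT x|lebesgue_on T. \<theta>' * (\<Sum>\<sigma> | mlen \<sigma> = k. (z \<sigma> x)\<^sup>2) + \<theta>0 * (\<Sum>\<sigma> | mlen \<sigma> < k. (z \<sigma> x)\<^sup>2))"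
  proof (rule integral_mono)
    show "integrable (lebesgue_on T) (\<lambda>x. quad_form I a x (\<lambda>\<sigma>. z \<sigma> x))" by (rule quad_integrable[OF T z])
    show "integrable (lebesgue_on T) (\<lambda>x. \<theta>' * (\<Sum>\<sigma> | mlen \<sigma> = k. (z \<sigma> x)\<^sup>2) + \<theta>0 * (\<Sum>\<sigma> | mlen \<sigma> < k. (z \<sigma> x)\<^sup>2))"
      by (intro Bochner_Integration.integrable_add integrable_mult_right s1)
    fix x assume "x \<in> space (lebesgue_on T)"
    then show "quad_form I a x (\<lambda>\<sigma>. z \<sigma> x) \<le> \<theta>' * (\<Sum>\<sigma> | mlen \<sigma> = k. (z \<sigma> x)\<^sup>2) + \<theta>0 * (\<Sum>\<sigma> | mlen \<sigma> < k. (z \<sigma> x)\<^sup>2)"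
      using bd T by (auto simp: bounded_coeffs_def)
  qed
  also have "\<dots> = \<theta>' * (LINT x|lebesgue_on T. (\<Sum>\<sigma> | mlen \<sigma> = k. (z \<sigma> x)\<^sup>2)) + \<theta>0 * (LINT x|lebesgue_on T. (\<Sum>\<sigma> | mlen \<sigma> < k. (z \<sigma> x)\<^sup>2))"
    using s1 by simp
  also have "(LINT x|lebesgue_on T. (\<Sum>\<sigma> | mlen \<sigma> = k. (z \<sigma> x)\<^sup>2)) = (\<Sum>\<sigma> | mlen \<sigma> = k. LINT x|lebesgue_on T. (z \<sigma> x)\<^sup>2)"
    by (rule Bochner_Integration.integral_sum) (auto intro: i)
  also have "(LINT x|lebesgue_on T. (\<Sum>\<sigma> | mlen \<sigma> < k. (z \<sigma> x)\<^sup>2)) = (\<Sum>\<sigma> | mlen \<sigma> < k. LINT x|lebesgue_on T. (z \<sigma> x)\<^sup>2)"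
    by (rule Bochner_Integration.integral_sum) (auto intro: i)
  finally show ?thesis by (simp add: sum_mlen_less)
qed

text \<open>Pointwise coercivity leaves lower-order terms, which the projection bounds turn into a
  multiple of the top seminorm itself. By \<open>h2\<close> and \<theta>min <= \<theta>max this
  multiple is at most \<theta>min/8, so 7/8 of the left side remains; 2 divided by 7/8 is
  16/7.\<close>

lemma local_coercivity:
  assumes u: "u \<in> H0k k D" and T: "T \<in> sets lebesgue" "T \<subseteq> D" and D0: "D \<noteq> {}"
    and proj: "\<And>p. p < k \<Longrightarrow> seminorm2 p T u \<le> (Cp * h ^ (k - p))\<^sup>2 * seminorm2 k T u"
    and h2: "16 * \<theta>0 * \<theta>max * Cp\<^sup>2 * (\<Sum>j\<in>{1..k}. h ^ (2 * j)) \<le> \<theta>min\<^sup>2"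
  shows "seminorm2 k T u \<le> 16 / (7 * \<theta>min) * en T u"
proof -
  let ?N = "seminorm2 k T u" and ?M = "lebesgue_on T" and ?S = "\<Sum>j\<in>{1..k}. h ^ (2 * j)"
  have js: "(\<lambda>x. jet u x \<sigma>) \<in> sqint ?M" if "mlen \<sigma> \<le> k" for \<sigma> using jet_sqint[OF u T that] .
  have i: "integrable ?M (\<lambda>x. (jet u x \<sigma>)\<^sup>2)" if "mlen \<sigma> \<le> k" for \<sigma> by (rule sqint_square[OF js[OF that]])
  have s1: "integrable ?M (\<lambda>x. \<Sum>\<sigma> | mlen \<sigma> = k. (jet u x \<sigma>)\<^sup>2)"
    "integrable ?M (\<lambda>x. \<Sum>\<sigma> | mlen \<sigma> < k. (jet u x \<sigma>)\<^sup>2)"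
    by (auto intro!: Bochner_Integration.integrable_sum i)
  have iq: "integrable ?M (\<lambda>x. quad_form I a x (jet u x))" by (rule jet_quad_integrable[OF u T])
  have "\<theta>min * ?N = (LINT x|?M. \<theta>min * (\<Sum>\<sigma> | mlen \<sigma> = k. (jet u x \<sigma>)\<^sup>2))"
    unfolding seminorm2_def using i s1 by (subst Bochner_Integration.integral_sum[symmetric]) auto
  also have "\<dots> \<le> (LINT x|?M. 2 * quad_form I a x (jet u x) + 2 * \<theta>0 * (\<Sum>\<sigma> | mlen \<sigma> < k. (jet u x \<sigma>)\<^sup>2))"
  proof (rule integral_mono)
    fix x assume "x \<in> space ?M"
    then have "x \<in> D" using T by auto
    then show "\<theta>min * (\<Sum>\<sigma> | mlen \<sigma> = k. (jet u x \<sigma>)\<^sup>2) \<le> 2 * quad_form I a x (jet u x) + 2 * \<theta>0 * (\<Sum>\<sigma> | mlen \<sigma> < k. (jet u x \<sigma>)\<^sup>2)"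
      by (rule coercivity_pointwise[OF _ nn bd el])
  qed (use s1 iq in auto)
  also have "\<dots> = 2 * en T u + 2 * \<theta>0 * (LINT x|?M. (\<Sum>\<sigma> | mlen \<sigma> < k. (jet u x \<sigma>)\<^sup>2))"
    unfolding en_def using s1 iq by simp
  also have "(LINT x|?M. (\<Sum>\<sigma> | mlen \<sigma> < k. (jet u x \<sigma>)\<^sup>2)) = (\<Sum>p<k. seminorm2 p T u)"
    unfolding seminorm2_def using i by (subst Bochner_Integration.integral_sum) (auto simp: sum_mlen_less)
  also have "(\<Sum>p<k. seminorm2 p T u) \<le> (\<Sum>p<k. Cp\<^sup>2 * ?N * (h ^ (k - p))\<^sup>2)"
    using proj by (intro sum_mono) (auto simp: power_mult_distrib mult_ac)
  also have "\<dots> = Cp\<^sup>2 * ?N * ?S" unfolding sum_distrib_left[symmetric] sum_power_reindex ..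
  finally have 1: "\<theta>min * ?N \<le> 2 * en T u + 2 * \<theta>0 * (Cp\<^sup>2 * ?N * ?S)" using \<theta> by (simp add: mult_left_mono)
  have "2 * \<theta>0 * (Cp\<^sup>2 * ?S) \<le> \<theta>min / 8"
  proof -
    have "\<theta>max * (16 * \<theta>0 * (Cp\<^sup>2 * ?S)) \<le> \<theta>min * \<theta>min" using h2 by (simp add: power2_eq_square mult_ac)
    also have "\<dots> \<le> \<theta>max * \<theta>min" using \<theta>min_le[OF D0] \<theta> by (intro mult_right_mono) auto
    finally show ?thesis using \<theta>max_pos by simp
  qed
  then have "2 * \<theta>0 * (Cp\<^sup>2 * ?S) * ?N \<le> \<theta>min / 8 * ?N" by (intro mult_right_mono seminorm2_nonneg)
  with 1 have "\<theta>min * ?N \<le> 2 * en T u + \<theta>min * ?N / 8" by (simp add: mult_ac)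
  then have "7 * (\<theta>min * ?N) \<le> 16 * en T u" by linarith
  then show ?thesis using \<theta> by (simp add: field_simps)
qed

text \<open>The derivative of order \<sigma> of \<eta> u minus \<eta> times that of u. Dropping the
  head of \<open>splits\<close> removes the single term in which no derivative falls on
  \<eta>.\<close>

definition commutator :: "(real^'n \<Rightarrow> real) \<Rightarrow> (real^'n \<Rightarrow> real) \<Rightarrow> 'n midx \<Rightarrow> real^'n \<Rightarrow> real" where
  "commutator \<eta> u \<sigma> x = (\<Sum>(ys, zs)\<leftarrow>tl (splits (mlist \<sigma>)). foldr pd ys \<eta> x * jet u x (count_list zs))"

lemma jet_mult:
  assumes u: "u \<in> H0k k D" and \<eta>: "smooth \<eta>" and B: "\<And>xs x. length xs \<le> k \<Longrightarrow> \<bar>foldr pd xs \<eta> x\<bar> \<le> B xs"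
    and \<sigma>: "mlen \<sigma> \<le> k"
  shows "AE x in lebesgue_on D. jet (\<lambda>x. \<eta> x * u x) x \<sigma> = commutator \<eta> u \<sigma> x + \<eta> x * jet u x \<sigma>"
proof -
  have "AE x in lebesgue_on D. wderiv D \<sigma> (\<lambda>x. \<eta> x * u x) x =
      (\<Sum>(ys, zs)\<leftarrow>splits (mlist \<sigma>). foldr pd ys \<eta> x * wderiv D (count_list zs) u x)"
    by (rule H0k_mult_smooth(2)[OF D(1) u \<eta>, of B]) (use B \<sigma> in auto)
  then show ?thesis
  proof eventually_elim
    case (elim x)
    have "splits (mlist \<sigma>) = ([], mlist \<sigma>) # tl (splits (mlist \<sigma>))" by (rule splits_Cons)
    then have "(\<Sum>(ys, zs)\<leftarrow>splits (mlist \<sigma>). foldr pd ys \<eta> x * wderiv D (count_list zs) u x)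
       = \<eta> x * wderiv D (count_list (mlist \<sigma>)) u x + (\<Sum>(ys, zs)\<leftarrow>tl (splits (mlist \<sigma>)). foldr pd ys \<eta> x * wderiv D (count_list zs) u x)"
      by (metis (no_types, lifting) case_prod_conv foldr.simps(1) id_apply list.simps(9) sum_list.Cons)
    then show ?case using elim unfolding commutator_def jet_def count_list_mlist by simp
  qed
qed

lemma splits_tl:
  assumes "(ys, zs) \<in> set (tl (splits xs))"
  shows "length ys + length zs = length xs" "ys \<noteq> []"
  using assms splits_length tl_splits_nonempty list.set_sel(2) splits_Cons
  by (metis list.distinct(1))+

lemma commutator_sqint:
  assumes u: "u \<in> H0k k D" and T: "T \<in> sets lebesgue" "T \<subseteq> D" and \<eta>: "smooth \<eta>"
    and B: "\<And>xs x. length xs \<le> k \<Longrightarrow> \<bar>foldr pd xs \<eta> x\<bar> \<le> B xs" and \<sigma>: "mlen \<sigma> \<le> k"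
    and yz: "(ys, zs) \<in> set (tl (splits (mlist \<sigma>)))"
  shows "(\<lambda>x. foldr pd ys \<eta> x * jet u x (count_list zs)) \<in> sqint (lebesgue_on T)"
proof -
  have len: "length ys \<le> k" "length zs \<le> k" using splits_tl[OF yz] \<sigma> by (auto simp: length_mlist)
  have "foldr pd ys \<eta> \<in> borel_measurable (lebesgue_on T)"
    using smooth_measurable[OF smooth_foldr[OF \<eta>]]
    by (intro measurable_restrict_space1) (simp add: measurable_completion)
  then show ?thesis
    using jet_sqint[OF u T, of "count_list zs"] len B by (intro sqint_bounded_mult[of _ _ _ "B ys"]) (auto simp: mlen_count_list)
qed

text \<open>A derivative of \<eta> of order s costs L^(-s). The derivative of u beside it has order
  s below that of \<sigma>, so its projection bound gains h^s. Together this is (h/L)^s, which is at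
  most h/L because s >= 1.\<close>

lemma commutator_estimate:
  assumes u: "u \<in> H0k k D" and T: "T \<in> sets lebesgue" "T \<subseteq> D" and \<eta>: "smooth \<eta>"
    and B: "\<And>xs x. length xs \<le> k \<Longrightarrow> \<bar>foldr pd xs \<eta> x\<bar> \<le> B xs"
    and C: "\<And>xs x. xs \<noteq> [] \<Longrightarrow> length xs \<le> k \<Longrightarrow> \<bar>foldr pd xs \<eta> x\<bar> \<le> C / L ^ length xs"
    and C0: "C \<ge> 0" and hL: "0 < h" "h \<le> L"
    and proj: "\<And>p. p \<le> k \<Longrightarrow> seminorm2 p T u \<le> (Cp * h ^ (k - p))\<^sup>2 * N" and N0: "N \<ge> 0"
    and \<sigma>: "mlen \<sigma> \<le> k"
  shows "commutator \<eta> u \<sigma> \<in> sqint (lebesgue_on T)"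
    and "(LINT x|lebesgue_on T. (commutator \<eta> u \<sigma> x)\<^sup>2) \<le> (2 ^ k * C * (h / L) * Cp * h ^ (k - mlen \<sigma>))\<^sup>2 * N"
proof -
  let ?M = "lebesgue_on T" and ?ps = "tl (splits (mlist \<sigma>))"
  let ?F = "\<lambda>p x. foldr pd (fst p) \<eta> x * jet u x (count_list (snd p))"
  let ?K = "(C * (h / L) * Cp * h ^ (k - mlen \<sigma>))\<^sup>2 * N"
  have com: "commutator \<eta> u \<sigma> = (\<lambda>x. \<Sum>p\<leftarrow>?ps. ?F p x)" by (simp add: commutator_def[abs_def] case_prod_unfold)
  have Fs: "?F p \<in> sqint ?M" if "p \<in> set ?ps" for p
    using commutator_sqint[OF u T \<eta> B \<sigma>, of "fst p" "snd p"] that by simp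
  then show cs: "commutator \<eta> u \<sigma> \<in> sqint ?M" unfolding com by (rule sqint_sum_list)
  have Fb: "(LINT x|?M. (?F p x)\<^sup>2) \<le> ?K" if p: "p \<in> set ?ps" for p
  proof -
    obtain ys zs where yz: "p = (ys, zs)" by (cases p)
    have len: "length ys + length zs = mlen \<sigma>" and ne: "ys \<noteq> []"
      using splits_tl[of ys zs "mlist \<sigma>"] p by (simp_all add: yz length_mlist)
    have zk: "mlen (count_list zs) \<le> k" "length ys \<le> k" using len \<sigma> by (auto simp: mlen_count_list)
    have jz: "(\<lambda>x. jet u x (count_list zs)) \<in> sqint ?M" by (rule jet_sqint[OF u T zk(1)])
    have "(LINT x|?M. (?F p x)\<^sup>2) \<le> (LINT x|?M. (C / L ^ length ys)\<^sup>2 * (jet u x (count_list zs))\<^sup>2)"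
    proof (rule integral_mono)
      show "integrable ?M (\<lambda>x. (?F p x)\<^sup>2)" by (rule sqint_square[OF Fs[OF p]])
      show "integrable ?M (\<lambda>x. (C / L ^ length ys)\<^sup>2 * (jet u x (count_list zs))\<^sup>2)" by (intro integrable_mult_right sqint_square jz)
      fix x
      have "(foldr pd ys \<eta> x)\<^sup>2 \<le> (C / L ^ length ys)\<^sup>2"
        using C[OF ne zk(2), of x] by (metis abs_ge_zero power2_abs power_mono)
      then show "(?F p x)\<^sup>2 \<le> (C / L ^ length ys)\<^sup>2 * (jet u x (count_list zs))\<^sup>2"
        by (simp add: yz power_mult_distrib mult_right_mono)
    qed
    also have "\<dots> = (C / L ^ length ys)\<^sup>2 * (LINT x|?M. (jet u x (count_list zs))\<^sup>2)" by simp
    also have "(LINT x|?M. (jet u x (count_list zs))\<^sup>2) \<le> seminorm2 (length zs) T u"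
      unfolding seminorm2_def by (rule member_le_sum) (auto simp: mlen_count_list finite_mlen_eq)
    also have "seminorm2 (length zs) T u \<le> (Cp * h ^ (k - length zs))\<^sup>2 * N" using len \<sigma> by (intro proj) auto
    also have "(C / L ^ length ys)\<^sup>2 * ((Cp * h ^ (k - length zs))\<^sup>2 * N) = (C * Cp * (h ^ (k - length zs) / L ^ length ys))\<^sup>2 * N"
      by (simp add: power_mult_distrib power_divide mult_ac)
    also have "h ^ (k - length zs) / L ^ length ys = h ^ (k - mlen \<sigma>) * (h / L) ^ length ys"
    proof -
      have "k - length zs = (k - mlen \<sigma>) + length ys" using len \<sigma> by simp
      then show ?thesis by (simp add: power_add power_divide)
    qed
    also have "(C * Cp * (h ^ (k - mlen \<sigma>) * (h / L) ^ length ys))\<^sup>2 * N = (C * Cp * h ^ (k - mlen \<sigma>))\<^sup>2 * (((h / L) ^ length ys)\<^sup>2 * N)"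
      by (simp add: power_mult_distrib mult_ac)
    also have "\<dots> \<le> (C * Cp * h ^ (k - mlen \<sigma>))\<^sup>2 * ((h / L)\<^sup>2 * N)"
    proof -
      have "(h / L) ^ length ys \<le> (h / L) ^ 1" using hL ne by (intro power_decreasing) (auto simp: Suc_le_eq)
      then have "((h / L) ^ length ys)\<^sup>2 \<le> (h / L)\<^sup>2" using hL by (intro power_mono) auto
      then show ?thesis using N0 by (intro mult_left_mono mult_right_mono) auto
    qed
    also have "\<dots> = ?K" by (simp only: power_mult_distrib mult_ac)
    finally show ?thesis by (simp add: mult_left_mono)
  qed
  have len: "length ?ps \<le> 2 ^ k"
  proof -
    have "length ?ps \<le> 2 ^ mlen \<sigma>" by (simp add: length_splits length_mlist)
    also have "\<dots> \<le> 2 ^ k" using \<sigma> by (intro power_increasing) auto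
    finally show ?thesis .
  qed
  have K0: "?K \<ge> 0" using N0 by simp
  have si: "integrable ?M (\<lambda>x. \<Sum>p\<leftarrow>qs. (?F p x)\<^sup>2) \<and> (LINT x|?M. (\<Sum>p\<leftarrow>qs. (?F p x)\<^sup>2)) \<le> real (length qs) * ?K"
    if "set qs \<subseteq> set ?ps" for qs
    using that
  proof (induction qs)
    case (Cons q qs)
    have "integrable ?M (\<lambda>x. (?F q x)\<^sup>2)" using Cons.prems by (intro sqint_square Fs) auto
    moreover have "(LINT x|?M. (?F q x)\<^sup>2) \<le> ?K" using Cons.prems by (intro Fb) auto
    ultimately show ?case using Cons by (simp add: algebra_simps)
  qed simp
  \<comment> \<open>The number of terms enters twice, once from squaring a sum and once from adding
    the bounds, which gives the square of 2^k.\<close>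
  have "(LINT x|?M. (commutator \<eta> u \<sigma> x)\<^sup>2) \<le> (LINT x|?M. real (length ?ps) * (\<Sum>p\<leftarrow>?ps. (?F p x)\<^sup>2))"
  proof (rule integral_mono)
    show "integrable ?M (\<lambda>x. (commutator \<eta> u \<sigma> x)\<^sup>2)" by (rule sqint_square[OF cs])
    show "integrable ?M (\<lambda>x. real (length ?ps) * (\<Sum>p\<leftarrow>?ps. (?F p x)\<^sup>2))"
      using si[of ?ps] by (intro integrable_mult_right) auto
    show "(commutator \<eta> u \<sigma> x)\<^sup>2 \<le> real (length ?ps) * (\<Sum>p\<leftarrow>?ps. (?F p x)\<^sup>2)" for x
      unfolding com by (rule square_sum_list_le)
  qed
  also have "\<dots> = real (length ?ps) * (LINT x|?M. (\<Sum>p\<leftarrow>?ps. (?F p x)\<^sup>2))" by simp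
  also have "\<dots> \<le> real (length ?ps) * (real (length ?ps) * ?K)" using si[of ?ps] by (intro mult_left_mono) auto
  also have "\<dots> \<le> 2 ^ k * (2 ^ k * ?K)"
  proof -
    have "real (length ?ps) \<le> real (2 ^ k)" using len by (rule of_nat_mono)
    then have l: "real (length ?ps) \<le> 2 ^ k" by simp
    show ?thesis using l K0 by (intro mult_mono mult_right_mono) auto
  qed
  also have "\<dots> = (2 ^ k * C * (h / L) * Cp * h ^ (k - mlen \<sigma>))\<^sup>2 * N"
    by (simp add: power2_eq_square mult_ac)
  finally show "(LINT x|?M. (commutator \<eta> u \<sigma> x)\<^sup>2) \<le> (2 ^ k * C * (h / L) * Cp * h ^ (k - mlen \<sigma>))\<^sup>2 * N" .
qed

end

section \<open>Local constancy, polynomials and the elements of the partition\<close>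

lemma foldr_pd_local:
  assumes S: "open S" and f: "smooth f" and eq: "\<And>x. x \<in> S \<Longrightarrow> f x = c" and xs: "xs \<noteq> []" and x: "x \<in> S"
  shows "foldr pd xs f x = 0"
  using xs x
proof (induction xs arbitrary: x)
  case (Cons i xs)
  have "\<exists>d. \<forall>y\<in>S. foldr pd xs f y = d" using Cons.IH eq by (cases "xs = []") auto
  then obtain d where d: "\<And>y. y \<in> S \<Longrightarrow> foldr pd xs f y = d" by blast
  have "((\<lambda>_. d) has_derivative (\<lambda>_. 0)) (at x)" by simp
  then have "(foldr pd xs f has_derivative (\<lambda>_. 0)) (at x)"
    by (rule has_derivative_transform_within_open[OF _ S Cons.prems(2)]) (simp add: d)
  then show ?case by (simp add: pd_eq)
qed simp

lemma polys_lincomb: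
  assumes "finite A" "\<And>p. p \<in> A \<Longrightarrow> P p \<in> polys s"
  shows "(\<lambda>x. \<Sum>p\<in>A. c p * P p x) \<in> polys s"
proof -
  have "\<forall>p\<in>A. \<exists>d. \<forall>x. P p x = (\<Sum>\<sigma> | mlen \<sigma> \<le> s. d \<sigma> * (\<Prod>i\<in>UNIV. (x $ i) ^ \<sigma> i))"
    using assms(2) unfolding polys_def by blast
  then obtain d where d: "\<And>p x. p \<in> A \<Longrightarrow> P p x = (\<Sum>\<sigma> | mlen \<sigma> \<le> s. d p \<sigma> * (\<Prod>i\<in>UNIV. (x $ i) ^ \<sigma> i))"
    by metis
  have "(\<Sum>p\<in>A. c p * P p x) = (\<Sum>\<sigma> | mlen \<sigma> \<le> s. (\<Sum>p\<in>A. c p * d p \<sigma>) * (\<Prod>i\<in>UNIV. (x $ i) ^ \<sigma> i))" for x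
  proof -
    have "(\<Sum>p\<in>A. c p * P p x) = (\<Sum>p\<in>A. \<Sum>\<sigma> | mlen \<sigma> \<le> s. c p * d p \<sigma> * (\<Prod>i\<in>UNIV. (x $ i) ^ \<sigma> i))"
      by (intro sum.cong refl) (simp add: d sum_distrib_left mult.assoc)
    also have "\<dots> = (\<Sum>\<sigma> | mlen \<sigma> \<le> s. \<Sum>p\<in>A. c p * d p \<sigma> * (\<Prod>i\<in>UNIV. (x $ i) ^ \<sigma> i))" by (rule sum.swap)
    finally show ?thesis by (simp add: sum_distrib_right)
  qed
  then show ?thesis unfolding polys_def
    by (intro CollectI exI[of _ "\<lambda>\<sigma>. \<Sum>p\<in>A. c p * d p \<sigma>"] allI)
qed

lemma mesh_element_open:
  assumes "mesh_element T"
  shows "open T" "bounded T" "T \<noteq> {}" "diameter T > 0"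
proof -
  obtain F where F: "finite F" "\<And>P. P \<in> F \<Longrightarrow> polytope P" "T = interior (\<Union>F)" and ne: "T \<noteq> {}"
    using assms unfolding mesh_element_def by blast
  show "open T" "T \<noteq> {}" using F ne by auto
  have "bounded (\<Union>F)" using F(1,2) by (auto intro: polytope_imp_bounded)
  then show b: "bounded T" using F(3) interior_subset bounded_subset by blast
  obtain x where "x \<in> T" using ne by blast
  then obtain e where e: "e > 0" "ball x e \<subseteq> T" using \<open>open T\<close> open_contains_ball by blast
  have "x + (e / 2) *\<^sub>R axis undefined 1 \<in> T"
    using e by (intro subsetD[OF e(2)]) (simp add: dist_norm)
  from diameter_bounded_bound[OF b this \<open>x \<in> T\<close>] have "e / 2 \<le> diameter T" using e by (simp add: dist_norm)
  then show "diameter T > 0" using e by simp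
qed

lemma mesh_size_ge: "i \<in> {1..m} \<Longrightarrow> diameter (\<tau> i) \<le> mesh_size m \<tau>"
  unfolding mesh_size_def by (rule Max_ge) auto

text \<open>The elements are disjoint and miss only a null set of \<open>D\<close>. The set S is
  arbitrary so that the energy of a layer can be split as well.\<close>

lemma partition_integral:
  fixes D :: "(real^'n::finite) set" and F :: "real^'n \<Rightarrow> real"
  assumes mp: "mesh_partition D m \<tau>" and F: "integrable (lebesgue_on S) F" and S: "S \<in> sets lebesgue" "S \<subseteq> D"
  shows "(LINT x|lebesgue_on S. F x) = (\<Sum>j\<in>{1..m}. LINT x|lebesgue_on (\<tau> j \<inter> S). F x)"
proof -
  let ?U = "\<Union>j\<in>{1..m}. \<tau> j \<inter> S"
  have \<tau>s: "\<tau> j \<inter> S \<in> sets lebesgue" if "j \<in> {1..m}" for j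
  proof -
    have "\<tau> j \<in> sets lebesgue" using mp that by (intro open_sets_lebesgue mesh_element_open(1)) (auto simp: mesh_partition_def)
    then show ?thesis using S by auto
  qed
  have Us: "?U \<in> sets lebesgue" by (rule sets.finite_UN) (use \<tau>s in auto)
  have sub: "?U \<subseteq> S" by auto
  have null: "S - ?U \<in> null_sets lebesgue"
  proof -
    have "negligible (D - (\<Union>j\<in>{1..m}. \<tau> j))" using mp by (simp add: mesh_partition_def)
    then have "negligible (S - ?U)" by (rule negligible_subset) (use S in auto)
    then show ?thesis by (simp add: negligible_iff_null_sets)
  qed
  have iF: "set_integrable lebesgue S F" using F S by (simp add: set_integrable_lebesgue_on)
  have "(LINT x|lebesgue_on S. F x) = (LINT x:S|lebesgue. F x)" using S by (simp add: set_integral_lebesgue_on)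
  also have "\<dots> = (LINT x:?U|lebesgue. F x)"
    unfolding set_lebesgue_integral_def
  proof (rule integral_cong_AE)
    show "(\<lambda>x. indicat_real S x *\<^sub>R F x) \<in> borel_measurable lebesgue"
      using iF unfolding set_integrable_def by (rule borel_measurable_integrable)
    show "(\<lambda>x. indicat_real ?U x *\<^sub>R F x) \<in> borel_measurable lebesgue"
      using set_integrable_subset[OF iF Us sub] unfolding set_integrable_def by (rule borel_measurable_integrable)
    have "AE x in lebesgue. x \<notin> S - ?U" using null by (rule AE_not_in)
    then show "AE x in lebesgue. indicat_real S x *\<^sub>R F x = indicat_real ?U x *\<^sub>R F x"
      by eventually_elim (use sub in \<open>auto simp: indicator_def\<close>)
  qed
  also have "\<dots> = (\<Sum>j\<in>{1..m}. LINT x:\<tau> j \<inter> S|lebesgue. F x)"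
  proof (rule set_integral_finite_Union)
    show "disjoint_family_on (\<lambda>j. \<tau> j \<inter> S) {1..m}" using mp unfolding mesh_partition_def disjoint_family_on_def by blast
    show "set_integrable lebesgue (\<tau> j \<inter> S) F" if "j \<in> {1..m}" for j
      using set_integrable_subset[OF iF \<tau>s[OF that]] by simp
  qed (use \<tau>s in auto)
  also have "\<dots> = (\<Sum>j\<in>{1..m}. LINT x|lebesgue_on (\<tau> j \<inter> S). F x)"
    by (intro sum.cong refl set_integral_lebesgue_on \<tau>s)
  finally show ?thesis .
qed

context elliptic
begin

section \<open>Commutator and source term on one element\<close>

lemma en_Un:
  assumes u: "u \<in> H0k k D" and T: "T \<in> sets lebesgue" "S \<in> sets lebesgue" "T \<subseteq> D" "S \<subseteq> D" "T \<inter> S = {}"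
  shows "en (T \<union> S) u = en T u + en S u"
proof -
  have "(LINT x:T \<union> S|lebesgue. quad_form I a x (jet u x)) = (LINT x:T|lebesgue. quad_form I a x (jet u x)) + (LINT x:S|lebesgue. quad_form I a x (jet u x))"
    using T jet_quad_integrable[OF u T(1,3)] jet_quad_integrable[OF u T(2,4)]
    by (intro set_integral_Un) (auto simp: set_integrable_lebesgue_on)
  then show ?thesis using T by (simp add: en_def set_integral_lebesgue_on)
qed

lemma en_mono:
  assumes u: "u \<in> H0k k D" and T: "T \<in> sets lebesgue" "S \<in> sets lebesgue" "T \<subseteq> S" "S \<subseteq> D"
  shows "en T u \<le> en S u"
proof -
  have "en (T \<union> (S - T)) u = en T u + en (S - T) u" using T by (intro en_Un[OF u]) auto
  moreover have "T \<union> (S - T) = S" using T by auto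
  moreover have "0 \<le> en (S - T) u" using T by (intro en_nonneg) auto
  ultimately show ?thesis by simp
qed

text \<open>The energy of the commutator is at most \<kappa>^2 times that of u, where \<kappa> is
  the factor claimed. Young's inequality with weight \<kappa> then gives two equal terms.\<close>

lemma commutator_energy:
  assumes u: "u \<in> H0k k D" and T: "T \<in> sets lebesgue" "T \<subseteq> D" and \<eta>: "smooth \<eta>"
    and B: "\<And>xs x. length xs \<le> k \<Longrightarrow> \<bar>foldr pd xs \<eta> x\<bar> \<le> B xs"
    and C: "\<And>xs x. xs \<noteq> [] \<Longrightarrow> length xs \<le> k \<Longrightarrow> \<bar>foldr pd xs \<eta> x\<bar> \<le> C / L ^ length xs"
    and C1: "C \<ge> 1" and hL: "0 < h" "h \<le> L" and Cp: "Cp \<ge> 1"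
    and proj: "\<And>p. p \<le> k \<Longrightarrow> seminorm2 p T u \<le> (Cp * h ^ (k - p))\<^sup>2 * seminorm2 k T u"
    and h1: "(\<Sum>j\<in>{1..<k}. h ^ (2 * j)) \<le> 1 / Cp\<^sup>2"
    and co: "seminorm2 k T u \<le> 16 / (7 * \<theta>min) * en T u"
  shows "\<bar>LINT x|lebesgue_on T. sym_form I a x (jet u x) (\<lambda>\<sigma>. commutator \<eta> u \<sigma> x)\<bar>
     \<le> 3 * real (card I) * 2 ^ k * C * (h / L) * Cp * sqrt (\<theta>max / \<theta>min) * en T u"
proof -
  let ?M = "lebesgue_on T" and ?N = "seminorm2 k T u" and ?m = "real (card I)"
  define Z where "Z = 2 ^ k * C * (h / L) * Cp"
  have Z0: "Z > 0" using C1 hL Cp by (simp add: Z_def)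
  have N0: "?N \<ge> 0" by (rule seminorm2_nonneg)
  have finI: "finite I" by (rule finite_mlen_le)
  have "(\<lambda>_. 0) \<in> I" by (simp add: mlen_0)
  then have m1: "?m \<ge> 1" using finI card_gt_0_iff[of I] by (simp add: Suc_le_eq) blast
  have cs: "commutator \<eta> u \<sigma> \<in> sqint ?M" and
    cb: "(LINT x|?M. (commutator \<eta> u \<sigma> x)\<^sup>2) \<le> (Z * h ^ (k - mlen \<sigma>))\<^sup>2 * ?N" if "mlen \<sigma> \<le> k" for \<sigma>
    using commutator_estimate[OF u T \<eta>, of B C L h Cp ?N \<sigma>] B C C1 hL proj N0 that by (auto simp: Z_def)
  have c0: "commutator \<eta> u \<sigma> x = 0" if "mlen \<sigma> = 0" for \<sigma> x
    using length_mlist[of \<sigma>] that by (simp add: commutator_def)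
  have card: "real (card {\<sigma>::'n midx. mlen \<sigma> = p}) \<le> ?m" if "p \<le> k" for p
    using that finI by (intro of_nat_mono card_mono) auto
  have lev: "(\<Sum>\<sigma> | mlen \<sigma> = p. LINT x|?M. (commutator \<eta> u \<sigma> x)\<^sup>2) \<le> ?m * Z\<^sup>2 * ?N * (h ^ (k - p))\<^sup>2" if "p \<le> k" for p
  proof -
    have "(\<Sum>\<sigma> | mlen \<sigma> = p. LINT x|?M. (commutator \<eta> u \<sigma> x)\<^sup>2) \<le> (\<Sum>\<sigma>::'n midx | mlen \<sigma> = p. Z\<^sup>2 * ?N * (h ^ (k - p))\<^sup>2)"
      using cb that by (intro sum_mono) (auto simp: power_mult_distrib mult_ac)
    also have "\<dots> = real (card {\<sigma>::'n midx. mlen \<sigma> = p}) * (Z\<^sup>2 * ?N * (h ^ (k - p))\<^sup>2)" by simp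
    also have "\<dots> \<le> ?m * (Z\<^sup>2 * ?N * (h ^ (k - p))\<^sup>2)" using card[OF that] N0 by (intro mult_right_mono) auto
    finally show ?thesis by (simp add: mult_ac)
  qed
  \<comment> \<open>Order 0 has no commutator, so only the powers h^(2j) with 1 <= j < k occur.
    Their sum is what the first threshold condition bounds.\<close>
  have low: "(\<Sum>p<k. \<Sum>\<sigma> | mlen \<sigma> = p. LINT x|?M. (commutator \<eta> u \<sigma> x)\<^sup>2) \<le> ?m * Z\<^sup>2 * ?N"
  proof -
    have "(\<Sum>p<k. \<Sum>\<sigma> | mlen \<sigma> = p. LINT x|?M. (commutator \<eta> u \<sigma> x)\<^sup>2)
       = (\<Sum>p\<in>{1..<k}. \<Sum>\<sigma> | mlen \<sigma> = p. LINT x|?M. (commutator \<eta> u \<sigma> x)\<^sup>2)"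
      by (rule sum.mono_neutral_right) (auto simp: c0 not_less_eq_eq less_Suc_eq_le)
    also have "\<dots> \<le> (\<Sum>p\<in>{1..<k}. ?m * Z\<^sup>2 * ?N * (h ^ (k - p))\<^sup>2)" by (intro sum_mono lev) auto
    also have "\<dots> = ?m * Z\<^sup>2 * ?N * (\<Sum>p\<in>{1..<k}. (h ^ (k - p))\<^sup>2)" by (simp add: sum_distrib_left)
    also have "(\<Sum>p\<in>{1..<k}. (h ^ (k - p))\<^sup>2) = (\<Sum>j\<in>{1..<k}. h ^ (2 * j))"
      by (rule sum.reindex_bij_witness[of _ "\<lambda>j. k - j" "\<lambda>p. k - p"]) (auto simp: power_mult[symmetric] mult.commute)
    also have "\<dots> \<le> 1 / Cp\<^sup>2" by (rule h1)
    also have "1 / Cp\<^sup>2 \<le> 1" using Cp by (simp add: one_le_power)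
    finally show ?thesis using m1 N0 by (simp add: mult_left_mono)
  qed
  have "(LINT x|?M. quad_form I a x (\<lambda>\<sigma>. commutator \<eta> u \<sigma> x))
     \<le> \<theta>' * (\<Sum>\<sigma> | mlen \<sigma> = k. LINT x|?M. (commutator \<eta> u \<sigma> x)\<^sup>2)
       + \<theta>0 * (\<Sum>p<k. \<Sum>\<sigma> | mlen \<sigma> = p. LINT x|?M. (commutator \<eta> u \<sigma> x)\<^sup>2)"
    by (rule quad_integral_upper[OF T cs])
  also have "\<dots> \<le> \<theta>max * (?m * Z\<^sup>2 * ?N) + \<theta>max * (?m * Z\<^sup>2 * ?N)"
  proof -
    have p: "0 \<le> ?m * Z\<^sup>2 * ?N" using N0 by simp
    have "\<theta>' * (\<Sum>\<sigma> | mlen \<sigma> = k. LINT x|?M. (commutator \<eta> u \<sigma> x)\<^sup>2) \<le> \<theta>max * (?m * Z\<^sup>2 * ?N)"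
      using lev[of k] \<theta> p by (intro mult_mono) (auto intro!: sum_nonneg)
    moreover have "\<theta>0 * (\<Sum>p<k. \<Sum>\<sigma> | mlen \<sigma> = p. LINT x|?M. (commutator \<eta> u \<sigma> x)\<^sup>2) \<le> \<theta>max * (?m * Z\<^sup>2 * ?N)"
      using low \<theta> p by (intro mult_mono) (auto intro!: sum_nonneg)
    ultimately show ?thesis by (rule add_mono)
  qed
  also have "\<dots> = (2 * \<theta>max * ?m * Z\<^sup>2) * ?N" by simp
  also have "\<dots> \<le> (2 * \<theta>max * ?m * Z\<^sup>2) * (16 / (7 * \<theta>min) * en T u)"
    using \<theta>max_pos m1 by (intro mult_left_mono co) auto
  also have "\<dots> = (32 / 7 * ?m) * (Z\<^sup>2 * (\<theta>max / \<theta>min) * en T u)" using \<theta> by (simp add: field_simps)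
  \<comment> \<open>The factor is enlarged to a perfect square, which is possible because
    \<open>?m\<close> is at least 1.\<close>
  also have "\<dots> \<le> (3 * ?m)\<^sup>2 * (Z\<^sup>2 * (\<theta>max / \<theta>min) * en T u)"
  proof (intro mult_right_mono)
    have "32 / 7 * ?m \<le> 9 * (?m * ?m)" using m1 mult_mono[of 1 ?m ?m ?m] by simp
    then show "32 / 7 * ?m \<le> (3 * ?m)\<^sup>2" by (simp add: power2_eq_square)
  qed (use \<theta>max_pos \<theta> en_nonneg[OF T(2)] in auto)
  finally have U: "(LINT x|?M. quad_form I a x (\<lambda>\<sigma>. commutator \<eta> u \<sigma> x)) \<le> (3 * ?m)\<^sup>2 * (Z\<^sup>2 * (\<theta>max / \<theta>min) * en T u)" .
  define \<kappa> where "\<kappa> = 3 * ?m * Z * sqrt (\<theta>max / \<theta>min)"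
  have \<kappa>0: "\<kappa> > 0" using m1 Z0 \<theta>max_pos \<theta> by (simp add: \<kappa>_def)
  have "(3 * ?m)\<^sup>2 * (Z\<^sup>2 * (\<theta>max / \<theta>min) * en T u) = \<kappa>\<^sup>2 * en T u"
    using \<theta>max_pos \<theta> unfolding \<kappa>_def by (simp add: power_mult_distrib mult_ac)
  with U have U': "(LINT x|?M. quad_form I a x (\<lambda>\<sigma>. commutator \<eta> u \<sigma> x)) \<le> \<kappa>\<^sup>2 * en T u" by simp
  have iq: "integrable ?M (\<lambda>x. quad_form I a x (jet u x))" by (rule jet_quad_integrable[OF u T])
  have ic: "integrable ?M (\<lambda>x. quad_form I a x (\<lambda>\<sigma>. commutator \<eta> u \<sigma> x))" by (rule quad_integrable[OF T cs])
  have isf: "integrable ?M (\<lambda>x. sym_form I a x (jet u x) (\<lambda>\<sigma>. commutator \<eta> u \<sigma> x))"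
    using sym_integrable[OF T, of "\<lambda>\<sigma> x. jet u x \<sigma>" "commutator \<eta> u"] jet_sqint[OF u T] cs by simp
  have "2 * \<bar>LINT x|?M. sym_form I a x (jet u x) (\<lambda>\<sigma>. commutator \<eta> u \<sigma> x)\<bar>
      \<le> 2 * (LINT x|?M. \<bar>sym_form I a x (jet u x) (\<lambda>\<sigma>. commutator \<eta> u \<sigma> x)\<bar>)"
    by simp
  also have "\<dots> = (LINT x|?M. 2 * \<bar>sym_form I a x (jet u x) (\<lambda>\<sigma>. commutator \<eta> u \<sigma> x)\<bar>)" by simp
  also have "\<dots> \<le> (LINT x|?M. \<kappa> * quad_form I a x (jet u x) + quad_form I a x (\<lambda>\<sigma>. commutator \<eta> u \<sigma> x) / \<kappa>)"
  proof (rule integral_mono)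
    fix x assume "x \<in> space ?M"
    then have "x \<in> D" using T by auto
    then show "2 * \<bar>sym_form I a x (jet u x) (\<lambda>\<sigma>. commutator \<eta> u \<sigma> x)\<bar>
       \<le> \<kappa> * quad_form I a x (jet u x) + quad_form I a x (\<lambda>\<sigma>. commutator \<eta> u \<sigma> x) / \<kappa>"
      by (intro sym_form_bound quad_nonneg \<kappa>0)
  qed (use iq ic isf in auto)
  also have "\<dots> = \<kappa> * en T u + (LINT x|?M. quad_form I a x (\<lambda>\<sigma>. commutator \<eta> u \<sigma> x)) / \<kappa>"
    using iq ic by (simp add: en_def)
  also have "\<dots> \<le> \<kappa> * en T u + \<kappa>\<^sup>2 * en T u / \<kappa>" using U' \<kappa>0 by (intro add_left_mono divide_right_mono) auto
  also have "\<dots> = 2 * (\<kappa> * en T u)" using \<kappa>0 by (simp add: power2_eq_square)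
  finally have "\<bar>LINT x|?M. sym_form I a x (jet u x) (\<lambda>\<sigma>. commutator \<eta> u \<sigma> x)\<bar> \<le> \<kappa> * en T u" by linarith
  then show ?thesis unfolding \<kappa>_def Z_def by (simp add: mult_ac)
qed

text \<open>Orthogonality allows \<eta> to be replaced by its difference from one of its values,
  which is at most C h/L on the element. The powers of t in the inverse and the projection bound
  cancel, and 3/2 times 16/7 is 24/7, whose root is below 2.\<close>

lemma source_term_estimate:
  assumes u: "u \<in> H0k k D" and T: "open T" "T \<subseteq> D" "bounded T" "T \<noteq> {}" and \<eta>: "smooth \<eta>"
    and lip: "\<And>x y. \<bar>\<eta> x - \<eta> y\<bar> \<le> C / L * norm (x - y)" and C1: "C \<ge> 1"
    and t: "0 < t" "diameter T \<le> t" "t \<le> h" and hL: "h \<le> L" and Cp: "Cp > 0" and Cin: "Cin > 0"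
    and u0: "seminorm2 0 T u \<le> (Cp * t ^ k)\<^sup>2 * seminorm2 k T u"
    and co: "seminorm2 k T u \<le> 16 / (7 * \<theta>min) * en T u"
    and p: "p \<in> sqint (lebesgue_on T)" "(LINT x|lebesgue_on T. (p x)\<^sup>2) \<le> (Cin / t ^ k)\<^sup>2 * (3 / 2 * \<theta>max * en T u)"
    and orth: "(LINT x|lebesgue_on T. u x * p x) = 0"
  shows "\<bar>LINT x|lebesgue_on T. (\<eta> x * u x) * p x\<bar> \<le> 2 * C * (h / L) * Cp * Cin * sqrt (\<theta>max / \<theta>min) * en T u"
proof -
  let ?M = "lebesgue_on T"
  have Ts: "T \<in> sets lebesgue" using T by (simp add: open_sets_lebesgue)
  have L0: "L > 0" using t hL by linarith
  have h0: "h > 0" using t by linarith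
  have us: "u \<in> sqint ?M" using sqint_subset[OF H0k_sob_seq(1)[OF D(1) u] T(2) Ts Ds] .
  obtain y where y: "y \<in> T" using T by blast
  have em: "\<eta> \<in> borel_measurable ?M"
    using smooth_measurable[OF \<eta>] by (intro measurable_restrict_space1) (simp add: measurable_completion)
  have eb: "\<bar>\<eta> x - \<eta> y\<bar> \<le> C * h / L" if "x \<in> T" for x
  proof -
    have "norm (x - y) \<le> diameter T" using diameter_bounded_bound[OF T(3) that y] by (simp add: dist_norm)
    then have "C / L * norm (x - y) \<le> C / L * h" using t C1 L0 by (intro mult_left_mono) auto
    then show ?thesis using lip[of x y] by simp
  qed
  have ds: "(\<lambda>x. (\<eta> x - \<eta> y) * u x) \<in> sqint ?M"
    using em eb by (intro sqint_bounded_mult[OF us, of _ "C * h / L"]) (auto intro!: AE_I2)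
  have eq: "(LINT x|?M. (\<eta> x * u x) * p x) = (LINT x|?M. p x * ((\<eta> x - \<eta> y) * u x))"
  proof -
    have "(LINT x|?M. (\<eta> x * u x) * p x) = (LINT x|?M. p x * ((\<eta> x - \<eta> y) * u x) + \<eta> y * (u x * p x))"
      by (intro Bochner_Integration.integral_cong refl) (simp add: algebra_simps)
    also have "\<dots> = (LINT x|?M. p x * ((\<eta> x - \<eta> y) * u x)) + \<eta> y * (LINT x|?M. u x * p x)"
      using sqint_mult_integrable[OF p(1) ds] sqint_mult_integrable[OF us p(1)] by simp
    finally show ?thesis using orth by simp
  qed
  have E0: "en T u \<ge> 0" by (rule en_nonneg[OF T(2)])
  have v1: "(LINT x|?M. ((\<eta> x - \<eta> y) * u x)\<^sup>2) \<le> (LINT x|?M. (C * h / L)\<^sup>2 * (u x)\<^sup>2)"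
  proof (rule integral_mono)
    show "integrable ?M (\<lambda>x. ((\<eta> x - \<eta> y) * u x)\<^sup>2)" by (rule sqint_square[OF ds])
    show "integrable ?M (\<lambda>x. (C * h / L)\<^sup>2 * (u x)\<^sup>2)" by (intro integrable_mult_right sqint_square us)
    fix x assume "x \<in> space ?M"
    then have "(\<eta> x - \<eta> y)\<^sup>2 \<le> (C * h / L)\<^sup>2" using eb[of x] by (metis abs_ge_zero power2_abs power_mono space_lebesgue_on)
    then show "((\<eta> x - \<eta> y) * u x)\<^sup>2 \<le> (C * h / L)\<^sup>2 * (u x)\<^sup>2" by (simp add: power_mult_distrib mult_right_mono)
  qed
  have "(LINT x|?M. (u x)\<^sup>2) = seminorm2 0 T u"
  proof -
    have "(LINT x|?M. (u x)\<^sup>2) = (LINT x|?M. (jet u x (\<lambda>_. 0))\<^sup>2)"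
    proof (rule integral_cong_AE)
      have "AE x in lebesgue_on D. u x = jet u x (\<lambda>_. 0)" unfolding jet_def by (rule H0k_sob_seq(4)[OF D(1) u])
      then show "AE x in ?M. (u x)\<^sup>2 = (jet u x (\<lambda>_. 0))\<^sup>2"
        using T Ts Ds by (auto simp: AE_lebesgue_on elim!: eventually_mono)
    qed (use us jet_sqint[OF u Ts T(2), of "\<lambda>_. 0"] in \<open>auto simp: mlen_0 dest!: sqint_measurable\<close>)
    moreover have "{\<sigma>::'n midx. mlen \<sigma> = 0} = {\<lambda>_. 0}" by (auto simp: mlen_eq_0_iff)
    ultimately show ?thesis by (simp add: seminorm2_def)
  qed
  also have "\<dots> \<le> (Cp * t ^ k)\<^sup>2 * (16 / (7 * \<theta>min) * en T u)"
    by (rule order_trans[OF u0 mult_left_mono[OF co]]) simp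
  finally have v2: "(LINT x|?M. (u x)\<^sup>2) \<le> (Cp * t ^ k)\<^sup>2 * (16 / (7 * \<theta>min) * en T u)" .
  have v: "(LINT x|?M. ((\<eta> x - \<eta> y) * u x)\<^sup>2) \<le> (C * h / L * (Cp * t ^ k))\<^sup>2 * (16 / (7 * \<theta>min) * en T u)"
    using order_trans[OF v1[unfolded integral_mult_right_zero] mult_left_mono[OF v2, of "(C * h / L)\<^sup>2"]]
    by (simp only: power_mult_distrib mult.assoc zero_le_power2 simp_thms)
  have "\<bar>LINT x|?M. p x * ((\<eta> x - \<eta> y) * u x)\<bar> \<le> sqrt (LINT x|?M. (p x)\<^sup>2) * sqrt (LINT x|?M. ((\<eta> x - \<eta> y) * u x)\<^sup>2)"
    by (rule sqint_cauchy_schwarz[OF p(1) ds])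
  also have "\<dots> \<le> sqrt ((Cin / t ^ k)\<^sup>2 * (3 / 2 * \<theta>max * en T u)) * sqrt ((C * h / L * (Cp * t ^ k))\<^sup>2 * (16 / (7 * \<theta>min) * en T u))"
  proof (intro mult_mono real_sqrt_le_mono p(2) v)
    have "0 \<le> 3 / 2 * \<theta>max * en T u" by (intro mult_nonneg_nonneg E0 less_imp_le[OF \<theta>max_pos]) simp
    then have "0 \<le> (Cin / t ^ k)\<^sup>2 * (3 / 2 * \<theta>max * en T u)" by (rule mult_nonneg_nonneg[OF zero_le_power2])
    then show "0 \<le> sqrt ((Cin / t ^ k)\<^sup>2 * (3 / 2 * \<theta>max * en T u))" by (rule real_sqrt_ge_zero)
  qed simp
  also have "\<dots> = (Cin / t ^ k * (C * h / L * (Cp * t ^ k))) * sqrt ((3 / 2 * \<theta>max * en T u) * (16 / (7 * \<theta>min) * en T u))"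
  proof -
    have "sqrt (A\<^sup>2 * X) * sqrt (B\<^sup>2 * Y) = (A * B) * sqrt (X * Y)" if "A \<ge> 0" "B \<ge> 0" for A B X Y :: real
      using that by (simp add: real_sqrt_mult)
    note sq = this
    show ?thesis by (rule sq) (use Cin t C1 h0 L0 Cp in auto)
  qed
  also have "Cin / t ^ k * (C * h / L * (Cp * t ^ k)) = C * (h / L) * Cp * Cin" using t by simp
  also have "sqrt ((3 / 2 * \<theta>max * en T u) * (16 / (7 * \<theta>min) * en T u)) = sqrt (24 / 7) * sqrt (\<theta>max / \<theta>min) * en T u"
  proof -
    have "(3 / 2 * \<theta>max * en T u) * (16 / (7 * \<theta>min) * en T u) = (24 / 7) * (\<theta>max / \<theta>min) * (en T u)\<^sup>2"
      using \<theta> by (simp add: field_simps power2_eq_square)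
    moreover have "sqrt ((24 / 7) * (\<theta>max / \<theta>min) * (en T u)\<^sup>2) = sqrt (24 / 7) * sqrt (\<theta>max / \<theta>min) * en T u"
      unfolding real_sqrt_mult using E0 by simp
    ultimately show ?thesis by (simp only:)
  qed
  also have "C * (h / L) * Cp * Cin * (sqrt (24 / 7) * sqrt (\<theta>max / \<theta>min) * en T u) \<le> C * (h / L) * Cp * Cin * (2 * sqrt (\<theta>max / \<theta>min) * en T u)"
  proof -
    have "sqrt (24 / 7) \<le> (2::real)" by (rule real_le_lsqrt) auto
    then show ?thesis using C1 h0 L0 Cp Cin E0 \<theta>max_pos \<theta> by (intro mult_left_mono mult_right_mono) auto
  qed
  finally show ?thesis unfolding eq by (simp add: mult_ac)
qed

end

section \<open>The minimisers and their exponential decay\<close>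

lemma test_zero_outside: "f \<in> test_functions \<Omega> \<Longrightarrow> x \<notin> \<Omega> \<Longrightarrow> f x = 0"
  by (erule test_functionsE) auto

context elliptic
begin

text \<open>Adding a multiple of v keeps all moments and hence admissibility, so the energy along
  this line is least at the minimiser and its first variation vanishes.\<close>

lemma minimizer_orthogonal:
  assumes min: "energy_minimizer k a D (admissible k D m \<phi> i q) \<psi>"
    and \<phi>: "\<And>j q'. j \<in> {1..m} \<Longrightarrow> q' \<in> {1..num_basis TYPE('n) k} \<Longrightarrow> \<phi> j q' \<in> sqint (lebesgue_on D)"
    and v: "v \<in> H0k k D"
    and z: "\<And>j q'. j \<in> {1..m} \<Longrightarrow> q' \<in> {1..num_basis TYPE('n) k} \<Longrightarrow> (LINT x|lebesgue_on D. v x * \<phi> j q' x) = 0"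
  shows "Bf \<psi> v = 0"
proof (rule nonneg_quadratic_imp_zero)
  fix s :: real
  have \<psi>: "\<psi> \<in> H0k k D" using min by (simp add: energy_minimizer_def admissible_def)
  have s: "(\<lambda>x. \<psi> x + s * v x) \<in> H0k k D" by (rule H0k_add_cmult(1)[OF D(1) \<psi> v])
  have "(\<lambda>x. \<psi> x + s * v x) \<in> admissible k D m \<phi> i q"
    unfolding admissible_def
  proof (intro CollectI conjI ballI s)
    fix j q' assume jq: "j \<in> {1..m}" "q' \<in> {1..num_basis TYPE('n) k}"
    have "(LINT x|lebesgue_on D. (\<psi> x + s * v x) * \<phi> j q' x) = (LINT x|lebesgue_on D. \<psi> x * \<phi> j q' x + s * (v x * \<phi> j q' x))"
      by (intro Bochner_Integration.integral_cong refl) (simp add: algebra_simps)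
    also have "\<dots> = (LINT x|lebesgue_on D. \<psi> x * \<phi> j q' x) + s * (LINT x|lebesgue_on D. v x * \<phi> j q' x)"
      using sqint_mult_integrable[OF H0k_sob_seq(1)[OF D(1) \<psi>] \<phi>[OF jq]]
        sqint_mult_integrable[OF H0k_sob_seq(1)[OF D(1) v] \<phi>[OF jq]] by simp
    also have "\<dots> = (LINT x:D|lebesgue. \<psi> x * \<phi> j q' x)" using z[OF jq] by (simp add: set_integral_lebesgue_on[OF Ds])
    also have "\<dots> = (if i = j \<and> q = q' then 1 else 0)"
      using min jq unfolding energy_minimizer_def admissible_def by blast
    finally show "(LINT x:D|lebesgue. (\<psi> x + s * v x) * \<phi> j q' x) = (if i = j \<and> q = q' then 1 else 0)"
      by (simp add: set_integral_lebesgue_on[OF Ds])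
  qed
  then have "energy k a D D \<psi> \<le> energy k a D D (\<lambda>x. \<psi> x + s * v x)" using min by (simp add: energy_minimizer_def)
  then show "0 \<le> 2 * s * Bf \<psi> v + s\<^sup>2 * en D v"
    unfolding energy_en[OF \<psi> Ds order_refl] energy_en[OF s Ds order_refl] en_add[OF \<psi> v] by simp
qed

lemma local_basis_polys_on:
  fixes \<phi> :: "nat \<Rightarrow> nat \<Rightarrow> real^'n \<Rightarrow> real"
  assumes "local_basis k m \<tau> \<phi>" "j \<in> {1..m}" "q' \<in> {1..num_basis TYPE('n) k}"
  shows "\<phi> j q' \<in> polys_on (k - 1) (\<tau> j)"
  using assms unfolding local_basis_def poly_basis_def Let_def by blast

lemma partition_sets:
  assumes "mesh_partition D m \<tau>" "j \<in> {1..m}"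
  shows "\<tau> j \<in> sets lebesgue" "\<tau> j \<subseteq> D" "open (\<tau> j)" "bounded (\<tau> j)" "\<tau> j \<noteq> {}" "diameter (\<tau> j) > 0"
proof -
  have "mesh_element (\<tau> j)" "\<tau> j \<subseteq> D" using assms by (auto simp: mesh_partition_def)
  then show "\<tau> j \<in> sets lebesgue" "\<tau> j \<subseteq> D" "open (\<tau> j)" "bounded (\<tau> j)" "\<tau> j \<noteq> {}" "diameter (\<tau> j) > 0"
    using mesh_element_open[of "\<tau> j"] by (auto intro: open_sets_lebesgue)
qed

lemma integral_cut_off:
  fixes F :: "real^'n \<Rightarrow> real"
  assumes "mesh_partition D m \<tau>" "j \<in> {1..m}" "\<And>x. x \<in> \<tau> j \<Longrightarrow> F x = G x" "\<And>x. x \<in> D \<Longrightarrow> x \<notin> \<tau> j \<Longrightarrow> F x = 0"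
  shows "(LINT x|lebesgue_on D. F x) = (LINT x|lebesgue_on (\<tau> j). G x)"
proof -
  have "(LINT x|lebesgue_on D. F x) = (LINT x|lebesgue_on (\<tau> j). F x)"
    using assms(4) by (intro integral_on_zero_outside partition_sets[OF assms(1,2)] Ds) auto
  also have "\<dots> = (LINT x|lebesgue_on (\<tau> j). G x)"
    using assms(3) by (intro Bochner_Integration.integral_cong) auto
  finally show ?thesis .
qed

text \<open>The basis functions span the polynomials on each element, and only element i carries a
  nonzero constraint.\<close>

lemma zero_moments:
  assumes mp: "mesh_partition D m \<tau>" and lb: "local_basis k m \<tau> \<phi>"
    and \<psi>: "\<psi> \<in> admissible k D m \<phi> i q" and j: "j \<in> {1..m}" "j \<noteq> i" and p: "p \<in> polys (k - 1)"
  shows "(LINT x|lebesgue_on (\<tau> j). \<psi> x * p x) = 0"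
proof -
  let ?p = "\<lambda>x. if x \<in> \<tau> j then p x else 0"
  have \<psi>H: "\<psi> \<in> H0k k D" using \<psi> by (simp add: admissible_def)
  have "?p \<in> polys_on (k - 1) (\<tau> j)" unfolding polys_on_def using p by blast
  moreover have "\<forall>p\<in>polys_on (k - 1) (\<tau> j). \<exists>c. \<forall>x. p x = (\<Sum>q'=1..num_basis TYPE('n) k. c q' * \<phi> j q' x)"
    using lb j(1) unfolding local_basis_def poly_basis_def Let_def by blast
  ultimately have "\<exists>c. \<forall>x. ?p x = (\<Sum>q'=1..num_basis TYPE('n) k. c q' * \<phi> j q' x)" by (rule bspec[rotated])
  then obtain c where c: "\<And>x. ?p x = (\<Sum>q'=1..num_basis TYPE('n) k. c q' * \<phi> j q' x)" by blast
  have i: "integrable (lebesgue_on D) (\<lambda>x. \<psi> x * \<phi> j q' x)" if "q' \<in> {1..num_basis TYPE('n) k}" for q'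
    using polys_on_sqint[OF local_basis_polys_on[OF lb j(1) that] partition_sets(1)[OF mp j(1)] D(2) Ds]
    by (intro sqint_mult_integrable H0k_sob_seq(1)[OF D(1) \<psi>H])
  have "(LINT x|lebesgue_on (\<tau> j). \<psi> x * p x) = (LINT x|lebesgue_on D. \<psi> x * ?p x)"
    by (rule integral_cut_off[OF mp j(1), symmetric]) auto
  also have "\<dots> = (LINT x|lebesgue_on D. (\<Sum>q'=1..num_basis TYPE('n) k. c q' * (\<psi> x * \<phi> j q' x)))"
    by (intro Bochner_Integration.integral_cong refl) (simp add: c sum_distrib_left mult_ac)
  also have "\<dots> = (\<Sum>q'=1..num_basis TYPE('n) k. c q' * (LINT x|lebesgue_on D. \<psi> x * \<phi> j q' x))"
    using i by (subst Bochner_Integration.integral_sum) auto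
  also have "\<dots> = 0"
  proof (intro sum.neutral ballI)
    fix q' assume "q' \<in> {1..num_basis TYPE('n) k}"
    then have "(LINT x:D|lebesgue. \<psi> x * \<phi> j q' x) = (if i = j \<and> q = q' then 1 else 0)"
      using \<psi> j(1) unfolding admissible_def by blast
    then show "c q' * (LINT x|lebesgue_on D. \<psi> x * \<phi> j q' x) = 0" using j(2) by (simp add: set_integral_lebesgue_on[OF Ds])
  qed
  finally show ?thesis .
qed

text \<open>The operator applied to a minimiser is a polynomial on every element: subtracting from \<open>v\<close> the
  combination of the minimisers with the same moments makes it orthogonal to \<open>\<psi> i q\<close>.\<close>

lemma minimizer_equation:
  assumes mp: "mesh_partition D m \<tau>" and lb: "local_basis k m \<tau> \<phi>"
    and min: "\<And>i q. i \<in> {1..m} \<Longrightarrow> q \<in> {1..num_basis TYPE('n) k} \<Longrightarrow> energy_minimizer k a D (admissible k D m \<phi> i q) (\<psi> i q)"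
    and iq: "i \<in> {1..m}" "q \<in> {1..num_basis TYPE('n) k}"
  obtains g where "\<And>j. j \<in> {1..m} \<Longrightarrow> g j \<in> polys (k - 1)"
    "\<And>v. v \<in> H0k k D \<Longrightarrow> Bf (\<psi> i q) v = (\<Sum>j\<in>{1..m}. LINT x|lebesgue_on (\<tau> j). v x * g j x)"
proof -
  let ?A = "{1..m} \<times> {1..num_basis TYPE('n) k}"
  have \<psi>A: "\<psi> j q' \<in> admissible k D m \<phi> j q'" if "j \<in> {1..m}" "q' \<in> {1..num_basis TYPE('n) k}" for j q'
    using min[OF that] by (simp add: energy_minimizer_def)
  then have \<psi>H: "\<psi> j q' \<in> H0k k D" if "j \<in> {1..m}" "q' \<in> {1..num_basis TYPE('n) k}" for j q'
    using that by (auto simp: admissible_def)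
  have \<phi>s: "\<phi> j q' \<in> sqint (lebesgue_on D)" if "j \<in> {1..m}" "q' \<in> {1..num_basis TYPE('n) k}" for j q'
    by (rule polys_on_sqint[OF local_basis_polys_on[OF lb that] partition_sets(1)[OF mp that(1)] D(2) Ds])
  \<comment> \<open>A polynomial on the whole space behind each basis function, which is itself cut
    off outside its element.\<close>
  define P where "P j q' = (SOME p. p \<in> polys (k - 1) \<and> \<phi> j q' = (\<lambda>x. if x \<in> \<tau> j then p x else 0))" for j q'
  have P: "P j q' \<in> polys (k - 1)" "\<phi> j q' = (\<lambda>x. if x \<in> \<tau> j then P j q' x else 0)"
    if "j \<in> {1..m}" "q' \<in> {1..num_basis TYPE('n) k}" for j q'
  proof -
    have "\<exists>p. p \<in> polys (k - 1) \<and> \<phi> j q' = (\<lambda>x. if x \<in> \<tau> j then p x else 0)"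
      using local_basis_polys_on[OF lb that] unfolding polys_on_def image_iff Bex_def .
    from someI_ex[OF this] show "P j q' \<in> polys (k - 1)" "\<phi> j q' = (\<lambda>x. if x \<in> \<tau> j then P j q' x else 0)"
      unfolding P_def by (rule conjunct1, rule conjunct2)
  qed
  \<comment> \<open>The energy products of \<open>\<psi> i q\<close> with the minimisers are the
    Lagrange multipliers of the moment constraints, because the minimisers are dual to the basis
    functions.\<close>
  define g where "g j = (\<lambda>x. \<Sum>q'=1..num_basis TYPE('n) k. Bf (\<psi> i q) (\<psi> j q') * P j q' x)" for j
  show ?thesis
  proof (rule that)
    show "g j \<in> polys (k - 1)" if "j \<in> {1..m}" for j
      unfolding g_def using P(1)[OF that] by (intro polys_lincomb) auto
    fix v assume v: "v \<in> H0k k D"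
    have vs: "v \<in> sqint (lebesgue_on D)" by (rule H0k_sob_seq(1)[OF D(1) v])
    define mo where "mo p = (LINT x|lebesgue_on D. v x * \<phi> (fst p) (snd p) x)" for p
    define w where "w x = v x + (\<Sum>p\<in>?A. (- mo p) * \<psi> (fst p) (snd p) x)" for x
    have w: "w \<in> H0k k D" "Bf (\<psi> i q) w = Bf (\<psi> i q) v + (\<Sum>p\<in>?A. (- mo p) * Bf (\<psi> i q) (\<psi> (fst p) (snd p)))"
      using Bf_lincomb[OF \<psi>H[OF iq] v, of ?A "\<lambda>p. \<psi> (fst p) (snd p)" "\<lambda>p. - mo p"] \<psi>H
      unfolding w_def[abs_def] by auto
    have "Bf (\<psi> i q) w = 0"
    proof (rule minimizer_orthogonal[OF min[OF iq] \<phi>s w(1)])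
      fix j q' assume jq: "j \<in> {1..m}" "q' \<in> {1..num_basis TYPE('n) k}"
      have iv: "integrable (lebesgue_on D) (\<lambda>x. v x * \<phi> j q' x)" by (rule sqint_mult_integrable[OF vs \<phi>s[OF jq]])
      have ip: "integrable (lebesgue_on D) (\<lambda>x. \<psi> (fst p) (snd p) x * \<phi> j q' x)" if "p \<in> ?A" for p
        using that by (intro sqint_mult_integrable H0k_sob_seq(1)[OF D(1) \<psi>H] \<phi>s jq) auto
      have "(LINT x|lebesgue_on D. w x * \<phi> j q' x) = (LINT x|lebesgue_on D. v x * \<phi> j q' x + (\<Sum>p\<in>?A. (- mo p) * (\<psi> (fst p) (snd p) x * \<phi> j q' x)))"
        by (intro Bochner_Integration.integral_cong refl) (simp add: w_def distrib_right sum_distrib_right mult.assoc)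
      also have "\<dots> = (LINT x|lebesgue_on D. v x * \<phi> j q' x) + (LINT x|lebesgue_on D. (\<Sum>p\<in>?A. (- mo p) * (\<psi> (fst p) (snd p) x * \<phi> j q' x)))"
        by (intro Bochner_Integration.integral_add iv Bochner_Integration.integrable_sum integrable_mult_right ip)
      also have "(LINT x|lebesgue_on D. (\<Sum>p\<in>?A. (- mo p) * (\<psi> (fst p) (snd p) x * \<phi> j q' x)))
          = (\<Sum>p\<in>?A. (- mo p) * (LINT x|lebesgue_on D. \<psi> (fst p) (snd p) x * \<phi> j q' x))"
        by (subst Bochner_Integration.integral_sum) (auto intro!: ip integrable_mult_right simp del: mult_minus_left)
      also have "\<dots> = (\<Sum>p\<in>?A. if p = (j, q') then - mo p else 0)"
      proof (rule sum.cong[OF refl])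
        fix p assume p: "p \<in> ?A"
        then have "(LINT x:D|lebesgue. \<psi> (fst p) (snd p) x * \<phi> j q' x) = (if fst p = j \<and> snd p = q' then 1 else 0)"
          using \<psi>A[of "fst p" "snd p"] jq unfolding admissible_def by auto
        then show "(- mo p) * (LINT x|lebesgue_on D. \<psi> (fst p) (snd p) x * \<phi> j q' x) = (if p = (j, q') then - mo p else 0)"
          by (simp add: set_integral_lebesgue_on[OF Ds] prod_eq_iff)
      qed
      also have "\<dots> = - mo (j, q')" using jq by simp
      finally show "(LINT x|lebesgue_on D. w x * \<phi> j q' x) = 0" by (simp add: mo_def)
    qed
    then have "Bf (\<psi> i q) v = (\<Sum>p\<in>?A. mo p * Bf (\<psi> i q) (\<psi> (fst p) (snd p)))"
      using w(2) by (simp add: sum_negf)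
    also have "\<dots> = (\<Sum>j\<in>{1..m}. \<Sum>q'=1..num_basis TYPE('n) k. mo (j, q') * Bf (\<psi> i q) (\<psi> j q'))"
      by (simp add: sum.cartesian_product case_prod_unfold)
    also have "\<dots> = (\<Sum>j\<in>{1..m}. LINT x|lebesgue_on (\<tau> j). v x * g j x)"
    proof (rule sum.cong[OF refl])
      fix j assume j: "j \<in> {1..m}"
      have vj: "v \<in> sqint (lebesgue_on (\<tau> j))" by (rule sqint_subset[OF vs partition_sets(2,1)[OF mp j] Ds])
      have ij: "integrable (lebesgue_on (\<tau> j)) (\<lambda>x. v x * P j q' x)" if "q' \<in> {1..num_basis TYPE('n) k}" for q'
        by (rule sqint_mult_integrable[OF vj continuous_sqint_bounded[OF polys_continuous[OF P(1)[OF j that]] partition_sets(4,1)[OF mp j]]])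
      have "mo (j, q') = (LINT x|lebesgue_on (\<tau> j). v x * P j q' x)" if "q' \<in> {1..num_basis TYPE('n) k}" for q'
        unfolding mo_def using P(2)[OF j that] by (intro integral_cut_off[OF mp j]) auto
      then have "(\<Sum>q'=1..num_basis TYPE('n) k. mo (j, q') * Bf (\<psi> i q) (\<psi> j q')) = (\<Sum>q'=1..num_basis TYPE('n) k. Bf (\<psi> i q) (\<psi> j q') * (LINT x|lebesgue_on (\<tau> j). v x * P j q' x))"
        by (intro sum.cong refl) (simp add: mult.commute)
      also have "\<dots> = (LINT x|lebesgue_on (\<tau> j). (\<Sum>q'=1..num_basis TYPE('n) k. Bf (\<psi> i q) (\<psi> j q') * (v x * P j q' x)))"
        using ij by (subst Bochner_Integration.integral_sum) auto
      also have "\<dots> = (LINT x|lebesgue_on (\<tau> j). v x * g j x)"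
        by (intro Bochner_Integration.integral_cong refl) (simp add: g_def sum_distrib_left mult_ac)
      finally show "(\<Sum>q'=1..num_basis TYPE('n) k. mo (j, q') * Bf (\<psi> i q) (\<psi> j q')) = (LINT x|lebesgue_on (\<tau> j). v x * g j x)" .
    qed
    finally show "Bf (\<psi> i q) v = (\<Sum>j\<in>{1..m}. LINT x|lebesgue_on (\<tau> j). v x * g j x)" .
  qed
qed

text \<open>Vanishing moments say that the zero polynomial is the projection of u, so the projection
  bound applies to u itself.\<close>

lemma projection_seminorm:
  assumes mp: "mesh_partition D m \<tau>" and pc: "projection_const k D m \<tau> Cp" and Cp: "Cp > 0"
    and u: "u \<in> H0k k D" and j: "j \<in> {1..m}"
    and mom: "\<And>p. p \<in> polys (k - 1) \<Longrightarrow> (LINT x|lebesgue_on (\<tau> j). u x * p x) = 0" and p: "p \<le> k"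
  shows "seminorm2 p (\<tau> j) u \<le> (Cp * diameter (\<tau> j) ^ (k - p))\<^sup>2 * seminorm2 k (\<tau> j) u"
proof -
  note T = partition_sets[OF mp j]
  have "(\<lambda>_. 0) \<in> polys (k - 1)" unfolding polys_def by (auto intro!: exI[of _ "\<lambda>_. 0"])
  then have "L2_projection (k - 1) (\<tau> j) u (\<lambda>_. 0)"
    using mom by (simp add: L2_projection_def set_integral_lebesgue_on[OF T(1)])
  moreover have "u \<in> Hk k D" using u by (simp add: H0k_def)
  ultimately have "seminormk p (\<tau> j) (\<lambda>x. u x - 0) \<le> Cp * diameter (\<tau> j) ^ (k - p) * seminormk k (\<tau> j) u"
    using pc j p unfolding projection_const_def by blast
  then have "seminormk p (\<tau> j) u \<le> Cp * diameter (\<tau> j) ^ (k - p) * seminormk k (\<tau> j) u" by simp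
  moreover have "0 \<le> seminormk p (\<tau> j) u"
    by (auto simp: seminormk_def set_integral_lebesgue_on[OF T(1)] intro!: sum_nonneg)
  ultimately have "(seminormk p (\<tau> j) u)\<^sup>2 \<le> (Cp * diameter (\<tau> j) ^ (k - p) * seminormk k (\<tau> j) u)\<^sup>2"
    by (intro power_mono)
  then show ?thesis
    unfolding power_mult_distrib seminormk_restrict[OF u T(3,2) p] seminormk_restrict[OF u T(3,2) order_refl] .
qed

text \<open>A test function on the element sees only \<open>g j\<close>, so its pairing with
  \<open>g j\<close> is an energy product with u. Young's inequality with weight 3/2 \<theta>max
  supplies the domination asked for by \<open>inverse_estimate\<close>: the energy of f is at most
  that weight times the square of its top seminorm.\<close>

lemma local_inverse_estimate:
  assumes mp: "mesh_partition D m \<tau>" and u: "u \<in> H0k k D" and j: "j \<in> {1..m}"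
    and g: "\<And>j. j \<in> {1..m} \<Longrightarrow> g j \<in> polys (k - 1)"
    and rep: "\<And>v. v \<in> H0k k D \<Longrightarrow> Bf u v = (\<Sum>j\<in>{1..m}. LINT x|lebesgue_on (\<tau> j). v x * g j x)"
    and fr: "friedrichs_const TYPE('n) k Cf" and Cf: "Cf > 0"
    and inv: "inverse_const TYPE('n) k \<delta> Cin" and Cin: "Cin > 0"
    and ball: "ball (c j) (\<delta> * diameter (\<tau> j) / 2) \<subseteq> \<tau> j"
    and h3: "2 * \<theta>0 * Cf\<^sup>2 * (\<Sum>i\<in>{1..k}. diameter (\<tau> j) ^ (2 * i)) \<le> \<theta>max"
  shows "(LINT x|lebesgue_on (\<tau> j). (g j x)\<^sup>2) \<le> (Cin / diameter (\<tau> j) ^ k)\<^sup>2 * (3 / 2 * \<theta>max * en (\<tau> j) u)"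
proof (rule inverse_estimate[OF fr Cf inv, of _ _ "c j"])
  note T = partition_sets[OF mp j]
  let ?M = "lebesgue_on (\<tau> j)" and ?t = "diameter (\<tau> j)" and ?\<Theta> = "3 / 2 * \<theta>max"
  show "open (\<tau> j)" "bounded (\<tau> j)" "diameter (\<tau> j) > 0" "diameter (\<tau> j) \<le> diameter (\<tau> j)"
    "ball (c j) (\<delta> * diameter (\<tau> j) / 2) \<subseteq> \<tau> j" "Cin > 0" "g j \<in> polys (k - 1)"
    using T ball Cin g[OF j] by auto
  show \<Theta>: "?\<Theta> > 0" using \<theta>max_pos by (intro mult_pos_pos) auto
  fix f assume f: "f \<in> test_functions (\<tau> j)"
  have fD: "f \<in> test_functions D" by (rule test_mono[OF T(2) f])
  have fH: "f \<in> H0k k D" by (rule test_H0k(1)[OF fD D(1)])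
  have f0: "f x = 0" if "x \<notin> \<tau> j" for x by (rule test_zero_outside[OF f that])
  have df0: "mderiv \<sigma> f x = 0" if "x \<notin> \<tau> j" for x \<sigma>
    by (rule test_zero_outside[OF test_mderiv[OF f] that])
  have ms: "mderiv \<sigma> f \<in> sqint (lebesgue_on S)" if "S \<in> sets lebesgue" for S \<sigma>
    by (rule test_sqint[OF test_mderiv[OF f] that])
  have "Bf u f = (\<Sum>i\<in>{1..m}. LINT x|lebesgue_on (\<tau> i). f x * g i x)" by (rule rep[OF fH])
  also have "\<dots> = (\<Sum>i\<in>{1..m}. if i = j then LINT x|?M. f x * g j x else 0)"
  proof (rule sum.cong[OF refl])
    fix i assume i: "i \<in> {1..m}"
    show "(LINT x|lebesgue_on (\<tau> i). f x * g i x) = (if i = j then LINT x|?M. f x * g j x else 0)"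
    proof (cases "i = j")
      case False
      have "\<tau> i \<inter> \<tau> j = {}" using mp i j False unfolding mesh_partition_def disjoint_family_on_def by blast
      then have "(LINT x|lebesgue_on (\<tau> i). f x * g i x) = (LINT x|lebesgue_on (\<tau> i). 0)"
        by (intro Bochner_Integration.integral_cong refl) (use f0 in auto)
      then show ?thesis using False by simp
    qed simp
  qed
  also have "\<dots> = (LINT x|?M. g j x * f x)" using j by (simp add: mult.commute)
  finally have eq1: "Bf u f = (LINT x|?M. g j x * f x)" .
  have is1: "integrable ?M (\<lambda>x. sym_form I a x (jet u x) (\<lambda>\<sigma>. mderiv \<sigma> f x))"
    using sym_integrable[OF T(1,2), of "\<lambda>\<sigma> x. jet u x \<sigma>" "\<lambda>\<sigma>. mderiv \<sigma> f"] jet_sqint[OF u T(1,2)] ms[OF T(1)] by simp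
  have isD: "integrable (lebesgue_on D) (\<lambda>x. sym_form I a x (jet u x) (\<lambda>\<sigma>. mderiv \<sigma> f x))"
    using sym_integrable[OF Ds order_refl, of "\<lambda>\<sigma> x. jet u x \<sigma>" "\<lambda>\<sigma>. mderiv \<sigma> f"] jet_sqint[OF u Ds order_refl] ms[OF Ds] by simp
  have "Bf u f = (LINT x|lebesgue_on D. sym_form I a x (jet u x) (\<lambda>\<sigma>. mderiv \<sigma> f x))"
    unfolding Bf_def
  proof (rule integral_cong_AE)
    have "AE x in lebesgue_on D. \<forall>\<sigma>\<in>I. jet f x \<sigma> = mderiv \<sigma> f x"
      unfolding jet_def using test_H0k(2)[OF fD D(1)] finite_mlen_le by (intro AE_finite_allI) auto
    then show "AE x in lebesgue_on D. sym_form I a x (jet u x) (jet f x) = sym_form I a x (jet u x) (\<lambda>\<sigma>. mderiv \<sigma> f x)"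
      by eventually_elim (rule sym_form_cong, auto)
    show "(\<lambda>x. sym_form I a x (jet u x) (jet f x)) \<in> borel_measurable (lebesgue_on D)"
      by (rule borel_measurable_integrable[OF jet_sym_integrable[OF u fH Ds order_refl]])
    show "(\<lambda>x. sym_form I a x (jet u x) (\<lambda>\<sigma>. mderiv \<sigma> f x)) \<in> borel_measurable (lebesgue_on D)"
      by (rule borel_measurable_integrable[OF isD])
  qed
  also have "\<dots> = (LINT x|?M. sym_form I a x (jet u x) (\<lambda>\<sigma>. mderiv \<sigma> f x))"
    by (rule integral_cut_off[OF mp j]) (auto simp: sym_form_def df0)
  finally have eq2: "Bf u f = (LINT x|?M. sym_form I a x (jet u x) (\<lambda>\<sigma>. mderiv \<sigma> f x))" .
  have iq: "integrable ?M (\<lambda>x. quad_form I a x (jet u x))" by (rule jet_quad_integrable[OF u T(1,2)])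
  have iqf: "integrable ?M (\<lambda>x. quad_form I a x (\<lambda>\<sigma>. mderiv \<sigma> f x))" by (rule quad_integrable[OF T(1,2) ms[OF T(1)]])
  have "2 * (LINT x|?M. g j x * f x) = (LINT x|?M. 2 * sym_form I a x (jet u x) (\<lambda>\<sigma>. mderiv \<sigma> f x))"
    using eq1 eq2 by simp
  also have "\<dots> \<le> (LINT x|?M. ?\<Theta> * quad_form I a x (jet u x) + quad_form I a x (\<lambda>\<sigma>. mderiv \<sigma> f x) / ?\<Theta>)"
  proof (rule integral_mono)
    fix x assume "x \<in> space ?M"
    then have "x \<in> D" using T by auto
    then show "2 * sym_form I a x (jet u x) (\<lambda>\<sigma>. mderiv \<sigma> f x) \<le> ?\<Theta> * quad_form I a x (jet u x) + quad_form I a x (\<lambda>\<sigma>. mderiv \<sigma> f x) / ?\<Theta>"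
      using sym_form_bound[OF quad_nonneg \<Theta>, of x "jet u x" "\<lambda>\<sigma>. mderiv \<sigma> f x"] by linarith
  qed (use is1 iq iqf in \<open>auto intro!: integrable_divide Bochner_Integration.integrable_add integrable_mult_right\<close>)
  also have "\<dots> = ?\<Theta> * en (\<tau> j) u + (LINT x|?M. quad_form I a x (\<lambda>\<sigma>. mderiv \<sigma> f x)) / ?\<Theta>"
    unfolding en_def using iq iqf by (subst Bochner_Integration.integral_add) (auto intro!: integrable_divide integrable_mult_right)
  finally have 1: "2 * (LINT x|?M. g j x * f x) \<le> ?\<Theta> * en (\<tau> j) u + (LINT x|?M. quad_form I a x (\<lambda>\<sigma>. mderiv \<sigma> f x)) / ?\<Theta>" .
  \<comment> \<open>The top order costs \<theta>' <= \<theta>max; by Friedrichs and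
    \<open>h3\<close> all lower orders together cost at most half of \<theta>max. This is the origin
    of the weight 3/2.\<close>
  have "(LINT x|?M. quad_form I a x (\<lambda>\<sigma>. mderiv \<sigma> f x)) \<le> grad_form k (\<tau> j) f f * ?\<Theta>"
  proof -
    let ?G = "grad_form k (\<tau> j) f f" and ?S = "\<Sum>i\<in>{1..k}. ?t ^ (2 * i)"
    have G0: "?G \<ge> 0" unfolding grad_form_def by (auto intro!: sum_nonneg)
    have "(LINT x|?M. quad_form I a x (\<lambda>\<sigma>. mderiv \<sigma> f x)) \<le> \<theta>' * ?G + \<theta>0 * (\<Sum>p<k. grad_form p (\<tau> j) f f)"
      using quad_integral_upper[OF T(1,2), of "\<lambda>\<sigma>. mderiv \<sigma> f"] ms[OF T(1)]
      by (simp add: grad_form_def power2_eq_square)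
    also have "(\<Sum>p<k. grad_form p (\<tau> j) f f) \<le> (\<Sum>p<k. Cf\<^sup>2 * ?G * (?t ^ (k - p))\<^sup>2)"
      using friedrichs_test[OF fr Cf T(3,4) f _ order_refl] T(6)
      by (intro sum_mono) (auto simp: power_mult_distrib mult_ac)
    also have "\<dots> = Cf\<^sup>2 * ?G * ?S" unfolding sum_distrib_left[symmetric] sum_power_reindex ..
    finally have "(LINT x|?M. quad_form I a x (\<lambda>\<sigma>. mderiv \<sigma> f x)) \<le> \<theta>' * ?G + \<theta>0 * (Cf\<^sup>2 * ?G * ?S)"
      using \<theta> by (simp add: mult_left_mono)
    moreover have "2 * (\<theta>0 * (Cf\<^sup>2 * ?G * ?S)) \<le> \<theta>max * ?G"
      using mult_right_mono[OF h3 G0] by (simp add: mult_ac)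
    moreover have "\<theta>' * ?G \<le> \<theta>max * ?G" using G0 by (intro mult_right_mono) auto
    ultimately have "(LINT x|?M. quad_form I a x (\<lambda>\<sigma>. mderiv \<sigma> f x)) \<le> 3 / 2 * (\<theta>max * ?G)" by linarith
    then show ?thesis by (simp only: mult_ac)
  qed
  then have "(LINT x|?M. quad_form I a x (\<lambda>\<sigma>. mderiv \<sigma> f x)) / ?\<Theta> \<le> grad_form k (\<tau> j) f f"
    unfolding pos_divide_le_eq[OF \<Theta>] .
  then show "2 * (LINT x|?M. g j x * f x) \<le> ?\<Theta> * en (\<tau> j) u + grad_form k (\<tau> j) f f"
    by (rule order_trans[OF 1 add_left_mono])
qed

end

section \<open>Testing across one layer\<close>

lemma card_mlen_le_pos: "card {\<sigma>::'n::finite midx. mlen \<sigma> \<le> p} > 0"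
proof -
  have "(\<lambda>_. 0) \<in> {\<sigma>::'n midx. mlen \<sigma> \<le> p}" by (simp add: mlen_0)
  then show ?thesis unfolding card_gt_0_iff using finite_mlen_le by blast
qed

context elliptic
begin

text \<open>The strict inequality makes this the part of \<open>D\<close> off a closed cube, so it
  is open and hence measurable.\<close>

definition outer :: "real^'n \<Rightarrow> real \<Rightarrow> (real^'n) set" where
  "outer c r = {x \<in> D. \<exists>i. \<bar>x $ i - c $ i\<bar> > r}"

lemma outer_sets: "outer c r \<in> sets lebesgue" "outer c r \<subseteq> D"
proof -
  have "open (\<Union>i. {x::real^'n. \<bar>x $ i - c $ i\<bar> > r})"
    by (intro open_UN ballI open_Collect_less continuous_intros)
  then have "open (D \<inter> (\<Union>i. {x::real^'n. \<bar>x $ i - c $ i\<bar> > r}))" using D(1) by (rule open_Int[rotated])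
  moreover have "outer c r = D \<inter> (\<Union>i. {x::real^'n. \<bar>x $ i - c $ i\<bar> > r})" by (auto simp: outer_def)
  ultimately show "outer c r \<in> sets lebesgue" by (simp add: open_sets_lebesgue)
qed (auto simp: outer_def)

lemma commutator_zero:
  assumes "open T" "smooth \<eta>" "\<And>x. x \<in> T \<Longrightarrow> \<eta> x = d" "x \<in> T"
  shows "commutator \<eta> u \<sigma> x = 0"
proof -
  have "(case p of (ys, zs) \<Rightarrow> foldr pd ys \<eta> x * jet u x (count_list zs)) = 0" if "p \<in> set (tl (splits (mlist \<sigma>)))" for p
  proof -
    obtain ys zs where yz: "p = (ys, zs)" by (cases p)
    have "ys \<noteq> []" using that unfolding yz by (rule tl_splits_nonempty)
    then have "foldr pd ys \<eta> x = 0" by (intro foldr_pd_local[OF assms(1,2), of d] assms(3,4))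
    then show ?thesis by (simp add: yz)
  qed
  then have meq: "map (\<lambda>(ys, zs). foldr pd ys \<eta> x * jet u x (count_list zs)) (tl (splits (mlist \<sigma>))) = map (\<lambda>_. 0) (tl (splits (mlist \<sigma>)))"
    by (intro map_cong) auto
  show ?thesis unfolding commutator_def meq by simp
qed

text \<open>Testing with \<open>\<eta> u\<close>, where \<open>\<eta>\<close> vanishes near the centre and is 1 far away: elements on which
  \<open>\<eta>\<close> is constant contribute nothing, since there the commutator vanishes and \<open>u\<close> is orthogonal to the
  polynomial \<open>g j\<close>.\<close>

lemma layer_step:
  assumes mp: "mesh_partition D m \<tau>" and i: "i \<in> {1..m}" and ci: "c \<in> \<tau> i" and u: "u \<in> H0k k D"
    and g: "\<And>j. j \<in> {1..m} \<Longrightarrow> g j \<in> polys (k - 1)"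
    and rep: "\<And>v. v \<in> H0k k D \<Longrightarrow> Bf u v = (\<Sum>j\<in>{1..m}. LINT x|lebesgue_on (\<tau> j). v x * g j x)"
    and mom: "\<And>j p. j \<in> {1..m} \<Longrightarrow> j \<noteq> i \<Longrightarrow> p \<in> polys (k - 1) \<Longrightarrow> (LINT x|lebesgue_on (\<tau> j). u x * p x) = 0"
    and proj: "\<And>j p. j \<in> {1..m} \<Longrightarrow> j \<noteq> i \<Longrightarrow> p \<le> k \<Longrightarrow>
        seminorm2 p (\<tau> j) u \<le> (Cp * diameter (\<tau> j) ^ (k - p))\<^sup>2 * seminorm2 k (\<tau> j) u"
    and inv: "\<And>j. j \<in> {1..m} \<Longrightarrow>
        (LINT x|lebesgue_on (\<tau> j). (g j x)\<^sup>2) \<le> (Cin / diameter (\<tau> j) ^ k)\<^sup>2 * (3 / 2 * \<theta>max * en (\<tau> j) u)"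
    and Cp: "Cp \<ge> 1" and Cin: "Cin > 0" and h: "h = mesh_size m \<tau>"
    and h1: "(\<Sum>j\<in>{1..<k}. h ^ (2 * j)) \<le> 1 / Cp\<^sup>2"
    and h2: "16 * \<theta>0 * \<theta>max * Cp\<^sup>2 * (\<Sum>j\<in>{1..k}. h ^ (2 * j)) \<le> \<theta>min\<^sup>2"
    and C1: "C \<ge> 1" and R: "R \<ge> h" and hL: "h \<le> L"
    and cut: "\<exists>\<eta>. smooth \<eta> \<and> (\<forall>x. 0 \<le> \<eta> x \<and> \<eta> x \<le> 1) \<and>
      (\<forall>x. (\<forall>i. \<bar>x $ i - c $ i\<bar> \<le> R) \<longrightarrow> \<eta> x = 0) \<and>
      (\<forall>x. (\<exists>i. \<bar>x $ i - c $ i\<bar> \<ge> R + L) \<longrightarrow> \<eta> x = 1) \<and>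
      (\<forall>xs x. xs \<noteq> [] \<and> length xs \<le> k \<longrightarrow> \<bar>foldr pd xs \<eta> x\<bar> \<le> C / L ^ length xs) \<and>
      (\<forall>x y. \<bar>\<eta> x - \<eta> y\<bar> \<le> C / L * norm (x - y))" (is "\<exists>\<eta>. ?body \<eta>")
  defines "\<kappa> \<equiv> 3 * real (card I) * 2 ^ k * C * (h / L) * Cp * (1 + Cin) * sqrt (\<theta>max / \<theta>min)"
  shows "en (outer c (R + L + h)) u \<le> \<kappa> * (en (outer c (R - h)) u - en (outer c (R + L + h)) u)"
proof -
  obtain \<eta> where E0: "?body \<eta>" using cut by (rule exE)
  have \<eta>: "smooth \<eta>" using E0 by (rule conjunct1)
  note E = E0[THEN conjunct2, THEN conjunct1] E0[THEN conjunct2, THEN conjunct2, THEN conjunct1]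
    E0[THEN conjunct2, THEN conjunct2, THEN conjunct2, THEN conjunct1]
    E0[THEN conjunct2, THEN conjunct2, THEN conjunct2, THEN conjunct2, THEN conjunct1]
    E0[THEN conjunct2, THEN conjunct2, THEN conjunct2, THEN conjunct2, THEN conjunct2]
  have e01: "0 \<le> \<eta> x" "\<eta> x \<le> 1" for x using E(1) by auto
  have e0: "\<eta> x = 0" if "\<And>i. \<bar>x $ i - c $ i\<bar> \<le> R" for x using E(2) that by simp
  have e1: "\<eta> x = 1" if "\<bar>x $ i - c $ i\<bar> \<ge> R + L" for x i
    by (rule E(3)[rule_format]) (rule exI, rule that)
  have ed: "\<bar>foldr pd xs \<eta> x\<bar> \<le> C / L ^ length xs" if "xs \<noteq> []" "length xs \<le> k" for xs x
    using E(4) that by simp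
  have lip: "\<bar>\<eta> x - \<eta> y\<bar> \<le> C / L * norm (x - y)" for x y using E(5) by simp
  note T = partition_sets[OF mp]
  have D0: "D \<noteq> {}" using T[OF i] by blast
  have diam: "diameter (\<tau> j) \<le> h" if "j \<in> {1..m}" for j unfolding h by (rule mesh_size_ge[OF that])
  have h0: "h > 0" using diam[OF i] T(6)[OF i] by linarith
  have L0: "L > 0" using h0 hL by linarith
  \<comment> \<open>The list-dependent bound for the product rule: 1 for \<eta> itself, the scale of
    the layer for its proper derivatives.\<close>
  define B where "B xs = (if xs = [] then 1 else C / L ^ length xs)" for xs :: "'n list"
  have B: "\<bar>foldr pd xs \<eta> x\<bar> \<le> B xs" if "length xs \<le> k" for xs x
    using ed[of xs x] e01[of x] that by (cases "xs = []") (auto simp: B_def)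
  have v: "(\<lambda>x. \<eta> x * u x) \<in> H0k k D" by (rule H0k_mult_smooth(1)[OF D(1) u \<eta> B])
  let ?q = "\<lambda>x. quad_form I a x (jet u x)"
  let ?s = "\<lambda>x. sym_form I a x (jet u x) (\<lambda>\<sigma>. commutator \<eta> u \<sigma> x)"
  have cs: "commutator \<eta> u \<sigma> \<in> sqint (lebesgue_on D)" if "mlen \<sigma> \<le> k" for \<sigma>
  proof -
    have "commutator \<eta> u \<sigma> = (\<lambda>x. \<Sum>p\<leftarrow>tl (splits (mlist \<sigma>)). foldr pd (fst p) \<eta> x * jet u x (count_list (snd p)))"
      by (simp add: commutator_def[abs_def] case_prod_unfold)
    moreover have "(\<lambda>x. \<Sum>p\<leftarrow>tl (splits (mlist \<sigma>)). foldr pd (fst p) \<eta> x * jet u x (count_list (snd p))) \<in> sqint (lebesgue_on D)"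
      by (rule sqint_sum_list, rule commutator_sqint[OF u Ds order_refl \<eta> B that]) auto
    ultimately show ?thesis by simp
  qed
  have isD: "integrable (lebesgue_on D) ?s"
    using sym_integrable[OF Ds order_refl, of "\<lambda>\<sigma> x. jet u x \<sigma>" "commutator \<eta> u"] jet_sqint[OF u Ds order_refl] cs by simp
  have iqD: "integrable (lebesgue_on D) ?q" by (rule jet_quad_integrable[OF u Ds order_refl])
  have em: "\<eta> \<in> borel_measurable (lebesgue_on D)"
    using smooth_measurable[OF \<eta>] by (intro measurable_restrict_space1) (simp add: measurable_completion)
  have ieq: "integrable (lebesgue_on D) (\<lambda>x. \<eta> x * ?q x)"
  proof (rule Bochner_Integration.integrable_bound[OF iqD])
    show "(\<lambda>x. \<eta> x * ?q x) \<in> borel_measurable (lebesgue_on D)"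
      by (rule borel_measurable_times[OF em borel_measurable_integrable[OF iqD]])
    show "AE x in lebesgue_on D. norm (\<eta> x * ?q x) \<le> norm (?q x)"
      using e01 by (intro AE_I2) (simp add: abs_mult mult_left_le_one_le)
  qed
  \<comment> \<open>The second term is the energy weighted by \<eta>, which dominates the energy
    where \<eta> is 1; the first is the commutator to be estimated.\<close>
  have Bv: "Bf u (\<lambda>x. \<eta> x * u x) = (LINT x|lebesgue_on D. ?s x) + (LINT x|lebesgue_on D. \<eta> x * ?q x)"
  proof -
    have "AE x in lebesgue_on D. \<forall>\<sigma>\<in>I. jet (\<lambda>x. \<eta> x * u x) x \<sigma> = commutator \<eta> u \<sigma> x + \<eta> x * jet u x \<sigma>"
      using jet_mult[OF u \<eta> B] finite_mlen_le by (intro AE_finite_allI) auto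
    then have ae: "AE x in lebesgue_on D. sym_form I a x (jet u x) (jet (\<lambda>x. \<eta> x * u x) x) = ?s x + \<eta> x * ?q x"
    proof eventually_elim
      case (elim x)
      then have "sym_form I a x (jet u x) (jet (\<lambda>x. \<eta> x * u x) x) = sym_form I a x (jet u x) (\<lambda>\<sigma>. commutator \<eta> u \<sigma> x + \<eta> x * jet u x \<sigma>)"
        by (intro sym_form_cong) auto
      then show ?case by (simp add: sym_form_add_right sym_form_self)
    qed
    have "Bf u (\<lambda>x. \<eta> x * u x) = (LINT x|lebesgue_on D. ?s x + \<eta> x * ?q x)"
      unfolding Bf_def
      by (rule integral_cong_AE[OF borel_measurable_integrable[OF jet_sym_integrable[OF u v Ds order_refl]] _ ae])
        (intro borel_measurable_integrable Bochner_Integration.integrable_add isD ieq)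
    also have "\<dots> = (LINT x|lebesgue_on D. ?s x) + (LINT x|lebesgue_on D. \<eta> x * ?q x)"
      by (rule Bochner_Integration.integral_add[OF isD ieq])
    finally show ?thesis .
  qed
  let ?O1 = "outer c (R + L + h)" and ?O0 = "outer c (R - h)"
  let ?A = "?O0 - ?O1"
  have As: "?A \<in> sets lebesgue" "?A \<subseteq> D"
    using outer_sets(1) outer_sets(2)[of c "R - h"] by (blast intro: sets.Diff)+
  have "en ?O1 u = (LINT x|lebesgue_on D. indicator ?O1 x * ?q x)"
  proof -
    have "(LINT x|lebesgue_on D. indicator ?O1 x * ?q x) = (LINT x|lebesgue_on ?O1. indicator ?O1 x * ?q x)"
      by (rule integral_on_zero_outside[OF outer_sets(1) Ds outer_sets(2)]) auto
    also have "\<dots> = en ?O1 u" unfolding en_def by (intro Bochner_Integration.integral_cong) auto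
    finally show ?thesis by simp
  qed
  also have "\<dots> \<le> (LINT x|lebesgue_on D. \<eta> x * ?q x)"
  proof (rule integral_mono[OF _ ieq])
    have "indicat_real ?O1 \<in> borel_measurable (lebesgue_on D)"
      using outer_sets by (intro measurable_restrict_space1 borel_measurable_indicator)
    then have "(\<lambda>x. indicat_real ?O1 x * ?q x) \<in> borel_measurable (lebesgue_on D)"
      by (rule borel_measurable_times[OF _ borel_measurable_integrable[OF iqD]])
    then show "integrable (lebesgue_on D) (\<lambda>x. indicator ?O1 x * ?q x)"
      by (rule Bochner_Integration.integrable_bound[OF iqD]) (auto intro!: AE_I2 simp: indicator_def)
    fix x assume "x \<in> space (lebesgue_on D)"
    then have x: "x \<in> D" by simp
    have "indicator ?O1 x \<le> \<eta> x"
    proof (cases "x \<in> ?O1")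
      case True
      then obtain i where "\<bar>x $ i - c $ i\<bar> > R + L + h" by (auto simp: outer_def)
      then have "\<eta> x = 1" using h0 by (intro e1[of x i]) linarith
      then show ?thesis by simp
    qed (simp add: e01)
    then show "indicator ?O1 x * ?q x \<le> \<eta> x * ?q x" by (intro mult_right_mono quad_nonneg x)
  qed
  also have "\<dots> = (\<Sum>j\<in>{1..m}. (LINT x|lebesgue_on (\<tau> j). (\<eta> x * u x) * g j x) - (LINT x|lebesgue_on (\<tau> j). ?s x))"
  proof -
    have "(LINT x|lebesgue_on D. ?s x) = (\<Sum>j\<in>{1..m}. LINT x|lebesgue_on (\<tau> j \<inter> D). ?s x)"
      by (rule partition_integral[OF mp isD Ds order_refl])
    also have "\<dots> = (\<Sum>j\<in>{1..m}. LINT x|lebesgue_on (\<tau> j). ?s x)"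
      by (intro sum.cong refl) (simp add: Int_absorb2[OF T(2)])
    finally show ?thesis using Bv rep[OF v] by (simp add: sum_subtractf)
  qed
  also have "\<dots> \<le> (\<Sum>j\<in>{1..m}. \<kappa> * en (\<tau> j \<inter> ?A) u)"
  proof (rule sum_mono)
    fix j assume j: "j \<in> {1..m}"
    let ?X = "(LINT x|lebesgue_on (\<tau> j). (\<eta> x * u x) * g j x) - (LINT x|lebesgue_on (\<tau> j). ?s x)"
    have \<kappa>0: "\<kappa> \<ge> 0" unfolding \<kappa>_def using C1 h0 L0 Cp Cin \<theta>max_pos \<theta>
      by (intro mult_nonneg_nonneg real_sqrt_ge_zero divide_nonneg_nonneg) auto
    have rhs0: "0 \<le> \<kappa> * en (\<tau> j \<inter> ?A) u" using T(2)[OF j] by (intro mult_nonneg_nonneg \<kappa>0 en_nonneg) auto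
    have near: "\<bar>x $ l - y $ l\<bar> \<le> h" if "x \<in> \<tau> j" "y \<in> \<tau> j" for x y l
    proof -
      have "\<bar>x $ l - y $ l\<bar> \<le> norm (x - y)" using component_le_norm_cart[of "x - y" l] by simp
      also have "\<dots> \<le> diameter (\<tau> j)" using diameter_bounded_bound[OF T(4)[OF j] that] by (simp add: dist_norm)
      finally show ?thesis using diam[OF j] by linarith
    qed
    have const: "(LINT x|lebesgue_on (\<tau> j). ?s x) = 0" if "\<And>x. x \<in> \<tau> j \<Longrightarrow> \<eta> x = d" for d
    proof -
      have "(LINT x|lebesgue_on (\<tau> j). ?s x) = (LINT x|lebesgue_on (\<tau> j). 0)"
      proof (intro Bochner_Integration.integral_cong refl)
        fix x assume "x \<in> space (lebesgue_on (\<tau> j))"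
        then have "commutator \<eta> u \<sigma> x = 0" for \<sigma> by (intro commutator_zero[OF T(3)[OF j] \<eta> that]) auto
        then show "?s x = 0" by (simp add: sym_form_def)
      qed
      then show ?thesis by simp
    qed
    \<comment> \<open>On elements of the first two kinds \<eta> is constant. An element of the third
      kind has diameter at most h, so all its points lie between the cubes of half-width R - h and R
      + L + h.\<close>
    consider (inside) "\<And>x l. x \<in> \<tau> j \<Longrightarrow> \<bar>x $ l - c $ l\<bar> \<le> R"
      | (outside) "\<And>x. x \<in> \<tau> j \<Longrightarrow> \<exists>l. \<bar>x $ l - c $ l\<bar> \<ge> R + L"
      | (mixed) x l y where "x \<in> \<tau> j" "\<bar>x $ l - c $ l\<bar> > R" "y \<in> \<tau> j" "\<And>l. \<bar>y $ l - c $ l\<bar> < R + L"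
      by (meson not_le)
    then show "?X \<le> \<kappa> * en (\<tau> j \<inter> ?A) u"
    proof cases
      case inside
      have z: "\<eta> x = 0" if "x \<in> \<tau> j" for x by (rule e0) (rule inside[OF that])
      then have "(LINT x|lebesgue_on (\<tau> j). (\<eta> x * u x) * g j x) = (LINT x|lebesgue_on (\<tau> j). 0)"
        by (intro Bochner_Integration.integral_cong) auto
      then show ?thesis using const[OF z] rhs0 by simp
    next
      case outside
      have z: "\<eta> x = 1" if "x \<in> \<tau> j" for x using outside[OF that] e1 by blast
      \<comment> \<open>Element i contains the centre, where \<eta> is 0, so it cannot lie where
        \<eta> is 1. Hence the moments used next do vanish.\<close>
      have "j \<noteq> i"
      proof
        assume "j = i"
        then obtain l where "\<bar>c $ l - c $ l\<bar> \<ge> R + L" using outside ci by blast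
        then show False using R h0 L0 by simp
      qed
      then have "(LINT x|lebesgue_on (\<tau> j). u x * g j x) = 0" by (intro mom j g)
      moreover have "(LINT x|lebesgue_on (\<tau> j). (\<eta> x * u x) * g j x) = (LINT x|lebesgue_on (\<tau> j). u x * g j x)"
        using z by (intro Bochner_Integration.integral_cong) auto
      ultimately show ?thesis using const[OF z] rhs0 by simp
    next
      case mixed
      have sub: "\<tau> j \<subseteq> ?A"
      proof
        fix z assume z: "z \<in> \<tau> j"
        have in0: "\<bar>z $ l - c $ l\<bar> > R - h" using near[OF mixed(1) z, of l] mixed(2) by linarith
        have out1: "\<bar>z $ l' - c $ l'\<bar> \<le> R + L + h" for l'
          using near[OF z mixed(3), of l'] mixed(4)[of l'] by linarith
        have "z \<in> D" using T(2)[OF j] z by blast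
        then have "z \<in> ?O0" using in0 unfolding outer_def by blast
        moreover have "z \<notin> ?O1"
        proof
          assume "z \<in> ?O1"
          then obtain l' where "\<bar>z $ l' - c $ l'\<bar> > R + L + h" unfolding outer_def by blast
          then show False using out1[of l'] by linarith
        qed
        ultimately show "z \<in> ?A" by blast
      qed
      \<comment> \<open>R >= h keeps the whole of element i inside the inner cube. Vanishing moments
        and the projection bound are available only on the other elements.\<close>
      have ji: "j \<noteq> i"
      proof
        assume "j = i"
        then have "\<bar>x $ l - c $ l\<bar> \<le> h" using near[OF mixed(1)] ci by blast
        then show False using mixed(2) R by linarith
      qed
      let ?t = "diameter (\<tau> j)"
      note Tj = T[OF j]
      have pow: "?t ^ p \<le> h ^ p" for p using diam[OF j] Tj(6) by (intro power_mono) auto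
      have projh: "seminorm2 p (\<tau> j) u \<le> (Cp * h ^ (k - p))\<^sup>2 * seminorm2 k (\<tau> j) u" if "p \<le> k" for p
      proof -
        have "(Cp * ?t ^ (k - p))\<^sup>2 \<le> (Cp * h ^ (k - p))\<^sup>2"
        proof (rule power_mono)
          show "Cp * ?t ^ (k - p) \<le> Cp * h ^ (k - p)" using Cp by (intro mult_left_mono pow) simp
        qed (use Cp Tj(6) in simp)
        then show ?thesis using order_trans[OF proj[OF j ji that] mult_right_mono[OF _ seminorm2_nonneg]] by blast
      qed
      have co: "seminorm2 k (\<tau> j) u \<le> 16 / (7 * \<theta>min) * en (\<tau> j) u"
        by (rule local_coercivity[OF u Tj(1,2) D0 projh h2]) simp
      have 1: "\<bar>LINT x|lebesgue_on (\<tau> j). ?s x\<bar>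
          \<le> 3 * real (card I) * 2 ^ k * C * (h / L) * Cp * sqrt (\<theta>max / \<theta>min) * en (\<tau> j) u"
        by (rule commutator_energy[OF u Tj(1,2) \<eta> B ed C1 h0 hL Cp projh h1 co])
      have Cp0: "Cp > 0" using Cp by linarith
      have gs: "g j \<in> sqint (lebesgue_on (\<tau> j))"
        by (rule continuous_sqint_bounded[OF polys_continuous[OF g[OF j]] Tj(4,1)])
      have u0: "seminorm2 0 (\<tau> j) u \<le> (Cp * ?t ^ k)\<^sup>2 * seminorm2 k (\<tau> j) u" using proj[OF j ji, of 0] by simp
      have 2: "\<bar>LINT x|lebesgue_on (\<tau> j). (\<eta> x * u x) * g j x\<bar>
          \<le> 2 * C * (h / L) * Cp * Cin * sqrt (\<theta>max / \<theta>min) * en (\<tau> j) u"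
        by (rule source_term_estimate[OF u Tj(3,2,4,5) \<eta> lip C1 Tj(6) order_refl diam[OF j] hL Cp0 Cin u0 co gs inv[OF j] mom[OF j ji g[OF j]]])
      let ?P = "C * (h / L) * Cp * sqrt (\<theta>max / \<theta>min) * en (\<tau> j) u"
      have P0: "?P \<ge> 0" using C1 h0 L0 Cp \<theta>max_pos \<theta> en_nonneg[OF Tj(2)]
        by (intro mult_nonneg_nonneg real_sqrt_ge_zero divide_nonneg_nonneg) auto
      have m1: "real (card I) \<ge> 1"
      proof -
        have "card I > 0" by (rule card_mlen_le_pos)
        then show ?thesis by simp
      qed
      \<comment> \<open>The factor 2 of the source term is absorbed into the larger factor of the
        commutator term. The common factor 1 + \<open>Cin\<close> left over is the origin of the
        constant 1 added to the inverse constant.\<close>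
      have big: "2 \<le> 3 * real (card I) * 2 ^ k"
      proof -
        have "(1::real) \<le> 2 ^ k" by simp
        then have "1 * 1 \<le> real (card I) * 2 ^ k" using m1 by (intro mult_mono) auto
        then show ?thesis by simp
      qed
      define P where "P = ?P"
      define M where "M = 3 * real (card I) * 2 ^ k"
      have i1: "M * C * (h / L) * Cp * sqrt (\<theta>max / \<theta>min) * en (\<tau> j) u = M * P"
        and i2: "2 * C * (h / L) * Cp * Cin * sqrt (\<theta>max / \<theta>min) * en (\<tau> j) u = 2 * Cin * P"
        and i3: "\<kappa> * en (\<tau> j) u = M * (1 + Cin) * P"
        unfolding P_def \<kappa>_def M_def by (simp_all only: mult_ac)
      have "?X \<le> M * P + 2 * Cin * P"
        using 1 2 unfolding M_def[symmetric] i1 i2 by linarith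
      also have "\<dots> \<le> M * P + M * Cin * P"
        using big Cin P0 unfolding M_def[symmetric] P_def[symmetric] by (intro add_left_mono mult_right_mono) auto
      also have "\<dots> = \<kappa> * en (\<tau> j) u" unfolding i3 by (simp add: distrib_left distrib_right)
      finally show ?thesis using sub by (simp add: Int_absorb2)
    qed
  qed
  also have "\<dots> = \<kappa> * (\<Sum>j\<in>{1..m}. en (\<tau> j \<inter> ?A) u)" by (simp add: sum_distrib_left)
  also have "(\<Sum>j\<in>{1..m}. en (\<tau> j \<inter> ?A) u) = en ?A u"
    unfolding en_def by (rule partition_integral[OF mp jet_quad_integrable[OF u As] As, symmetric])
  also have "en ?A u = en ?O0 u - en ?O1 u"
  proof -
    have sub: "?O1 \<subseteq> ?O0"
    proof
      fix x assume "x \<in> ?O1"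
      then obtain l where "x \<in> D" "\<bar>x $ l - c $ l\<bar> > R + L + h" by (auto simp: outer_def)
      then have "\<bar>x $ l - c $ l\<bar> > R - h" using h0 L0 by linarith
      then show "x \<in> ?O0" using \<open>x \<in> D\<close> by (auto simp: outer_def)
    qed
    have "en (?A \<union> ?O1) u = en ?A u + en ?O1 u" using outer_sets As by (intro en_Un[OF u]) auto
    moreover have "?A \<union> ?O1 = ?O0" using sub by auto
    ultimately show ?thesis by simp
  qed
  finally show ?thesis .
qed

end

section \<open>The mesh size threshold\<close>

text \<open>For b = 0 the quotient is infinite and the left side true, in agreement with 0 <= A on
  the right.\<close>

lemma ereal_le_divide_iff:
  assumes "A > 0" "b \<ge> 0"
  shows "ereal S \<le> ereal A / ereal b \<longleftrightarrow> b * S \<le> A"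
  using assms by (cases "b = 0") (auto simp: divide_ereal_def field_simps zero_ereal_def[symmetric])

text \<open>The conditions of \<open>mesh_threshold\<close> with those denominators multiplied out
  that may be 0, so that \<theta>0 = 0 becomes an ordinary real case.\<close>

definition threshold_set :: "nat \<Rightarrow> real \<Rightarrow> real \<Rightarrow> real \<Rightarrow> real \<Rightarrow> real \<Rightarrow> real set" where
  "threshold_set k Cp Cf \<theta>0 \<theta>max \<theta>min = {h. h > 0 \<and> (\<Sum>j\<in>{1..<k}. h ^ (2 * j)) \<le> 1 / Cp\<^sup>2 \<and>
     2 * \<theta>0 * Cf\<^sup>2 * (\<Sum>j\<in>{1..k}. h ^ (2 * j)) \<le> \<theta>max \<and>
     16 * \<theta>0 * \<theta>max * Cp\<^sup>2 * (\<Sum>j\<in>{1..k}. h ^ (2 * j)) \<le> \<theta>min\<^sup>2}"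

lemma mesh_threshold_eq:
  assumes "\<theta>0 \<ge> 0" "\<theta>max > 0" "\<theta>min > 0"
  shows "mesh_threshold k Cp Cf \<theta>0 \<theta>max \<theta>min = Sup (ereal ` threshold_set k Cp Cf \<theta>0 \<theta>max \<theta>min)"
proof -
  have "ereal S \<le> min (ereal \<theta>max / ereal (2 * \<theta>0 * Cf\<^sup>2)) (ereal (\<theta>min\<^sup>2) / ereal (16 * \<theta>0 * \<theta>max * Cp\<^sup>2))
    \<longleftrightarrow> 2 * \<theta>0 * Cf\<^sup>2 * S \<le> \<theta>max \<and> 16 * \<theta>0 * \<theta>max * Cp\<^sup>2 * S \<le> \<theta>min\<^sup>2" for S
    using assms ereal_le_divide_iff[of \<theta>max "2 * \<theta>0 * Cf\<^sup>2" S] ereal_le_divide_iff[of "\<theta>min\<^sup>2" "16 * \<theta>0 * \<theta>max * Cp\<^sup>2" S]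
    by simp
  then show ?thesis unfolding mesh_threshold_def threshold_set_def by (intro arg_cong[where f = Sup]) auto
qed

text \<open>All exponents are at least 2, so the sums tend to 0 with h while the bounds are
  positive. This makes the threshold positive.\<close>

lemma threshold_set_nonempty:
  assumes "Cp > 0" "\<theta>0 \<ge> 0" "\<theta>max > 0" "\<theta>min > 0"
  shows "\<exists>h. h \<in> threshold_set k Cp Cf \<theta>0 \<theta>max \<theta>min"
proof -
  let ?P = "\<lambda>h. (\<Sum>j\<in>{1..<k}. h ^ (2 * j)) < 1 / Cp\<^sup>2 \<and>
     2 * \<theta>0 * Cf\<^sup>2 * (\<Sum>j\<in>{1..k}. h ^ (2 * j)) < \<theta>max \<and>
     16 * \<theta>0 * \<theta>max * Cp\<^sup>2 * (\<Sum>j\<in>{1..k}. h ^ (2 * j)) < \<theta>min\<^sup>2"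
  have z: "(\<Sum>j\<in>A. (0::real) ^ (2 * j)) = 0" if "A \<subseteq> {1..}" for A using that by (intro sum.neutral) (auto simp: power_0_left)
  have l: "((\<lambda>h::real. \<Sum>j\<in>A. h ^ (2 * j)) \<longlongrightarrow> 0) (at_right 0)" if "A \<subseteq> {1..}" for A
  proof -
    have "((\<lambda>h::real. \<Sum>j\<in>A. h ^ (2 * j)) \<longlongrightarrow> (\<Sum>j\<in>A. 0 ^ (2 * j))) (at_right 0)" by (intro tendsto_intros)
    then show ?thesis using z[OF that] by simp
  qed
  have l1: "((\<lambda>h::real. c * (\<Sum>j\<in>A. h ^ (2 * j))) \<longlongrightarrow> 0) (at_right 0)" if "A \<subseteq> {1..}" for A c
    using tendsto_mult[OF tendsto_const l[OF that], of c] by simp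
  have "\<forall>\<^sub>F h in at_right 0. (\<Sum>j\<in>{1..<k}. h ^ (2 * j)) < 1 / Cp\<^sup>2"
    by (rule order_tendstoD(2)[OF l]) (use assms in auto)
  moreover have "\<forall>\<^sub>F h in at_right 0. 2 * \<theta>0 * Cf\<^sup>2 * (\<Sum>j\<in>{1..k}. h ^ (2 * j)) < \<theta>max"
    by (rule order_tendstoD(2)[OF l1]) (use assms in auto)
  moreover have "\<forall>\<^sub>F h in at_right 0. 16 * \<theta>0 * \<theta>max * Cp\<^sup>2 * (\<Sum>j\<in>{1..k}. h ^ (2 * j)) < \<theta>min\<^sup>2"
    by (rule order_tendstoD(2)[OF l1]) (use assms in auto)
  ultimately have "\<forall>\<^sub>F h in at_right 0. ?P h" by eventually_elim simp
  moreover have "\<forall>\<^sub>F h::real in at_right 0. h > 0" by (simp add: eventually_at_right_less)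
  ultimately have "\<forall>\<^sub>F h in at_right 0. ?P h \<and> h > 0" by (rule eventually_conj)
  then obtain h where "?P h" "h > 0" using eventually_happens'[OF trivial_limit_at_right_real] by blast
  then show ?thesis by (intro exI[of _ h]) (auto simp: threshold_set_def)
qed

text \<open>Every smaller positive number satisfies the conditions because the sums increase with h,
  and the conditions survive a limit from below. The limit matters because a mesh size equal to the
  supremum is allowed.\<close>

lemma threshold_set_closed:
  assumes h: "h > 0" and le: "ereal h \<le> Sup (ereal ` threshold_set k Cp Cf \<theta>0 \<theta>max \<theta>min)"
    and pos: "\<theta>0 \<ge> 0" "\<theta>max > 0"
  shows "h \<in> threshold_set k Cp Cf \<theta>0 \<theta>max \<theta>min"
proof -
  have down: "s \<in> threshold_set k Cp Cf \<theta>0 \<theta>max \<theta>min" if s: "0 < s" "s < h" for s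
  proof -
    have "ereal s < Sup (ereal ` threshold_set k Cp Cf \<theta>0 \<theta>max \<theta>min)" using s le by (meson ereal_less_eq(3) less_ereal.simps(1) order_less_le_trans)
    then obtain t where t: "t \<in> threshold_set k Cp Cf \<theta>0 \<theta>max \<theta>min" "s < t" unfolding less_Sup_iff by auto
    have mono: "(\<Sum>j\<in>A. s ^ (2 * j)) \<le> (\<Sum>j\<in>A. t ^ (2 * j))" for A
      using s t by (intro sum_mono power_mono) auto
    have c: "x * (\<Sum>j\<in>{1..k}. s ^ (2 * j)) \<le> y" if "x * (\<Sum>j\<in>{1..k}. t ^ (2 * j)) \<le> y" "x \<ge> 0" for x y
      using mult_left_mono[OF mono that(2), of "{1..k}"] that(1) by linarith
    have "2 * \<theta>0 * Cf\<^sup>2 * (\<Sum>j\<in>{1..k}. s ^ (2 * j)) \<le> \<theta>max"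
      "16 * \<theta>0 * \<theta>max * Cp\<^sup>2 * (\<Sum>j\<in>{1..k}. s ^ (2 * j)) \<le> \<theta>min\<^sup>2"
      using t(1) pos by (auto simp: threshold_set_def intro!: c simp del: One_nat_def)
    moreover have "(\<Sum>j\<in>{1..<k}. s ^ (2 * j)) \<le> 1 / Cp\<^sup>2"
      using t(1) order_trans[OF mono] by (simp add: threshold_set_def)
    ultimately show ?thesis using s by (simp add: threshold_set_def)
  qed
  \<comment> \<open>The shift by 2 keeps \<open>r n\<close> positive already for n = 0.\<close>
  define r where "r n = h * (1 - 1 / real (n + 2))" for n
  have r: "r \<longlonglongrightarrow> h * (1 - 0)" unfolding r_def
    by (intro tendsto_intros LIMSEQ_ignore_initial_segment[of "\<lambda>n. 1 / real n" 0 2, OF lim_1_over_n])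
  have rp: "0 < r n" "r n < h" for n using h by (auto simp: r_def field_simps intro: add_pos_nonneg)
  have rt: "r n \<in> threshold_set k Cp Cf \<theta>0 \<theta>max \<theta>min" for n by (rule down[OF rp])
  have lim: "(\<lambda>n. c * (\<Sum>j\<in>A. r n ^ (2 * j))) \<longlonglongrightarrow> c * (\<Sum>j\<in>A. h ^ (2 * j))" for c A
    using r by (intro tendsto_intros) simp
  have cl: "c * (\<Sum>j\<in>A. h ^ (2 * j)) \<le> y" if "\<And>n. c * (\<Sum>j\<in>A. r n ^ (2 * j)) \<le> y" for c A y
    using LIMSEQ_le_const2[OF lim] that by blast
  have "1 * (\<Sum>j\<in>{1..<k}. h ^ (2 * j)) \<le> 1 / Cp\<^sup>2"
    by (rule cl) (use rt in \<open>simp add: threshold_set_def\<close>)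
  moreover have "2 * \<theta>0 * Cf\<^sup>2 * (\<Sum>j\<in>{1..k}. h ^ (2 * j)) \<le> \<theta>max"
    by (rule cl) (use rt in \<open>simp add: threshold_set_def\<close>)
  moreover have "16 * \<theta>0 * \<theta>max * Cp\<^sup>2 * (\<Sum>j\<in>{1..k}. h ^ (2 * j)) \<le> \<theta>min\<^sup>2"
    by (rule cl) (use rt in \<open>simp add: threshold_set_def\<close>)
  ultimately show ?thesis using h by (simp add: threshold_set_def)
qed

lemma layer_decay:
  fixes e :: "nat \<Rightarrow> real"
  assumes step: "\<And>n. e (Suc n) \<le> \<kappa> * (e n - e (Suc n))" and mono: "\<And>n. e (Suc n) \<le> e n"
    and \<kappa>: "\<kappa> * (exp 1 - 1) \<le> 1"
  shows "e n \<le> exp (- real n) * e 0"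
proof (induction n)
  case (Suc n)
  have e1: "exp 1 - 1 > (0::real)" by simp
  have "(exp 1 - 1) * e (Suc n) \<le> (exp 1 - 1) * (\<kappa> * (e n - e (Suc n)))"
    using step e1 by (intro mult_left_mono) auto
  also have "\<dots> = (\<kappa> * (exp 1 - 1)) * (e n - e (Suc n))" by simp
  also have "\<dots> \<le> 1 * (e n - e (Suc n))" using mono \<kappa> by (intro mult_right_mono) auto
  finally have "exp 1 * e (Suc n) \<le> e n" by (simp add: algebra_simps)
  then have "exp (-1) * (exp 1 * e (Suc n)) \<le> exp (-1) * e n" by (intro mult_left_mono) auto
  moreover have "exp (-1) * (exp 1 * e (Suc n)) = e (Suc n)" by (simp add: mult.assoc[symmetric] exp_add[symmetric])
  moreover have "exp (-1) * e n \<le> exp (-1) * (exp (- real n) * e 0)" using Suc by (intro mult_left_mono) auto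
  moreover have "exp (-1) * (exp (- real n) * e 0) = exp (- real (Suc n)) * e 0"
    by (simp add: mult.assoc[symmetric] exp_add[symmetric])
  ultimately show ?case by linarith
qed simp

section \<open>Iteration over the layers and the final estimate\<close>

context elliptic
begin

text \<open>For the degenerate case Cp < 1, in which all seminorms off element i vanish.\<close>

lemma en_zero_of_seminorms:
  assumes u: "u \<in> H0k k D" and T: "T \<in> sets lebesgue" "T \<subseteq> D"
    and z: "\<And>p. p \<le> k \<Longrightarrow> seminorm2 p T u = 0"
  shows "en T u = 0"
proof -
  have "en T u \<le> \<theta>' * seminorm2 k T u + \<theta>0 * (\<Sum>p<k. seminorm2 p T u)"
    using quad_integral_upper[OF T, of "\<lambda>\<sigma> x. jet u x \<sigma>"] jet_sqint[OF u T] by (simp add: en_def seminorm2_def)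
  also have "\<dots> = 0" using z by simp
  finally show ?thesis using en_nonneg[OF T(2)] by (simp add: order_antisym)
qed

text \<open>The Euclidean norm is at most the sum of the d coordinates, so outside the ball of
  radius r some coordinate differs from that of the centre by at least r/d. This is why the layers
  have width l h/d.\<close>

lemma outer_superset:
  assumes r: "r > 0" and l: "l > 0" and h: "h > 0"
  shows "\<exists>n. real n \<ge> r / (l * h) - 1 \<and> D \<inter> - ball c r \<subseteq> outer c (real n * (l * h / real CARD('n)))"
proof -
  let ?d = "real CARD('n)"
  have d0: "?d > 0" by simp
  have lh: "l * h > 0" using l h by simp
  \<comment> \<open>The largest integer strictly below r/(l h). Strictness gives the contradiction
    with the distance being at least r, and at most 1 is lost.\<close>
  define n where "n = nat (\<lceil>r / (l * h)\<rceil> - 1)"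
  have "r / (l * h) > 0" using r lh by simp
  then have n: "real n = of_int \<lceil>r / (l * h)\<rceil> - 1" by (simp add: n_def)
  then have n1: "real n < r / (l * h)" "real n \<ge> r / (l * h) - 1" by linarith+
  have "D \<inter> - ball c r \<subseteq> outer c (real n * (l * h / ?d))"
  proof
    fix x assume x: "x \<in> D \<inter> - ball c r"
    show "x \<in> outer c (real n * (l * h / ?d))"
    proof (rule ccontr)
      assume "x \<notin> outer c (real n * (l * h / ?d))"
      then have le: "\<bar>x $ i - c $ i\<bar> \<le> real n * (l * h / ?d)" for i using x by (auto simp: outer_def not_less)
      have "norm (x - c) \<le> (\<Sum>i\<in>UNIV. \<bar>(x - c) $ i\<bar>)" by (rule norm_le_l1_cart)
      also have "\<dots> \<le> (\<Sum>i\<in>(UNIV::'n set). real n * (l * h / ?d))" using le by (intro sum_mono) simp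
      also have "\<dots> = real n * (l * h)" using d0 by simp
      also have "\<dots> < r" using n1(1) lh by (simp add: field_simps)
      finally show False using x by (simp add: dist_norm norm_minus_commute)
    qed
  qed
  with n1 show ?thesis by blast
qed

text \<open>The layer argument requires Cp >= 1 and l large compared with the dimension. In the
  remaining cases the right side is at least the full energy, or u has no energy off element
  i.\<close>

lemma decay:
  assumes mp: "mesh_partition D m \<tau>" and i: "i \<in> {1..m}" and ci: "c \<in> \<tau> i" and u: "u \<in> H0k k D"
    and g: "\<And>j. j \<in> {1..m} \<Longrightarrow> g j \<in> polys (k - 1)"
    and rep: "\<And>v. v \<in> H0k k D \<Longrightarrow> Bf u v = (\<Sum>j\<in>{1..m}. LINT x|lebesgue_on (\<tau> j). v x * g j x)"
    and mom: "\<And>j p. j \<in> {1..m} \<Longrightarrow> j \<noteq> i \<Longrightarrow> p \<in> polys (k - 1) \<Longrightarrow> (LINT x|lebesgue_on (\<tau> j). u x * p x) = 0"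
    and proj: "\<And>j p. j \<in> {1..m} \<Longrightarrow> j \<noteq> i \<Longrightarrow> p \<le> k \<Longrightarrow>
        seminorm2 p (\<tau> j) u \<le> (Cp * diameter (\<tau> j) ^ (k - p))\<^sup>2 * seminorm2 k (\<tau> j) u"
    and inv: "\<And>j. j \<in> {1..m} \<Longrightarrow>
        (LINT x|lebesgue_on (\<tau> j). (g j x)\<^sup>2) \<le> (Cin / diameter (\<tau> j) ^ k)\<^sup>2 * (3 / 2 * \<theta>max * en (\<tau> j) u)"
    and Cp: "Cp > 0" and Cin: "Cin > 0" and h: "h = mesh_size m \<tau>"
    and h1: "(\<Sum>j\<in>{1..<k}. h ^ (2 * j)) \<le> 1 / Cp\<^sup>2"
    and h2: "16 * \<theta>0 * \<theta>max * Cp\<^sup>2 * (\<Sum>j\<in>{1..k}. h ^ (2 * j)) \<le> \<theta>min\<^sup>2"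
    and C1: "C \<ge> 1"
    and cut: "\<And>R L. R \<ge> 0 \<Longrightarrow> L > 0 \<Longrightarrow> \<exists>\<eta>. smooth \<eta> \<and> (\<forall>x. 0 \<le> \<eta> x \<and> \<eta> x \<le> 1) \<and>
      (\<forall>x. (\<forall>i. \<bar>x $ i - c $ i\<bar> \<le> R) \<longrightarrow> \<eta> x = 0) \<and>
      (\<forall>x. (\<exists>i. \<bar>x $ i - c $ i\<bar> \<ge> R + L) \<longrightarrow> \<eta> x = 1) \<and>
      (\<forall>xs x. xs \<noteq> [] \<and> length xs \<le> k \<longrightarrow> \<bar>foldr pd xs \<eta> x\<bar> \<le> C / L ^ length xs) \<and>
      (\<forall>x y. \<bar>\<eta> x - \<eta> y\<bar> \<le> C / L * norm (x - y))"
    and K: "K = 3 * real (card I) * 2 ^ k * C"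
    and l: "sqrt (l\<^sup>2 - 1) \<ge> 2 * (exp 1 - 1) * (4 * real CARD('n) * K) * Cp * (1 + Cin) * sqrt (\<theta>max / \<theta>min)"
    and r: "r > 0"
  shows "en (D \<inter> - ball c r) u \<le> exp (1 - r / (l * h)) * en D u"
proof -
  let ?d = "real CARD('n)" and ?A0 = "sqrt (\<theta>max / \<theta>min)"
  note T = partition_sets[OF mp]
  have D0: "D \<noteq> {}" using T[OF i] by blast
  have diam: "diameter (\<tau> j) \<le> h" if "j \<in> {1..m}" for j unfolding h by (rule mesh_size_ge[OF that])
  have h0: "h > 0" using diam[OF i] T(6)[OF i] by linarith
  have Bs: "D \<inter> - ball c r \<in> sets lebesgue" "D \<inter> - ball c r \<subseteq> D" using Ds by auto
  have E0: "en D u \<ge> 0" by (rule en_nonneg) simp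
  have trivial: ?thesis if "r / (l * h) \<le> 1"
  proof -
    have "en (D \<inter> - ball c r) u \<le> 1 * en D u" using en_mono[OF u Bs(1) Ds Bs(2)] by simp
    also have "\<dots> \<le> exp (1 - r / (l * h)) * en D u" using that E0 by (intro mult_right_mono) auto
    finally show ?thesis .
  qed
  have d1: "?d \<ge> 1" using zero_less_card_finite[where 'a='n] by linarith
  have A1: "?A0 \<ge> 1" using \<theta>min_le[OF D0] \<theta> by simp
  have "card I > 0" by (rule card_mlen_le_pos)
  then have m1: "real (card I) \<ge> 1" by simp
  have K1: "K \<ge> 1"
  proof -
    have "(1::real) \<le> 2 ^ k" by simp
    then have "1 * 1 * 1 \<le> (3 * real (card I)) * 2 ^ k * C" using m1 C1 by (intro mult_mono) auto
    then show ?thesis by (simp add: K)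
  qed
  have e2: "exp 1 - 1 \<ge> (1::real)" using exp_ge_add_one_self[of "1::real"] by simp
  define X where "X = 2 * (exp 1 - 1) * (4 * ?d * K) * Cp * (1 + Cin) * ?A0"
  have X0: "X > 0" unfolding X_def using e2 d1 K1 Cp Cin A1 by (intro mult_pos_pos) auto
  have lX: "sqrt (l\<^sup>2 - 1) \<ge> X" using l unfolding X_def .
  show ?thesis
  \<comment> \<open>For l <= 0 the exponent is at least 1; for l = 0 this rests on division by 0
    being 0.\<close>
  proof (cases "l \<le> 0")
    case True
    then have "r / (l * h) \<le> 0" using r h0 by (intro divide_nonneg_nonpos mult_nonpos_nonneg) auto
    then show ?thesis by (intro trivial) simp
  next
    case False
    then have l0: "l > 0" by simp
    have "sqrt (l\<^sup>2 - 1) \<le> sqrt (l\<^sup>2)" by (rule real_sqrt_le_mono) simp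
    then have Xl: "X \<le> l" using lX l0 by simp
    \<comment> \<open>\<open>sqrt\<close> of a negative number is negative, so a positive root does
      yield l^2 > 1.\<close>
    have "sqrt (l\<^sup>2 - 1) > 0" using lX X0 by linarith
    then have "l\<^sup>2 > 1\<^sup>2" by simp
    then have l1: "l > 1" using l0 by (meson not_less power2_less_imp_less less_imp_le)
    show ?thesis
    \<comment> \<open>For p = k the projection bound compares the top seminorm with Cp times itself,
      so Cp < 1 forces it, and with it all other seminorms, to vanish on every element but
      i.\<close>
    proof (cases "Cp \<ge> 1")
      case False
      have en0: "en (\<tau> j) u = 0" if j: "j \<in> {1..m}" "j \<noteq> i" for j
      proof (rule en_zero_of_seminorms[OF u T(1,2)[OF j(1)]])
        have "seminorm2 k (\<tau> j) u \<le> Cp\<^sup>2 * seminorm2 k (\<tau> j) u" using proj[OF j, of k] by simp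
        moreover have "Cp\<^sup>2 < 1" using False Cp by (simp add: power_less_one_iff)
        ultimately have "(1 - Cp\<^sup>2) * seminorm2 k (\<tau> j) u \<le> 0" "1 - Cp\<^sup>2 > 0" by (simp_all add: algebra_simps)
        then have "seminorm2 k (\<tau> j) u \<le> 0" by (simp add: mult_le_0_iff)
        then have z: "seminorm2 k (\<tau> j) u = 0" using seminorm2_nonneg by (simp add: order_antisym)
        show "seminorm2 p (\<tau> j) u = 0" if "p \<le> k" for p
          using proj[OF j that] seminorm2_nonneg[of p "\<tau> j" u] unfolding z by simp
      qed
      show ?thesis
      proof (cases "r \<le> h")
        case True
        have "1 * h \<le> l * h" using l1 h0 by (intro mult_right_mono) auto
        then have "r \<le> l * h" using True by simp
        then show ?thesis using l0 h0 by (intro trivial) simp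
      next
        case False
        \<comment> \<open>Now r > h, so the ball about c covers element i, the only one that can
          carry energy.\<close>
        have "en (D \<inter> - ball c r) u = (\<Sum>j\<in>{1..m}. en (\<tau> j \<inter> (D \<inter> - ball c r)) u)"
          unfolding en_def by (rule partition_integral[OF mp jet_quad_integrable[OF u Bs] Bs])
        also have "\<dots> \<le> (\<Sum>j\<in>{1..m}. 0)"
        proof (rule sum_mono)
          fix j assume j: "j \<in> {1..m}"
          show "en (\<tau> j \<inter> (D \<inter> - ball c r)) u \<le> 0"
          proof (cases "j = i")
            case True
            have "x \<in> ball c r" if "x \<in> \<tau> i" for x
              using diameter_bounded_bound[OF T(4)[OF i] ci that] diam[OF i] False by simp
            then have "\<tau> j \<inter> (D \<inter> - ball c r) = {}" using True by auto
            then show ?thesis by (simp add: en_def)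
          next
            case False
            have "en (\<tau> j \<inter> (D \<inter> - ball c r)) u \<le> en (\<tau> j) u"
              using T[OF j] Bs by (intro en_mono[OF u]) auto
            then show ?thesis using en0[OF j False] by simp
          qed
        qed
        also have "\<dots> = 0" by simp
        finally show ?thesis using E0 by (meson exp_ge_zero mult_nonneg_nonneg order_trans)
      qed
    next
      case True
      define P where "P = Cp * (1 + Cin) * ?A0"
      have P1: "P \<ge> 1"
      proof -
        have "1 * 1 * 1 \<le> Cp * (1 + Cin) * ?A0" using True Cin A1 by (intro mult_mono) auto
        then show ?thesis by (simp add: P_def)
      qed
      have XP: "X = 8 * (exp 1 - 1) * ?d * K * P" by (simp add: X_def P_def)
      \<comment> \<open>Makes the layer width W at least 4h, so that taking away 2h leaves at least
        half of it.\<close>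
      have l4: "l \<ge> 4 * ?d"
      proof -
        define Y where "Y = (exp 1 - 1) * ?d * K * P"
        have "1 * ?d * 1 * 1 \<le> Y" unfolding Y_def using e2 d1 K1 P1 by (intro mult_mono) auto
        moreover have "X = 8 * Y" by (simp only: XP Y_def mult_ac)
        ultimately show ?thesis using Xl d1 by linarith
      qed
      \<comment> \<open>An element that meets the transition zone may protrude by h on either side.
        A layer of width W therefore leaves width L = W - 2h to the cutoff.\<close>
      define W where "W = l * h / ?d"
      define L where "L = W - 2 * h"
      have W4: "W \<ge> 4 * h" using mult_right_mono[OF l4, of h] h0 d1 by (simp add: W_def field_simps)
      have LW: "L \<ge> W / 2" using W4 by (simp add: L_def)
      have hL: "h \<le> L" using LW W4 h0 by linarith
      have L0: "L > 0" using hL h0 by linarith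
      have hLl: "h / L \<le> 2 * ?d / l"
      proof -
        have "h / L \<le> h / (W / 2)" using LW W4 h0 by (intro divide_left_mono mult_pos_pos) auto
        also have "\<dots> = 2 * ?d / l" using h0 l0 by (simp add: W_def field_simps)
        finally show ?thesis .
      qed
      define \<kappa> where "\<kappa> = K * (h / L) * P"
      \<comment> \<open>With h/L <= 2d/l the left side is at most a quarter of X/l, and X <=
        l.\<close>
      have \<kappa>e: "\<kappa> * (exp 1 - 1) \<le> 1"
      proof -
        have "\<kappa> * (exp 1 - 1) \<le> K * (2 * ?d / l) * P * (exp 1 - 1)"
          unfolding \<kappa>_def using K1 P1 e2 hLl by (intro mult_right_mono mult_left_mono) auto
        also have "\<dots> = (2 * (exp 1 - 1) * ?d * K * P) / l" by simp
        also have "\<dots> \<le> X / l"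
        proof (rule divide_right_mono)
          have Y: "0 \<le> (exp 1 - 1) * ?d * K * P" using e2 d1 K1 P1 by (intro mult_nonneg_nonneg) auto
          have "2 * ((exp 1 - 1) * ?d * K * P) \<le> 8 * ((exp 1 - 1) * ?d * K * P)" by (rule mult_right_mono[OF _ Y]) simp
          then show "2 * (exp 1 - 1) * ?d * K * P \<le> X" unfolding XP by (simp only: mult.assoc)
        qed (use l0 in simp)
        also have "\<dots> \<le> 1" using Xl l0 by simp
        finally show ?thesis .
      qed
      define e where "e n = en (outer c (real n * W)) u" for n
      have W0: "W > 0" using W4 h0 by linarith
      have step: "e (Suc n) \<le> \<kappa> * (e n - e (Suc n))" for n
      proof -
        \<comment> \<open>The cutoff starts at R = n W + h, so that the layer, widened by h, begins
          exactly at n W, and R >= h holds already for n = 0.\<close>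
        have R0: "real n * W + h \<ge> h" using W0 by simp
        have "en (outer c ((real n * W + h) + L + h)) u
          \<le> 3 * real (card I) * 2 ^ k * C * (h / L) * Cp * (1 + Cin) * ?A0
            * (en (outer c ((real n * W + h) - h)) u - en (outer c ((real n * W + h) + L + h)) u)"
          by (rule layer_step[OF mp i ci u g rep mom proj inv True Cin h h1 h2 C1 R0 hL cut])
            (use R0 h0 L0 in auto)
        moreover have "(real n * W + h) + L + h = real (Suc n) * W" "(real n * W + h) - h = real n * W"
          by (simp_all add: L_def algebra_simps)
        moreover have "3 * real (card I) * 2 ^ k * C * (h / L) * Cp * (1 + Cin) * ?A0 = \<kappa>"
          by (simp add: \<kappa>_def K P_def)
        ultimately show ?thesis unfolding e_def by (simp only:)
      qed
      have mono: "e (Suc n) \<le> e n" for n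
        unfolding e_def
      proof (rule en_mono[OF u outer_sets(1) outer_sets(1) _ outer_sets(2)])
        have "real n * W \<le> real (Suc n) * W" using W0 by (intro mult_right_mono) auto
        then show "outer c (real (Suc n) * W) \<subseteq> outer c (real n * W)"
          unfolding outer_def by (auto intro: le_less_trans)
      qed
      obtain n where n: "real n \<ge> r / (l * h) - 1" "D \<inter> - ball c r \<subseteq> outer c (real n * W)"
        using outer_superset[OF r l0 h0, of c] unfolding W_def by blast
      have "en (D \<inter> - ball c r) u \<le> e n"
        unfolding e_def by (rule en_mono[OF u Bs(1) outer_sets(1) n(2) outer_sets(2)])
      also have "\<dots> \<le> exp (- real n) * e 0" by (rule layer_decay[of e \<kappa> n, OF step mono \<kappa>e])
      also have "\<dots> \<le> exp (- real n) * en D u"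
        unfolding e_def by (intro mult_left_mono en_mono[OF u outer_sets(1) Ds outer_sets(2)]) auto
      also have "\<dots> \<le> exp (1 - r / (l * h)) * en D u" using n(1) E0 by (intro mult_right_mono) auto
      finally show ?thesis .
    qed
  qed
qed

end

theorem theorem6p4:
  fixes k :: nat
  assumes "k \<ge> 1"
  shows "\<exists>C1>0. \<exists>C\<eta>>0.
    \<forall>(D::(real^'n::finite) set) (a::'n midx \<Rightarrow> 'n midx \<Rightarrow> real^'n \<Rightarrow> real)
      (\<theta>0max::real) (\<theta>k'max::real) (\<theta>kmin::real) (\<delta>::real) (Cp::real) (Cf::real) (Ckd\<delta>::real).
      open D \<and> connected D \<and> D \<noteq> {} \<and> bounded D \<and>
      (\<forall>\<sigma> \<gamma>. mlen \<sigma> \<le> k \<and> mlen \<gamma> \<le> k \<longrightarrow> a \<sigma> \<gamma> \<in> Linf D) \<and>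
      self_adjoint k a D \<and> energy_equivalent k a D \<and>
      nonneg_coeffs k a D \<and>
      \<theta>0max \<ge> 0 \<and> \<theta>k'max > 0 \<and> bounded_coeffs k a D \<theta>0max \<theta>k'max \<and>
      \<theta>kmin > 0 \<and> strongly_elliptic k a D \<theta>kmin \<and>
      \<delta> > 0 \<and> Cp > 0 \<and>
      Cf > 0 \<and> friedrichs_const TYPE('n) k Cf \<and>
      Ckd\<delta> > 0 \<and> inverse_const TYPE('n) k \<delta> Ckd\<delta> \<longrightarrow>
      (let \<theta>kmax = max \<theta>0max \<theta>k'max in
       \<exists>h0>0. h0 = mesh_threshold k Cp Cf \<theta>0max \<theta>kmax \<theta>kmin \<and>
        (\<forall>(m::nat) (\<tau>::nat \<Rightarrow> (real^'n) set) (c::nat \<Rightarrow> real^'n)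
           (\<phi>::nat \<Rightarrow> nat \<Rightarrow> real^'n \<Rightarrow> real) (\<psi>::nat \<Rightarrow> nat \<Rightarrow> real^'n \<Rightarrow> real).
           mesh_partition D m \<tau> \<and> regular_partition \<delta> m \<tau> \<and> centers \<delta> m \<tau> c \<and>
           projection_const k D m \<tau> Cp \<and> local_basis k m \<tau> \<phi> \<and>
           (\<forall>i\<in>{1..m}. \<forall>q\<in>{1..num_basis TYPE('n) k}.
              energy_minimizer k a D (admissible k D m \<phi> i q) (\<psi> i q)) \<and>
           ereal (mesh_size m \<tau>) \<le> h0 \<longrightarrow>
           (\<forall>i\<in>{1..m}. \<forall>q\<in>{1..num_basis TYPE('n) k}. \<forall>r>0. \<forall>l::real.
              sqrt (l\<^sup>2 - 1) \<ge> 2 * (exp 1 - 1) * C\<eta> * Cp * (C1 + Ckd\<delta>) * sqrt (\<theta>kmax / \<theta>kmin) \<longrightarrow>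
              energy k a D (D \<inter> - ball (c i) r) (\<psi> i q)
                \<le> exp (1 - r / (l * mesh_size m \<tau>)) * energy k a D D (\<psi> i q))))"
proof -
  obtain C where C1: "C \<ge> 1" and cut: "\<forall>(c::real^'n) R L. R \<ge> 0 \<and> L > 0 \<longrightarrow> (\<exists>\<eta>. smooth \<eta> \<and>
    (\<forall>x. 0 \<le> \<eta> x \<and> \<eta> x \<le> 1) \<and>
    (\<forall>x. (\<forall>i. \<bar>x $ i - c $ i\<bar> \<le> R) \<longrightarrow> \<eta> x = 0) \<and>
    (\<forall>x. (\<exists>i. \<bar>x $ i - c $ i\<bar> \<ge> R + L) \<longrightarrow> \<eta> x = 1) \<and>
    (\<forall>xs x. xs \<noteq> [] \<and> length xs \<le> k \<longrightarrow> \<bar>foldr pd xs \<eta> x\<bar> \<le> C / L ^ length xs) \<and>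
    (\<forall>x y. \<bar>\<eta> x - \<eta> y\<bar> \<le> C / L * norm (x - y)))"
    using cutoff_exists[OF assms] by (elim exE conjE)
  define K where "K = 3 * real (card {\<sigma>::'n midx. mlen \<sigma> \<le> k}) * 2 ^ k * C"
  have "card {\<sigma>::'n midx. mlen \<sigma> \<le> k} > 0" by (rule card_mlen_le_pos)
  then have K0: "K > 0" using C1 by (simp add: K_def)
  show ?thesis
  \<comment> \<open>C1 is 1 and C_eta is 4 d K. K depends only on k and the dimension: through the
    number of multi-indices, 2^k and the constant of the cutoff.\<close>
  proof (rule exI[of _ 1], rule conjI, simp, rule exI[of _ "4 * real CARD('n) * K"], rule conjI, simp add: K0, intro allI impI)
    fix D :: "(real^'n) set" and a :: "'n midx \<Rightarrow> 'n midx \<Rightarrow> real^'n \<Rightarrow> real"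
      and \<theta>0max \<theta>k'max \<theta>kmin \<delta> Cp Cf Ckd\<delta> :: real
    assume H: "open D \<and> connected D \<and> D \<noteq> {} \<and> bounded D \<and>
      (\<forall>\<sigma> \<gamma>. mlen \<sigma> \<le> k \<and> mlen \<gamma> \<le> k \<longrightarrow> a \<sigma> \<gamma> \<in> Linf D) \<and>
      self_adjoint k a D \<and> energy_equivalent k a D \<and>
      nonneg_coeffs k a D \<and>
      \<theta>0max \<ge> 0 \<and> \<theta>k'max > 0 \<and> bounded_coeffs k a D \<theta>0max \<theta>k'max \<and>
      \<theta>kmin > 0 \<and> strongly_elliptic k a D \<theta>kmin \<and>
      \<delta> > 0 \<and> Cp > 0 \<and>
      Cf > 0 \<and> friedrichs_const TYPE('n) k Cf \<and>
      Ckd\<delta> > 0 \<and> inverse_const TYPE('n) k \<delta> Ckd\<delta>"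
    then have Cp: "Cp > 0" and Cf: "Cf > 0" and fr: "friedrichs_const TYPE('n) k Cf"
      and Cin: "Ckd\<delta> > 0" and inv: "inverse_const TYPE('n) k \<delta> Ckd\<delta>"
      and \<theta>: "\<theta>0max \<ge> 0" "\<theta>k'max > 0" "\<theta>kmin > 0" by simp_all
    interpret elliptic k D a \<theta>0max \<theta>k'max \<theta>kmin
      by unfold_locales (use H assms in auto)
    have tm: "mesh_threshold k Cp Cf \<theta>0max \<theta>max \<theta>kmin = Sup (ereal ` threshold_set k Cp Cf \<theta>0max \<theta>max \<theta>kmin)"
      by (rule mesh_threshold_eq[OF \<theta>(1) \<theta>max_pos \<theta>(3)])
    obtain h' where h': "h' \<in> threshold_set k Cp Cf \<theta>0max \<theta>max \<theta>kmin"
      using threshold_set_nonempty[OF Cp \<theta>(1) \<theta>max_pos \<theta>(3)] by blast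
    have "ereal 0 < ereal h'" using h' by (simp add: threshold_set_def)
    also have "ereal h' \<le> mesh_threshold k Cp Cf \<theta>0max \<theta>max \<theta>kmin" unfolding tm using h' by (intro Sup_upper) auto
    finally have pos: "mesh_threshold k Cp Cf \<theta>0max \<theta>max \<theta>kmin > 0" by (simp add: zero_ereal_def)
    show "let \<theta>kmax = max \<theta>0max \<theta>k'max in
       \<exists>h0>0. h0 = mesh_threshold k Cp Cf \<theta>0max \<theta>kmax \<theta>kmin \<and>
        (\<forall>(m::nat) (\<tau>::nat \<Rightarrow> (real^'n) set) (c::nat \<Rightarrow> real^'n)
           (\<phi>::nat \<Rightarrow> nat \<Rightarrow> real^'n \<Rightarrow> real) (\<psi>::nat \<Rightarrow> nat \<Rightarrow> real^'n \<Rightarrow> real).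
           mesh_partition D m \<tau> \<and> regular_partition \<delta> m \<tau> \<and> centers \<delta> m \<tau> c \<and>
           projection_const k D m \<tau> Cp \<and> local_basis k m \<tau> \<phi> \<and>
           (\<forall>i\<in>{1..m}. \<forall>q\<in>{1..num_basis TYPE('n) k}.
              energy_minimizer k a D (admissible k D m \<phi> i q) (\<psi> i q)) \<and>
           ereal (mesh_size m \<tau>) \<le> h0 \<longrightarrow>
           (\<forall>i\<in>{1..m}. \<forall>q\<in>{1..num_basis TYPE('n) k}. \<forall>r>0. \<forall>l::real.
              sqrt (l\<^sup>2 - 1) \<ge> 2 * (exp 1 - 1) * (4 * real CARD('n) * K) * Cp * (1 + Ckd\<delta>) * sqrt (\<theta>kmax / \<theta>kmin) \<longrightarrow>
              energy k a D (D \<inter> - ball (c i) r) (\<psi> i q)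
                \<le> exp (1 - r / (l * mesh_size m \<tau>)) * energy k a D D (\<psi> i q)))"
      unfolding Let_def
    proof (rule exI, rule conjI[OF pos], rule conjI[OF refl], intro allI impI ballI)
      fix m :: nat and \<tau> :: "nat \<Rightarrow> (real^'n) set" and c :: "nat \<Rightarrow> real^'n"
        and \<phi> \<psi> :: "nat \<Rightarrow> nat \<Rightarrow> real^'n \<Rightarrow> real" and i q :: nat and r l :: real
      assume P: "mesh_partition D m \<tau> \<and> regular_partition \<delta> m \<tau> \<and> centers \<delta> m \<tau> c \<and>
           projection_const k D m \<tau> Cp \<and> local_basis k m \<tau> \<phi> \<and>
           (\<forall>i\<in>{1..m}. \<forall>q\<in>{1..num_basis TYPE('n) k}.
              energy_minimizer k a D (admissible k D m \<phi> i q) (\<psi> i q)) \<and>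
           ereal (mesh_size m \<tau>) \<le> mesh_threshold k Cp Cf \<theta>0max \<theta>max \<theta>kmin"
        and i: "i \<in> {1..m}" and q: "q \<in> {1..num_basis TYPE('n) k}" and r: "r > 0"
        and l: "2 * (exp 1 - 1) * (4 * real CARD('n) * K) * Cp * (1 + Ckd\<delta>) * sqrt (\<theta>max / \<theta>kmin) \<le> sqrt (l\<^sup>2 - 1)"
      let ?h = "mesh_size m \<tau>"
      have mp: "mesh_partition D m \<tau>" and ce: "centers \<delta> m \<tau> c" and pc: "projection_const k D m \<tau> Cp"
        and lb: "local_basis k m \<tau> \<phi>" and hle: "ereal ?h \<le> mesh_threshold k Cp Cf \<theta>0max \<theta>max \<theta>kmin"
        using P by simp_all
      have min: "energy_minimizer k a D (admissible k D m \<phi> j q') (\<psi> j q')"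
        if "j \<in> {1..m}" "q' \<in> {1..num_basis TYPE('n) k}" for j q' using P that by blast
      have \<psi>A: "\<psi> i q \<in> admissible k D m \<phi> i q" using min[OF i q] by (simp add: energy_minimizer_def)
      then have u: "\<psi> i q \<in> H0k k D" by (simp add: admissible_def)
      have h0: "?h > 0" using mesh_size_ge[OF i, of \<tau>] partition_sets(6)[OF mp i] by linarith
      have ht: "?h \<in> threshold_set k Cp Cf \<theta>0max \<theta>max \<theta>kmin"
        by (rule threshold_set_closed[OF h0 hle[unfolded tm] \<theta>(1) \<theta>max_pos])
      obtain g where g: "\<And>j. j \<in> {1..m} \<Longrightarrow> g j \<in> polys (k - 1)"
        and rep: "\<And>v. v \<in> H0k k D \<Longrightarrow> Bf (\<psi> i q) v = (\<Sum>j\<in>{1..m}. LINT x|lebesgue_on (\<tau> j). v x * g j x)"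
        using minimizer_equation[OF mp lb min i q] by blast
      have mom: "(LINT x|lebesgue_on (\<tau> j). \<psi> i q x * p x) = 0"
        if "j \<in> {1..m}" "j \<noteq> i" "p \<in> polys (k - 1)" for j p
        by (rule zero_moments[OF mp lb \<psi>A that])
      have proj: "seminorm2 p (\<tau> j) (\<psi> i q) \<le> (Cp * diameter (\<tau> j) ^ (k - p))\<^sup>2 * seminorm2 k (\<tau> j) (\<psi> i q)"
        if "j \<in> {1..m}" "j \<noteq> i" "p \<le> k" for j p
        by (rule projection_seminorm[OF mp pc Cp u that(1) mom[OF that(1,2)] that(3)])
      have ine: "(LINT x|lebesgue_on (\<tau> j). (g j x)\<^sup>2) \<le> (Ckd\<delta> / diameter (\<tau> j) ^ k)\<^sup>2 * (3 / 2 * \<theta>max * en (\<tau> j) (\<psi> i q))"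
        if j: "j \<in> {1..m}" for j
      proof (rule local_inverse_estimate[OF mp u j g rep fr Cf inv Cin])
        show "ball (c j) (\<delta> * diameter (\<tau> j) / 2) \<subseteq> \<tau> j" using ce j by (simp add: centers_def)
        \<comment> \<open>The condition is known for the mesh size and is needed for the diameter of
          one element, since that is the scale at which the inverse constant is applied.\<close>
        have "(\<Sum>i\<in>{1..k}. diameter (\<tau> j) ^ (2 * i)) \<le> (\<Sum>i\<in>{1..k}. ?h ^ (2 * i))"
          using mesh_size_ge[OF j, of \<tau>] partition_sets(6)[OF mp j] by (intro sum_mono power_mono) auto
        then have "2 * \<theta>0max * Cf\<^sup>2 * (\<Sum>i\<in>{1..k}. diameter (\<tau> j) ^ (2 * i)) \<le> 2 * \<theta>0max * Cf\<^sup>2 * (\<Sum>i\<in>{1..k}. ?h ^ (2 * i))"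
          using \<theta>(1) by (intro mult_left_mono) auto
        also have "\<dots> \<le> \<theta>max" using ht by (simp add: threshold_set_def)
        finally show "2 * \<theta>0max * Cf\<^sup>2 * (\<Sum>i\<in>{1..k}. diameter (\<tau> j) ^ (2 * i)) \<le> \<theta>max" .
      qed
      have ci: "c i \<in> \<tau> i" using ce i by (simp add: centers_def)
      have h1: "(\<Sum>j\<in>{1..<k}. ?h ^ (2 * j)) \<le> 1 / Cp\<^sup>2"
        and h2: "16 * \<theta>0max * \<theta>max * Cp\<^sup>2 * (\<Sum>j\<in>{1..k}. ?h ^ (2 * j)) \<le> \<theta>kmin\<^sup>2"
        using ht by (simp_all add: threshold_set_def)
      have "en (D \<inter> - ball (c i) r) (\<psi> i q) \<le> exp (1 - r / (l * ?h)) * en D (\<psi> i q)"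
        by (rule decay[OF mp i ci u g rep mom proj ine Cp Cin refl h1 h2 C1 _ K_def l r])
          (assumption | rule HOL.mp[OF spec[OF spec[OF spec[OF cut]]]], rule conjI)+
      moreover have "D \<inter> - ball (c i) r \<in> sets lebesgue" using Ds by auto
      ultimately show "energy k a D (D \<inter> - ball (c i) r) (\<psi> i q) \<le> exp (1 - r / (l * ?h)) * energy k a D D (\<psi> i q)"
        by (simp add: energy_en[OF u] Ds)
    qed
  qed
qed

end
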